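(* Let $1\le p<q$ be fixed integers such that $p$ divides $q$. Given an input word $w\in\{t,T,a,A\}^*$, one can compute a geodesic word for $w$ in $\mathbf{BS}(p,q)$, and its geodesic length, in quadratic time $\mathcal{O}\bigl(s(w)\,(s(w)+\Vert w\Vert)\bigr)$.
   Context: $\mathbf{BS}(p,q)=\langle a,t\mid ta^pt^{-1}=a^q\rangle$. Words over $\{t,T,a,A\}$ are read in $\mathbf{BS}(p,q)$ with $T=t^{-1}$, $A=a^{-1}$; $u\sim v$ means that $u$ and $v$ represent the same group element. A geodesic word for $w$ is a shortest word $g(w)\in\{t,T,a,A\}^*$ with $g(w)\sim w$; its length $|g(w)|$ is the geodesic length of $w$. An integer $\alpha$ is identified with the word $a^\alpha$ (i.e. $A^{|\alpha|}$ if $\alpha<0$), and $0$ is the empty word. After cancelling factors $aA$ and $Aa$, every word is uniquely written as $u=\alpha_0\theta_1\alpha_1\cdots\theta_k\alpha_k$ with $k\ge 0$, $\alpha_i\in\mathbb{Z}$, $\theta_i\in\{t,T\}$. For an integer $\alpha$, $\Vert\alpha\Vert$ is the geodesic length of $a^\alpha$, and the norm of $u$ is $\Vert u\Vert=k+\sum_{i=0}^k\Vert\alpha_i\Vert$. A sink of $u$ is a position $i\in\{0,\dots,k\}$ such that $\theta_i\ne t$ and $\theta_{i+1}\neq T$ (conditions on the non-existing $\theta_0$ and $\theta_{k+1}$ are regarded as satisfied; so for $k=0$ position $0$ is a sink). $s(u)$ is the number of sinks of $u$. For a word $w\in\{t,T,a,A\}^*$, $s(w)$ and $\Vert w\Vert$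 are those of the corresponding expression $u$. Complexity convention: $p,q$ are constants, integers are kept in binary, and an arithmetic operation on integers with $\mathcal{O}(n)$ bits ($n$ the input length) takes constant time. *)

theory Defs
  imports Complex_Main "HOL-Library.Log_Nat"
begin

text \<open>\<open>Lt\<close>, \<open>LT\<close>, \<open>La\<close>, \<open>LA\<close> are the letters t, T, a, A.\<close>

datatype letter = Lt | LT | La | LA

text \<open>\<open>bs_eq p q\<close> is the congruence on words generated by \<open>T = t\<^sup>-\<^sup>1\<close>, \<open>A = a\<^sup>-\<^sup>1\<close> and the defining
  relator. Its quotient of the free monoid is the group BS(p,q), so \<open>bs_eq p q u v\<close> is \<open>u \<sim> v\<close>.\<close>

inductive bs_eq :: "nat \<Rightarrow> nat \<Rightarrow> letter list \<Rightarrow> letter list \<Rightarrow> bool" for p q :: nat where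
  refl: "bs_eq p q u u"
| sym: "bs_eq p q u v \<Longrightarrow> bs_eq p q v u"
| trans: "bs_eq p q u v \<Longrightarrow> bs_eq p q v w \<Longrightarrow> bs_eq p q u w"
| cong: "bs_eq p q u u' \<Longrightarrow> bs_eq p q v v' \<Longrightarrow> bs_eq p q (u @ v) (u' @ v')"
| aA: "bs_eq p q [La, LA] []"
| Aa: "bs_eq p q [LA, La] []"
| tT: "bs_eq p q [Lt, LT] []"
| Tt: "bs_eq p q [LT, Lt] []"
| relator: "bs_eq p q ([Lt] @ replicate p La @ [LT]) (replicate q La)"

definition geodesic :: "nat \<Rightarrow> nat \<Rightarrow> letter list \<Rightarrow> letter list \<Rightarrow> bool" where
  "geodesic p q w g \<longleftrightarrow> bs_eq p q g w \<and> (\<forall>v. bs_eq p q v w \<longrightarrow> length g \<le> length v)"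

definition geo_len :: "nat \<Rightarrow> nat \<Rightarrow> letter list \<Rightarrow> nat" where
  "geo_len p q w = (LEAST n. \<exists>v. bs_eq p q v w \<and> length v = n)"

definition a_pow :: "int \<Rightarrow> letter list" where
  "a_pow \<alpha> = (if 0 \<le> \<alpha> then replicate (nat \<alpha>) La else replicate (nat (- \<alpha>)) LA)"

text \<open>The expression \<open>\<alpha>\<^sub>0 \<theta>\<^sub>1 \<alpha>\<^sub>1 \<dots> \<theta>\<^sub>k \<alpha>\<^sub>k\<close> of a word, split into the list of its \<open>\<theta>\<^sub>i\<close> and the list of
  its \<open>\<alpha>\<^sub>i\<close>. Cancelling a A and A a (but not t T or T t) turns each maximal block of letters
  a, A into the power of a given by its exponent sum. Thus \<open>\<alpha>\<^sub>i = alphas w ! i\<close>, while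
  \<open>\<theta>\<^sub>i = thetas w ! (i - 1)\<close>.\<close>

definition thetas :: "letter list \<Rightarrow> letter list" where
  "thetas w = filter (\<lambda>x. x = Lt \<or> x = LT) w"

fun alphas :: "letter list \<Rightarrow> int list" where
  "alphas [] = [0]"
| "alphas (La # w) = (hd (alphas w) + 1) # tl (alphas w)"
| "alphas (LA # w) = (hd (alphas w) - 1) # tl (alphas w)"
| "alphas (Lt # w) = 0 # alphas w"
| "alphas (LT # w) = 0 # alphas w"

definition norm_w :: "nat \<Rightarrow> nat \<Rightarrow> letter list \<Rightarrow> nat" where
  "norm_w p q w = length (thetas w) + (\<Sum>\<alpha>\<leftarrow>alphas w. geo_len p q (a_pow \<alpha>))"

definition sinks :: "letter list \<Rightarrow> nat set" where
  "sinks w = {i. i \<le> length (thetas w)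
     \<and> (i = 0 \<or> thetas w ! (i - 1) \<noteq> Lt)
     \<and> (i = length (thetas w) \<or> thetas w ! i \<noteq> LT)}"

definition num_sinks :: "letter list \<Rightarrow> nat" where
  "num_sinks w = card (sinks w)"

text \<open>Programs are structured random access programs. The memory consists of named integer arrays
  (a scalar is an array used only at index 0), and \<open>Cell x e\<close> is the content of array \<open>x\<close> at the
  computed index \<open>e\<close>. Every memory access, arithmetic operation and comparison takes one time unit,
  provided that the integers involved have at most \<open>B\<close> bits; a program handling a longer integer
  has no execution.\<close>

datatype aop = Plus | Minus | Times | Div | Mod

datatype exp = Lit int | Cell string exp | Arith aop exp exp

datatype bexp = Less exp exp | Neg bexp | Conj bexp bexp

datatype com =
    Skip
  | Store string exp exp
  | Seq com com
  | Cond bexp com com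
  | While bexp com

type_synonym state = "string \<Rightarrow> int \<Rightarrow> int"

definition bits :: "int \<Rightarrow> nat" where
  "bits x = floorlog 2 (nat \<bar>x\<bar>)"

fun arith :: "aop \<Rightarrow> int \<Rightarrow> int \<Rightarrow> int" where
  "arith Plus x y = x + y"
| "arith Minus x y = x - y"
| "arith Times x y = x * y"
| "arith Div x y = x div y"
| "arith Mod x y = x mod y"

primrec eval_exp :: "exp \<Rightarrow> state \<Rightarrow> int" where
  "eval_exp (Lit c) s = c"
| "eval_exp (Cell x e) s = s x (eval_exp e s)"
| "eval_exp (Arith f e1 e2) s = arith f (eval_exp e1 s) (eval_exp e2 s)"

text \<open>\<open>fits_exp B e s\<close>: all values arising in the evaluation of \<open>e\<close>, indices included, have at
  most \<open>B\<close> bits.\<close>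

primrec fits_exp :: "nat \<Rightarrow> exp \<Rightarrow> state \<Rightarrow> bool" where
  "fits_exp B (Lit c) s \<longleftrightarrow> bits c \<le> B"
| "fits_exp B (Cell x e) s \<longleftrightarrow> fits_exp B e s \<and> bits (eval_exp (Cell x e) s) \<le> B"
| "fits_exp B (Arith f e1 e2) s \<longleftrightarrow>
     fits_exp B e1 s \<and> fits_exp B e2 s \<and> bits (eval_exp (Arith f e1 e2) s) \<le> B"

primrec cost_exp :: "exp \<Rightarrow> nat" where
  "cost_exp (Lit c) = 1"
| "cost_exp (Cell x e) = cost_exp e + 1"
| "cost_exp (Arith f e1 e2) = cost_exp e1 + cost_exp e2 + 1"

primrec eval_bexp :: "bexp \<Rightarrow> state \<Rightarrow> bool" where
  "eval_bexp (Less e1 e2) s \<longleftrightarrow> eval_exp e1 s < eval_exp e2 s"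
| "eval_bexp (Neg b) s \<longleftrightarrow> \<not> eval_bexp b s"
| "eval_bexp (Conj b1 b2) s \<longleftrightarrow> eval_bexp b1 s \<and> eval_bexp b2 s"

primrec fits_bexp :: "nat \<Rightarrow> bexp \<Rightarrow> state \<Rightarrow> bool" where
  "fits_bexp B (Less e1 e2) s \<longleftrightarrow> fits_exp B e1 s \<and> fits_exp B e2 s"
| "fits_bexp B (Neg b) s \<longleftrightarrow> fits_bexp B b s"
| "fits_bexp B (Conj b1 b2) s \<longleftrightarrow> fits_bexp B b1 s \<and> fits_bexp B b2 s"

primrec cost_bexp :: "bexp \<Rightarrow> nat" where
  "cost_bexp (Less e1 e2) = cost_exp e1 + cost_exp e2 + 1"
| "cost_bexp (Neg b) = cost_bexp b + 1"
| "cost_bexp (Conj b1 b2) = cost_bexp b1 + cost_bexp b2 + 1"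

text \<open>\<open>run B c s n s'\<close>: with integers of at most \<open>B\<close> bits, program \<open>c\<close> started in \<open>s\<close> halts in
  \<open>s'\<close> after \<open>n\<close> time units.\<close>

inductive run :: "nat \<Rightarrow> com \<Rightarrow> state \<Rightarrow> nat \<Rightarrow> state \<Rightarrow> bool" for B :: nat where
  Skip: "run B Skip s 1 s"
| Store: "fits_exp B i s \<Longrightarrow> fits_exp B e s \<Longrightarrow>
    run B (Store x i e) s (cost_exp i + cost_exp e + 1)
      (s(x := (s x)(eval_exp i s := eval_exp e s)))"
| Seq: "run B c1 s n1 s1 \<Longrightarrow> run B c2 s1 n2 s2 \<Longrightarrow> run B (Seq c1 c2) s (n1 + n2) s2"
| CondTrue: "fits_bexp B b s \<Longrightarrow> eval_bexp b s \<Longrightarrow> run B c1 s n s1 \<Longrightarrow>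
    run B (Cond b c1 c2) s (cost_bexp b + n) s1"
| CondFalse: "fits_bexp B b s \<Longrightarrow> \<not> eval_bexp b s \<Longrightarrow> run B c2 s n s1 \<Longrightarrow>
    run B (Cond b c1 c2) s (cost_bexp b + n) s1"
| WhileFalse: "fits_bexp B b s \<Longrightarrow> \<not> eval_bexp b s \<Longrightarrow>
    run B (While b c) s (cost_bexp b) s"
| WhileTrue: "fits_bexp B b s \<Longrightarrow> eval_bexp b s \<Longrightarrow> run B c s n1 s1 \<Longrightarrow>
    run B (While b c) s1 n2 s2 \<Longrightarrow> run B (While b c) s (cost_bexp b + n1 + n2) s2"

fun code :: "letter \<Rightarrow> int" where
  "code Lt = 1"
| "code LT = -1"
| "code La = 2"
| "code LA = -2"

text \<open>The input is the expression of \<open>w\<close>, each integer \<open>\<alpha>\<^sub>i\<close> occupying one cell; all other cells are 0.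
  It is not presented letter by letter: for \<open>w = a\<^sup>n\<close> the claimed running time is logarithmic in
  \<open>n\<close>, so it could not even be read in that form.\<close>

definition input_state :: "letter list \<Rightarrow> state" where
  "input_state w = (\<lambda>x i.
     if x = ''k'' \<and> i = 0 then int (length (thetas w))
     else if x = ''alpha'' \<and> 0 \<le> i \<and> i \<le> int (length (thetas w)) then alphas w ! nat i
     else if x = ''theta'' \<and> 1 \<le> i \<and> i \<le> int (length (thetas w)) then code (thetas w ! nat (i - 1))
     else 0)"

text \<open>Length of this input with integers in binary. The summand 1 accounts for the sign.\<close>

definition input_length :: "letter list \<Rightarrow> nat" where
  "input_length w = length (thetas w) + (\<Sum>\<alpha>\<leftarrow>alphas w. bits \<alpha> + 1)"

definition output_word :: "state \<Rightarrow> letter list \<Rightarrow> bool" where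
  "output_word s g \<longleftrightarrow> s ''length'' 0 = int (length g)
     \<and> (\<forall>i < length g. s ''word'' (int i) = code (g ! i))"

end

theory Submission
  imports Defs
begin

text \<open>Britton reduction turns the input into a reduced expression. All reduced expressions of one group
  element have the same letters \<open>t\<close>, \<open>T\<close> and differ only by powers of \<open>a\<close> (multiples of \<open>p\<close> or \<open>q\<close>)
  that are moved across them, i.e. by a flow. A geodesic has the shape of a reduced expression whose
  exponents are written out, except that one of them may carry a spur
  \<open>t a\<^sup>\<gamma> t a\<^sup>\<gamma>' \<dots> T T\<close>; since \<open>p\<close> divides \<open>q\<close>, all spurs can be merged into a single one at a topmost
  position, where the expression is virtually prolonged by letters \<open>t\<close>.
  The optimal flow is found by dynamic programming over the tree given by the bracket structure of the
  letters: the cost \<open>F i z\<close> of pushing \<open>z\<close> units into node \<open>i\<close> is, outside a window of length linear in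
  the number of sinks below \<open>i\<close>, affine with slope \<open>\<plusminus>p\<close>, so a table of that window suffices. Merging
  the windows of two children costs the product of their lengths, which sums up to a quadratic bound.\<close>

section \<open>Words and normal forms\<close>

text \<open>Writing q = p r, whatever crosses a letter is a power of a^p, so a flow is a list of
  integers counting units of a^p: r units become one across \<open>t\<close>, one unit becomes r
  across \<open>T\<close>. This dilation drives the time bound. The child between a \<open>T\<close>
  and its matching \<open>t\<close> is seen by its parent only at multiples of r, where its cost has
  slopes p r outside its window, steeper than the slope p of everything it is combined with; at most
  about half of its window length survives. Along a chain of single children a length L becomes L/2
  plus a constant and stays bounded; only the joining of several sinks lets it grow. The obstacle in
  the lower bound is that a word may carry spurs of any height at every position. Each is split into
  a lowest digit and r times the rest; the digit is handed to the subtree, whose cost is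
  \<open>P\<close>-Lipschitz, and the rest passes through the next \<open>t\<close>. At the root a
  level of a spur is one more virtual \<open>t\<close> at the price of 2 letters, so it remains to
  minimise \<open>F (root + j) 0 + 2 * j\<close> over j, a search cut off by the summand 2j.
  Reduction may multiply exponents by r^k, which costs only linearly many bits.\<close>

lemma a_pow_0 [simp]: "a_pow 0 = []"
  by (simp add: a_pow_def)

locale bs =
  fixes p r :: nat
  assumes p1: "1 \<le> p" and r2: "2 \<le> r"
begin

abbreviation "P \<equiv> int p"
abbreviation "R \<equiv> int r"
abbreviation "Q \<equiv> int p * int r"
abbreviation eqv (infix "\<approx>" 50) where "u \<approx> v \<equiv> bs_eq p (p * r) u v"

lemma P1: "1 \<le> P" and R2: "2 \<le> R" and Ppos: "0 < P" and Rpos: "0 < R" and Qpos: "0 < Q"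
  using p1 r2 by auto

declare bs_eq.refl [simp, intro]
declare bs_eq.trans [trans]

section \<open>Powers of \<open>a\<close> moving across \<open>t\<close> and
  \<open>T\<close>\<close>

lemma eqv_context: "u \<approx> u' \<Longrightarrow> x = a @ u @ b \<Longrightarrow> y = a @ u' @ b \<Longrightarrow> x \<approx> y"
  by (auto intro!: bs_eq.cong)

lemma eqv_left: "u \<approx> u' \<Longrightarrow> u @ b \<approx> u' @ b"
  and eqv_right: "u \<approx> u' \<Longrightarrow> b @ u \<approx> b @ u'"
  by (auto intro!: bs_eq.cong)

lemma a_pow_snoc_La: "a_pow x @ [La] \<approx> a_pow (x + 1)"
proof (cases "0 \<le> x")
  case True
  then have "a_pow x @ [La] = a_pow (x + 1)"
    by (simp add: a_pow_def nat_add_distrib replicate_append_same)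
  then show ?thesis by simp
next
  case False
  then obtain k where k: "nat (- x) = Suc k" by (cases "nat (- x)") auto
  then have "nat (- (x + 1)) = k" by simp
  moreover have "nat (x + 1) = 0" using False by simp
  ultimately have "a_pow x = a_pow (x + 1) @ [LA]"
    using False k by (auto simp: a_pow_def replicate_append_same)
  with eqv_context[OF bs_eq.Aa, of "a_pow x @ [La]" "a_pow (x + 1)" "[]" "a_pow (x + 1)"] show ?thesis
    by simp
qed

lemma a_pow_snoc_LA: "a_pow x @ [LA] \<approx> a_pow (x - 1)"
proof -
  have "a_pow x @ [LA] \<approx> a_pow (x - 1) @ [La, LA]"
    using eqv_context[OF bs_eq.sym[OF a_pow_snoc_La[of "x - 1"]], of _ "[]" "[LA]"]
    by simp
  also have "\<dots> \<approx> a_pow (x - 1)"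
    by (rule eqv_context[OF bs_eq.aA, where a = "a_pow (x - 1)" and b = "[]"]) auto
  finally show ?thesis .
qed

lemma a_pow_add: "a_pow x @ a_pow y \<approx> a_pow (x + y)"
proof (induction y rule: int_induct[where k = 0])
  case (step1 i)
  have "a_pow x @ a_pow (i + 1) \<approx> (a_pow x @ a_pow i) @ [La]"
    by (rule eqv_context[OF bs_eq.sym[OF a_pow_snoc_La[of i]], where a = "a_pow x" and b = "[]"]) auto
  also have "\<dots> \<approx> a_pow (x + i) @ [La]"
    using step1 by (intro eqv_left)
  also have "\<dots> \<approx> a_pow (x + (i + 1))"
    using a_pow_snoc_La[of "x + i"] by (simp add: algebra_simps)
  finally show ?case .
next
  case (step2 i)
  have "a_pow x @ a_pow (i - 1) \<approx> (a_pow x @ a_pow i) @ [LA]"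
    by (rule eqv_context[OF bs_eq.sym[OF a_pow_snoc_LA[of i]], where a = "a_pow x" and b = "[]"]) auto
  also have "\<dots> \<approx> a_pow (x + i) @ [LA]"
    using step2 by (intro eqv_left)
  also have "\<dots> \<approx> a_pow (x + (i - 1))"
    using a_pow_snoc_LA[of "x + i"] by (simp add: algebra_simps)
  finally show ?case .
qed simp

lemma a_pow_split: "z = x + y \<Longrightarrow> a_pow z \<approx> a_pow x @ a_pow y"
  using a_pow_add bs_eq.sym by blast

lemma t_a_pow: "[Lt] @ a_pow P \<approx> a_pow Q @ [Lt]"
proof -
  have r: "[Lt] @ a_pow P @ [LT] \<approx> a_pow Q"
    using bs_eq.relator[of p "p * r"] by (simp add: a_pow_def nat_mult_distrib)
  have "[Lt] @ a_pow P \<approx> ([Lt] @ a_pow P @ [LT]) @ [Lt]"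
    by (rule eqv_context[OF bs_eq.sym[OF bs_eq.Tt], where a = "[Lt] @ a_pow P" and b = "[]"]) auto
  also have "\<dots> \<approx> a_pow Q @ [Lt]"
    using r by (rule eqv_left)
  finally show ?thesis .
qed

lemma t_a_pow_neg: "[Lt] @ a_pow (- P) \<approx> a_pow (- Q) @ [Lt]"
proof -
  have "[Lt] @ a_pow (- P) \<approx> a_pow (- Q) @ a_pow Q @ [Lt] @ a_pow (- P)"
    using eqv_left[OF a_pow_split[of 0 "- Q" Q], of "[Lt] @ a_pow (- P)"]
    by simp
  also have "\<dots> \<approx> a_pow (- Q) @ [Lt] @ a_pow P @ a_pow (- P)"
    by (rule eqv_context[OF bs_eq.sym[OF t_a_pow], where a = "a_pow (- Q)" and b = "a_pow (- P)"]) auto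
  also have "\<dots> \<approx> a_pow (- Q) @ [Lt]"
    using eqv_right[OF a_pow_add[of P "- P"], of "a_pow (- Q) @ [Lt]"]
    by simp
  finally show ?thesis .
qed

lemma t_push: "[Lt] @ a_pow (P * m) \<approx> a_pow (Q * m) @ [Lt]"
proof (induction m rule: int_induct[where k = 0])
  case (step1 i)
  have "[Lt] @ a_pow (P * (i + 1)) \<approx> ([Lt] @ a_pow (P * i)) @ a_pow P"
    by (rule eqv_context[OF a_pow_split[of "P * (i + 1)" "P * i" P], where a = "[Lt]" and b = "[]"])
      (auto simp: distrib_left)
  also have "\<dots> \<approx> (a_pow (Q * i) @ [Lt]) @ a_pow P"
    using step1(2) by (rule eqv_left)
  also have "\<dots> \<approx> (a_pow (Q * i) @ a_pow Q) @ [Lt]"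
    by (rule eqv_context[OF t_a_pow, where a = "a_pow (Q * i)" and b = "[]"]) auto
  also have "\<dots> \<approx> a_pow (Q * (i + 1)) @ [Lt]"
    using a_pow_add[of "Q * i" Q] by (intro eqv_left) (simp add: distrib_left)
  finally show ?case .
next
  case (step2 i)
  have "[Lt] @ a_pow (P * (i - 1)) \<approx> ([Lt] @ a_pow (P * i)) @ a_pow (- P)"
    by (rule eqv_context[OF a_pow_split[of "P * (i - 1)" "P * i" "- P"], where a = "[Lt]" and b = "[]"])
      (auto simp: right_diff_distrib)
  also have "\<dots> \<approx> (a_pow (Q * i) @ [Lt]) @ a_pow (- P)"
    using step2(2) by (rule eqv_left)
  also have "\<dots> \<approx> (a_pow (Q * i) @ a_pow (- Q)) @ [Lt]"
    by (rule eqv_context[OF t_a_pow_neg, where a = "a_pow (Q * i)" and b = "[]"]) auto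
  also have "\<dots> \<approx> a_pow (Q * (i - 1)) @ [Lt]"
    using a_pow_add[of "Q * i" "- Q"] by (intro eqv_left) (simp add: right_diff_distrib)
  finally show ?case .
qed simp

lemma T_push: "[LT] @ a_pow (Q * m) \<approx> a_pow (P * m) @ [LT]"
proof -
  have "[LT] @ a_pow (Q * m) \<approx> [LT] @ (a_pow (Q * m) @ [Lt]) @ [LT]"
    by (rule eqv_context[OF bs_eq.sym[OF bs_eq.tT], where a = "[LT] @ a_pow (Q * m)" and b = "[]"]) auto
  also have "\<dots> \<approx> [LT] @ ([Lt] @ a_pow (P * m)) @ [LT]"
    by (rule eqv_context[OF bs_eq.sym[OF t_push[of m]], where a = "[LT]" and b = "[LT]"]) auto
  also have "\<dots> \<approx> a_pow (P * m) @ [LT]"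
    by (rule eqv_context[OF bs_eq.Tt, where a = "[]" and b = "a_pow (P * m) @ [LT]"]) auto
  finally show ?thesis .
qed

lemma t_pinch: "[Lt] @ a_pow (P * m) @ [LT] \<approx> a_pow (Q * m)"
proof -
  have "[Lt] @ a_pow (P * m) @ [LT] \<approx> (a_pow (Q * m) @ [Lt]) @ [LT]"
    by (rule eqv_context[OF t_push[of m], where a = "[]" and b = "[LT]"]) auto
  also have "\<dots> \<approx> a_pow (Q * m)"
    by (rule eqv_context[OF bs_eq.tT, where a = "a_pow (Q * m)" and b = "[]"]) auto
  finally show ?thesis .
qed

lemma T_pinch: "[LT] @ a_pow (Q * m) @ [Lt] \<approx> a_pow (P * m)"
proof -
  have "[LT] @ a_pow (Q * m) @ [Lt] \<approx> (a_pow (P * m) @ [LT]) @ [Lt]"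
    by (rule eqv_context[OF T_push[of m], where a = "[]" and b = "[Lt]"]) auto
  also have "\<dots> \<approx> a_pow (P * m)"
    by (rule eqv_context[OF bs_eq.Tt, where a = "a_pow (P * m)" and b = "[]"]) auto
  finally show ?thesis .
qed

section \<open>Expressions and flows between them\<close>

definition tl_of :: "bool \<Rightarrow> letter" where "tl_of b = (if b then Lt else LT)"

lemma tl_of_simps [simp]: "tl_of True = Lt" "tl_of False = LT"
  by (auto simp: tl_of_def)

text \<open>Positions are numbered from 1, and \<open>H i\<close> tells whether the letter in front
  of position \<open>i\<close> is \<open>t\<close>. No letter stands in front of position 1; by the
  convention \<open>\<not> H 1\<close> it counts as entered by a \<open>T\<close>.\<close>

primrec wd :: "(nat \<Rightarrow> bool) \<Rightarrow> (nat \<Rightarrow> int) \<Rightarrow> nat \<Rightarrow> letter list" where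
  "wd H g 0 = []"
| "wd H g (Suc i) = wd H g i @ (if i = 0 then [] else [tl_of (H (Suc i))]) @ a_pow (g (Suc i))"

lemma wd_cong: "(\<And>i. 1 < i \<Longrightarrow> i \<le> n \<Longrightarrow> H i = H' i) \<Longrightarrow> (\<And>i. 1 \<le> i \<Longrightarrow> i \<le> n \<Longrightarrow> g i = g' i)
  \<Longrightarrow> wd H g n = wd H' g' n"
  by (induction n) auto

text \<open>\<open>f i\<close> counts the units a^p that leave position \<open>i\<close> to the
  right. By t a^p = a^q t with q = p r, r units shrink to one when they cross \<open>t\<close>, and
  one unit swells to r units when it crosses \<open>T\<close>.\<close>

definition inflow :: "(nat \<Rightarrow> bool) \<Rightarrow> (nat \<Rightarrow> int) \<Rightarrow> nat \<Rightarrow> int" where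
  "inflow H f i = (if H i then P * (f (i - 1) div R) else Q * f (i - 1))"

definition flow :: "(nat \<Rightarrow> bool) \<Rightarrow> (nat \<Rightarrow> int) \<Rightarrow> (nat \<Rightarrow> int) \<Rightarrow> (nat \<Rightarrow> int) \<Rightarrow> nat \<Rightarrow> bool" where
  "flow H e g f n \<longleftrightarrow> f 0 = 0 \<and>
    (\<forall>i. 1 \<le> i \<and> i \<le> n \<longrightarrow> g i = e i + inflow H f i - P * f i \<and> (H i \<longrightarrow> R dvd f (i - 1)))"

text \<open>The product telescopes: what has left position \<open>i\<close> stands as a power of a^p
  at the right end of the prefix. With \<open>f n = 0\<close> both expressions therefore represent
  the same element.\<close>

lemma flow_word:
  assumes "flow H e g f n" "i \<le> n"
  shows "wd H g i @ a_pow (P * f i) \<approx> wd H e i"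
  using assms(2)
proof (induction i)
  case 0
  then show ?case using assms by (simp add: flow_def)
next
  case (Suc i)
  let ?x = "if i = 0 then [] else [tl_of (H (Suc i))]"
  have g: "g (Suc i) + P * f (Suc i) = inflow H f (Suc i) + e (Suc i)"
    and d: "H (Suc i) \<Longrightarrow> R dvd f i"
    using assms Suc.prems by (auto simp: flow_def)
  have key: "?x @ a_pow (inflow H f (Suc i)) \<approx> a_pow (P * f i) @ ?x"
  proof (cases "i = 0")
    case True
    then show ?thesis using assms by (auto simp: flow_def inflow_def)
  next
    case i: False
    show ?thesis
    proof (cases "H (Suc i)")
      case True
      then obtain m where "f i = R * m" using d by auto
      then show ?thesis using t_push[of m] i True R2 by (simp add: inflow_def mult.assoc)
    next
      case False
      then show ?thesis using T_push[of "f i"] i by (simp add: inflow_def)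
    qed
  qed
  have "wd H g (Suc i) @ a_pow (P * f (Suc i))
      \<approx> wd H g i @ ?x @ a_pow (g (Suc i) + P * f (Suc i))"
    by (rule eqv_context[OF a_pow_add, where a = "wd H g i @ ?x" and b = "[]"]) auto
  also have "\<dots> \<approx> wd H g i @ (?x @ a_pow (inflow H f (Suc i))) @ a_pow (e (Suc i))"
    unfolding g by (rule eqv_context[OF a_pow_split[OF HOL.refl], where a = "wd H g i @ ?x" and b = "[]"]) auto
  also have "\<dots> \<approx> (wd H g i @ a_pow (P * f i)) @ ?x @ a_pow (e (Suc i))"
    by (rule eqv_context[OF key, where a = "wd H g i" and b = "a_pow (e (Suc i))"]) auto
  also have "\<dots> \<approx> wd H e (Suc i)"
    using eqv_left[OF Suc.IH, of "?x @ a_pow (e (Suc i))"] Suc.prems by simp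
  finally show ?case .
qed

section \<open>Reduced expressions whose exponents carry spurs\<close>

definition reduced :: "(nat \<Rightarrow> bool) \<Rightarrow> (nat \<Rightarrow> int) \<Rightarrow> nat \<Rightarrow> bool" where
  "reduced H g n \<longleftrightarrow> (\<forall>i. 1 < i \<and> i < n \<longrightarrow>
     (H i \<and> \<not> H (Suc i) \<longrightarrow> \<not> P dvd g i) \<and> (\<not> H i \<and> H (Suc i) \<longrightarrow> \<not> Q dvd g i))"

text \<open>\<open>spur x c\<close>: the power \<open>a\<^sup>x\<close> can be written as
  \<open>a\<^bsup>e\<^esub>\<^sub>0\<^esup> t a\<^bsup>e\<^esub>\<^sub>1\<^esup> t \<dots> t a\<^bsup>e\<^esub>\<^sub>j\<^esup> T\<^sup>j\<close> with \<open>c\<close> letters.\<close>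

inductive spur :: "int \<Rightarrow> nat \<Rightarrow> bool" where
  base: "spur e (nat \<bar>e\<bar>)"
| step: "spur (P * m) c \<Longrightarrow> spur (e + Q * m) (nat \<bar>e\<bar> + 2 + c)"

text \<open>Spurs are superposed level by level; exponents on the same level are added and one of
  the two pairs \<open>t\<close>, \<open>T\<close> of each common level is saved.\<close>

lemma spur_add:
  assumes "spur x c" "spur y d"
  shows "\<exists>c' \<le> c + d. spur (x + y) c'"
  using assms
proof (induction arbitrary: y d rule: spur.induct)
  case (base e)
  from base show ?case
  proof cases
    case base
    then show ?thesis using spur.base[of "e + y"] by (intro exI[of _ "nat \<bar>e + y\<bar>"]) auto
  next
    case (step m c e')
    then show ?thesis using spur.step[of m c "e + e'"]
      by (intro exI[of _ "nat \<bar>e + e'\<bar> + 2 + c"]) (auto simp: algebra_simps)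
  qed
next
  case (step m c e)
  from step.prems show ?case
  proof cases
    case base
    then show ?thesis using spur.step[OF step.hyps, of "e + y"]
      by (intro exI[of _ "nat \<bar>e + y\<bar> + 2 + c"]) (auto simp: algebra_simps)
  next
    case (step m' c' e')
    from step.IH[OF step(3)] obtain c'' where "c'' \<le> c + c'" "spur (P * (m + m')) c''"
      by (auto simp: algebra_simps)
    then show ?thesis using spur.step[of "m + m'" c'' "e + e'"] step(1,2)
      by (intro exI[of _ "nat \<bar>e + e'\<bar> + 2 + c''"]) (auto simp: algebra_simps)
  qed
qed

text \<open>This pays for removing a pinch T a^(qm) t. The bottom exponent is forced to be q(m -
  m'); it shrinks to p(m - m') and is then added to the bottom of the inner spur, whose enclosing
  \<open>t\<close> and \<open>T\<close> disappear.\<close>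

lemma spur_lower:
  assumes "spur (Q * m) c"
  shows "\<exists>c' \<le> c. spur (P * m) c'"
  using assms
proof cases
  case base
  have "\<bar>P * m\<bar> * 1 \<le> \<bar>P * m\<bar> * R" using R2 by (intro mult_left_mono) auto
  then have "\<bar>P * m\<bar> \<le> \<bar>Q * m\<bar>" by (simp add: abs_mult algebra_simps)
  then show ?thesis using base spur.base[of "P * m"]
    by (intro exI[of _ "nat \<bar>P * m\<bar>"]) auto
next
  case (step m' c' e)
  then have e: "e = Q * (m - m')" by (simp add: algebra_simps)
  have "\<bar>P * (m - m')\<bar> * 1 \<le> \<bar>P * (m - m')\<bar> * R" using R2 by (intro mult_left_mono) auto
  then have le: "\<bar>P * (m - m')\<bar> \<le> \<bar>e\<bar>" by (simp add: e abs_mult mult_ac)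
  from spur_add[OF spur.base[of "P * (m - m')"] step(3)]
  obtain c'' where "c'' \<le> nat \<bar>P * (m - m')\<bar> + c'" "spur (P * m) c''"
    by (auto simp: algebra_simps)
  then show ?thesis using le step(2) by (intro exI[of _ c'']) auto
qed

lemma spur_raise: "spur (P * m) c \<Longrightarrow> spur (Q * m) (2 + c)"
  using spur.step[of m c 0] by simp

lemma sum_fun_upd_last:
  fixes c :: "nat \<Rightarrow> nat"
  assumes "1 \<le> n" "x \<le> c n + k"
  shows "(\<Sum>i=1..n. (c(n := x)) i) \<le> (\<Sum>i=1..n. c i) + k"
proof -
  obtain m where m: "n = Suc m" using assms(1) by (cases n) auto
  have "(\<Sum>i=1..m. (c(n := x)) i) = (\<Sum>i=1..m. c i)" by (rule sum.cong) (auto simp: m)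
  then show ?thesis using assms(2) by (simp add: m)
qed

lemma reduced_upd_last: "reduced H g n \<Longrightarrow> reduced H (g(n := x)) n"
  by (auto simp: reduced_def)

lemma reduced_expression_a:
  assumes "1 \<le> n" "reduced H g n" "wd H g n \<approx> v"
    "\<forall>i. 1 \<le> i \<and> i \<le> n \<longrightarrow> spur (g i) (c i)" "n - 1 + (\<Sum>i=1..n. c i) \<le> length v"
    "spur x 1" "a_pow x = [l]"
  shows "\<exists>g c. reduced H g n \<and> wd H g n \<approx> v @ [l]
    \<and> (\<forall>i. 1 \<le> i \<and> i \<le> n \<longrightarrow> spur (g i) (c i)) \<and> n - 1 + (\<Sum>i=1..n. c i) \<le> length (v @ [l])"
proof -
  obtain c' where c': "c' \<le> c n + 1" "spur (g n + x) c'"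
    using spur_add[OF _ assms(6), of "g n" "c n"] assms(1,4) by auto
  let ?g = "g(n := g n + x)" and ?c = "c(n := c')"
  obtain m where m: "n = Suc m" using assms(1) by (cases n) auto
  have "wd H ?g m = wd H g m" by (rule wd_cong) (auto simp: m)
  then have "wd H ?g n \<approx> wd H g n @ a_pow x"
    using eqv_right[OF a_pow_split[OF HOL.refl, of "g (Suc m)" x],
      of "wd H g m @ (if m = 0 then [] else [tl_of (H (Suc m))])"] by (simp add: m)
  also have "\<dots> \<approx> v @ [l]" using eqv_left[OF assms(3)] assms(7) by simp
  finally have w: "wd H ?g n \<approx> v @ [l]" .
  have "(\<Sum>i=1..n. ?c i) \<le> (\<Sum>i=1..n. c i) + 1"
    using assms(1) c' by (intro sum_fun_upd_last) auto
  then have "n - 1 + (\<Sum>i=1..n. ?c i) \<le> length (v @ [l])" using assms(5) by simp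
  moreover have "\<forall>i. 1 \<le> i \<and> i \<le> n \<longrightarrow> spur (?g i) (?c i)" using assms(4) c'(2) by simp
  ultimately have "reduced H ?g n \<and> wd H ?g n \<approx> v @ [l]
    \<and> (\<forall>i. 1 \<le> i \<and> i \<le> n \<longrightarrow> spur (?g i) (?c i)) \<and> n - 1 + (\<Sum>i=1..n. ?c i) \<le> length (v @ [l])"
    using w reduced_upd_last[OF assms(2)] by (intro conjI)
  then show ?thesis by (intro exI[of _ ?g] exI[of _ ?c])
qed

lemma reduced_expression_push:
  assumes "1 \<le> n" "\<not> H 1" "reduced H g n" "wd H g n \<approx> v"
    "\<forall>i. 1 \<le> i \<and> i \<le> n \<longrightarrow> spur (g i) (c i)" "n - 1 + (\<Sum>i=1..n. c i) \<le> length v"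
    "1 < n \<Longrightarrow> b \<Longrightarrow> \<not> H n \<Longrightarrow> \<not> Q dvd g n" "1 < n \<Longrightarrow> \<not> b \<Longrightarrow> H n \<Longrightarrow> \<not> P dvd g n"
  shows "\<exists>n H g c. 1 \<le> n \<and> \<not> H 1 \<and> reduced H g n \<and> wd H g n \<approx> v @ [tl_of b]
    \<and> (\<forall>i. 1 \<le> i \<and> i \<le> n \<longrightarrow> spur (g i) (c i))
    \<and> n - 1 + (\<Sum>i=1..n. c i) \<le> length (v @ [tl_of b])"
proof -
  let ?H = "H(Suc n := b)" and ?g = "g(Suc n := 0)" and ?c = "c(Suc n := 0)"
  have "wd ?H ?g n = wd H g n" by (rule wd_cong) auto
  then have "wd ?H ?g (Suc n) = wd H g n @ [tl_of b]"
    using assms(1) by simp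
  then have w: "wd ?H ?g (Suc n) \<approx> v @ [tl_of b]" using eqv_left[OF assms(4)] by metis
  have "(\<Sum>i=1..n. ?c i) = (\<Sum>i=1..n. c i)" by (rule sum.cong) auto
  then have l: "Suc n - 1 + (\<Sum>i=1..Suc n. ?c i) \<le> length (v @ [tl_of b])"
    using assms(1,6) by simp
  have "reduced ?H ?g (Suc n)"
    using assms(3,7,8) by (auto simp: reduced_def less_Suc_eq)
  moreover have "\<forall>i. 1 \<le> i \<and> i \<le> Suc n \<longrightarrow> spur (?g i) (?c i)"
    using assms(5) spur.base[of 0] by (simp add: le_Suc_eq)
  moreover have "\<not> ?H 1" "1 \<le> Suc n" using assms(1,2) by auto
  ultimately have "1 \<le> Suc n \<and> \<not> ?H 1 \<and> reduced ?H ?g (Suc n) \<and> wd ?H ?g (Suc n) \<approx> v @ [tl_of b]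
    \<and> (\<forall>i. 1 \<le> i \<and> i \<le> Suc n \<longrightarrow> spur (?g i) (?c i))
    \<and> Suc n - 1 + (\<Sum>i=1..Suc n. ?c i) \<le> length (v @ [tl_of b])" using w l by (intro conjI)
  then show ?thesis by (intro exI[of _ "Suc n"] exI[of _ ?H] exI[of _ ?g] exI[of _ ?c])
qed

text \<open>The slack of 2 is the exact budget: the expression loses one letter while the word has
  become one letter longer, so the exponent left behind by the pinch may be dearer by two
  letters.\<close>

lemma reduced_expression_pop:
  assumes "1 < n" "reduced H g n" "wd H g n \<approx> v"
    "\<forall>i. 1 \<le> i \<and> i \<le> n \<longrightarrow> spur (g i) (c i)" "n - 1 + (\<Sum>i=1..n. c i) \<le> length v"
    "c' \<le> c n + 2" "spur x c'" "[tl_of (H n)] @ a_pow (g n) @ [l] \<approx> a_pow x"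
  shows "\<exists>n' g c. 1 \<le> n' \<and> reduced H g n' \<and> wd H g n' \<approx> v @ [l]
    \<and> (\<forall>i. 1 \<le> i \<and> i \<le> n' \<longrightarrow> spur (g i) (c i))
    \<and> n' - 1 + (\<Sum>i=1..n'. c i) \<le> length (v @ [l])"
proof -
  define k where "k = n - 2"
  have k: "n = Suc (Suc k)" using assms(1) by (simp add: k_def)
  let ?m = "Suc k"
  obtain c'' where c'': "c'' \<le> c ?m + c'" "spur (g ?m + x) c''"
    using spur_add[OF _ assms(7), of "g ?m" "c ?m"] assms(4) k by auto
  let ?g = "g(?m := g ?m + x)" and ?c = "c(?m := c'')"
  have "wd H ?g k = wd H g k" by (rule wd_cong) auto
  then have "wd H ?g ?m \<approx> wd H g ?m @ a_pow x"
    using eqv_right[OF a_pow_split[OF HOL.refl, of "g ?m" x],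
      of "wd H g k @ (if k = 0 then [] else [tl_of (H (Suc k))])"] by simp
  also have "\<dots> \<approx> wd H g ?m @ [tl_of (H n)] @ a_pow (g n) @ [l]"
    by (rule eqv_right[OF bs_eq.sym[OF assms(8)]])
  also have "\<dots> = wd H g n @ [l]" by (simp add: k)
  also have "\<dots> \<approx> v @ [l]" by (rule eqv_left[OF assms(3)])
  finally have w: "wd H ?g ?m \<approx> v @ [l]" .
  have "(\<Sum>i=1..?m. ?c i) \<le> (\<Sum>i=1..?m. c i) + c'"
    using c'' by (intro sum_fun_upd_last) auto
  then have "?m - 1 + (\<Sum>i=1..?m. ?c i) \<le> length (v @ [l])"
    using assms(5,6) by (simp add: k)
  moreover have "reduced H ?g ?m"
    using assms(2) by (auto simp: reduced_def k)
  moreover have "\<forall>i. 1 \<le> i \<and> i \<le> ?m \<longrightarrow> spur (?g i) (?c i)"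
    using assms(4) c''(2) k by simp
  moreover have "1 \<le> ?m" by simp
  ultimately have "1 \<le> ?m \<and> reduced H ?g ?m \<and> wd H ?g ?m \<approx> v @ [l]
    \<and> (\<forall>i. 1 \<le> i \<and> i \<le> ?m \<longrightarrow> spur (?g i) (?c i))
    \<and> ?m - 1 + (\<Sum>i=1..?m. ?c i) \<le> length (v @ [l])" using w by (intro conjI)
  then show ?thesis by (intro exI[of _ ?m] exI[of _ ?g] exI[of _ ?c])
qed

text \<open>Britton reduction is run on the word letter by letter, and every exponent keeps a spur
  that certifies how many letters realise it. A pinch t...T survives as a new level of a spur, which
  uses the budget of 2 completely; a pinch T...t never lengthens a spur. Thus any word, in
  particular a geodesic, is at least as long as some reduced expression with spurs.\<close>

theorem reduced_expression:
  "\<exists>n H g c. 1 \<le> n \<and> \<not> H 1 \<and> reduced H g n \<and> wd H g n \<approx> v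
     \<and> (\<forall>i. 1 \<le> i \<and> i \<le> n \<longrightarrow> spur (g i) (c i)) \<and> n - 1 + (\<Sum>i=1..n. c i) \<le> length v"
proof (induction v rule: rev_induct)
  case Nil
  have "spur 0 0" using spur.base[of 0] by simp
  then show ?case
    by (intro exI[of _ 1] exI[of _ "\<lambda>_. False"] exI[of _ "\<lambda>_. 0"]) (auto simp: reduced_def)
next
  case (snoc l v)
  then obtain n H g c where IH: "1 \<le> n" "\<not> H 1" "reduced H g n" "wd H g n \<approx> v"
      "\<forall>i. 1 \<le> i \<and> i \<le> n \<longrightarrow> spur (g i) (c i)" "n - 1 + (\<Sum>i=1..n. c i) \<le> length v"
    by blast
  show ?case
  proof (cases l)
    case Lt
    show ?thesis
    proof (cases "1 < n \<and> \<not> H n \<and> Q dvd g n")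
      case True
      then obtain m where m: "g n = Q * m" by auto
      have "spur (g n) (c n)" using IH(5) True by simp
      then obtain c' where c': "c' \<le> c n" "spur (P * m) c'"
        using spur_lower[of m "c n"] m by auto
      have "[tl_of (H n)] @ a_pow (g n) @ [l] \<approx> a_pow (P * m)"
        using T_pinch[of m] True Lt m by simp
      from reduced_expression_pop[OF _ IH(3-6) _ c'(2) this] c'(1) True
      obtain n' g' c'' where "1 \<le> n'" "reduced H g' n'" "wd H g' n' \<approx> v @ [l]"
        "\<forall>i. 1 \<le> i \<and> i \<le> n' \<longrightarrow> spur (g' i) (c'' i)"
        "n' - 1 + (\<Sum>i=1..n'. c'' i) \<le> length (v @ [l])" by (elim exE conjE meta_impE) simp_all
      then show ?thesis using IH(2)
        by (intro exI[of _ n'] exI[of _ H] exI[of _ g'] exI[of _ c''] conjI)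
    next
      case False
      then show ?thesis
        unfolding Lt tl_of_simps(1)[symmetric] by (intro reduced_expression_push[OF IH]) simp_all
    qed
  next
    case LT
    show ?thesis
    proof (cases "1 < n \<and> H n \<and> P dvd g n")
      case True
      then obtain m where m: "g n = P * m" by auto
      have c': "spur (Q * m) (2 + c n)"
        using spur_raise[of m "c n"] IH(5)[rule_format, of n] m True by simp
      have "[tl_of (H n)] @ a_pow (g n) @ [l] \<approx> a_pow (Q * m)"
        using t_pinch[of m] True LT m by simp
      from reduced_expression_pop[OF _ IH(3-6) _ c' this] True
      obtain n' g' c'' where "1 \<le> n'" "reduced H g' n'" "wd H g' n' \<approx> v @ [l]"
        "\<forall>i. 1 \<le> i \<and> i \<le> n' \<longrightarrow> spur (g' i) (c'' i)"
        "n' - 1 + (\<Sum>i=1..n'. c'' i) \<le> length (v @ [l])" by auto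
      then show ?thesis using IH(2)
        by (intro exI[of _ n'] exI[of _ H] exI[of _ g'] exI[of _ c''] conjI)
    next
      case False
      then show ?thesis
        unfolding LT tl_of_simps(2)[symmetric] by (intro reduced_expression_push[OF IH]) simp_all
    qed
  next
    case La
    have "spur (1) 1" "a_pow (1) = [l]" using spur.base[of "1"] La by (auto simp: a_pow_def)
    from reduced_expression_a[OF IH(1,3-6) this] obtain g' c' where "reduced H g' n" "wd H g' n \<approx> v @ [l]"
      "\<forall>i. 1 \<le> i \<and> i \<le> n \<longrightarrow> spur (g' i) (c' i)" "n - 1 + (\<Sum>i=1..n. c' i) \<le> length (v @ [l])"
      by (elim exE conjE)
    then show ?thesis using IH(1,2)
      by (intro exI[of _ n] exI[of _ H] exI[of _ g'] exI[of _ c'] conjI)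
  next
    case LA
    have "spur (-1) 1" "a_pow (-1) = [l]" using spur.base[of "-1"] LA by (auto simp: a_pow_def)
    from reduced_expression_a[OF IH(1,3-6) this] obtain g' c' where "reduced H g' n" "wd H g' n \<approx> v @ [l]"
      "\<forall>i. 1 \<le> i \<and> i \<le> n \<longrightarrow> spur (g' i) (c' i)" "n - 1 + (\<Sum>i=1..n. c' i) \<le> length (v @ [l])"
      by (elim exE conjE)
    then show ?thesis using IH(1,2)
      by (intro exI[of _ n] exI[of _ H] exI[of _ g'] exI[of _ c'] conjI)
  qed
qed

text \<open>The right action of the letters on normal forms: the list holds, last first, the coset
  representative in front of each letter \<open>t\<close> or \<open>T\<close>.\<close>

fun act :: "letter \<Rightarrow> (int \<times> bool) list \<times> int \<Rightarrow> (int \<times> bool) list \<times> int" where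
  "act La (L, z) = (L, z + 1)"
| "act LA (L, z) = (L, z - 1)"
| "act Lt (L, z) = (if Q dvd z \<and> L \<noteq> [] \<and> \<not> snd (hd L) then (tl L, fst (hd L) + P * (z div Q))
     else ((z mod Q, True) # L, P * (z div Q)))"
| "act LT (L, z) = (if P dvd z \<and> L \<noteq> [] \<and> snd (hd L) then (tl L, fst (hd L) + Q * (z div P))
     else ((z mod P, False) # L, Q * (z div P)))"

section \<open>Normal forms, and uniqueness of reduced expressions up to a flow\<close>

text \<open>A representative 0 between two opposite letters would be a pinch. Excluding it is what
  makes \<open>t\<close> and \<open>T\<close> act as mutually inverse maps.\<close>

fun valid :: "(int \<times> bool) list \<Rightarrow> bool" where
  "valid [] = True"
| "valid ((c, b) # L) = (0 \<le> c \<and> c < (if b then Q else P)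
     \<and> (L \<noteq> [] \<and> snd (hd L) \<noteq> b \<longrightarrow> c \<noteq> 0) \<and> valid L)"

lemma valid_act: "valid (fst s) \<Longrightarrow> valid (fst (act l s))"
proof (cases s)
  case (Pair L z)
  assume "valid (fst s)"
  then show ?thesis using Ppos Qpos
    by (cases l; cases L) (auto simp: Pair dvd_eq_mod_eq_0)
qed

definition acts :: "letter list \<Rightarrow> (int \<times> bool) list \<times> int \<Rightarrow> (int \<times> bool) list \<times> int" where
  "acts w s = fold act w s"

lemma acts_simps [simp]: "acts [] s = s" "acts (l # w) s = acts w (act l s)"
    "acts (u @ v) s = acts v (acts u s)"
  by (auto simp: acts_def)

lemma valid_acts: "valid (fst s) \<Longrightarrow> valid (fst (acts w s))"
  by (induction w arbitrary: s) (auto simp: valid_act)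

lemma acts_replicate_La: "acts (replicate k La) (L, z) = (L, z + int k)"
  by (induction k arbitrary: z) auto

lemma acts_replicate_LA: "acts (replicate k LA) (L, z) = (L, z - int k)"
  by (induction k arbitrary: z) auto

lemma acts_a_pow: "acts (a_pow x) (L, z) = (L, z + x)"
  by (auto simp: a_pow_def acts_replicate_La acts_replicate_LA)

text \<open>The case m = 0 is the relation tT = 1 and m = 1 is the defining relator. If
  \<open>t\<close> removes a letter \<open>T\<close> with representative c, then c is recovered
  afterwards as a remainder modulo \<open>P\<close>, and validity prevents the final
  \<open>T\<close> from removing one letter more.\<close>

lemma act_t_pow_T:
  assumes "valid L"
  shows "act LT (fst (act Lt (L, z)), snd (act Lt (L, z)) + P * m) = (L, z + Q * m)"
proof (cases "Q dvd z \<and> L \<noteq> [] \<and> \<not> snd (hd L)")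
  case True
  then obtain c L' where L: "L = (c, False) # L'" by (cases L) auto
  obtain k where k: "z = Q * k" using True by auto
  have c: "0 \<le> c" "c < P" "L' \<noteq> [] \<and> snd (hd L') \<longrightarrow> c \<noteq> 0" using assms L by auto
  have e: "(c + P * k + P * m) mod P = c" "(c + P * k + P * m) div P = k + m"
    using c Ppos by (auto simp: add.assoc distrib_left[symmetric])
  then have "P dvd (c + P * k + P * m) \<Longrightarrow> c = 0" by (metis dvd_imp_mod_0)
  then show ?thesis
    using True c e Qpos by (auto simp: L k algebra_simps)
next
  case False
  have "act Lt (L, z) = ((z mod Q, True) # L, P * (z div Q))" using False by auto
  moreover have "(P * (z div Q) + P * m) div P = z div Q + m" using Ppos
    by (simp add: distrib_left[symmetric])
  moreover have "z mod Q + Q * (z div Q + m) = z + Q * m"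
    unfolding distrib_left using mult_div_mod_eq[of Q z] by linarith
  ultimately show ?thesis by (simp add: distrib_left[symmetric])
qed

lemma act_T_t:
  assumes "valid L"
  shows "act Lt (act LT (L, z)) = (L, z)"
proof (cases "P dvd z \<and> L \<noteq> [] \<and> snd (hd L)")
  case True
  then obtain c L' where L: "L = (c, True) # L'" by (cases L) auto
  obtain k where k: "z = P * k" using True by auto
  have c: "0 \<le> c" "c < Q" "L' \<noteq> [] \<and> \<not> snd (hd L') \<longrightarrow> c \<noteq> 0" using assms L by auto
  have e: "(c + Q * k) mod Q = c" "(c + Q * k) div Q = k"
    using mod_mult_self2[of c Q k] mod_pos_pos_trivial[OF c(1,2)]
      div_mult_self2[of Q c k] div_pos_pos_trivial[OF c(1,2)] Qpos by linarith+
  then have "Q dvd (c + Q * k) \<Longrightarrow> c = 0" by (metis dvd_imp_mod_0)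
  then show ?thesis
    using True c e Ppos by (auto simp: L k)
next
  case False
  have "act LT (L, z) = ((z mod P, False) # L, Q * (z div P))" using False by auto
  then show ?thesis using p1 r2 by simp
qed

lemma act_a_inverse: "act LA (act La s) = s" "act La (act LA s) = s"
  by (cases s; simp)+

text \<open>All generating relations hold for the action, so equivalent words send a valid normal
  form to the same result. This replaces an appeal to Britton's lemma.\<close>

lemma bs_eq_acts:
  assumes "u \<approx> v" "valid (fst s)"
  shows "acts u s = acts v s"
  using assms
proof (induction arbitrary: s rule: bs_eq.induct)
  case (cong u u' v v')
  then show ?case using valid_acts by simp
next
  case tT
  then show ?case using act_t_pow_T[of "fst s" "snd s" 0] by simp
next
  case Tt
  then show ?case using act_T_t[of "fst s" "snd s"] by simp
next
  case relator
  obtain L z where s: "act Lt s = (L, z)" by fastforce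
  then show ?case
    using relator act_t_pow_T[of "fst s" "snd s" 1] acts_replicate_La[of "p * r" "fst s" "snd s"]
    by (simp add: acts_replicate_La)
next
  case (trans u v w)
  then show ?case by simp
qed (simp_all add: act_a_inverse)

text \<open>On a reduced expression no letter is ever removed. The power arriving at position
  \<open>i\<close> from the left is a multiple of \<open>P\<close> after \<open>t\<close> and of
  \<open>Q\<close> after \<open>T\<close>; so if the next letter removed something, the exponent
  \<open>g i\<close> itself would be divisible and form a pinch. Hence the height of the stack
  counts the letters.\<close>

lemma acts_wd:
  assumes "reduced H g n" "\<not> H 1" "1 \<le> i" "i \<le> n"
  shows "\<exists>L z. acts (wd H g i) ([], 0) = (L, z) \<and> length L = i - 1
     \<and> (1 < i \<longrightarrow> snd (hd L) = H i \<and> (if H i then P else Q) dvd (z - g i)) \<and> (i = 1 \<longrightarrow> z = g 1)"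
  using assms(3,4)
proof (induction i rule: dec_induct)
  case base
  then show ?case by (simp add: acts_a_pow)
next
  case (step i)
  then obtain L z where IH: "acts (wd H g i) ([], 0) = (L, z)" "length L = i - 1"
     "1 < i \<Longrightarrow> snd (hd L) = H i \<and> (if H i then P else Q) dvd (z - g i)"
    by auto
  have nd: "\<not> ((if H (Suc i) then Q else P) dvd z \<and> L \<noteq> [] \<and> snd (hd L) = (\<not> H (Suc i)))"
  proof
    assume a: "(if H (Suc i) then Q else P) dvd z \<and> L \<noteq> [] \<and> snd (hd L) = (\<not> H (Suc i))"
    then have i: "1 < i" using IH(2) by (cases L) auto
    note IH3 = IH(3)[OF i]
    have red: "H i \<and> \<not> H (Suc i) \<longrightarrow> \<not> P dvd g i" "\<not> H i \<and> H (Suc i) \<longrightarrow> \<not> Q dvd g i"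
      using assms(1) i step(4) by (auto simp: reduced_def)
    show False
    proof (cases "H (Suc i)")
      case True
      then have "\<not> H i" "Q dvd z" using a IH3 by auto
      moreover have "Q dvd z - g i" using IH3 \<open>\<not> H i\<close> by simp
      ultimately have "Q dvd g i" using dvd_diff[of Q z "z - g i"] by simp
      then show False using red True \<open>\<not> H i\<close> by simp
    next
      case False
      then have "H i" "P dvd z" using a IH3 by auto
      moreover have "P dvd z - g i" using IH3 \<open>H i\<close> by simp
      ultimately have "P dvd g i" using dvd_diff[of P z "z - g i"] by simp
      then show False using red False \<open>H i\<close> by simp
    qed
  qed
  then show ?case
    using IH step(1) by (cases "H (Suc i)") (auto simp: acts_a_pow)
qed

lemma acts_wd_Suc:
  assumes "reduced H g n" "\<not> H 1" "1 \<le> i" "Suc i \<le> n" "acts (wd H g i) ([], 0) = (L, z)"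
  shows "acts (wd H g (Suc i)) ([], 0) = (if H (Suc i)
     then ((z mod Q, True) # L, P * (z div Q) + g (Suc i))
     else ((z mod P, False) # L, Q * (z div P) + g (Suc i)))"
proof -
  have "length (fst (acts (wd H g (Suc i)) ([], 0))) = i" "length L = i - 1"
    using acts_wd[of H g n i] acts_wd[of H g n "Suc i"] assms by auto
  then have "length (fst (act (tl_of (H (Suc i))) (L, z))) = i"
    using assms(3,5) by (cases "act (tl_of (H (Suc i))) (L, z)") (simp add: acts_a_pow)
  then have "act (tl_of (H (Suc i))) (L, z) = (if H (Suc i)
     then ((z mod Q, True) # L, P * (z div Q)) else ((z mod P, False) # L, Q * (z div P)))"
    using \<open>length L = i - 1\<close> assms(3) by (cases "H (Suc i)") (auto split: if_splits)
  then show ?thesis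
    using assms(3,5) by (auto simp: acts_a_pow)
qed

text \<open>The induction needs prefixes: there the stacks agree, but the trailing powers may differ
  by a multiple of \<open>P\<close>, and this multiple is the value of the flow at the last position
  of the prefix.\<close>

lemma reduced_unique_aux:
  assumes "reduced H e n" "\<not> H 1" "reduced H' g n'" "\<not> H' 1" "1 \<le> i" "i \<le> n" "i \<le> n'"
    "acts (wd H e i) ([], 0) = (L, z)" "acts (wd H' g i) ([], 0) = (L, z')" "z = z' + P * m"
  shows "(\<forall>j. 1 \<le> j \<and> j \<le> i \<longrightarrow> H j = H' j) \<and> (\<exists>f. flow H e g f i \<and> f i = m)"
  using assms(5-)
proof (induction i arbitrary: L z z' m rule: dec_induct)
  case base
  then show ?case
    using assms(2,4) by (auto simp: acts_a_pow flow_def inflow_def intro!: exI[of _ "\<lambda>i. if i = 0 then 0 else m"])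
next
  case (step i)
  obtain L1 z1 where s1: "acts (wd H e i) ([], 0) = (L1, z1)" by fastforce
  obtain L2 z2 where s2: "acts (wd H' g i) ([], 0) = (L2, z2)" by fastforce
  note e1 = acts_wd_Suc[OF assms(1,2) step(1) step(4) s1]
  note e2 = acts_wd_Suc[OF assms(3,4) step(1) step(5) s2]
  have HH: "H (Suc i) = H' (Suc i)" and LL: "L1 = L2" using e1 e2 step(6,7) by (auto split: if_splits)
  \<comment> \<open>The representatives pushed in front of the new letter coincide, so the trailing
    powers are congruent modulo \<open>Q\<close> for \<open>t\<close> and modulo \<open>P\<close>
    for \<open>T\<close>. Counted in units of \<open>P\<close>, their difference is thus a multiple
    of \<open>R\<close> exactly in the case where the flow demands it.\<close>
  have "\<exists>f. z1 = z2 + P * f \<and> (H (Suc i) \<longrightarrow> R dvd f) \<and>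
     z1 div (if H (Suc i) then Q else P) = z2 div (if H (Suc i) then Q else P) + (if H (Suc i) then f div R else f)"
  proof (cases "H (Suc i)")
    case True
    then have "z1 mod Q = z2 mod Q" using e1 e2 step(6,7) HH by auto
    then have z1: "z1 = z2 + Q * (z1 div Q - z2 div Q)"
      using mult_div_mod_eq[of "Q" z1] mult_div_mod_eq[of "Q" z2] unfolding right_diff_distrib by linarith
    then show ?thesis using True R2
      by (intro exI[of _ "R * (z1 div Q - z2 div Q)"]) (auto simp: algebra_simps)
  next
    case False
    then have "z1 mod P = z2 mod P" using e1 e2 step(6,7) HH by auto
    then have z1: "z1 = z2 + P * (z1 div P - z2 div P)"
      using mult_div_mod_eq[of "P" z1] mult_div_mod_eq[of "P" z2] unfolding right_diff_distrib by linarith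
    then show ?thesis using False
      by (intro exI[of _ "z1 div P - z2 div P"]) auto
  qed
  then obtain f where f: "z1 = z2 + P * f" "H (Suc i) \<Longrightarrow> R dvd f"
     "z1 div (if H (Suc i) then Q else P) = z2 div (if H (Suc i) then Q else P) + (if H (Suc i) then f div R else f)"
    by auto
  have "i \<le> n" "i \<le> n'" using step by auto
  from step.IH[OF this s1 s2[folded LL] f(1)]
  obtain ff where IH: "\<forall>j. 1 \<le> j \<and> j \<le> i \<longrightarrow> H j = H' j" "flow H e g ff i" "ff i = f" by auto
  have eq: "g (Suc i) = e (Suc i) + (if H (Suc i) then P * (f div R) else Q * f) - P * m"
    using e1 e2 step(6,7,8) HH f(3) by (auto simp: algebra_simps)
  have "flow H e g (ff(Suc i := m)) (Suc i)"
    unfolding flow_def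
  proof (intro conjI allI impI)
    show "(ff(Suc i := m)) 0 = 0" using IH by (auto simp: flow_def)
    fix j
    assume j: "1 \<le> j \<and> j \<le> Suc i"
    show "g j = e j + inflow H (ff(Suc i := m)) j - P * (ff(Suc i := m)) j"
    proof (cases "j = Suc i")
      case True
      then show ?thesis using eq IH(3) by (auto simp: inflow_def)
    next
      case False
      then show ?thesis using IH(2) j by (auto simp: flow_def inflow_def)
    qed
    assume "H j"
    then show "R dvd (ff(Suc i := m)) (j - 1)"
      using f(2) IH(2,3) j by (cases "j = Suc i") (auto simp: flow_def)
  qed
  then show ?case using IH HH by (auto simp: le_Suc_eq intro!: exI[of _ "ff(Suc i := m)"])
qed

text \<open>Both expressions act equally on the empty normal form. Equal stack heights give equal
  numbers of letters, and equal trailing powers say that nothing flows out at the end.\<close>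

theorem reduced_unique:
  assumes "reduced H e n" "\<not> H 1" "1 \<le> n" "reduced H' g n'" "\<not> H' 1" "1 \<le> n'"
    "wd H e n \<approx> wd H' g n'"
  shows "n' = n \<and> (\<forall>j. 1 \<le> j \<and> j \<le> n \<longrightarrow> H j = H' j) \<and> (\<exists>f. flow H e g f n \<and> f n = 0)"
proof -
  obtain L z where s: "acts (wd H e n) ([], 0) = (L, z)" "length L = n - 1"
    using acts_wd[OF assms(1,2,3) order_refl] by auto
  moreover have s': "acts (wd H' g n') ([], 0) = (L, z)"
    using bs_eq_acts[OF assms(7), of "([], 0)"] s by simp
  ultimately have "n' = n"
    using acts_wd[OF assms(4,5,6) order_refl] assms(3,6) by auto
  then show ?thesis
    using reduced_unique_aux[OF assms(1,2,4,5,3) _ _ s(1), of z 0] s' by simp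
qed

end

section \<open>Convolution of convex-like profiles\<close>

text \<open>The slopes \<open>P\<close> and \<open>-P\<close> outside the window are the steepest
  ones that the Lipschitz condition admits. Such a function is known from its values on the
  \<open>L + 1\<close> integers from \<open>c\<close> to \<open>c + L\<close>.\<close>

definition win :: "int \<Rightarrow> (int \<Rightarrow> int) \<Rightarrow> int \<Rightarrow> int \<Rightarrow> bool" where
  "win P f c L \<longleftrightarrow> 0 \<le> L \<and> (\<forall>z. \<bar>f (z + 1) - f z\<bar> \<le> P)
     \<and> (\<forall>z \<le> c. f z = f c + P * (c - z)) \<and> (\<forall>z \<ge> c + L. f z = f (c + L) + P * (z - c - L))"

lemma winI: "0 \<le> L \<Longrightarrow> (\<And>z. \<bar>f (z + 1) - f z\<bar> \<le> P) \<Longrightarrow> (\<And>z. z \<le> c \<Longrightarrow> f z = f c + P * (c - z))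
    \<Longrightarrow> (\<And>z. c + L \<le> z \<Longrightarrow> f z = f (c + L) + P * (z - c - L)) \<Longrightarrow> win P f c L"
  unfolding win_def by blast

lemma lipschitz_steps:
  fixes f :: "int \<Rightarrow> int"
  assumes "\<And>z. \<bar>f (z + 1) - f z\<bar> \<le> P"
  shows "\<bar>f x - f y\<bar> \<le> P * \<bar>x - y\<bar>"
proof -
  have *: "\<bar>f (y + int n) - f y\<bar> \<le> P * int n" for y n
  proof (induction n)
    case (Suc n)
    then show ?case using assms[of "y + int n"] by (simp add: algebra_simps)
  qed simp
  show ?thesis
  proof (cases "y \<le> x")
    case True
    then show ?thesis using *[of y "nat (x - y)"] by simp
  next
    case False
    then show ?thesis using *[of x "nat (y - x)"] by (simp add: abs_minus_commute)
  qed
qed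

lemma win_lipschitz: "win P f c L \<Longrightarrow> \<bar>f x - f y\<bar> \<le> P * \<bar>x - y\<bar>"
  by (rule lipschitz_steps) (auto simp: win_def)

lemma win_left: "win P f c L \<Longrightarrow> z \<le> c \<Longrightarrow> f z = f c + P * (c - z)"
  and win_right: "win P f c L \<Longrightarrow> c + L \<le> z \<Longrightarrow> f z = f (c + L) + P * (z - c - L)"
  and win_nonneg: "win P f c L \<Longrightarrow> 0 \<le> L"
  unfolding win_def by blast+

lemma win_le: "win P f c L \<Longrightarrow> f x \<le> f y + P * \<bar>x - y\<bar>"
  using win_lipschitz[of P f c L x y] by linarith

lemma win_le_shift: "win P f c L \<Longrightarrow> f (z - x) \<le> f (z - y) + P * \<bar>y - x\<bar>"
  using win_le[of P f c L "z - x" "z - y"] by (simp add: algebra_simps)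

context bs
begin

text \<open>The halving rests on \<open>R >= 2\<close>: the summand \<open>R * (L div 2)\<close> is
  at least \<open>L - 1\<close>, and the extra step of length \<open>R\<close> outweighs the
  remainder of \<open>c\<close> by at least 1.\<close>

lemma div_window:
  assumes "0 \<le> L"
  shows "R * (c div R) \<le> c" "c + L \<le> R * (c div R + L div 2 + 1)"
proof -
  have c: "R * (c div R) + c mod R = c" by simp
  have m: "0 \<le> c mod R" "c mod R < R" using Rpos by auto
  show "R * (c div R) \<le> c" using c m by linarith
  have "2 * (L div 2) \<le> R * (L div 2)" using R2 assms by (intro mult_right_mono) auto
  moreover have "L \<le> 2 * (L div 2) + 1" by linarith
  ultimately show "c + L \<le> R * (c div R + L div 2 + 1)"
    unfolding distrib_left using c m by linarith
qed

text \<open>Infimal convolution of \<open>A\<close> with the dilation \<open>m \<mapsto> Y (r m)\<close>; outside the window of \<open>Y\<close> that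
  dilation has slopes \<open>\<plusminus> p r\<close>, steeper than \<open>A\<close>, so only \<open>m\<close> in the window matter.\<close>

definition conv :: "(int \<Rightarrow> int) \<Rightarrow> (int \<Rightarrow> int) \<Rightarrow> int \<Rightarrow> int \<Rightarrow> int \<Rightarrow> int" where
  "conv A Y c L z = Min ((\<lambda>m. Y (R * m) + A (z - m)) ` {c div R .. c div R + L div 2 + 1})"

lemma conv_attained:
  assumes "0 \<le> L"
  obtains m where "c div R \<le> m" "m \<le> c div R + L div 2 + 1" "conv A Y c L z = Y (R * m) + A (z - m)"
proof -
  let ?S = "(\<lambda>m. Y (R * m) + A (z - m)) ` {c div R .. c div R + L div 2 + 1}"
  have "?S \<noteq> {}" using assms by auto
  then have "conv A Y c L z \<in> ?S" unfolding conv_def by (intro Min_in) auto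
  then show thesis using that by auto
qed

lemma conv_le_window:
  "c div R \<le> m \<Longrightarrow> m \<le> c div R + L div 2 + 1 \<Longrightarrow> conv A Y c L z \<le> Y (R * m) + A (z - m)"
  unfolding conv_def by (intro Min_le) auto

text \<open>The minimum over the finite range is the infimum over all m. Moving m by one from
  outside towards the range lowers \<open>Y (R * m)\<close> by \<open>P * R\<close> and raises the
  value of \<open>A\<close> by at most \<open>P\<close>.\<close>

lemma conv_le:
  assumes Y: "win P Y c L" and A: "win P A cA K"
  shows "conv A Y c L z \<le> Y (R * m) + A (z - m)"
proof -
  let ?a = "c div R" and ?b = "c div R + L div 2 + 1"
  have L: "0 \<le> L" using Y by (simp add: win_def)
  have w: "R * ?a \<le> c" "c + L \<le> R * ?b" using div_window[OF L] by auto
  show ?thesis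
  proof (cases "?a \<le> m \<and> m \<le> ?b")
    case True
    then show ?thesis by (intro conv_le_window) auto
  next
    case False
    have steep: "P * \<bar>m - m'\<bar> \<le> P * (R * \<bar>m - m'\<bar>)" for m'
    proof -
      have "1 * \<bar>m - m'\<bar> \<le> R * \<bar>m - m'\<bar>" using R2 by (intro mult_right_mono) auto
      then show ?thesis using Ppos by (intro mult_left_mono) auto
    qed
    show ?thesis
    proof (cases "m < ?a")
      case True
      then have "R * m \<le> R * ?a" using Rpos by (intro mult_left_mono) auto
      then have "Y (R * m) = Y c + P * (c - R * m)" "Y (R * ?a) = Y c + P * (c - R * ?a)"
        using win_left[OF Y] w by (meson order_trans)+
      then have "Y (R * m) = Y (R * ?a) + P * (R * \<bar>m - ?a\<bar>)"
        using True by (simp add: algebra_simps)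
      moreover have "A (z - ?a) \<le> A (z - m) + P * \<bar>m - ?a\<bar>"
        by (rule win_le_shift[OF A])
      moreover have "conv A Y c L z \<le> Y (R * ?a) + A (z - ?a)"
        using L by (intro conv_le_window) auto
      ultimately show ?thesis using steep[of ?a] by linarith
    next
      case F: False
      then have m: "?b < m" using False by auto
      then have "R * ?b \<le> R * m" using Rpos by (intro mult_left_mono) auto
      then have "Y (R * m) = Y (c + L) + P * (R * m - c - L)"
          "Y (R * ?b) = Y (c + L) + P * (R * ?b - c - L)"
        using win_right[OF Y] w by (meson order_trans)+
      then have "Y (R * m) = Y (R * ?b) + P * (R * \<bar>m - ?b\<bar>)"
        using m by (simp add: algebra_simps)
      moreover have "A (z - ?b) \<le> A (z - m) + P * \<bar>m - ?b\<bar>"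
        by (rule win_le_shift[OF A])
      moreover have "conv A Y c L z \<le> Y (R * ?b) + A (z - ?b)"
        using L by (intro conv_le_window) auto
      ultimately show ?thesis using steep[of ?b] by linarith
    qed
  qed
qed

text \<open>If z lies left of \<open>cA + c div R\<close>, then every admissible shift
  \<open>z - m\<close> lies left of the window of \<open>A\<close>, so the extreme slope is
  inherited from \<open>A\<close> term by term; likewise on the right. The window of
  \<open>A\<close> is lengthened by the length of the range of m.\<close>

lemma conv_win:
  assumes Y: "win P Y c L" and A: "win P A cA K"
  shows "win P (conv A Y c L) (cA + c div R) (K + (L div 2 + 1))"
proof -
  let ?a = "c div R" and ?w = "L div 2 + 1" and ?G = "conv A Y c L"
  have L: "0 \<le> L" "0 \<le> K" using Y A by (auto simp: win_def)
  have shift: "?G z \<le> ?G z' + k" if "\<And>m. ?a \<le> m \<Longrightarrow> m \<le> ?a + ?w \<Longrightarrow> A (z - m) \<le> A (z' - m) + k" for z z' k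
  proof -
    obtain m where m: "?a \<le> m" "m \<le> ?a + ?w" "?G z' = Y (R * m) + A (z' - m)"
      using conv_attained[OF L(1), of c A Y z'] by (auto simp: add.assoc)
    then show ?thesis using conv_le[OF Y A, of z m] that[of m] by linarith
  qed
  have step: "A (z - m) \<le> A (z' - m) + P * \<bar>z - z'\<bar>" for z z' m
    using win_le[OF A, of "z - m" "z' - m"] by simp
  have "\<bar>?G (z + 1) - ?G z\<bar> \<le> P" for z
    using shift[of "z + 1" z P] shift[of z "z + 1" P] step[of "z + 1" _ z] step[of z _ "z + 1"] by auto
  moreover have "?G z = ?G (cA + ?a) + P * (cA + ?a - z)" if z: "z \<le> cA + ?a" for z
  proof -
    have A': "A (z - m) = A (cA + ?a - m) + P * (cA + ?a - z)" if "?a \<le> m" for m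
    proof -
      have "A (z - m) = A cA + P * (cA - (z - m))" using that z by (intro win_left[OF A]) simp
      moreover have "A (cA + ?a - m) = A cA + P * (cA - (cA + ?a - m))"
        using that by (intro win_left[OF A]) simp
      ultimately show ?thesis by (simp add: algebra_simps)
    qed
    have "?G z \<le> ?G (cA + ?a) + P * (cA + ?a - z)" by (rule shift) (simp add: A')
    moreover have "?G (cA + ?a) \<le> ?G z + - (P * (cA + ?a - z))" by (rule shift) (simp add: A')
    ultimately show ?thesis by linarith
  qed
  moreover have "?G z = ?G (cA + ?a + (K + ?w)) + P * (z - (cA + ?a) - (K + ?w))"
    if z: "cA + ?a + (K + ?w) \<le> z" for z
  proof -
    let ?e = "cA + ?a + (K + ?w)"
    have A': "A (z - m) = A (?e - m) + P * (z - ?e)" if "m \<le> ?a + ?w" for m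
    proof -
      have "cA + K \<le> z - m" "cA + K \<le> ?e - m" using that z by auto
      then have "A (z - m) = A (cA + K) + P * (z - m - cA - K)"
          "A (?e - m) = A (cA + K) + P * (?e - m - cA - K)"
        using win_right[OF A, of "z - m"] win_right[OF A, of "?e - m"] by blast+
      then show ?thesis by (simp add: algebra_simps)
    qed
    have "?G z \<le> ?G ?e + P * (z - ?e)" by (rule shift) (simp add: A')
    moreover have "?G ?e \<le> ?G z + - (P * (z - ?e))" by (rule shift) (simp add: A')
    ultimately show ?thesis by (simp add: algebra_simps)
  qed
  moreover have "0 \<le> K + ?w" using L by simp
  ultimately show ?thesis by (intro winI)
qed

text \<open>Infimal convolution of \<open>X\<close> with \<open>z \<mapsto> \<bar>e + p z\<bar>\<close>.\<close>

definition lconv :: "(int \<Rightarrow> int) \<Rightarrow> int \<Rightarrow> int \<Rightarrow> int" where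
  "lconv X e u = min (X (u + e div P + 1) + (P - e mod P)) (X (u + e div P) + e mod P)"

lemma abs_leaf:
  "\<bar>e + P * (- (e div P) - 1)\<bar> = P - e mod P" "\<bar>e + P * (- (e div P))\<bar> = e mod P"
proof -
  have "e = P * (e div P) + e mod P" by simp
  moreover have "0 \<le> e mod P" "e mod P < P" using Ppos by auto
  ultimately show "\<bar>e + P * (- (e div P) - 1)\<bar> = P - e mod P" "\<bar>e + P * (- (e div P))\<bar> = e mod P"
    by (simp_all add: right_diff_distrib, linarith+)
qed

text \<open>The number \<open>e + P * z\<close> is negative at \<open>- (e div P) - 1\<close> and
  nonnegative at the next integer. The sign change fills a window of length 1.\<close>

lemma leaf_win: "win P (\<lambda>z. \<bar>e + P * z\<bar>) (- (e div P) - 1) 1"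
proof -
  let ?b = "e div P"
  have e: "e = P * ?b + e mod P" and m: "0 \<le> e mod P" "e mod P < P" using Ppos by auto
  have s: "e + P * z = P * (?b + z) + e mod P" for z by (simp add: algebra_simps flip: e)
  have "\<bar>e + P * z\<bar> = \<bar>e + P * (- ?b - 1)\<bar> + P * (- ?b - 1 - z)" if "z \<le> - ?b - 1" for z
  proof -
    have "P * (?b + z) \<le> P * (-1)" using that Ppos by (intro mult_left_mono) auto
    then have "e + P * z \<le> 0" using s m by simp
    then show ?thesis unfolding abs_leaf using s[of z] by (simp add: algebra_simps)
  qed
  moreover have "\<bar>e + P * z\<bar> = \<bar>e + P * (- ?b - 1 + 1)\<bar> + P * (z - (- ?b - 1) - 1)" if "- ?b - 1 + 1 \<le> z" for z
  proof -
    have "0 \<le> P * (?b + z)" using that Ppos by (intro mult_nonneg_nonneg) auto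
    then have "0 \<le> e + P * z" using s m by simp
    then show ?thesis using abs_leaf(2)[of e] s[of z] by (simp add: algebra_simps)
  qed
  moreover have "\<bar>\<bar>e + P * (z + 1)\<bar> - \<bar>e + P * z\<bar>\<bar> \<le> P" for z
    using Ppos by (simp add: distrib_left)
  moreover have "0 \<le> (1::int)" by simp
  ultimately show ?thesis by (intro winI)
qed

lemma lconv_cases:
  obtains x where "lconv X e u = X (u - x) + \<bar>e + P * x\<bar>" "x = - (e div P) - 1 \<or> x = - (e div P)"
proof (cases "X (u + e div P + 1) + (P - e mod P) \<le> X (u + e div P) + e mod P")
  case True
  have s: "u - (- (e div P) - 1) = u + e div P + 1" by simp
  show ?thesis
  proof (rule that[of "- (e div P) - 1"])
    show "lconv X e u = X (u - (- (e div P) - 1)) + \<bar>e + P * (- (e div P) - 1)\<bar>"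
      unfolding s abs_leaf lconv_def using True by (rule min_absorb1)
  qed simp
next
  case False
  show ?thesis
  proof (rule that[of "- (e div P)"])
    show "lconv X e u = X (u - (- (e div P))) + \<bar>e + P * (- (e div P))\<bar>"
      unfolding abs_leaf lconv_def using False by (simp add: min_absorb2)
  qed simp
qed

text \<open>Beyond the two integers around the zero of \<open>e + P * x\<close> its absolute value
  has slope exactly \<open>P\<close>, while \<open>X\<close> is \<open>P\<close>-Lipschitz. Moving x
  to the nearer of the two never increases the sum.\<close>

lemma lconv_le:
  assumes "win P X c L"
  shows "lconv X e u \<le> X (u - x) + \<bar>e + P * x\<bar>"
proof -
  let ?b = "e div P"
  have lconv_le_aux: "u - (- ?b - 1) = u + ?b + 1" by simp
  have l: "lconv X e u \<le> X (u - (- ?b - 1)) + \<bar>e + P * (- ?b - 1)\<bar>"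
      "lconv X e u \<le> X (u - (- ?b)) + \<bar>e + P * (- ?b)\<bar>"
    unfolding lconv_le_aux abs_leaf by (simp_all add: lconv_def)
  note W = leaf_win[of e]
  show ?thesis
  proof (cases "x \<le> - ?b - 1")
    case True
    then have "\<bar>e + P * x\<bar> = \<bar>e + P * (- ?b - 1)\<bar> + P * (- ?b - 1 - x)" by (rule win_left[OF W])
    moreover have "X (u - (- ?b - 1)) \<le> X (u - x) + P * (- ?b - 1 - x)"
    proof -
      have "\<bar>x - (- ?b - 1)\<bar> = - ?b - 1 - x" using True by linarith
      then show ?thesis using win_le_shift[OF assms, of u "- ?b - 1" x] by (simp only:)
    qed
    ultimately show ?thesis using l by linarith
  next
    case False
    then have "\<bar>e + P * x\<bar> = \<bar>e + P * (- ?b)\<bar> + P * (x + ?b)" using win_right[OF W, of x] by simp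
    moreover have "X (u - (- ?b)) \<le> X (u - x) + P * (x + ?b)"
    proof -
      have "\<bar>x - (- ?b)\<bar> = x + ?b" using False by linarith
      then show ?thesis using win_le_shift[OF assms, of u "- ?b" x] by (simp only:)
    qed
    ultimately show ?thesis using l by linarith
  qed
qed

lemma lconv_win:
  assumes "win P X c L"
  shows "win P (lconv X e) (c - e div P - 1) (L + 1)"
proof -
  let ?b = "e div P"
  note X = assms[unfolded win_def]
  have m: "0 \<le> e mod P" "e mod P < P" using Ppos by auto
  have lo: "X z = X c + P * (c - z)" if "z \<le> c" for z using X that by blast
  have hi: "X z = X (c + L) + P * (z - c - L)" if "c + L \<le> z" for z using X that by blast
  have "\<bar>lconv X e (z + 1) - lconv X e z\<bar> \<le> P" for z
  proof -
    have "\<bar>X (z + ?b + 1 + 1) - X (z + ?b + 1)\<bar> \<le> P" "\<bar>X (z + ?b + 1) - X (z + ?b)\<bar> \<le> P"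
      using X by blast+
    moreover have "z + 1 + ?b = z + ?b + 1" by simp
    ultimately show ?thesis unfolding lconv_def by (simp only:)
  qed
  moreover have "lconv X e z = lconv X e (c - ?b - 1) + P * (c - ?b - 1 - z)" if "z \<le> c - ?b - 1" for z
  proof -
    have key: "lconv X e z = X c + P * (c - ?b - z) - e mod P" if "z \<le> c - ?b - 1" for z
    proof -
      have "X (z + ?b + 1) = X c + P * (c - ?b - z) - P" "X (z + ?b) = X c + P * (c - ?b - z)"
        using lo[of "z + ?b + 1"] lo[of "z + ?b"] that by (simp_all add: algebra_simps)
      then show ?thesis using m by (simp add: lconv_def)
    qed
    show ?thesis using key[of z] key[of "c - ?b - 1"] that by (simp add: right_diff_distrib)
  qed
  moreover have "lconv X e z = lconv X e (c - ?b - 1 + (L + 1)) + P * (z - (c - ?b - 1) - (L + 1))"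
    if "c - ?b - 1 + (L + 1) \<le> z" for z
  proof -
    have key: "lconv X e z = X (c + L) + P * (z + ?b - c - L) + e mod P" if "c - ?b - 1 + (L + 1) \<le> z" for z
    proof -
      have "X (z + ?b + 1) = X (c + L) + P * (z + ?b - c - L) + P" "X (z + ?b) = X (c + L) + P * (z + ?b - c - L)"
        using hi[of "z + ?b + 1"] hi[of "z + ?b"] that by (simp_all add: algebra_simps)
      then show ?thesis using m by (simp add: lconv_def)
    qed
    show ?thesis using key[of z] key[of "c - ?b - 1 + (L + 1)"] that by (simp add: algebra_simps)
  qed
  moreover have "0 \<le> L + 1" using X by simp
  ultimately show ?thesis by (intro winI)
qed

end

section \<open>The tree of an expression\<close>

lemma abs_div_le_pos: "0 < k \<Longrightarrow> \<bar>(x::int) div k\<bar> \<le> \<bar>x\<bar>"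
proof (cases "0 \<le> x")
  case True
  assume k: "0 < k"
  have "x div k \<le> x div 1" using True k by (intro zdiv_mono2) auto
  then show ?thesis using True k by (simp add: pos_imp_zdiv_nonneg_iff)
next
  case False
  assume k: "0 < k"
  have "x div 1 \<le> x div k" using False k by (intro zdiv_mono2_neg) auto
  moreover have "x div k < 0" using False k by (simp add: pos_imp_zdiv_neg_iff)
  ultimately show ?thesis by simp
qed

lemma abs_div_le: "\<bar>(x::int) div k\<bar> \<le> \<bar>x\<bar>"
proof (cases k "0 :: int" rule: linorder_cases)
  case less
  then show ?thesis using abs_div_le_pos[of "- k" "- x"] by simp
qed (use abs_div_le_pos in auto)

locale tree = bs +
  fixes H :: "nat \<Rightarrow> bool" and e :: "nat \<Rightarrow> int"
  assumes H1: "\<not> H (Suc 0)"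
begin

text \<open>Position \<open>i\<close> of an expression has the exponent \<open>e i\<close>, and \<open>H i\<close> says that the letter in front
  of it is \<open>t\<close>. \<open>pr i\<close> is the position in front of the last \<open>T\<close> up to \<open>i\<close> that is not yet matched by a
  later \<open>t\<close>, and 0 if there is none.\<close>

function pr :: "nat \<Rightarrow> nat" where
  "pr 0 = 0"
| "pr (Suc i) = (if H (Suc i) then pr (pr i) else i)"
  by pat_completeness auto

text \<open>The recursion is nested, so its termination needs a bound on the inner value, proved on
  the domain of the function beforehand.\<close>

lemma pr_le_aux: "pr_dom i \<Longrightarrow> pr i \<le> i"
proof (induction rule: pr.pinduct)
  case (2 i)
  then show ?case by (auto simp: pr.psimps)
qed (simp add: pr.psimps)

termination
  by (relation "measure id") (auto dest: pr_le_aux)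

lemma pr_less: "0 < i \<Longrightarrow> pr i < i"
proof (induction i rule: less_induct)
  case (less i)
  then obtain j where i: "i = Suc j" by (cases i) auto
  have le: "pr k \<le> k" if "k \<le> j" for k
    using less.IH[of k] that i by (cases k) auto
  have "pr (pr j) \<le> j" using le[of j] le[of "pr j"] by simp
  then show ?case using i by simp
qed

lemma pr_le: "pr i \<le> i"
  using pr_less[of i] by (cases i) auto

lemma pr_less_Suc [simp]: "pr i < Suc i" "pr (Suc i) < Suc i"
  using pr_le[of i] pr_less[of "Suc i"] by (auto simp del: pr.simps)

lemma pr_pr_less [simp]: "pr (pr i) < Suc i"
  using pr_le[of i] pr_le[of "pr i"] by simp

section \<open>Sums over the stack of open positions\<close>

text \<open>The chain \<open>i\<close>, \<open>pr i\<close>, \<open>pr (pr i)\<close>, ... lists the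
  roots of the subtrees into which the positions up to \<open>i\<close> are grouped; it is the stack
  of the left-to-right sweep. A \<open>T\<close> pushes the new position, and a \<open>t\<close>
  replaces the two top entries \<open>i\<close> and \<open>pr i\<close> by \<open>Suc i\<close>. An
  induction over positions with this sum takes the place of an induction over the tree.\<close>

fun ch :: "(nat \<Rightarrow> int) \<Rightarrow> nat \<Rightarrow> int" where
  "ch g 0 = 0"
| "ch g (Suc i) = g (Suc i) + ch g (pr (Suc i))"

declare ch.simps(2) [simp del]

lemma ch_unfold: "g 0 = 0 \<Longrightarrow> ch g i = g i + ch g (pr i)"
  by (cases i) (auto simp: ch.simps)

lemma ch_push: "\<not> H (Suc i) \<Longrightarrow> ch g (Suc i) = g (Suc i) + ch g i"
  by (simp add: ch.simps)

lemma ch_pop: "g 0 = 0 \<Longrightarrow> H (Suc i) \<Longrightarrow> ch g (Suc i) = g (Suc i) - g i - g (pr i) + ch g i"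
  using ch_unfold[of g i] ch_unfold[of g "pr i"] by (simp add: ch.simps)

text \<open>A potential argument: inequalities between a node and its two children add up, over the
  sweep, to a bound by a sum over positions. The requirement \<open>g 0 = 0\<close> makes missing
  children harmless.\<close>

lemma ch_le_sum:
  assumes "g 0 = 0"
    and "\<And>i. i < n \<Longrightarrow> \<not> H (Suc i) \<Longrightarrow> g (Suc i) \<le> w (Suc i)"
    and "\<And>i. i < n \<Longrightarrow> H (Suc i) \<Longrightarrow> g (Suc i) \<le> g i + g (pr i) + w (Suc i)"
  shows "ch g n \<le> (\<Sum>j=1..n. w j)"
  using assms(2,3)
proof (induction n)
  case (Suc n)
  then have IH: "ch g n \<le> (\<Sum>j=1..n. w j)" by auto
  show ?case
  proof (cases "H (Suc n)")
    case True
    then show ?thesis using IH ch_pop[of g n, OF assms(1)] Suc.prems(2)[of n] by simp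
  next
    case False
    then show ?thesis using IH ch_push[of n g] Suc.prems(1)[of n] by simp
  qed
qed simp

lemma ch_uminus: "ch (\<lambda>i. - g i) n = - ch g n"
  by (induction g n rule: ch.induct) (auto simp: ch.simps)

lemma ch_ge_sum:
  assumes "g 0 = 0"
    and "\<And>i. i < n \<Longrightarrow> \<not> H (Suc i) \<Longrightarrow> w (Suc i) \<le> g (Suc i)"
    and "\<And>i. i < n \<Longrightarrow> H (Suc i) \<Longrightarrow> g i + g (pr i) + w (Suc i) \<le> g (Suc i)"
  shows "(\<Sum>j=1..n. w j) \<le> ch g n"
proof -
  have "ch (\<lambda>i. - g i) n \<le> (\<Sum>j=1..n. - w j)"
  proof (rule ch_le_sum)
    show "- g (Suc i) \<le> - g i + - g (pr i) + - w (Suc i)" if "i < n" "H (Suc i)" for i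
      using assms(3)[OF that] by linarith
  qed (use assms in auto)
  then show ?thesis by (simp add: ch_uminus sum_negf)
qed

lemma ch_nonneg: "(\<And>i. 0 \<le> g i) \<Longrightarrow> 0 \<le> ch g n"
  by (induction g n rule: ch.induct) (auto simp: ch.simps)

lemma ch_ge_head:
  assumes "g 0 = 0" "\<And>i. 0 \<le> g i"
  shows "g n \<le> ch g n"
  using ch_unfold[of g n] ch_nonneg[of g "pr n"] assms by simp

lemma ch_root: "g 0 = 0 \<Longrightarrow> pr n = 0 \<Longrightarrow> ch g n = g n"
  using ch_unfold[of g n] by simp

section \<open>Windows and costs of the nodes\<close>

text \<open>Left end of the window of the node. The recursion chains the shifts of
  \<open>lconv_win\<close> and \<open>conv_win\<close>, and at a leaf that of
  \<open>leaf_win\<close>; the lengths below arise in the same way.\<close>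

fun cc :: "nat \<Rightarrow> int" where
  "cc 0 = 0"
| "cc (Suc i) = (if H (Suc i) then cc (pr i) - e (Suc i) div P - 1 + cc i div R else - (e (Suc i) div P) - 1)"

fun LL :: "nat \<Rightarrow> int" where
  "LL 0 = 0"
| "LL (Suc i) = (if H (Suc i) then LL (pr i) + 1 + (LL i div 2 + 1) else 1)"

text \<open>\<open>F i z\<close> is the least sum of \<open>\<bar>\<gamma>\<^sub>j\<bar>\<close> over the positions \<open>j\<close> of the subtree rooted at \<open>i\<close>, when
  \<open>a\<^bsup>pz\<^esup>\<close> is pushed into it. The left child of a position \<open>Suc i\<close> after a \<open>t\<close> is \<open>pr i\<close>, its middle
  child is \<open>i\<close>.\<close>

fun F :: "nat \<Rightarrow> int \<Rightarrow> int" where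
  "F 0 z = P * \<bar>z\<bar>"
| "F (Suc i) z = (if H (Suc i) then conv (lconv (F (pr i)) (e (Suc i))) (F i) (cc i) (LL i) z
     else \<bar>e (Suc i) + P * z\<bar>)"

lemma F_win: "win P (F i) (cc i) (LL i)"
proof (induction i rule: less_induct)
  case (less i)
  show ?case
  proof (cases i)
    case 0
    \<comment> \<open>Node 0 stands for a missing left child. Its cost has slope \<open>P\<close>
      everywhere, the steepest one allowed, so infimal convolution with it leaves a
      \<open>P\<close>-Lipschitz function unchanged.\<close>
    have "win P (\<lambda>z. P * \<bar>z\<bar>) 0 0"
    proof (rule winI)
      fix z :: int
      have "\<bar>P * \<bar>z + 1\<bar> - P * \<bar>z\<bar>\<bar> = P * \<bar>\<bar>z + 1\<bar> - \<bar>z\<bar>\<bar>"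
        by (metis abs_mult abs_of_nat right_diff_distrib)
      also have "\<dots> \<le> P * 1" by (intro mult_left_mono) auto
      finally show "\<bar>P * \<bar>z + 1\<bar> - P * \<bar>z\<bar>\<bar> \<le> P" by simp
    qed auto
    moreover have "F 0 = (\<lambda>z. P * \<bar>z\<bar>)" by (rule ext) simp
    ultimately show ?thesis using 0 by simp
  next
    case (Suc j)
    show ?thesis
    proof (cases "H i")
      case True
      have "F i = conv (lconv (F (pr j)) (e i)) (F j) (cc j) (LL j)"
        using True Suc by (intro ext) simp
      moreover have "win P (lconv (F (pr j)) (e i)) (cc (pr j) - e i div P - 1) (LL (pr j) + 1)"
        using less[of "pr j"] Suc by (intro lconv_win) simp
      then have "win P (conv (lconv (F (pr j)) (e i)) (F j) (cc j) (LL j))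
          (cc (pr j) - e i div P - 1 + cc j div R) (LL (pr j) + 1 + (LL j div 2 + 1))"
        using less[of j] Suc by (intro conv_win) simp_all
      ultimately show ?thesis using True Suc by simp
    next
      case False
      then have "F i = (\<lambda>z. \<bar>e i + P * z\<bar>)" using Suc by (intro ext) simp
      then show ?thesis using leaf_win[of "e i"] False Suc by simp
    qed
  qed
qed

lemma LL_nonneg: "0 \<le> LL i"
  using win_nonneg[OF F_win] .

lemma F_nonneg: "0 \<le> F i z"
proof (induction i arbitrary: z rule: less_induct)
  case (less i)
  show ?case
  proof (cases i)
    case (Suc j)
    show ?thesis
    proof (cases "H i")
      case True
      obtain m where m: "F i z = F j (R * m) + lconv (F (pr j)) (e i) (z - m)"
        using conv_attained[OF LL_nonneg, of "cc j" j "lconv (F (pr j)) (e i)" "F j" z] True Suc by auto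
      obtain x where x: "lconv (F (pr j)) (e i) (z - m) = F (pr j) (z - m - x) + \<bar>e i + P * x\<bar>"
        by (rule lconv_cases)
      have "0 \<le> F j (R * m)" "0 \<le> F (pr j) (z - m - x)" using less Suc by auto
      then show ?thesis using m x by simp
    qed (simp add: Suc)
  qed simp
qed

lemma F_le_shift: "F i x \<le> F i y + P * \<bar>x - y\<bar>"
  by (rule win_le[OF F_win])

lemma F_pop_le_lconv:
  assumes "H (Suc i)"
  shows "F (Suc i) z \<le> F i (R * m) + lconv (F (pr i)) (e (Suc i)) (z - m)"
  using assms conv_le[OF F_win lconv_win[OF F_win]] by simp

lemma F_pop_le:
  assumes "H (Suc i)" "z = m + x + y"
  shows "F (Suc i) z \<le> F i (R * m) + F (pr i) x + \<bar>e (Suc i) + P * y\<bar>"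
proof -
  have "lconv (F (pr i)) (e (Suc i)) (z - m) \<le> F (pr i) x + \<bar>e (Suc i) + P * y\<bar>"
    using lconv_le[OF F_win, of "pr i" "e (Suc i)" "z - m" y] assms(2) by simp
  then show ?thesis using F_pop_le_lconv[OF assms(1), of z m] by simp
qed

text \<open>Moving no unit at all is one admissible distribution, and it leaves every exponent as it
  is. The bound keeps the table entries small.\<close>

lemma F0_le_sum: "F i 0 \<le> (\<Sum>j=1..i. \<bar>e j\<bar>)"
proof -
  have "ch (\<lambda>i. F i 0) i \<le> (\<Sum>j=1..i. \<bar>e j\<bar>)"
    by (rule ch_le_sum) (auto simp del: F.simps(2) intro!: F_pop_le[of _ 0 0 0 0, simplified mult_zero_right add_0_right], simp_all)
  then show ?thesis using ch_ge_head[of "\<lambda>i. F i 0" i] F_nonneg by simp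
qed

lemma cc_le_sum: "\<bar>cc i\<bar> \<le> (\<Sum>j=1..i. \<bar>e j\<bar> + 1)"
proof -
  have d: "\<bar>x div P\<bar> \<le> \<bar>x\<bar>" "\<bar>x div R\<bar> \<le> \<bar>x\<bar>" for x
    using abs_div_le by auto
  have "ch (\<lambda>i. \<bar>cc i\<bar>) i \<le> (\<Sum>j=1..i. \<bar>e j\<bar> + 1)"
  proof (rule ch_le_sum)
    fix j
    assume "\<not> H (Suc j)"
    then show "\<bar>cc (Suc j)\<bar> \<le> \<bar>e (Suc j)\<bar> + 1" using d(1)[of "e (Suc j)"] by simp
  next
    fix j
    assume "H (Suc j)"
    then show "\<bar>cc (Suc j)\<bar> \<le> \<bar>cc j\<bar> + \<bar>cc (pr j)\<bar> + (\<bar>e (Suc j)\<bar> + 1)"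
      using d(1)[of "e (Suc j)"] d(2)[of "cc j"] by simp
  qed simp
  then show ?thesis using ch_ge_head[of "\<lambda>i. \<bar>cc i\<bar>" i] by simp
qed

section \<open>Window lengths against sinks, and the total work\<close>

text \<open>Counts the valleys, places where a \<open>T\<close> is followed by a \<open>t\<close>,
  inside the subtree. A leaf contributes nothing until a \<open>t\<close> closes it, which explains
  \<open>max 1\<close>.\<close>

fun sg :: "nat \<Rightarrow> int" where
  "sg 0 = 0"
| "sg (Suc i) = (if H (Suc i) then sg (pr i) + max 1 (sg i) else 0)"

lemma sg_nonneg: "0 \<le> sg i"
  by (induction i rule: sg.induct) auto

lemma sg_pos: "H i \<Longrightarrow> 0 < i \<Longrightarrow> 1 \<le> sg i"
  using sg_nonneg by (cases i) (auto simp: add_increasing max_def)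

text \<open>If the middle subtree has no valley, its window has length at most 1, and closing it
  adds 2 to the length but also 1 to \<open>sg\<close>. Otherwise halving the window of the middle
  child sets free \<open>3 * sg i\<close>, more than the constants that are added.\<close>

lemma LL_le: "LL i \<le> 6 * sg i + 1"
proof (induction i rule: less_induct)
  case (less i)
  show ?case
  proof (cases i)
    case (Suc j)
    then have "LL (pr j) \<le> 6 * sg (pr j) + 1" "LL j \<le> 6 * sg j + 1"
      using less by auto
    then show ?thesis using Suc sg_nonneg[of j] sg_nonneg[of "pr j"] by (auto simp: max_def)
  qed simp
qed

text \<open>Summed over the stack, \<open>sg\<close> grows exactly when a leaf is closed by a
  \<open>t\<close>. Hence this sum is the number of valleys met so far, which ties window lengths to
  sinks.\<close>

lemma ch_sg_Suc: "ch sg (Suc i) = ch sg i + (if 0 < i \<and> \<not> H i \<and> H (Suc i) then 1 else 0)"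
proof (cases "H (Suc i)")
  case True
  have "sg i = 0" if "\<not> H i" using that by (cases i) auto
  moreover have "0 < i" using True H1 by (cases i) auto
  ultimately show ?thesis using ch_pop[of sg i] True sg_pos[of i] by (auto simp: max_def)
next
  case False
  then show ?thesis using ch_push[of i sg] by simp
qed

lemma ch_sg_mono: "m \<le> n \<Longrightarrow> ch sg m \<le> ch sg n"
  by (rule lift_Suc_mono_le[of "ch sg"]) (auto simp: ch_sg_Suc)

lemma sg_le_ch: "i \<le> n \<Longrightarrow> sg i \<le> ch sg n"
  using ch_ge_head[of sg i] ch_sg_mono[of i n] sg_nonneg by (simp add: order_trans)

text \<open>Product of the window lengths of the two children. The summands 3 let the product
  dominate the linear passes over the tables as well.\<close>

definition work :: "nat \<Rightarrow> int" where
  "work i = (if H i then (LL (pr (i - 1)) + 3) * (LL (i - 1) + 3) else 0)"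

lemma work_nonneg: "0 \<le> work i"
  using LL_nonneg by (simp add: work_def add_nonneg_nonneg)

lemma ch_mult: "ch (\<lambda>i. k * g i) n = k * ch g n"
  by (induction g n rule: ch.induct) (auto simp: ch.simps algebra_simps)

text \<open>The potential is \<open>30 * sg^2\<close>. Joining subtrees with x and y valleys raises
  the sum of squares by 2xy, which pays for the product of their windows; the terms linear in x and
  y and the constants are charged to a credit of \<open>40 * S\<close> per position.\<close>

lemma work_sum:
  assumes "1 \<le> S" "ch sg n \<le> S"
  shows "(\<Sum>j=1..n. work j) \<le> 40 * S * (S + int n)"
proof -
  have S: "sg i \<le> S" if "i \<le> n" for i using sg_le_ch[OF that] assms by simp
  let ?g = "\<lambda>i. 30 * (sg i * sg i)"
  have "(\<Sum>j=1..n. work j - 40 * S) \<le> ch ?g n"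
  proof (rule ch_ge_sum)
    fix i
    assume "\<not> H (Suc i)"
    then show "work (Suc i) - 40 * S \<le> ?g (Suc i)" using assms by (simp add: work_def)
  next
    fix i
    assume i: "i < n" and h: "H (Suc i)"
    define x y where "x = sg (pr i)" and "y = sg i"
    have n: "0 \<le> x" "0 \<le> y" "x \<le> S" "y \<le> S"
      using sg_nonneg S[of i] S[of "pr i"] i pr_le[of i] by (auto simp: x_def y_def)
    have "work (Suc i) \<le> (6 * x + 4) * (6 * y + 4)"
    proof -
      have "LL (pr i) + 3 \<le> 6 * x + 4" "LL i + 3 \<le> 6 * y + 4"
        using LL_le[of i] LL_le[of "pr i"] by (auto simp: x_def y_def)
      then have "(LL (pr i) + 3) * (LL i + 3) \<le> (6 * x + 4) * (6 * y + 4)"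
        using n LL_nonneg[of i] by (intro mult_mono) auto
      then show ?thesis using h by (simp add: work_def)
    qed
    also have "\<dots> = 36 * (x * y) + 24 * x + 24 * y + 16" by (simp add: algebra_simps)
    also have "\<dots> \<le> 30 * ((x + max 1 y) * (x + max 1 y)) - 30 * (y * y) - 30 * (x * x) + 40 * S"
    proof (cases "y = 0")
      case True
      then show ?thesis using n assms by (simp add: algebra_simps)
    next
      case False
      then have y: "max 1 y = y" "1 \<le> y" using n by auto
      have "x * 1 \<le> x * y" using y n by (intro mult_left_mono) auto
      then show ?thesis using y n assms by (simp add: algebra_simps)
    qed
    finally show "?g i + ?g (pr i) + (work (Suc i) - 40 * S) \<le> ?g (Suc i)"
      using h by (simp add: x_def y_def)
  qed simp
  also have "ch ?g n \<le> 30 * S * S"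
  proof -
    have "ch (\<lambda>i. sg i * sg i) m \<le> S * ch sg m" if "m \<le> n" for m
      using that
    proof (induction m rule: less_induct)
      case (less m)
      show ?case
      proof (cases m)
        case (Suc k)
        have "sg m * sg m \<le> S * sg m" using S[OF less.prems] sg_nonneg by (intro mult_right_mono) auto
        moreover have "ch (\<lambda>i. sg i * sg i) (pr m) \<le> S * ch sg (pr m)"
          using less.IH[of "pr m"] less.prems pr_less[of m] Suc by simp
        ultimately show ?thesis
          using ch_unfold[of "\<lambda>i. sg i * sg i" m] ch_unfold[of sg m] by (simp add: distrib_left)
      qed simp
    qed
    then have "ch (\<lambda>i. sg i * sg i) n \<le> S * ch sg n" by simp
    also have "\<dots> \<le> S * S" using assms by (intro mult_left_mono) auto
    finally show ?thesis by (simp add: ch_mult)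
  qed
  finally have "(\<Sum>j=1..n. work j) \<le> 30 * S * S + 40 * S * int n"
    by (simp add: sum_subtractf algebra_simps)
  moreover have "30 * (S * S) \<le> 40 * (S * S)" by simp
  ultimately show ?thesis unfolding distrib_left mult.assoc by linarith
qed

declare F.simps(2) [simp del]

lemma F_leaf [simp]: "\<not> H (Suc i) \<Longrightarrow> F (Suc i) z = \<bar>e (Suc i) + P * z\<bar>"
  by (simp add: F.simps)

section \<open>Lower bound: all spurs move to the root\<close>

lemma spur_split:
  assumes "spur g c"
  shows "\<exists>x c'. spur (P * x) c' \<and> \<bar>g - P * x\<bar> + int c' \<le> int c"
  using assms
proof cases
  case base
  then show ?thesis using spur.base[of 0] by (intro exI[of _ 0] exI[of _ "0::nat"]) simp
next
  case (step m c' e)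
  show ?thesis using spur_raise[OF step(3)] step(1,2)
    by (intro exI[of _ "R * m"] exI[of _ "2 + c'"]) (simp add: mult.assoc)
qed

text \<open>The bottom exponent of such a spur must itself be a multiple \<open>P * x0\<close>;
  everything else stands under a \<open>t\<close> and therefore counts r-fold. This is the lowest
  digit in base r, with no restriction on its size.\<close>

lemma spur_digit:
  assumes "spur (P * x) c"
  shows "\<exists>x0 x1 c'. x = x0 + R * x1 \<and> spur (P * x1) c' \<and> P * \<bar>x0\<bar> + int c' \<le> int c
    \<and> (x1 \<noteq> 0 \<longrightarrow> P * \<bar>x0\<bar> + 2 + int c' \<le> int c)"
  using assms
proof cases
  case base
  then show ?thesis using spur.base[of 0]
    by (intro exI[of _ x] exI[of _ 0] exI[of _ "0::nat"]) (simp add: abs_mult)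
next
  case (step m c' e)
  then have "e = P * (x - R * m)" by (simp add: algebra_simps)
  then show ?thesis using step
    by (intro exI[of _ "x - R * m"] exI[of _ m] exI[of _ c']) (simp add: abs_mult)
qed

text \<open>Optimal cost of the subtree if one spur, standing at its root, may absorb part of the
  demand. Minimising over natural numbers avoids any question about attained infima.\<close>

definition Fs :: "nat \<Rightarrow> int \<Rightarrow> nat" where
  "Fs i z = (LEAST C. \<exists>x c. spur (P * x) c \<and> F i (z - x) + int c \<le> int C)"

lemma Fs_attained: "\<exists>x c. spur (P * x) c \<and> F i (z - x) + int c \<le> int (Fs i z)"
  unfolding Fs_def
proof (rule LeastI_ex)
  show "\<exists>C x c. spur (P * x) c \<and> F i (z - x) + int c \<le> int C"
    using spur.base[of 0] by (intro exI[of _ "nat (F i z)"] exI[of _ 0] exI[of _ "0::nat"]) simp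
qed

lemma Fs_le:
  assumes "spur (P * x) c" "F i (z - x) + int c \<le> C"
  shows "int (Fs i z) \<le> C"
proof -
  have "0 \<le> C" using assms(2) F_nonneg[of i "z - x"] by linarith
  then have "Fs i z \<le> nat C" unfolding Fs_def using assms
    by (intro Least_le exI[of _ x] exI[of _ c]) simp
  then show ?thesis using \<open>0 \<le> C\<close> by simp
qed

lemma Fs_leaf:
  assumes "\<not> H (Suc i)" "g = e (Suc i) + P * z" "spur g c"
  shows "int (Fs (Suc i) z) \<le> int c"
proof -
  obtain x c' where x: "spur (P * x) c'" "\<bar>g - P * x\<bar> + int c' \<le> int c"
    using spur_split[OF assms(3)] by auto
  then show ?thesis using assms(1,2)
    by (intro Fs_le[OF x(1)]) (simp add: right_diff_distrib add_diff_eq)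
qed

text \<open>The spur of the middle child gives up its lowest digit \<open>b0\<close>. The child
  takes it over at a cost of at most \<open>P * |b0|\<close>, just what the spur had paid for it.
  The remainder is divisible by r, passes through the letter \<open>t\<close>, and then stands on
  the level of the other two spurs, to which it is added.\<close>

lemma Fs_pop:
  assumes h: "H (Suc i)" and "g = e (Suc i) + P * y" "spur g c" "z = m + x + y"
  shows "int (Fs (Suc i) z) \<le> int (Fs i (R * m)) + int (Fs (pr i) x) + int c"
proof -
  obtain a1 c1 where 1: "spur (P * a1) c1" "F i (R * m - a1) + int c1 \<le> int (Fs i (R * m))"
    using Fs_attained by blast
  obtain a2 c2 where 2: "spur (P * a2) c2" "F (pr i) (x - a2) + int c2 \<le> int (Fs (pr i) x)"
    using Fs_attained by blast
  obtain a3 c3 where 3: "spur (P * a3) c3" "\<bar>g - P * a3\<bar> + int c3 \<le> int c"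
    using spur_split[OF assms(3)] by auto
  obtain b0 b1 c1' where b: "a1 = b0 + R * b1" "spur (P * b1) c1'" "P * \<bar>b0\<bar> + int c1' \<le> int c1"
    using spur_digit[OF 1(1)] by blast
  obtain c12 where c12: "c12 \<le> c1' + c2" "spur (P * b1 + P * a2) c12" using spur_add[OF b(2) 2(1)] by auto
  obtain c123 where c123: "c123 \<le> c12 + c3" "spur (P * b1 + P * a2 + P * a3) c123"
    using spur_add[OF c12(2) 3(1)] by auto
  have s: "spur (P * (b1 + a2 + a3)) c123" using c123(2) by (simp add: distrib_left)
  have "F i (R * (m - b1)) \<le> F i (R * m - a1) + P * \<bar>b0\<bar>"
    using F_le_shift[of i "R * (m - b1)" "R * m - a1"] by (simp add: b(1) right_diff_distrib)
  moreover have "F (Suc i) (z - (b1 + a2 + a3)) \<le> F i (R * (m - b1)) + F (pr i) (x - a2)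
      + \<bar>e (Suc i) + P * (y - a3)\<bar>"
    using assms(4) by (intro F_pop_le[OF h]) simp
  moreover have "\<bar>e (Suc i) + P * (y - a3)\<bar> = \<bar>g - P * a3\<bar>"
    by (simp add: assms(2) right_diff_distrib)
  ultimately show ?thesis
    using 1 2 3 b c12 c123 by (intro Fs_le[OF s]) linarith
qed

lemma Fs_0: "Fs 0 0 = 0"
  using Fs_le[of 0 0 0 0 0] spur.base[of 0] by simp

text \<open>What the subtree of \<open>i\<close> must absorb: \<open>f (pr i)\<close> units enter it
  through the \<open>T\<close> on its left, where they are multiplied by r, and \<open>f i\<close>
  units leave it on the right.\<close>

definition dem :: "(nat \<Rightarrow> int) \<Rightarrow> nat \<Rightarrow> int" where
  "dem f i = R * f (pr i) - f i"

text \<open>A flow prescribes the demand of every subtree at once. The local estimates for leaves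
  and for positions after \<open>t\<close> are then summed over the stack, which at a root consists
  of \<open>n\<close> alone.\<close>

lemma Fs_flow_le:
  assumes fl: "flow H e g f n" and sp: "\<forall>i. 1 \<le> i \<and> i \<le> n \<longrightarrow> spur (g i) (c i)"
    and "pr n = 0" "f n = 0"
  shows "int (Fs n 0) \<le> (\<Sum>i=1..n. int (c i))"
proof -
  have f0: "f 0 = 0" using fl by (simp add: flow_def)
  let ?g = "\<lambda>i. int (Fs i (dem f i))"
  have g0: "?g 0 = 0" using Fs_0 f0 by (simp add: dem_def)
  have "ch ?g n \<le> (\<Sum>i=1..n. int (c i))"
  proof (rule ch_le_sum[of ?g, OF g0])
    fix i
    assume i: "i < n" and h: "\<not> H (Suc i)"
    have "g (Suc i) = e (Suc i) + P * dem f (Suc i)"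
      using fl i h by (simp add: flow_def inflow_def dem_def algebra_simps)
    then show "?g (Suc i) \<le> int (c (Suc i))"
      by (rule Fs_leaf[OF h]) (use sp i in simp)
  next
    fix i
    assume i: "i < n" and h: "H (Suc i)"
    have "R dvd f i" using fl[unfolded flow_def, THEN conjunct2, rule_format, of "Suc i"] i h by simp
    then obtain k where k: "f i = R * k" by auto
    have g: "g (Suc i) = e (Suc i) + P * (k - f (Suc i))"
      using fl i h Rpos by (simp add: flow_def inflow_def k algebra_simps)
    have "dem f (Suc i) = (f (pr i) - k) + dem f (pr i) + (k - f (Suc i))"
      using h by (simp add: dem_def)
    from Fs_pop[OF h g _ this] sp i
    have "int (Fs (Suc i) (dem f (Suc i))) \<le> int (Fs i (R * (f (pr i) - k))) + int (Fs (pr i) (dem f (pr i))) + int (c (Suc i))"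
      by simp
    moreover have "R * (f (pr i) - k) = dem f i" by (simp add: dem_def k right_diff_distrib)
    ultimately show "?g (Suc i) \<le> ?g i + ?g (pr i) + int (c (Suc i))" by simp
  qed
  moreover have "ch ?g n = ?g n" using assms g0 by (intro ch_root) auto
  moreover have "dem f n = 0" using assms f0 by (simp add: dem_def)
  ultimately show ?thesis by simp
qed

text \<open>At a root a spur is traded for virtual positions: a level enclosed by \<open>t\<close>
  and \<open>T\<close> becomes one more padding letter \<open>t\<close>, priced 2, and the exponent
  of that level is handed to the tree by the Lipschitz bound.\<close>

lemma spur_levels:
  assumes "spur y c" "y = P * x" "pr n = 0" "\<And>i. n < i \<Longrightarrow> H i \<and> e i = 0"
  shows "\<exists>j. F (n + j) 0 + 2 * int j \<le> F n (- x) + int c"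
  using assms
proof (induction arbitrary: n x rule: spur.induct)
  case (base u)
  then show ?case using F_le_shift[of n 0 "- x"] by (intro exI[of _ 0]) (simp add: abs_mult)
next
  case (step m c u)
  have u: "u = P * (x - R * m)" using step.prems(1) by (simp add: algebra_simps)
  have "F (Suc n) (- m) \<le> F n (R * (- m)) + F (pr n) 0 + \<bar>e (Suc n) + P * 0\<bar>"
    using step.prems(3)[of "Suc n"] by (intro F_pop_le) auto
  then have "F (Suc n) (- m) \<le> F n (R * (- m))" using step.prems(2) step.prems(3)[of "Suc n"] by simp
  moreover have "F n (R * (- m)) \<le> F n (- x) + \<bar>u\<bar>"
  proof -
    have "P * \<bar>R * (- m) - - x\<bar> = \<bar>u\<bar>" by (simp add: u abs_mult)
    then show ?thesis using F_le_shift[of n "R * (- m)" "- x"] by simp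
  qed
  moreover have "pr (Suc n) = 0" using step.prems(2,3) by simp
  then obtain j where "F (Suc n + j) 0 + 2 * int j \<le> F (Suc n) (- m) + int c"
    using step.IH[of m "Suc n"] step.prems(3) by fastforce
  ultimately show ?case by (intro exI[of _ "Suc j"]) simp
qed

text \<open>Since \<open>f n = 0\<close>, the flow extends by zero over the padding without cost,
  and at the root \<open>N\<close> a single spur remains, which is then unrolled.\<close>

theorem optimum_le:
  assumes fl: "flow H e g f n" and sp: "\<forall>i. 1 \<le> i \<and> i \<le> n \<longrightarrow> spur (g i) (c i)"
    and "f n = 0" "pr N = 0" "n \<le> N" and pad: "\<And>i. n < i \<Longrightarrow> H i \<and> e i = 0"
  shows "\<exists>j. F (N + j) 0 + 2 * int j \<le> (\<Sum>i=1..n. int (c i))"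
proof -
  let ?f = "\<lambda>i. if i \<le> n then f i else 0" and ?g = "\<lambda>i. if i \<le> n then g i else 0"
    and ?c = "\<lambda>i. if i \<le> n then c i else 0"
  have "flow H e ?g ?f N"
    unfolding flow_def
  proof (intro conjI allI impI)
    show "?f 0 = 0" using fl by (simp add: flow_def)
    fix i
    assume i: "1 \<le> i \<and> i \<le> N"
    have "?f (i - 1) = 0" if "n < i" using that assms(3) by (cases "i = Suc n") auto
    then have "?g i = e i + inflow H ?f i - P * ?f i \<and> (H i \<longrightarrow> R dvd ?f (i - 1))"
      using fl i pad[of i] by (cases "n < i") (auto simp: flow_def inflow_def not_le)
    then show "?g i = e i + inflow H ?f i - P * ?f i" "H i \<Longrightarrow> R dvd ?f (i - 1)" by auto
  qed
  moreover have "\<forall>i. 1 \<le> i \<and> i \<le> N \<longrightarrow> spur (?g i) (?c i)" using sp spur.base[of 0] by simp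
  moreover have "?f N = 0" using assms(3,5) by (cases "N = n") auto
  ultimately have "int (Fs N 0) \<le> (\<Sum>i=1..N. int (?c i))" using assms(4) by (intro Fs_flow_le)
  also have "\<dots> = (\<Sum>i=1..n. int (?c i))" using assms(5) by (intro sum.mono_neutral_right) auto
  also have "\<dots> = (\<Sum>i=1..n. int (c i))" by (rule sum.cong) auto
  finally have le: "int (Fs N 0) \<le> (\<Sum>i=1..n. int (c i))" .
  obtain x c' where x: "spur (P * x) c'" "F N (0 - x) + int c' \<le> int (Fs N 0)"
    using Fs_attained by blast
  obtain j where "F (N + j) 0 + 2 * int j \<le> F N (- x) + int c'"
    using spur_levels[OF x(1) HOL.refl assms(4)] pad assms(5) by fastforce
  then show ?thesis using x le by (intro exI[of _ j]) simp
qed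

text \<open>\<open>d\<close> distributes the demand \<open>d n\<close> at the root optimally over the subtrees.\<close>

definition optimal :: "nat \<Rightarrow> (nat \<Rightarrow> int) \<Rightarrow> (nat \<Rightarrow> int) \<Rightarrow> nat \<Rightarrow> bool" where
  "optimal i d g n \<longleftrightarrow> d 0 = 0 \<and> (\<forall>j. i \<le> j \<and> j < n \<longrightarrow>
     (if H (Suc j) then \<exists>m y. d j = R * m \<and> g (Suc j) = e (Suc j) + P * y \<and> d (Suc j) = m + d (pr j) + y
        \<and> F j (d j) + F (pr j) (d (pr j)) + \<bar>g (Suc j)\<bar> \<le> F (Suc j) (d (Suc j))
      else g (Suc j) = e (Suc j) + P * d (Suc j)))"

lemma optimal_sum:
  assumes "optimal 0 d g n" "pr n = 0"
  shows "(\<Sum>i=1..n. \<bar>g i\<bar>) \<le> F n (d n)"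
proof -
  have 0: "F 0 (d 0) = 0" using assms by (simp add: optimal_def)
  have "(\<Sum>i=1..n. \<bar>g i\<bar>) \<le> ch (\<lambda>i. F i (d i)) n"
  proof (rule ch_ge_sum[of "\<lambda>i. F i (d i)", OF 0])
    show "\<bar>g (Suc i)\<bar> \<le> F (Suc i) (d (Suc i))" if "i < n" "\<not> H (Suc i)" for i
      using assms that by (auto simp: optimal_def)
    show "F i (d i) + F (pr i) (d (pr i)) + \<bar>g (Suc i)\<bar> \<le> F (Suc i) (d (Suc i))"
      if "i < n" "H (Suc i)" for i
      using assms(1)[unfolded optimal_def, THEN conjunct2, rule_format, of i] that by auto
  qed
  then show ?thesis using ch_root[of "\<lambda>i. F i (d i)" n, OF 0 assms(2)] by simp
qed

text \<open>Inverts \<open>dem\<close>: it recovers the flow whose demands are \<open>d\<close> by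
  descending along \<open>pr\<close>.\<close>

fun out :: "(nat \<Rightarrow> int) \<Rightarrow> nat \<Rightarrow> int" where
  "out d 0 = 0"
| "out d (Suc i) = R * out d (pr (Suc i)) - d (Suc i)"

lemma out_eq: "d 0 = 0 \<Longrightarrow> out d i = R * out d (pr i) - d i"
  by (cases i) auto

lemma optimal_flow:
  assumes "optimal 0 d g n" "pr n = 0" "d n = 0"
  shows "flow H e g (out d) n" "out d n = 0"
proof -
  have d0: "d 0 = 0" using assms by (simp add: optimal_def)
  note o = out_eq[of d, OF d0]
  show "out d n = 0" using o[of n] assms by simp
  show "flow H e g (out d) n"
    unfolding flow_def
  proof (intro conjI allI impI)
    show "out d 0 = 0" by simp
    fix i
    assume i: "1 \<le> i \<and> i \<le> n"
    then obtain j where j: "i = Suc j" by (cases i) auto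
    have A: "if H (Suc j) then \<exists>m y. d j = R * m \<and> g (Suc j) = e (Suc j) + P * y \<and> d (Suc j) = m + d (pr j) + y
        \<and> F j (d j) + F (pr j) (d (pr j)) + \<bar>g (Suc j)\<bar> \<le> F (Suc j) (d (Suc j))
      else g (Suc j) = e (Suc j) + P * d (Suc j)"
      using assms(1)[unfolded optimal_def, THEN conjunct2, rule_format, of j] i j by simp
    have "g i = e i + inflow H (out d) i - P * out d i \<and> (H i \<longrightarrow> R dvd out d j)"
    proof (cases "H i")
      case True
      then obtain m y where m: "d j = R * m" "g i = e i + P * y" "d i = m + d (pr j) + y"
        using A j by auto
      have oj: "out d j = R * (out d (pr j) - m)" using o[of j] m by (simp add: right_diff_distrib)
      then have "out d j div R = out d (pr j) - m" using Rpos by simp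
      moreover have "out d i = R * out d (pr (pr j)) - d i" using o[of i] True j by simp
      moreover have "out d (pr j) = R * out d (pr (pr j)) - d (pr j)" using o[of "pr j"] by simp
      ultimately have "y = out d j div R - out d i" using m by simp
      then show ?thesis using True m oj j by (simp add: inflow_def right_diff_distrib)
    next
      case False
      then have "out d i = R * out d j - d i" using o[of i] j by simp
      then show ?thesis using False A j by (simp add: inflow_def algebra_simps)
    qed
    then show "g i = e i + inflow H (out d) i - P * out d i" "H i \<Longrightarrow> R dvd out d (i - 1)"
      using j by auto
  qed
qed

section \<open>A finite table determines the cost of a node\<close>

text \<open>Only candidates from inside the windows of the children are ever tried. An optimal
  candidate whose argument leaves the window of the inner convolution lies on a branch of slope
  \<open>P\<close> or \<open>-P\<close>, and its value follows from the end of that window by the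
  Lipschitz property of the table. Sound entries that are Lipschitz and below all tried candidates
  are therefore exact.\<close>

lemma table_exact:
  assumes h: "H (Suc i)"
    and sound: "\<And>j. 0 \<le> j \<Longrightarrow> j \<le> LL (Suc i) \<Longrightarrow> F (Suc i) (cc (Suc i) + j) \<le> D j"
    and lip: "\<And>j. 0 \<le> j \<Longrightarrow> j < LL (Suc i) \<Longrightarrow> D (j + 1) \<le> D j + P \<and> D j \<le> D (j + 1) + P"
    and pairs: "\<And>k j. 0 \<le> k \<Longrightarrow> k \<le> LL i div 2 + 1 \<Longrightarrow> 0 \<le> j \<Longrightarrow> j \<le> LL (pr i) \<Longrightarrow>
      D (j + k) \<le> F (pr i) (cc (pr i) + j) + (P - e (Suc i) mod P) + F i (R * (cc i div R + k)) \<and>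
      D (j + k + 1) \<le> F (pr i) (cc (pr i) + j) + e (Suc i) mod P + F i (R * (cc i div R + k))"
    and j: "0 \<le> j" "j \<le> LL (Suc i)"
  shows "D j = F (Suc i) (cc (Suc i) + j)"
proof -
  define X where "X = F (pr i)"
  define cX LX where "cX = cc (pr i)" and "LX = LL (pr i)"
  define b \<rho> where "b = e (Suc i) div P" and "\<rho> = e (Suc i) mod P"
  define M w where "M = cc i div R" and "w = LL i div 2 + 1"
  define A where "A = lconv X (e (Suc i))"
  have \<rho>: "0 \<le> \<rho>" "\<rho> < P" using Ppos by (auto simp: \<rho>_def)
  have WX: "win P X cX LX" unfolding X_def cX_def LX_def by (rule F_win)
  have WA: "win P A (cX - b - 1) (LX + 1)" unfolding A_def b_def by (rule lconv_win[OF WX])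
  have LX0: "0 \<le> LX" using win_nonneg[OF WX] .
  have c: "cc (Suc i) = cX - b - 1 + M" "LL (Suc i) = LX + 1 + w"
    using h by (auto simp: cX_def LX_def b_def M_def w_def)
  note [simp del] = cc.simps(2) LL.simps(2)
  have ps: "D (l + k) \<le> X (cX + l) + (P - \<rho>) + F i (R * (M + k))"
      "D (l + k + 1) \<le> X (cX + l) + \<rho> + F i (R * (M + k))"
    if "0 \<le> k" "k \<le> w" "0 \<le> l" "l \<le> LX" for k l
    using pairs[of k l] that by (auto simp: X_def cX_def LX_def \<rho>_def M_def w_def)
  have inA: "D (u - (cX - b - 1) + k) \<le> A u + F i (R * (M + k))"
    if u: "cX - b - 1 \<le> u" "u \<le> cX - b + LX" and k: "0 \<le> k" "k \<le> w" for u k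
  proof -
    have o1: "D (u - (cX - b - 1) + k) \<le> X (u + b + 1) + (P - \<rho>) + F i (R * (M + k))" if "u < cX - b + LX"
    proof -
      have e: "cX + (u - (cX - b - 1)) = u + b + 1" by simp
      show ?thesis using ps(1)[of k "u - (cX - b - 1)", unfolded e] that u k by simp
    qed
    have o2: "D (u - (cX - b - 1) + k) \<le> X (u + b) + \<rho> + F i (R * (M + k))" if "cX - b - 1 < u"
    proof -
      have e: "cX + (u - (cX - b)) = u + b" "u - (cX - b) + k + 1 = u - (cX - b - 1) + k" by simp_all
      show ?thesis using ps(2)[of k "u - (cX - b)", unfolded e] that u k by simp
    qed
    \<comment> \<open>At either end of the range of u one of the two candidates for
      \<open>A u\<close> falls outside the window of \<open>X\<close>. The extreme slope there makes
      it no better than the other one, because the remainder lies between 0 and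
      \<open>P\<close>.\<close>
    have l: "X (u + b + 1) = X (u + b) + P" if "u = cX - b + LX"
      using win_right[OF WX, of "u + b + 1"] that LX0 by simp
    have r: "X (u + b) = X (u + b + 1) + P" if "u = cX - b - 1"
      using win_left[OF WX, of "u + b"] that by simp
    have A: "A u = min (X (u + b + 1) + (P - \<rho>)) (X (u + b) + \<rho>)"
      by (simp add: A_def lconv_def b_def \<rho>_def)
    have "u < cX - b + LX \<or> u = cX - b + LX" "cX - b - 1 < u \<or> u = cX - b - 1" using u by auto
    then show ?thesis
      using o1 o2 l r \<rho> LX0 unfolding A min_def by (auto split: if_splits)
  qed
  have lip': "D k \<le> D l + P * \<bar>k - l\<bar>" if "0 \<le> k" "k \<le> LL (Suc i)" "0 \<le> l" "l \<le> LL (Suc i)" for k l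
  proof -
    \<comment> \<open>Clamping the index extends the table to all integers, so that the bound on
      single steps turns into a bound over any distance.\<close>
    let ?D = "\<lambda>z. D (max 0 (min (LL (Suc i)) z))"
    have "\<bar>?D (z + 1) - ?D z\<bar> \<le> P" for z
    proof (cases "0 \<le> z \<and> z < LL (Suc i)")
      case True
      then have e: "max 0 (min (LL (Suc i)) (z + 1)) = z + 1" "max 0 (min (LL (Suc i)) z) = z"
        by auto
      have "D (z + 1) \<le> D z + P" "D z \<le> D (z + 1) + P" using lip[of z] True by auto
      then show ?thesis unfolding e by linarith
    next
      case False
      then have "max 0 (min (LL (Suc i)) (z + 1)) = max 0 (min (LL (Suc i)) z)"
        using LL_nonneg[of "Suc i"] by linarith
      then show ?thesis using Ppos by simp
    qed
    from lipschitz_steps[of ?D P k l, OF this] show ?thesis using that by (simp add: abs_le_iff)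
  qed
  obtain m where m: "M \<le> m" "m \<le> M + w" "F (Suc i) (cc (Suc i) + j) = F i (R * m) + A (cc (Suc i) + j - m)"
    using conv_attained[OF LL_nonneg, of "cc i" i A "F i" "cc (Suc i) + j"] h
    by (auto simp: F.simps M_def w_def A_def X_def add.assoc)
  let ?u = "cc (Suc i) + j - m"
  have "D j \<le> F (Suc i) (cc (Suc i) + j)"
  proof (cases "?u < cX - b - 1")
    case True
    have "D (m - M) \<le> A (cX - b - 1) + F i (R * m)"
      using inA[of "cX - b - 1" "m - M"] m LX0 by simp
    moreover have "A ?u = A (cX - b - 1) + P * (cX - b - 1 - ?u)" using True by (intro win_left[OF WA]) simp
    moreover have "D j \<le> D (m - M) + P * \<bar>j - (m - M)\<bar>" using lip'[of j "m - M"] j m c LX0 by simp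
    moreover have "\<bar>j - (m - M)\<bar> = cX - b - 1 - ?u" using True c by simp
    ultimately show ?thesis using m by simp
  next
    case 1: False
    show ?thesis
    proof (cases "cX - b + LX < ?u")
      case True
      let ?k = "LX + 1 + (m - M)"
      have "D ?k \<le> A (cX - b + LX) + F i (R * m)"
        using inA[of "cX - b + LX" "m - M"] m LX0 by (simp add: algebra_simps)
      moreover have "A ?u = A (cX - b + LX) + P * (?u - (cX - b + LX))"
        using win_right[OF WA, of ?u] True by (simp add: algebra_simps)
      moreover have "D j \<le> D ?k + P * \<bar>j - ?k\<bar>" using lip'[of j ?k] j m c LX0 by simp
      moreover have "\<bar>j - ?k\<bar> = ?u - (cX - b + LX)" using True c by simp
      ultimately show ?thesis using m by simp
    next
      case False
      have "D (?u - (cX - b - 1) + (m - M)) \<le> A ?u + F i (R * m)"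
        using inA[of ?u "m - M"] m 1 False by simp
      moreover have "?u - (cX - b - 1) + (m - M) = j" using c by simp
      ultimately show ?thesis using m by simp
    qed
  qed
  then show ?thesis using sound[OF j] by simp
qed

end

section \<open>Reasoning about programs\<close>

definition upd :: "state \<Rightarrow> string \<Rightarrow> int \<Rightarrow> int \<Rightarrow> state" where
  "upd s x i v = s(x := (s x)(i := v))"

lemma upd_same [simp]: "upd s x i v x j = (if j = i then v else s x j)"
  and upd_other [simp]: "y \<noteq> x \<Longrightarrow> upd s x i v y = s y"
  by (auto simp: upd_def)

text \<open>Like \<open>run\<close>, but with a uniform bound on the absolute values that are stored, in place of the
  bound on the bits of all intermediate results.\<close>

inductive exec :: "int \<Rightarrow> com \<Rightarrow> state \<Rightarrow> nat \<Rightarrow> state \<Rightarrow> bool" for M :: int where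
  Skip: "exec M Skip s 1 s"
| Store: "\<bar>eval_exp e s\<bar> \<le> M \<Longrightarrow>
    exec M (Store x i e) s (cost_exp i + cost_exp e + 1) (upd s x (eval_exp i s) (eval_exp e s))"
| Seq: "exec M c1 s n1 s1 \<Longrightarrow> exec M c2 s1 n2 s2 \<Longrightarrow> exec M (Seq c1 c2) s (n1 + n2) s2"
| CondTrue: "eval_bexp b s \<Longrightarrow> exec M c1 s n s1 \<Longrightarrow> exec M (Cond b c1 c2) s (cost_bexp b + n) s1"
| CondFalse: "\<not> eval_bexp b s \<Longrightarrow> exec M c2 s n s1 \<Longrightarrow> exec M (Cond b c1 c2) s (cost_bexp b + n) s1"
| WhileFalse: "\<not> eval_bexp b s \<Longrightarrow> exec M (While b c) s (cost_bexp b) s"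
| WhileTrue: "eval_bexp b s \<Longrightarrow> exec M c s n1 s1 \<Longrightarrow> exec M (While b c) s1 n2 s2 \<Longrightarrow>
    exec M (While b c) s (cost_bexp b + n1 + n2) s2"

text \<open>Total correctness with a running clock: \<open>t\<close> is the time already spent, and
  the postcondition sees the time at the end. Bounds thus pass through sequences of commands without
  being added up separately.\<close>

definition wp :: "int \<Rightarrow> com \<Rightarrow> (nat \<Rightarrow> state \<Rightarrow> bool) \<Rightarrow> nat \<Rightarrow> state \<Rightarrow> bool" where
  "wp M c R t s \<longleftrightarrow> (\<exists>n s'. exec M c s n s' \<and> R (t + n) s')"

inductive_cases exec_SkipE: "exec M Skip s n s'"
inductive_cases exec_StoreE: "exec M (Store x i e) s n s'"
inductive_cases exec_SeqE: "exec M (Seq c1 c2) s n s'"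
inductive_cases exec_CondE: "exec M (Cond b c1 c2) s n s'"

lemma wp_Skip: "wp M Skip R t s = R (t + 1) s"
proof
  assume "R (t + 1) s"
  then show "wp M Skip R t s" unfolding wp_def using exec.Skip by blast
qed (auto simp: wp_def elim!: exec_SkipE)

lemma wp_Store: "wp M (Store x i e) R t s = (\<bar>eval_exp e s\<bar> \<le> M \<and>
    R (t + (cost_exp i + cost_exp e + 1)) (upd s x (eval_exp i s) (eval_exp e s)))"
proof
  assume "\<bar>eval_exp e s\<bar> \<le> M \<and>
    R (t + (cost_exp i + cost_exp e + 1)) (upd s x (eval_exp i s) (eval_exp e s))"
  then show "wp M (Store x i e) R t s"
    unfolding wp_def using exec.Store by blast
qed (auto simp: wp_def elim!: exec_StoreE)

lemma wp_Seq: "wp M (Seq c1 c2) R t s = wp M c1 (wp M c2 R) t s"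
proof
  assume "wp M (Seq c1 c2) R t s"
  then show "wp M c1 (wp M c2 R) t s"
    unfolding wp_def by (auto elim!: exec_SeqE simp: add.assoc)
next
  assume "wp M c1 (wp M c2 R) t s"
  then show "wp M (Seq c1 c2) R t s"
    unfolding wp_def using exec.Seq by (metis add.assoc)
qed

lemma wp_Seq_fun: "wp M (Seq c1 c2) R = wp M c1 (wp M c2 R)"
  by (intro ext wp_Seq)

lemma wp_Cond: "wp M (Cond b c1 c2) R t s =
    (if eval_bexp b s then wp M c1 R (t + cost_bexp b) s else wp M c2 R (t + cost_bexp b) s)"
proof
  assume "wp M (Cond b c1 c2) R t s"
  then show "if eval_bexp b s then wp M c1 R (t + cost_bexp b) s else wp M c2 R (t + cost_bexp b) s"
    unfolding wp_def by (auto elim!: exec_CondE simp: add.assoc)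
next
  assume "if eval_bexp b s then wp M c1 R (t + cost_bexp b) s else wp M c2 R (t + cost_bexp b) s"
  then show "wp M (Cond b c1 c2) R t s"
    unfolding wp_def using exec.CondTrue exec.CondFalse by (metis add.assoc)
qed

lemmas wp_simps [simp] = wp_Skip wp_Store wp_Seq wp_Cond

lemma wp_mono: "wp M c R t s \<Longrightarrow> (\<And>t s. R t s \<Longrightarrow> R' t s) \<Longrightarrow> wp M c R' t s"
  unfolding wp_def by blast

lemma wp_While_False: "\<not> eval_bexp b s \<Longrightarrow> R (t + cost_bexp b) s \<Longrightarrow> wp M (While b c) R t s"
  unfolding wp_def using exec.WhileFalse by blast

lemma wp_While_True: "eval_bexp b s \<Longrightarrow> wp M c (wp M (While b c) R) (t + cost_bexp b) s \<Longrightarrow> wp M (While b c) R t s"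
  unfolding wp_def using exec.WhileTrue by (metis add.assoc)

lemma wp_While:
  fixes \<mu> :: "state \<Rightarrow> nat"
  assumes "I t s"
    and "\<And>t s. I t s \<Longrightarrow> eval_bexp b s \<Longrightarrow> wp M c (\<lambda>t' s'. I t' s' \<and> \<mu> s' < \<mu> s) (t + cost_bexp b) s"
    and "\<And>t s. I t s \<Longrightarrow> \<not> eval_bexp b s \<Longrightarrow> R (t + cost_bexp b) s"
  shows "wp M (While b c) R t s"
  using assms(1)
proof (induction "\<mu> s" arbitrary: t s rule: less_induct)
  case less
  show ?case
  proof (cases "eval_bexp b s")
    case True
    from assms(2)[OF less.prems True] show ?thesis
      by (intro wp_While_True[OF True], elim wp_mono) (use less.hyps in blast)
  next
    case False
    then show ?thesis using assms(3)[OF less.prems] by (intro wp_While_False)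
  qed
qed

lemma wp_for:
  assumes "I 0 t s"
    and step: "\<And>k t s. k < N \<Longrightarrow> I k t s \<Longrightarrow> eval_bexp b s \<and> wp M c (I (Suc k)) (t + cost_bexp b) s"
    and "\<And>t s. I N t s \<Longrightarrow> \<not> eval_bexp b s \<and> R (t + cost_bexp b) s"
  shows "wp M (While b c) R t s"
proof -
  have "I k t s \<Longrightarrow> k \<le> N \<Longrightarrow> wp M (While b c) R t s" for k t s
  proof (induction "N - k" arbitrary: k t s)
    case 0
    then show ?case using assms(3)[of t s] by (intro wp_While_False) auto
  next
    case (Suc d)
    then have "k < N" by simp
    from step[OF this Suc.prems(1)] show ?case
      by (intro wp_While_True, simp, elim conjE wp_mono) (rule Suc.hyps(1)[of "Suc k"], use Suc in auto)
  qed
  then show ?thesis using assms(1) by blast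
qed

section \<open>Bit lengths of intermediate results\<close>

text \<open>With all cells bounded by \<open>M\<close>, the value of an expression is at most
  \<open>M ^ deg\<close>. An index does not count, since a cell obeys the bound whatever its address
  is.\<close>

fun deg :: "exp \<Rightarrow> nat" where
  "deg (Lit c) = 1"
| "deg (Cell x e) = 1"
| "deg (Arith f a b) = deg a + deg b"

text \<open>A check of the program text alone: literals are small and no expression, indices
  included, has a large degree. It has to be carried out once and then serves all
  executions.\<close>

fun okx :: "int \<Rightarrow> nat \<Rightarrow> exp \<Rightarrow> bool" where
  "okx M D (Lit c) = (\<bar>c\<bar> \<le> M)"
| "okx M D (Cell x e) = okx M D e"
| "okx M D (Arith f a b) = (okx M D a \<and> okx M D b \<and> deg a + deg b \<le> D)"

fun okb :: "int \<Rightarrow> nat \<Rightarrow> bexp \<Rightarrow> bool" where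
  "okb M D (Less a b) = (okx M D a \<and> okx M D b)"
| "okb M D (Neg b) = okb M D b"
| "okb M D (Conj a b) = (okb M D a \<and> okb M D b)"

fun okc :: "int \<Rightarrow> nat \<Rightarrow> com \<Rightarrow> bool" where
  "okc M D Skip = True"
| "okc M D (Store x i e) = (okx M D i \<and> okx M D e)"
| "okc M D (Seq a b) = (okc M D a \<and> okc M D b)"
| "okc M D (Cond b c1 c2) = (okb M D b \<and> okc M D c1 \<and> okc M D c2)"
| "okc M D (While b c) = (okb M D b \<and> okc M D c)"

lemma deg_pos: "1 \<le> deg e"
  by (induction e) auto

lemma abs_mod_le: "\<bar>(x::int) mod k\<bar> \<le> max \<bar>x\<bar> \<bar>k\<bar>"
proof (cases "k = 0")
  case False
  then have "\<bar>x mod k\<bar> < \<bar>k\<bar>" by (rule abs_mod_less)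
  then show ?thesis by simp
qed simp

text \<open>Once both bounds are at least 2 their product dominates their sum and their maximum, so
  one multiplicative rule covers all five operations.\<close>

lemma abs_arith_le:
  assumes "\<bar>x\<bar> \<le> a" "\<bar>y\<bar> \<le> b" "2 \<le> a" "2 \<le> b"
  shows "\<bar>arith f x y\<bar> \<le> a * b"
proof -
  have "0 \<le> (a - 2) * (b - 2)" using assms by simp
  then have ab: "2 * a + 2 * b \<le> a * b + 4" by (simp add: algebra_simps)
  have max: "\<bar>x mod y\<bar> \<le> max a b" using abs_mod_le[of x y] assms by linarith
  show ?thesis
  proof (cases f)
    case Times
    then show ?thesis using assms by (auto simp: abs_mult intro!: mult_mono)
  next
    case Div
    then show ?thesis using abs_div_le[of x y] assms ab by simp
  next
    case Mod
    then show ?thesis using max assms ab by (simp add: max_def split: if_splits)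
  qed (use assms ab in auto)
qed

definition bounded :: "int \<Rightarrow> state \<Rightarrow> bool" where
  "bounded M s \<longleftrightarrow> (\<forall>x i. \<bar>s x i\<bar> \<le> M)"

lemma eval_exp_le:
  assumes "bounded M s" "2 \<le> M" "okx M D e"
  shows "\<bar>eval_exp e s\<bar> \<le> M ^ deg e"
  using assms(3)
proof (induction e)
  case (Arith f a b)
  have "2 \<le> M ^ deg c" for c
    using self_le_power[of M "deg c"] deg_pos[of c] assms(2) by simp
  then show ?case using Arith by (auto simp: power_add intro!: abs_arith_le)
qed (use assms in \<open>auto simp: bounded_def\<close>)

lemma bits_le: "\<bar>x\<bar> < 2 ^ B \<Longrightarrow> bits x \<le> B"
proof -
  assume "\<bar>x\<bar> < 2 ^ B"
  then have "nat \<bar>x\<bar> < 2 ^ B" by (simp add: nat_less_iff)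
  then show ?thesis unfolding bits_def by (simp add: floorlog_le_iff)
qed

lemma fits_exp_ok:
  assumes "bounded M s" "2 \<le> M" "okx M D e" "1 \<le> D" "M ^ D < 2 ^ B"
  shows "fits_exp B e s"
  using assms(3)
proof (induction e)
  case (Lit c)
  have "M ^ 1 \<le> M ^ D" using assms by (intro power_increasing) auto
  then show ?case using Lit assms by (auto intro!: bits_le)
next
  case (Cell x e)
  have "M ^ 1 \<le> M ^ D" using assms by (intro power_increasing) auto
  moreover have "\<bar>s x (eval_exp e s)\<bar> \<le> M" using assms(1) by (simp add: bounded_def)
  ultimately show ?case using Cell assms by (auto intro!: bits_le)
next
  case (Arith f a b)
  have "\<bar>eval_exp (Arith f a b) s\<bar> \<le> M ^ deg (Arith f a b)"
    by (rule eval_exp_le[OF assms(1,2) Arith.prems])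
  also have "\<dots> \<le> M ^ D" using Arith.prems assms by (intro power_increasing) auto
  finally show ?case using Arith assms by (auto intro!: bits_le)
qed

lemma fits_bexp_ok:
  assumes "bounded M s" "2 \<le> M" "okb M D b" "1 \<le> D" "M ^ D < 2 ^ B"
  shows "fits_bexp B b s"
  using assms(3) by (induction b) (auto intro: fits_exp_ok[OF assms(1,2) _ assms(4,5)])

lemma exec_run:
  assumes "exec M c s n s'" "bounded M s" "okc M D c" "2 \<le> M" "1 \<le> D" "M ^ D < 2 ^ B"
  shows "run B c s n s' \<and> bounded M s'"
  using assms(1-3)
proof (induction rule: exec.induct)
  case (Store e s x i)
  have "bounded M (upd s x (eval_exp i s) (eval_exp e s))"
    using Store by (auto simp: bounded_def upd_def)
  moreover have "fits_exp B i s" "fits_exp B e s"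
    using Store assms by (auto intro: fits_exp_ok)
  ultimately show ?case unfolding upd_def by (intro conjI run.Store)
next
  case (CondTrue b s c1 n s1 c2)
  then show ?case using assms by (auto intro!: run.CondTrue fits_bexp_ok[of M])
next
  case (CondFalse b s c2 n s1 c1)
  then show ?case using assms by (auto intro!: run.CondFalse fits_bexp_ok[of M])
next
  case (WhileFalse b s c)
  then show ?case using assms by (auto intro!: run.WhileFalse fits_bexp_ok[of M])
next
  case (WhileTrue b s c n1 s1 n2 s2)
  then show ?case using assms by (auto intro!: run.WhileTrue fits_bexp_ok[of M])
qed (use run.Skip in \<open>auto intro: run.intros\<close>)

section \<open>Tables of a node\<close>

abbreviation V :: "string \<Rightarrow> exp" where "V x \<equiv> Cell x (Lit 0)"
abbreviation pls (infixl "\<oplus>" 65) where "a \<oplus> b \<equiv> Arith Plus a b"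
abbreviation mns (infixl "\<ominus>" 65) where "a \<ominus> b \<equiv> Arith Minus a b"
abbreviation tms (infixl "\<otimes>" 70) where "a \<otimes> b \<equiv> Arith Times a b"
abbreviation dvx (infixl "\<oslash>" 70) where "a \<oslash> b \<equiv> Arith Div a b"
abbreviation mdx (infixl "\<odot>" 70) where "a \<odot> b \<equiv> Arith Mod a b"
abbreviation lss (infix "\<prec>" 50) where "a \<prec> b \<equiv> Less a b"
abbreviation asg (infix "::=" 45) where "x ::= e \<equiv> Store x (Lit 0) e"
abbreviation sq (infixr ";;" 40) where "c ;; d \<equiv> Seq c d"

text \<open>The pairing function \<open>(i + j)\<^sup>2 + j\<close> lays out the tables of all nodes in one array.\<close>

definition adr :: "int \<Rightarrow> int \<Rightarrow> int" where "adr i j = (i + j) * (i + j) + j"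

lemma adr_inj:
  assumes "0 \<le> i" "0 \<le> j" "0 \<le> k" "0 \<le> l"
  shows "adr i j = adr k l \<longleftrightarrow> i = k \<and> j = l"
proof
  assume e: "adr i j = adr k l"
  have less: False if "adr i j = adr k l" "0 \<le> i" "0 \<le> j" "0 \<le> k" "0 \<le> l" "i + j < k + l" for i j k l
  proof -
    have "(i + j + 1) * (i + j + 1) \<le> (k + l) * (k + l)" using that by (intro mult_mono) auto
    then show False using that by (simp add: adr_def algebra_simps)
  qed
  have "i + j = k + l"
    using less[of i j k l] less[of k l i j] e assms by (cases "i + j" "k + l" rule: linorder_cases) auto
  then show "i = k \<and> j = l" using e by (simp add: adr_def)
qed simp

definition adrE :: "exp \<Rightarrow> exp \<Rightarrow> exp" where "adrE X J = (X \<oplus> J) \<otimes> (X \<oplus> J) \<oplus> J"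

lemma adrE_simps [simp]:
  "eval_exp (adrE X J) s = adr (eval_exp X s) (eval_exp J s)"
  "cost_exp (adrE X J) = 2 * cost_exp X + 3 * cost_exp J + 4"
  by (auto simp: adrE_def adr_def)

definition agree :: "string set \<Rightarrow> state \<Rightarrow> state \<Rightarrow> bool" where
  "agree A s0 s \<longleftrightarrow> (\<forall>x. x \<notin> A \<longrightarrow> s x = s0 x)"

lemma agree_upd [simp]: "x \<in> A \<Longrightarrow> agree A s0 (upd s x i v) = agree A s0 s"
  by (auto simp: agree_def upd_def)

lemma agree_refl [simp]: "agree A s s"
  by (simp add: agree_def)

lemma agreeD: "agree A s0 s \<Longrightarrow> x \<notin> A \<Longrightarrow> s x = s0 x"
  by (simp add: agree_def)

lemma agree_trans: "agree A s0 s1 \<Longrightarrow> agree B s1 s2 \<Longrightarrow> A \<subseteq> C \<Longrightarrow> B \<subseteq> C \<Longrightarrow> agree C s0 s2"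
  unfolding agree_def by (metis subsetD)

definition lower :: "exp \<Rightarrow> com" where
  "lower A = Cond (V ''o'' \<prec> Cell ''v'' A) (Store ''v'' A (V ''o'')) Skip"

lemma upd_triv: "upd s x i (s x i) = s"
  by (simp add: upd_def)

lemma wp_lower:
  assumes "\<bar>s ''o'' 0\<bar> \<le> M"
    "\<And>t'. t' \<le> t + (9 + 2 * cost_exp A) \<Longrightarrow>
       R t' (upd s ''v'' (eval_exp A s) (min (s ''v'' (eval_exp A s)) (s ''o'' 0)))"
  shows "wp M (lower A) R t s"
proof (cases "s ''o'' 0 < s ''v'' (eval_exp A s)")
  case True
  then show ?thesis using assms by (simp add: lower_def min_def)
next
  case False
  then have "upd s ''v'' (eval_exp A s) (min (s ''v'' (eval_exp A s)) (s ''o'' 0)) = s"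
    by (simp add: min_def upd_triv)
  then have "R t' s" if "t' \<le> t + (9 + 2 * cost_exp A)" for t' using assms(2)[OF that] by simp
  then show ?thesis using False by (simp add: lower_def)
qed

section \<open>Size bounds, and evaluation of a cost from its table\<close>

text \<open>\<open>U\<close> bounds the exponents, the windows and the number of positions.
  Arguments of \<open>F\<close> are then quadratic in \<open>U\<close> and its values cubic, so
  \<open>M\<close> is cubic; the factor 100 leaves room for sums of several such values.\<close>

locale prog = tree +
  fixes N :: nat and U M :: int
  assumes U100: "100 \<le> U" and QU: "Q \<le> U" and UM: "100 * (U * U * U) \<le> M" and NU: "int N \<le> U"
    and eU: "i \<le> N \<Longrightarrow> \<bar>e i\<bar> \<le> U" and cU: "i \<le> N \<Longrightarrow> \<bar>cc i\<bar> \<le> U"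
    and lU: "i \<le> N \<Longrightarrow> LL i \<le> U" and FU: "i \<le> N \<Longrightarrow> F i 0 \<le> U"
begin

lemma PU: "P \<le> U" and RU: "R \<le> U"
proof -
  have "P * 1 \<le> Q" "1 * R \<le> Q" using P1 R2 by (intro mult_mono; simp)+
  then show "P \<le> U" "R \<le> U" using QU by linarith+
qed

lemma UU: "100 * U \<le> U * U" "100 * (U * U) \<le> U * U * U" "U \<le> M" "0 \<le> U" "10 * U \<le> M"
proof -
  show 1: "100 * U \<le> U * U" using U100 by (intro mult_right_mono) auto
  show 2: "100 * (U * U) \<le> U * U * U"
    using U100 mult_right_mono[of 100 U "U * U"] by (simp add: mult_ac)
  show "0 \<le> U" using U100 by simp
  show "U \<le> M" "10 * U \<le> M" using 1 2 UM U100 by linarith+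
qed

lemma mulU:
  assumes "0 \<le> c" "c \<le> U" "\<bar>x\<bar> \<le> k"
  shows "\<bar>c * x\<bar> \<le> U * k"
  using assms UU(4) by (auto simp: abs_mult intro!: mult_mono)

lemma F_le:
  assumes "i \<le> N" "\<bar>z\<bar> \<le> k"
  shows "F i z \<le> U + U * k"
proof -
  have "F i z \<le> F i 0 + P * \<bar>z\<bar>" using F_le_shift[of i z 0] by simp
  also have "\<dots> \<le> U + U * k"
    using FU[OF assms(1)] PU assms(2) UU(4) by (intro add_mono mult_mono) auto
  finally show ?thesis .
qed

lemma F_abs:
  assumes "i \<le> N" "\<bar>z\<bar> \<le> k * (U * U)" "0 \<le> k"
  shows "\<bar>F i z\<bar> \<le> U + k * (U * U * U)"
  using F_le[OF assms(1,2)] F_nonneg[of i z] by (simp add: algebra_simps)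

definition node :: "state \<Rightarrow> nat \<Rightarrow> bool" where
  "node s i \<longleftrightarrow> s ''c'' (int i) = cc i \<and> s ''l'' (int i) = LL i
     \<and> (\<forall>j. 0 \<le> j \<and> j \<le> LL i \<longrightarrow> s ''v'' (adr (int i) j) = F i (cc i + j))"

lemma node_upd [simp]: "x \<noteq> ''c'' \<Longrightarrow> x \<noteq> ''l'' \<Longrightarrow> x \<noteq> ''v'' \<Longrightarrow> node (upd s x k v) i = node s i"
  by (simp add: node_def)

lemma node_upd_c [simp]: "k \<noteq> int i \<Longrightarrow> node (upd s ''c'' k v) i = node s i"
  and node_upd_l [simp]: "k \<noteq> int i \<Longrightarrow> node (upd s ''l'' k v) i = node s i"
  by (auto simp: node_def)

lemma node_upd_v [simp]: "k \<noteq> int i \<Longrightarrow> 0 \<le> k \<Longrightarrow> 0 \<le> j \<Longrightarrow> node (upd s ''v'' (adr k j) v) i = node s i"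
  by (simp add: node_def adr_inj)

lemma node_agree: "agree A s s' \<Longrightarrow> ''c'' \<notin> A \<Longrightarrow> ''l'' \<notin> A \<Longrightarrow> ''v'' \<notin> A \<Longrightarrow> node s' i = node s i"
  by (simp add: node_def agree_def)

text \<open>Only the window is stored. Outside it the extreme slopes continue the value at the
  nearer end, so evaluation takes constant time at every integer.\<close>

definition EV :: "exp \<Rightarrow> exp \<Rightarrow> com" where
  "EV X Z = (''z'' ::= Z ;;
     Cond (V ''z'' \<prec> Cell ''c'' X)
       (''y'' ::= Cell ''v'' (adrE X (Lit 0)) \<oplus> Lit P \<otimes> (Cell ''c'' X \<ominus> V ''z''))
       (Cond (Cell ''c'' X \<oplus> Cell ''l'' X \<prec> V ''z'')
         (''y'' ::= Cell ''v'' (adrE X (Cell ''l'' X)) \<oplus> Lit P \<otimes> ((V ''z'' \<ominus> Cell ''c'' X) \<ominus> Cell ''l'' X))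
         (''y'' ::= Cell ''v'' (adrE X (V ''z'' \<ominus> Cell ''c'' X)))))"

lemma wp_EV:
  assumes "node s i" "\<And>v. eval_exp X (upd s ''z'' 0 v) = int i" "eval_exp Z s = z"
    "\<bar>z\<bar> \<le> M" "\<bar>F i z\<bar> \<le> M"
    "\<And>t'. t' \<le> t + (60 + 20 * cost_exp X + cost_exp Z) \<Longrightarrow> G t' (upd (upd s ''z'' 0 z) ''y'' 0 (F i z))"
  shows "wp M (EV X Z) G t s"
proof -
  note W = F_win[of i]
  have n: "s ''c'' (int i) = cc i" "s ''l'' (int i) = LL i"
      "\<And>j. 0 \<le> j \<Longrightarrow> j \<le> LL i \<Longrightarrow> s ''v'' (adr (int i) j) = F i (cc i + j)"
    using assms(1) by (auto simp: node_def)
  have l: "F i z = F i (cc i) + P * (cc i - z)" if "z < cc i" using win_left[OF W, of z] that by simp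
  have r: "F i z = F i (cc i + LL i) + P * (z - cc i - LL i)" if "cc i + LL i < z"
    using win_right[OF W, of z] that by simp
  have m: "F i z = s ''v'' (adr (int i) (z - cc i))" if "cc i \<le> z" "z \<le> cc i + LL i"
    using n(3)[of "z - cc i"] that by simp
  have e: "s ''v'' (adr (int i) 0) = F i (cc i)" "s ''v'' (adr (int i) (LL i)) = F i (cc i + LL i)"
    using n(3)[of 0] n(3)[of "LL i"] LL_nonneg[of i] by auto
  show ?thesis
    using assms(2-5)
    by (auto simp: EV_def n e l[symmetric] r[symmetric] m[symmetric] intro!: assms(6)[unfolded assms(3)[symmetric]])
qed

definition leafstep :: com where
  "leafstep =
     (''b'' ::= Cell ''e'' (V ''i'') \<oslash> Lit P ;;
      ''f'' ::= Cell ''e'' (V ''i'') \<odot> Lit P ;;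
      Store ''c'' (V ''i'') (Lit 0 \<ominus> V ''b'' \<ominus> Lit 1) ;;
      Store ''l'' (V ''i'') (Lit 1) ;;
      Store ''v'' (adrE (V ''i'') (Lit 0)) (Lit P \<ominus> V ''f'') ;;
      Store ''v'' (adrE (V ''i'') (Lit 1)) (V ''f'') ;;
      Store ''u'' (V ''i'') (V ''i'' \<ominus> Lit 1))"

definition built :: "nat \<Rightarrow> state \<Rightarrow> bool" where
  "built k s \<longleftrightarrow> (\<forall>j \<le> k. node s j \<and> s ''u'' (int j) = int (pr j))"

definition TS :: "string set" where
  "TS = {''x'', ''b'', ''f'', ''a'', ''w'', ''y'', ''z'', ''o'', ''j'', ''m'', ''s'', ''u'', ''c'', ''l'', ''v''}"

lemma wp_leafstep:
  assumes "built k s" "\<not> H (Suc k)" "Suc k \<le> N" "s ''i'' 0 = int (Suc k)" "s ''e'' (int (Suc k)) = e (Suc k)"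
    "\<And>t' s'. t' \<le> t + 100 \<Longrightarrow> agree TS s s' \<Longrightarrow> built (Suc k) s' \<Longrightarrow> G t' s'"
  shows "wp M leafstep G t s"
proof -
  let ?b = "e (Suc k) div P" and ?f = "e (Suc k) mod P"
  have b: "\<bar>?b\<bar> \<le> U" using eU[OF assms(3)] abs_div_le[of "e (Suc k)" P] by linarith
  have f: "0 \<le> ?f" "?f < P" using Ppos by auto
  have i: "1 + int k \<le> U" using NU assms(3) by linarith
  define s' where "s' = upd (upd (upd (upd (upd (upd (upd s ''b'' 0 ?b) ''f'' 0 ?f)
    ''c'' (1 + int k) (- ?b - 1)) ''l'' (1 + int k) 1) ''v'' (adr (1 + int k) 0) (P - ?f))
    ''v'' (adr (1 + int k) 1) ?f) ''u'' (1 + int k) (int k)"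
  have nodek: "node s' (Suc k)"
  proof -
    have F: "F (Suc k) (- ?b - 1) = P - ?f" "F (Suc k) (- ?b - 1 + 1) = ?f"
      using assms(2) abs_leaf[of "e (Suc k)"] by simp_all
    have "s' ''v'' (adr (1 + int k) j) = F (Suc k) (- ?b - 1 + j)" if "0 \<le> j" "j \<le> 1" for j
    proof -
      have "j = 0 \<or> j = 1" using that by linarith
      then show ?thesis using F by (auto simp: s'_def adr_inj simp del: F_leaf)
    qed
    then show ?thesis unfolding node_def using assms(2) by (auto simp: s'_def simp del: F_leaf)
  qed
  have "built (Suc k) s'"
    unfolding built_def
  proof (intro allI impI)
    fix j
    assume "j \<le> Suc k"
    then consider "j = Suc k" | "j \<le> k" by linarith
    then show "node s' j \<and> s' ''u'' (int j) = int (pr j)"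
    proof cases
      case 1
      then show ?thesis using nodek assms(2) by (simp add: s'_def)
    next
      case 2
      then have "node s j" "s ''u'' (int j) = int (pr j)" using assms(1) by (auto simp: built_def)
      then show ?thesis using 2 by (simp add: s'_def)
    qed
  qed
  moreover have "agree TS s s'" by (simp add: s'_def TS_def)
  ultimately have fin: "G t' s'" if "t' \<le> t + 100" for t' using assms(6) that by blast
  have "\<bar>- ?b - 1\<bar> \<le> M" using b UU U100 by linarith
  then show ?thesis
    using assms(4,5) b f i PU UU U100 by (simp add: leafstep_def s'_def[symmetric] fin)
qed


section \<open>Building the table of a position after \<open>t\<close>\<close>

text \<open>Besides the new window one candidate is computed: both children at the left ends of
  their ranges and the negative choice for the own exponent. It belongs to index 0 of the new
  table.\<close>

definition t_setup :: com where
  "t_setup =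
     (''x'' ::= Cell ''u'' (V ''i'' \<ominus> Lit 1) ;;
      Store ''u'' (V ''i'') (Cell ''u'' (V ''x'')) ;;
      ''b'' ::= Cell ''e'' (V ''i'') \<oslash> Lit P ;;
      ''f'' ::= Cell ''e'' (V ''i'') \<odot> Lit P ;;
      ''a'' ::= Cell ''c'' (V ''i'' \<ominus> Lit 1) \<oslash> Lit R ;;
      ''w'' ::= Cell ''l'' (V ''i'' \<ominus> Lit 1) \<oslash> Lit 2 \<oplus> Lit 1 ;;
      Store ''c'' (V ''i'') (Cell ''c'' (V ''x'') \<ominus> V ''b'' \<ominus> Lit 1 \<oplus> V ''a'') ;;
      Store ''l'' (V ''i'') (Cell ''l'' (V ''x'') \<oplus> Lit 1 \<oplus> V ''w'') ;;
      EV (V ''i'' \<ominus> Lit 1) (Lit R \<otimes> V ''a'') ;;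
      ''s'' ::= Cell ''v'' (adrE (V ''x'') (Lit 0)) \<oplus> (Lit P \<ominus> V ''f'') \<oplus> V ''y'' ;;
      ''j'' ::= Lit 0)"

text \<open>The minimum needs finite starting values. The candidate for index 0, continued with
  slope \<open>P\<close>, is an upper bound for every entry by the Lipschitz property of
  \<open>F\<close>.\<close>

definition t_init :: com where
  "t_init = While (V ''j'' \<prec> Cell ''l'' (V ''i'') \<oplus> Lit 1)
     (Store ''v'' (adrE (V ''i'') (V ''j'')) (V ''s'' \<oplus> Lit P \<otimes> V ''j'') ;;
      ''j'' ::= V ''j'' \<oplus> Lit 1)"

definition t_inner :: com where
  "t_inner = While (V ''j'' \<prec> Cell ''l'' (V ''x'') \<oplus> Lit 1)
     (''o'' ::= Cell ''v'' (adrE (V ''x'') (V ''j'')) \<oplus> (Lit P \<ominus> V ''f'') \<oplus> V ''y'' ;;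
      lower (adrE (V ''i'') (V ''j'' \<oplus> V ''m'')) ;;
      ''o'' ::= Cell ''v'' (adrE (V ''x'') (V ''j'')) \<oplus> V ''f'' \<oplus> V ''y'' ;;
      lower (adrE (V ''i'') (V ''j'' \<oplus> V ''m'' \<oplus> Lit 1)) ;;
      ''j'' ::= V ''j'' \<oplus> Lit 1)"

text \<open>The double loop that accounts for the product of the window lengths. The middle child is
  evaluated once per outer round, at a multiple of \<open>R\<close>, and the left child is read
  directly from its table.\<close>

definition t_pairs :: com where
  "t_pairs = While (V ''m'' \<prec> V ''w'' \<oplus> Lit 1)
     (EV (V ''i'' \<ominus> Lit 1) (Lit R \<otimes> (V ''a'' \<oplus> V ''m'')) ;;
      ''j'' ::= Lit 0 ;;
      t_inner ;;
      ''m'' ::= V ''m'' \<oplus> Lit 1)"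

text \<open>This sweep and the following one make the table \<open>P\<close>-Lipschitz in both
  directions; they supply the entries whose best candidate lies beyond the windows tried.\<close>

definition t_up :: com where
  "t_up = While (V ''j'' \<prec> Cell ''l'' (V ''i''))
     (''o'' ::= Cell ''v'' (adrE (V ''i'') (V ''j'')) \<oplus> Lit P ;;
      lower (adrE (V ''i'') (V ''j'' \<oplus> Lit 1)) ;;
      ''j'' ::= V ''j'' \<oplus> Lit 1)"

definition t_down :: com where
  "t_down = While (Lit 0 \<prec> V ''j'')
     (''o'' ::= Cell ''v'' (adrE (V ''i'') (V ''j'')) \<oplus> Lit P ;;
      ''j'' ::= V ''j'' \<ominus> Lit 1 ;;
      lower (adrE (V ''i'') (V ''j'')))"

definition tstep :: com where
  "tstep = (t_setup ;; t_init ;; ''m'' ::= Lit 0 ;; t_pairs ;; ''j'' ::= Lit 0 ;; t_up ;; t_down)"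

text \<open>The state after \<open>t_setup\<close>, up to the table of node \<open>Suc k\<close> and the loop variables.\<close>

definition ready :: "nat \<Rightarrow> state \<Rightarrow> state \<Rightarrow> bool" where
  "ready k s0 s \<longleftrightarrow> agree TS s0 s \<and> s ''i'' 0 = 1 + int k \<and> (\<forall>j \<le> k. node s j)
     \<and> (\<forall>j \<le> Suc k. s ''u'' (int j) = int (pr j))
     \<and> s ''c'' (1 + int k) = cc (Suc k) \<and> s ''l'' (1 + int k) = LL (Suc k)
     \<and> s ''x'' 0 = int (pr k) \<and> s ''f'' 0 = e (Suc k) mod P
     \<and> s ''a'' 0 = cc k div R \<and> s ''w'' 0 = LL k div 2 + 1"

lemma ready_upd [simp]:
  "x \<in> {''y'', ''z'', ''o'', ''j'', ''m'', ''s''} \<Longrightarrow> ready k s0 (upd s x i v) = ready k s0 s"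
  by (auto simp: ready_def TS_def)

lemma ready_upd_v [simp]: "0 \<le> j \<Longrightarrow> ready k s0 (upd s ''v'' (adr (1 + int k) j) v) = ready k s0 s"
  by (auto simp: ready_def TS_def)

abbreviation tab :: "nat \<Rightarrow> state \<Rightarrow> int \<Rightarrow> int" where
  "tab k s j \<equiv> s ''v'' (adr (1 + int k) j)"

context
  fixes k :: nat
  assumes h: "H (Suc k)" and kN: "Suc k \<le> N"
begin

lemmas defs_Suc [simp del] = cc.simps(2) LL.simps(2)

lemma cc_h: "cc (Suc k) = cc (pr k) - e (Suc k) div P - 1 + cc k div R"
  and LL_h: "LL (Suc k) = LL (pr k) + 1 + (LL k div 2 + 1)"
  using h by (simp_all add: cc.simps LL.simps)

lemma pN: "pr k \<le> N" "k \<le> N"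
  using pr_le[of k] kN by auto

lemma fP: "0 \<le> e (Suc k) mod P" "e (Suc k) mod P < P"
  using Ppos by auto

lemma arg_le:
  assumes "0 \<le> m" "m \<le> LL k div 2 + 1"
  shows "\<bar>R * (cc k div R + m)\<bar> \<le> 3 * (U * U)" "\<bar>F k (R * (cc k div R + m))\<bar> \<le> U + 3 * (U * U * U)"
proof -
  have "\<bar>cc k div R\<bar> \<le> U" using abs_div_le[of "cc k" R] cU[OF pN(2)] by linarith
  moreover have "LL k div 2 + 1 \<le> U + 1" using lU[OF pN(2)] LL_nonneg[of k] by linarith
  ultimately have "\<bar>cc k div R + m\<bar> \<le> 3 * U" using assms U100 by linarith
  from mulU[OF _ RU this] show "\<bar>R * (cc k div R + m)\<bar> \<le> 3 * (U * U)" by simp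
  then show "\<bar>F k (R * (cc k div R + m))\<bar> \<le> U + 3 * (U * U * U)" using pN by (intro F_abs) auto
qed

lemma entry_le:
  assumes "0 \<le> j" "j \<le> LL (pr k)"
  shows "\<bar>F (pr k) (cc (pr k) + j)\<bar> \<le> U + U * U * U"
proof -
  have "\<bar>cc (pr k) + j\<bar> \<le> 1 * (U * U)"
    using assms cU[OF pN(1)] lU[OF pN(1)] UU U100 by linarith
  from F_abs[OF pN(1) this] show ?thesis by simp
qed

definition base where "base = F (pr k) (cc (pr k)) + (P - e (Suc k) mod P) + F k (R * (cc k div R))"

lemma base_le: "\<bar>base\<bar> \<le> 5 * (U * U * U)"
proof -
  have "\<bar>F k (R * (cc k div R))\<bar> \<le> U + 3 * (U * U * U)" "\<bar>F (pr k) (cc (pr k))\<bar> \<le> U + U * U * U"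
    using arg_le(2)[of 0] entry_le[of 0] LL_nonneg[of k] LL_nonneg[of "pr k"] by simp_all
  then show ?thesis using fP PU UU U100 unfolding base_def by linarith
qed

lemma base_ge: "0 \<le> j \<Longrightarrow> F (Suc k) (cc (Suc k) + j) \<le> base + P * j"
proof -
  assume j: "0 \<le> j"
  have "F (Suc k) (cc (Suc k)) \<le> F k (R * (cc k div R)) + F (pr k) (cc (pr k))
      + \<bar>e (Suc k) + P * (- (e (Suc k) div P) - 1)\<bar>"
    by (rule F_pop_le[OF h]) (simp add: cc_h)
  then show ?thesis using F_le_shift[of "Suc k" "cc (Suc k) + j" "cc (Suc k)"] j
    unfolding abs_leaf base_def by simp
qed

lemma wp_t_setup:
  assumes "built k s" "s ''i'' 0 = int (Suc k)" "s ''e'' (int (Suc k)) = e (Suc k)"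
    "\<And>t' s'. t' \<le> t + 300 \<Longrightarrow> ready k s s' \<Longrightarrow> s' ''s'' 0 = base \<Longrightarrow> s' ''j'' 0 = 0 \<Longrightarrow> G t' s'"
  shows "wp M t_setup G t s"
proof -
  have nodes: "node s j" "s ''u'' (int j) = int (pr j)" if "j \<le> k" for j
    using assms(1) that by (auto simp: built_def)
  note nk = nodes[OF order_refl] and nx = nodes[OF pr_le[of k]]
  have ck: "s ''c'' (int k) = cc k" "s ''l'' (int k) = LL k" "s ''c'' (int (pr k)) = cc (pr k)"
    "s ''l'' (int (pr k)) = LL (pr k)" "s ''v'' (adr (int (pr k)) 0) = F (pr k) (cc (pr k))"
    using nk nx LL_nonneg[of "pr k"] unfolding node_def by force+
  have i: "1 + int k \<le> U" using NU kN by linarith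
  have b: "\<bar>e (Suc k) div P\<bar> \<le> M" "\<bar>cc k div R\<bar> \<le> M" "\<bar>LL k div 2 + 1\<bar> \<le> M" "\<bar>cc (Suc k)\<bar> \<le> M" "\<bar>LL (Suc k)\<bar> \<le> M"
    "\<bar>int (pr k)\<bar> \<le> M" "\<bar>int (pr (pr k))\<bar> \<le> M" "\<bar>e (Suc k) mod P\<bar> \<le> M"
    using eU[OF kN] abs_div_le[of "e (Suc k)" P] abs_div_le[of "cc k" R] cU[OF pN(2)] cU[OF kN] lU[OF kN]
      lU[OF pN(2)] LL_nonneg[of k] LL_nonneg[of "Suc k"] UU i pr_le[of k] pr_le[of "pr k"] fP PU U100
    by linarith+
  have c: "\<bar>R * (cc k div R)\<bar> \<le> M" "\<bar>F k (R * (cc k div R))\<bar> \<le> M" "\<bar>base\<bar> \<le> M"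
    using arg_le[of 0] base_le LL_nonneg[of k] UU UM U100 by (simp_all, linarith+)
  have pk: "int (pr k) \<noteq> 1 + int k" "int k \<noteq> 1 + int k" using pr_le[of k] by simp_all
  define s1 where "s1 = upd (upd (upd (upd (upd (upd (upd (upd s ''x'' 0 (int (pr k))) ''u'' (1 + int k) (int (pr (pr k))))
    ''b'' 0 (e (Suc k) div P)) ''f'' 0 (e (Suc k) mod P)) ''a'' 0 (cc k div R)) ''w'' 0 (LL k div 2 + 1))
    ''c'' (1 + int k) (cc (Suc k))) ''l'' (1 + int k) (LL (Suc k))"
  have s1: "ready k s s1"
    unfolding ready_def
  proof (intro conjI allI impI)
    fix j
    assume "j \<le> k"
    then show "node s1 j" using nodes(1)[of j] by (simp add: s1_def)
  next
    fix j
    assume "j \<le> Suc k"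
    then consider "j = Suc k" | "j \<le> k" by linarith
    then show "s1 ''u'' (int j) = int (pr j)"
    proof cases
      case 1
      then show ?thesis using h by (simp add: s1_def)
    next
      case 2
      then show ?thesis using nodes(2)[of j] by (simp add: s1_def)
    qed
  qed (use assms(2) in \<open>auto simp: s1_def TS_def\<close>)
  have n1: "node s1 k" using s1 by (simp add: ready_def)
  have v1: "s1 ''v'' = s ''v''" by (simp add: s1_def)
  have x1: "s1 ''x'' 0 = int (pr k)" "s1 ''f'' 0 = e (Suc k) mod P" "s1 ''i'' 0 = 1 + int k" "s1 ''a'' 0 = cc k div R"
    using s1 by (auto simp: ready_def)
  have fin: "G t' (upd (upd (upd (upd s1 ''z'' 0 (R * (cc k div R))) ''y'' 0 (F k (R * (cc k div R)))) ''s'' 0 base) ''j'' 0 0)"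
    if "t' \<le> t + 300" for t'
    using s1 by (intro assms(4) that) auto
  have ev: "wp M (EV (V ''i'' \<ominus> Lit 1) (Lit R \<otimes> V ''a'')) (wp M
      (''s'' ::= Cell ''v'' (adrE (V ''x'') (Lit 0)) \<oplus> (Lit P \<ominus> V ''f'') \<oplus> V ''y'' ;; ''j'' ::= Lit 0) G) t' s1"
    if "t' \<le> t + 100" for t'
    by (rule wp_EV[OF n1, where z = "R * (cc k div R)"])
      (use c that UU U100 ck in \<open>auto simp: x1 v1 base_def[symmetric] intro!: fin\<close>)
  have e: "s ''e'' (1 + int k) = e (Suc k)" "s ''i'' 0 = 1 + int k" using assms by auto
  show ?thesis
    unfolding t_setup_def
    using b nk nx pk ev by (simp add: e ck s1_def[symmetric] cc_h[symmetric] LL_h[symmetric])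
qed

lemma less_Suc_int: "j < 1 + int q \<longleftrightarrow> j = int q \<or> j < int q"
  by linarith

text \<open>Every stored number belongs to a realisable distribution or arises from one by a
  Lipschitz step, so lowering never goes below \<open>F\<close>. The cubic upper bound keeps the
  cells within \<open>M\<close>.\<close>

definition sound :: "state \<Rightarrow> bool" where
  "sound s \<longleftrightarrow> (\<forall>j. 0 \<le> j \<and> j \<le> LL (Suc k) \<longrightarrow>
     F (Suc k) (cc (Suc k) + j) \<le> tab k s j \<and> tab k s j \<le> 10 * (U * U * U))"

text \<open>The own exponent becomes negative of absolute value \<open>P - e mod P\<close> here, and
  the nonnegative remainder \<open>e mod P\<close> in \<open>C2\<close>. The latter absorbs one unit
  more, so its candidate belongs one index further to the right.\<close>

definition C1 where "C1 m j = F (pr k) (cc (pr k) + j) + (P - e (Suc k) mod P) + F k (R * (cc k div R + m))"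
definition C2 where "C2 m j = F (pr k) (cc (pr k) + j) + e (Suc k) mod P + F k (R * (cc k div R + m))"

definition lowered :: "state \<Rightarrow> int \<Rightarrow> int \<Rightarrow> bool" where
  "lowered s m j \<longleftrightarrow> tab k s (j + m) \<le> C1 m j \<and> tab k s (j + m + 1) \<le> C2 m j"

definition pairs :: "state \<Rightarrow> int \<Rightarrow> bool" where
  "pairs s m \<longleftrightarrow> (\<forall>m' j. 0 \<le> m' \<and> m' < m \<and> 0 \<le> j \<and> j \<le> LL (pr k) \<longrightarrow> lowered s m' j)"

lemma tab_upd [simp]: "0 \<le> a \<Longrightarrow> 0 \<le> j \<Longrightarrow> tab k (upd s ''v'' (adr (1 + int k) a) v) j = (if j = a then v else tab k s j)"
  by (simp add: adr_inj)

lemma sound_upd [simp]: "x \<noteq> ''v'' \<Longrightarrow> sound (upd s x i v) = sound s"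
  and lowered_upd [simp]: "x \<noteq> ''v'' \<Longrightarrow> lowered (upd s x i v) m j = lowered s m j"
  and pairs_upd [simp]: "x \<noteq> ''v'' \<Longrightarrow> pairs (upd s x i v) m = pairs s m"
  by (auto simp: sound_def lowered_def pairs_def)

lemma sound_lower:
  "sound s \<Longrightarrow> 0 \<le> a \<Longrightarrow> F (Suc k) (cc (Suc k) + a) \<le> v
    \<Longrightarrow> sound (upd s ''v'' (adr (1 + int k) a) (min (tab k s a) v))"
  unfolding sound_def by (auto simp: min_def adr_inj)

lemma lowered_lower:
  "lowered s m j \<Longrightarrow> 0 \<le> a \<Longrightarrow> 0 \<le> m \<Longrightarrow> 0 \<le> j
    \<Longrightarrow> lowered (upd s ''v'' (adr (1 + int k) a) (min (tab k s a) v)) m j"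
  unfolding lowered_def by (auto simp: min_def adr_inj)

lemma pairs_lower:
  "pairs s m \<Longrightarrow> 0 \<le> a \<Longrightarrow> pairs (upd s ''v'' (adr (1 + int k) a) (min (tab k s a) v)) m"
  unfolding pairs_def using lowered_lower by blast

lemma C_ge: "F (Suc k) (cc (Suc k) + (j + m)) \<le> C1 m j" "F (Suc k) (cc (Suc k) + (j + m + 1)) \<le> C2 m j"
proof -
  have "F (Suc k) (cc (Suc k) + (j + m)) \<le> F k (R * (cc k div R + m)) + F (pr k) (cc (pr k) + j)
      + \<bar>e (Suc k) + P * (- (e (Suc k) div P) - 1)\<bar>"
    by (rule F_pop_le[OF h]) (simp add: cc_h)
  then show "F (Suc k) (cc (Suc k) + (j + m)) \<le> C1 m j" unfolding abs_leaf C1_def by simp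
  have "F (Suc k) (cc (Suc k) + (j + m + 1)) \<le> F k (R * (cc k div R + m)) + F (pr k) (cc (pr k) + j)
      + \<bar>e (Suc k) + P * (- (e (Suc k) div P))\<bar>"
    by (rule F_pop_le[OF h]) (simp add: cc_h)
  then show "F (Suc k) (cc (Suc k) + (j + m + 1)) \<le> C2 m j" unfolding abs_leaf C2_def by simp
qed

lemma C_le:
  assumes "0 \<le> m" "m \<le> LL k div 2 + 1" "0 \<le> j" "j \<le> LL (pr k)"
  shows "\<bar>C1 m j\<bar> \<le> M" "\<bar>C2 m j\<bar> \<le> M"
  using arg_le(2)[OF assms(1,2)] entry_le[OF assms(3,4)] fP PU UU U100 UM unfolding C1_def C2_def by linarith+

lemma LL_Suc_le: "0 \<le> LL (Suc k)" "LL (Suc k) \<le> U"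
  using LL_nonneg lU[OF kN] by auto

lemma wp_t_init:
  assumes "ready k s0 s" "s ''s'' 0 = base" "s ''j'' 0 = 0"
    "\<And>t' s'. int t' \<le> int t + 100 * (LL (Suc k) + 2) \<Longrightarrow> ready k s0 s' \<Longrightarrow> sound s' \<Longrightarrow> G t' s'"
  shows "wp M t_init G t s"
proof -
  let ?I = "\<lambda>q t' s. ready k s0 s \<and> s ''s'' 0 = base \<and> s ''j'' 0 = int q
    \<and> (\<forall>j. 0 \<le> j \<and> j < int q \<longrightarrow> tab k s j = base + P * j) \<and> t' \<le> t + 100 * q"
  have Pj: "\<bar>P * int q\<bar> \<le> U * U" if "int q \<le> U" for q using mulU[OF _ PU, of "int q" U] that by simp
  show ?thesis
    unfolding t_init_def
  proof (rule wp_for[where I = ?I and N = "nat (LL (Suc k) + 1)"])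
    show "?I 0 t s" using assms by auto
  next
    fix q t' s
    assume q: "q < nat (LL (Suc k) + 1)" and I: "?I q t' s"
    have r: "s ''i'' 0 = 1 + int k" "s ''l'' (1 + int k) = LL (Suc k)" using I by (auto simp: ready_def)
    have "\<bar>base + P * int q\<bar> \<le> M" using Pj[of q] q LL_Suc_le base_le UU UM U100 by linarith
    moreover have "\<bar>int q + 1\<bar> \<le> M" using q LL_Suc_le UU U100 by linarith
    ultimately show "eval_bexp (V ''j'' \<prec> Cell ''l'' (V ''i'') \<oplus> Lit 1) s \<and> wp M
     (Store ''v'' (adrE (V ''i'') (V ''j'')) (V ''s'' \<oplus> Lit P \<otimes> V ''j'') ;; ''j'' ::= V ''j'' \<oplus> Lit 1)
      (?I (Suc q)) (t' + cost_bexp (V ''j'' \<prec> Cell ''l'' (V ''i'') \<oplus> Lit 1)) s"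
      using I q r by (auto simp: less_Suc_int adr_inj)
  next
    fix t' s
    assume I: "?I (nat (LL (Suc k) + 1)) t' s"
    then have r: "s ''i'' 0 = 1 + int k" "s ''l'' (1 + int k) = LL (Suc k)" by (auto simp: ready_def)
    have "sound s"
      unfolding sound_def
    proof (intro allI impI)
      fix j
      assume j: "0 \<le> j \<and> j \<le> LL (Suc k)"
      have "\<bar>P * j\<bar> \<le> U * U" using mulU[OF _ PU, of j U] j LL_Suc_le by simp
      then have "base + P * j \<le> 10 * (U * U * U)" using base_le UU U100 by linarith
      then show "F (Suc k) (cc (Suc k) + j) \<le> tab k s j \<and> tab k s j \<le> 10 * (U * U * U)"
        using I j base_ge[of j] by auto
    qed
    then show "\<not> eval_bexp (V ''j'' \<prec> Cell ''l'' (V ''i'') \<oplus> Lit 1) s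
        \<and> G (t' + cost_bexp (V ''j'' \<prec> Cell ''l'' (V ''i'') \<oplus> Lit 1)) s"
      using I r LL_Suc_le by (auto intro!: assms(4))
  qed
qed

lemma wp_t_inner:
  assumes "ready k s0 s" "s ''j'' 0 = 0" "s ''m'' 0 = m" "s ''y'' 0 = F k (R * (cc k div R + m))"
    "sound s" "pairs s m" "0 \<le> m" "m \<le> LL k div 2 + 1"
    "\<And>t' s'. int t' \<le> int t + 400 * (LL (pr k) + 2) \<Longrightarrow> ready k s0 s' \<Longrightarrow> sound s' \<Longrightarrow> pairs s' (m + 1)
      \<Longrightarrow> s' ''m'' 0 = m \<Longrightarrow> G t' s'"
  shows "wp M t_inner G t s"
proof -
  let ?I = "\<lambda>q t' s. ready k s0 s \<and> s ''j'' 0 = int q \<and> s ''m'' 0 = m \<and> s ''y'' 0 = F k (R * (cc k div R + m))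
    \<and> sound s \<and> pairs s m \<and> (\<forall>j. 0 \<le> j \<and> j < int q \<longrightarrow> lowered s m j) \<and> t' \<le> t + 400 * q"
  let ?b = "V ''j'' \<prec> Cell ''l'' (V ''x'') \<oplus> Lit 1"
  show ?thesis
    unfolding t_inner_def
  proof (rule wp_for[where I = ?I and N = "nat (LL (pr k) + 1)"])
    show "?I 0 t s" using assms by auto
  next
    fix q t' s
    assume q: "q < nat (LL (pr k) + 1)" and I: "?I q t' s"
    have r: "s ''i'' 0 = 1 + int k" "s ''x'' 0 = int (pr k)" "s ''f'' 0 = e (Suc k) mod P" "node s (pr k)"
      using I pr_le[of k] by (auto simp: ready_def)
    then have l: "s ''l'' (int (pr k)) = LL (pr k)" by (simp add: node_def)
    have v: "s ''v'' (adr (int (pr k)) (int q)) = F (pr k) (cc (pr k) + int q)"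
      using r(4) q by (simp add: node_def)
    have pk: "int (pr k) \<noteq> 1 + int k" using pr_le[of k] by simp
    let ?c1 = "C1 m (int q)" and ?c2 = "C2 m (int q)"
    have c: "\<bar>?c1\<bar> \<le> M" "\<bar>?c2\<bar> \<le> M" using C_le[of m "int q"] assms(7,8) q by auto
    have qM: "\<bar>int q + 1\<bar> \<le> M" using q lU[OF pN(1)] LL_nonneg[of "pr k"] UU U100 by linarith
    define s1 where "s1 = upd s ''o'' 0 ?c1"
    define s2 where "s2 = upd s1 ''v'' (adr (1 + int k) (int q + m)) (min (tab k s1 (int q + m)) ?c1)"
    define s3 where "s3 = upd s2 ''o'' 0 ?c2"
    define s4 where "s4 = upd s3 ''v'' (adr (1 + int k) (int q + m + 1)) (min (tab k s3 (int q + m + 1)) ?c2)"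
    define s5 where "s5 = upd s4 ''j'' 0 (int q + 1)"
    have S1: "sound s1" "pairs s1 m" "\<forall>j. 0 \<le> j \<and> j < int q \<longrightarrow> lowered s1 m j" "ready k s0 s1"
      using I by (auto simp: s1_def)
    have S2: "sound s2" "pairs s2 m" "\<forall>j. 0 \<le> j \<and> j < int q \<longrightarrow> lowered s2 m j" "ready k s0 s2"
      unfolding s2_def using S1 assms(7) C_ge(1)[of "int q" m]
      by ((intro sound_lower pairs_lower allI impI lowered_lower)?; simp)+
    have S3: "sound s3" "pairs s3 m" "\<forall>j. 0 \<le> j \<and> j < int q \<longrightarrow> lowered s3 m j" "ready k s0 s3"
      using S2 by (auto simp: s3_def)
    have S4: "sound s4" "pairs s4 m" "\<forall>j. 0 \<le> j \<and> j < int q \<longrightarrow> lowered s4 m j" "ready k s0 s4"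
      unfolding s4_def using S3 assms(7) C_ge(2)[of "int q" m]
      by ((intro sound_lower pairs_lower allI impI lowered_lower)?; simp)+
    have L: "lowered s4 m (int q)"
      using assms(7) by (simp add: lowered_def s4_def s3_def s2_def adr_inj)
    have vals: "s4 ''j'' 0 = int q" "s4 ''m'' 0 = m" "s4 ''y'' 0 = F k (R * (cc k div R + m))"
        "s3 ''i'' 0 = 1 + int k" "s3 ''j'' 0 = int q" "s3 ''m'' 0 = m" "s3 ''o'' 0 = ?c2"
        "s2 ''x'' 0 = int (pr k)" "s2 ''f'' 0 = e (Suc k) mod P" "s2 ''j'' 0 = int q" "s2 ''y'' 0 = F k (R * (cc k div R + m))"
        "s2 ''v'' (adr (int (pr k)) (int q)) = F (pr k) (cc (pr k) + int q)"
        "s1 ''i'' 0 = 1 + int k" "s1 ''j'' 0 = int q" "s1 ''m'' 0 = m" "s1 ''o'' 0 = ?c1"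
      using I r v pk assms(7) by (auto simp: s4_def s3_def s2_def s1_def adr_inj)
    have fin: "?I (Suc q) t'' s5" if "t'' \<le> t' + 400" for t''
    proof -
      have "lowered s5 m j" if "0 \<le> j" "j < int q + 1" for j
      proof -
        have "j = int q \<or> j < int q" using that by linarith
        then show ?thesis using S4(3) L that by (auto simp: s5_def)
      qed
      then show ?thesis using S4 I that vals by (auto simp: s5_def)
    qed
    have w3: "wp M (lower (adrE (V ''i'') (V ''j'' \<oplus> V ''m'' \<oplus> Lit 1)))
        (wp M (''j'' ::= V ''j'' \<oplus> Lit 1) (?I (Suc q))) t'' s3" if "t'' \<le> t' + 200" for t''
    proof (rule wp_lower)
      fix t3
      assume "t3 \<le> t'' + (9 + 2 * cost_exp (adrE (V ''i'') (V ''j'' \<oplus> V ''m'' \<oplus> Lit 1)))"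
      then have "t3 + 6 \<le> t' + 400" using that by simp
      from fin[OF this] show "wp M (''j'' ::= V ''j'' \<oplus> Lit 1) (?I (Suc q)) t3
          (upd s3 ''v'' (eval_exp (adrE (V ''i'') (V ''j'' \<oplus> V ''m'' \<oplus> Lit 1)) s3)
            (min (s3 ''v'' (eval_exp (adrE (V ''i'') (V ''j'' \<oplus> V ''m'' \<oplus> Lit 1)) s3)) (s3 ''o'' 0)))"
        using qM by (simp add: vals s4_def[symmetric] s5_def[symmetric])
    qed (use c vals in simp)
    have w1: "wp M (lower (adrE (V ''i'') (V ''j'' \<oplus> V ''m''))) (wp M
        (''o'' ::= Cell ''v'' (adrE (V ''x'') (V ''j'')) \<oplus> V ''f'' \<oplus> V ''y'' ;;
          lower (adrE (V ''i'') (V ''j'' \<oplus> V ''m'' \<oplus> Lit 1)) ;; ''j'' ::= V ''j'' \<oplus> Lit 1) (?I (Suc q))) t'' s1"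
        if "t'' \<le> t' + 60" for t''
    proof (rule wp_lower)
      fix t3
      assume "t3 \<le> t'' + (9 + 2 * cost_exp (adrE (V ''i'') (V ''j'' \<oplus> V ''m'')))"
      then have t3: "t3 + 25 \<le> t' + 200" using that by simp
      show "wp M (''o'' ::= Cell ''v'' (adrE (V ''x'') (V ''j'')) \<oplus> V ''f'' \<oplus> V ''y'' ;;
          lower (adrE (V ''i'') (V ''j'' \<oplus> V ''m'' \<oplus> Lit 1)) ;; ''j'' ::= V ''j'' \<oplus> Lit 1) (?I (Suc q)) t3
          (upd s1 ''v'' (eval_exp (adrE (V ''i'') (V ''j'' \<oplus> V ''m'')) s1)
            (min (s1 ''v'' (eval_exp (adrE (V ''i'') (V ''j'' \<oplus> V ''m'')) s1)) (s1 ''o'' 0)))"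
        using w3 t3 c by (simp add: vals s2_def[symmetric] C2_def[symmetric] s3_def[symmetric] del: wp_simps add: wp_Seq wp_Store)
    qed (use c vals in simp)
    show "eval_bexp ?b s \<and> wp M
     (''o'' ::= Cell ''v'' (adrE (V ''x'') (V ''j'')) \<oplus> (Lit P \<ominus> V ''f'') \<oplus> V ''y'' ;;
      lower (adrE (V ''i'') (V ''j'' \<oplus> V ''m'')) ;;
      ''o'' ::= Cell ''v'' (adrE (V ''x'') (V ''j'')) \<oplus> V ''f'' \<oplus> V ''y'' ;;
      lower (adrE (V ''i'') (V ''j'' \<oplus> V ''m'' \<oplus> Lit 1)) ;;
      ''j'' ::= V ''j'' \<oplus> Lit 1) (?I (Suc q)) (t' + cost_bexp ?b) s"
      using w1 c q I by (simp add: r l v C1_def[symmetric] s1_def[symmetric])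
  next
    fix t' s
    assume I: "?I (nat (LL (pr k) + 1)) t' s"
    then have r: "s ''x'' 0 = int (pr k)" "node s (pr k)" using pr_le[of k] by (auto simp: ready_def)
    then have l: "s ''l'' (int (pr k)) = LL (pr k)" by (simp add: node_def)
    have "pairs s (m + 1)"
      unfolding pairs_def
    proof (intro allI impI)
      fix m' j
      assume a: "0 \<le> m' \<and> m' < m + 1 \<and> 0 \<le> j \<and> j \<le> LL (pr k)"
      then have "m' = m \<or> m' < m" by linarith
      then show "lowered s m' j" using I a by (auto simp: pairs_def)
    qed
    then show "\<not> eval_bexp ?b s \<and> G (t' + cost_bexp ?b) s"
      using I r l LL_nonneg[of "pr k"] by (auto intro!: assms(9))
  qed
qed

lemma wp_t_pairs:
  assumes "ready k s0 s" "s ''m'' 0 = 0" "sound s"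
    "\<And>t' s'. int t' \<le> int t + (LL k div 2 + 3) * (400 * (LL (pr k) + 3)) \<Longrightarrow> ready k s0 s' \<Longrightarrow> sound s'
      \<Longrightarrow> pairs s' (LL k div 2 + 2) \<Longrightarrow> G t' s'"
  shows "wp M t_pairs G t s"
proof -
  let ?I = "\<lambda>q t' s. ready k s0 s \<and> s ''m'' 0 = int q \<and> sound s \<and> pairs s (int q)
    \<and> int t' \<le> int t + int q * (400 * (LL (pr k) + 3))"
  let ?b = "V ''m'' \<prec> V ''w'' \<oplus> Lit 1"
  have l0: "0 \<le> LL k div 2" "LL k div 2 \<le> U" using LL_nonneg[of k] lU[OF pN(2)] by linarith+
  show ?thesis
    unfolding t_pairs_def
  proof (rule wp_for[where I = ?I and N = "nat (LL k div 2 + 2)"])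
    show "?I 0 t s" using assms by (auto simp: pairs_def)
  next
    fix q t' s
    assume q: "q < nat (LL k div 2 + 2)" and I: "?I q t' s"
    let ?z = "R * (cc k div R + int q)"
    have r: "s ''i'' 0 = 1 + int k" "s ''w'' 0 = LL k div 2 + 1" "s ''a'' 0 = cc k div R" "node s k"
      using I by (auto simp: ready_def)
    have q': "0 \<le> int q" "int q \<le> LL k div 2 + 1" using q by auto
    have z: "\<bar>?z\<bar> \<le> M" "\<bar>F k ?z\<bar> \<le> M" using arg_le[OF q'] UU UM U100 by linarith+
    have qM: "\<bar>int q + 1\<bar> \<le> M" using q' l0 UU U100 by linarith
    let ?s2 = "upd (upd (upd s ''z'' 0 ?z) ''y'' 0 (F k ?z)) ''j'' 0 0"
    define Z where "Z = ?I (Suc q)"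
    have inner: "wp M t_inner (wp M (''m'' ::= V ''m'' \<oplus> Lit 1) Z) t'' ?s2"
      if "t'' \<le> t' + 200" for t''
    proof (rule wp_t_inner[of s0 _ "int q"])
      fix t3 s'
      assume "int t3 \<le> int t'' + 400 * (LL (pr k) + 2)" "ready k s0 s'" "sound s'" "pairs s' (int q + 1)" "s' ''m'' 0 = int q"
      then show "wp M (''m'' ::= V ''m'' \<oplus> Lit 1) Z t3 s'"
        using qM that I by (simp add: Z_def add.commute algebra_simps)
    qed (use I q' in auto)
    have "wp M (EV (V ''i'' \<ominus> Lit 1) (Lit R \<otimes> (V ''a'' \<oplus> V ''m''))) (wp M
        (''j'' ::= Lit 0 ;; t_inner ;; ''m'' ::= V ''m'' \<oplus> Lit 1) Z) (t' + cost_bexp ?b) s"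
      by (rule wp_EV[OF r(4), where z = ?z])
        (use I r z UU U100 in \<open>auto intro!: inner\<close>)
    then show "eval_bexp ?b s \<and> wp M
      (EV (V ''i'' \<ominus> Lit 1) (Lit R \<otimes> (V ''a'' \<oplus> V ''m'')) ;; ''j'' ::= Lit 0 ;; t_inner ;; ''m'' ::= V ''m'' \<oplus> Lit 1)
      (?I (Suc q)) (t' + cost_bexp ?b) s"
      using I r q' unfolding Z_def by simp
  next
    fix t' s
    assume I: "?I (nat (LL k div 2 + 2)) t' s"
    then have r: "s ''w'' 0 = LL k div 2 + 1" by (auto simp: ready_def)
    have "int (t' + cost_bexp ?b) \<le> int t + (LL k div 2 + 3) * (400 * (LL (pr k) + 3))"
      using I l0 LL_nonneg[of "pr k"] by (simp add: algebra_simps)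
    then show "\<not> eval_bexp ?b s \<and> G (t' + cost_bexp ?b) s"
      using I r l0 by (auto intro!: assms(4))
  qed
qed

definition up_ok :: "state \<Rightarrow> int \<Rightarrow> bool" where
  "up_ok s m \<longleftrightarrow> (\<forall>j. 0 \<le> j \<and> j < m \<longrightarrow> tab k s (j + 1) \<le> tab k s j + P)"

definition down_ok :: "state \<Rightarrow> int \<Rightarrow> bool" where
  "down_ok s m \<longleftrightarrow> (\<forall>j. m \<le> j \<and> j < LL (Suc k) \<longrightarrow> tab k s j \<le> tab k s (j + 1) + P)"

lemma ok_upd [simp]: "x \<noteq> ''v'' \<Longrightarrow> up_ok (upd s x i v) m = up_ok s m"
  "x \<noteq> ''v'' \<Longrightarrow> down_ok (upd s x i v) m = down_ok s m"
  by (auto simp: up_ok_def down_ok_def)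

lemma sound_lower_step:
  assumes "sound s" "0 \<le> a" "a \<le> LL (Suc k)" "0 \<le> a'" "\<bar>a' - a\<bar> \<le> 1"
  shows "sound (upd s ''v'' (adr (1 + int k) a') (min (tab k s a') (tab k s a + P)))"
    "\<bar>tab k s a + P\<bar> \<le> M"
proof -
  have F: "F (Suc k) (cc (Suc k) + a) \<le> tab k s a" "tab k s a \<le> 10 * (U * U * U)"
    using assms unfolding sound_def by auto
  have "P * \<bar>a' - a\<bar> \<le> P * 1" using assms by (intro mult_left_mono) auto
  then have "F (Suc k) (cc (Suc k) + a') \<le> tab k s a + P"
    using F F_le_shift[of "Suc k" "cc (Suc k) + a'" "cc (Suc k) + a"] by simp
  then show "sound (upd s ''v'' (adr (1 + int k) a') (min (tab k s a') (tab k s a + P)))"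
    using assms by (intro sound_lower)
  show "\<bar>tab k s a + P\<bar> \<le> M" using F F_nonneg[of "Suc k" "cc (Suc k) + a"] PU UU UM U100 Ppos by linarith
qed

lemma wp_t_up:
  assumes "ready k s0 s" "s ''j'' 0 = 0" "sound s" "pairs s m"
    "\<And>t' s'. int t' \<le> int t + 200 * (LL (Suc k) + 1) \<Longrightarrow> ready k s0 s' \<Longrightarrow> sound s'
      \<Longrightarrow> pairs s' m \<Longrightarrow> up_ok s' (LL (Suc k)) \<Longrightarrow> s' ''j'' 0 = LL (Suc k) \<Longrightarrow> G t' s'"
  shows "wp M t_up G t s"
proof -
  let ?I = "\<lambda>q t' s. ready k s0 s \<and> s ''j'' 0 = int q \<and> sound s \<and> pairs s m \<and> up_ok s (int q) \<and> t' \<le> t + 200 * q"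
  let ?b = "V ''j'' \<prec> Cell ''l'' (V ''i'')"
  show ?thesis
    unfolding t_up_def
  proof (rule wp_for[where I = ?I and N = "nat (LL (Suc k))"])
    show "?I 0 t s" using assms by (auto simp: up_ok_def)
  next
    fix q t' s
    assume q: "q < nat (LL (Suc k))" and I: "?I q t' s"
    have r: "s ''i'' 0 = 1 + int k" "s ''l'' (1 + int k) = LL (Suc k)" using I by (auto simp: ready_def)
    let ?o = "tab k s (int q) + P"
    have qq: "0 \<le> int q" "int q \<le> LL (Suc k)" "0 \<le> int q + 1" "\<bar>int q + 1 - int q\<bar> \<le> 1" using q by auto
    define s1 where "s1 = upd s ''o'' 0 ?o"
    have s1: "s1 ''v'' = s ''v''" "sound s1" by (auto simp: s1_def I)
    define s2 where "s2 = upd s1 ''v'' (adr (1 + int k) (int q + 1)) (min (tab k s1 (int q + 1)) ?o)"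
    have S: "sound s2" "\<bar>?o\<bar> \<le> M" using sound_lower_step[OF s1(2) qq] unfolding s2_def s1(1) by auto
    have qM: "\<bar>int q + 1\<bar> \<le> M" using q LL_Suc_le UU U100 by linarith
    have p: "pairs s2 m" unfolding s2_def using I by (intro pairs_lower) (auto simp: s1_def)
    have u: "up_ok s2 (int q + 1)"
      unfolding up_ok_def
    proof (intro allI impI)
      fix j
      assume j: "0 \<le> j \<and> j < int q + 1"
      have "tab k s (j + 1) \<le> tab k s j + P" if "j < int q" using I j that by (auto simp: up_ok_def)
      moreover have "j < int q \<or> j = int q" using j by linarith
      ultimately show "tab k s2 (j + 1) \<le> tab k s2 j + P"
        using j Ppos by (auto simp: s2_def s1_def adr_inj)
    qed
    have vals: "s2 ''j'' 0 = int q" "ready k s0 s2" "s1 ''i'' 0 = 1 + int k" "s1 ''j'' 0 = int q" "s1 ''o'' 0 = ?o"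
      using I r by (auto simp: s2_def s1_def)
    have fin: "?I (Suc q) t'' (upd s2 ''j'' 0 (int q + 1))" if "t'' \<le> t' + 200" for t''
      using S p u I that vals by (auto simp: add.commute)
    have low: "wp M (lower (adrE (V ''i'') (V ''j'' \<oplus> Lit 1))) (wp M (''j'' ::= V ''j'' \<oplus> Lit 1) (?I (Suc q))) t'' s1"
      if "t'' \<le> t' + 60" for t''
    proof (rule wp_lower)
      fix t3
      assume "t3 \<le> t'' + (9 + 2 * cost_exp (adrE (V ''i'') (V ''j'' \<oplus> Lit 1)))"
      then have "t3 + 6 \<le> t' + 200" using that by simp
      from fin[OF this] show "wp M (''j'' ::= V ''j'' \<oplus> Lit 1) (?I (Suc q)) t3
          (upd s1 ''v'' (eval_exp (adrE (V ''i'') (V ''j'' \<oplus> Lit 1)) s1)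
            (min (s1 ''v'' (eval_exp (adrE (V ''i'') (V ''j'' \<oplus> Lit 1)) s1)) (s1 ''o'' 0)))"
        using qM by (simp add: vals s2_def[symmetric])
    qed (use S vals in simp)
    show "eval_bexp ?b s \<and> wp M
      (''o'' ::= Cell ''v'' (adrE (V ''i'') (V ''j'')) \<oplus> Lit P ;;
      lower (adrE (V ''i'') (V ''j'' \<oplus> Lit 1)) ;;
      ''j'' ::= V ''j'' \<oplus> Lit 1) (?I (Suc q)) (t' + cost_bexp ?b) s"
      using low q I S by (simp add: r s1_def[symmetric])
  next
    fix t' s
    assume I: "?I (nat (LL (Suc k))) t' s"
    then have r: "s ''i'' 0 = 1 + int k" "s ''l'' (1 + int k) = LL (Suc k)" by (auto simp: ready_def)
    then show "\<not> eval_bexp ?b s \<and> G (t' + cost_bexp ?b) s"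
      using I LL_Suc_le by (auto intro!: assms(5))
  qed
qed

text \<open>The second sweep must preserve what the first achieved. Entry \<open>a - 1\<close> is
  lowered no further than entry \<open>a\<close> plus \<open>P\<close>, so the step from
  \<open>a - 1\<close> up to \<open>a\<close> stays within bounds, and the step into
  \<open>a - 1\<close> from the left only becomes smaller.\<close>

lemma wp_t_down:
  assumes "ready k s0 s" "s ''j'' 0 = LL (Suc k)" "sound s" "pairs s m" "up_ok s (LL (Suc k))"
    "\<And>t' s'. int t' \<le> int t + 200 * (LL (Suc k) + 1) \<Longrightarrow> ready k s0 s' \<Longrightarrow> sound s'
      \<Longrightarrow> pairs s' m \<Longrightarrow> up_ok s' (LL (Suc k)) \<Longrightarrow> down_ok s' 0 \<Longrightarrow> G t' s'"
  shows "wp M t_down G t s"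
proof -
  let ?n = "LL (Suc k)"
  let ?I = "\<lambda>q t' s. ready k s0 s \<and> s ''j'' 0 = ?n - int q \<and> sound s \<and> pairs s m \<and> up_ok s ?n
     \<and> down_ok s (?n - int q) \<and> t' \<le> t + 200 * q"
  let ?b = "Lit 0 \<prec> V ''j''"
  show ?thesis
    unfolding t_down_def
  proof (rule wp_for[where I = ?I and N = "nat ?n"])
    show "?I 0 t s" using assms by (auto simp: down_ok_def)
  next
    fix q t' s
    assume q: "q < nat ?n" and I: "?I q t' s"
    have r: "s ''i'' 0 = 1 + int k" using I by (auto simp: ready_def)
    define a where "a = ?n - int q"
    have a: "0 < a" "a \<le> ?n" using q by (auto simp: a_def)
    let ?o = "tab k s a + P"
    have qq: "0 \<le> a" "a \<le> ?n" "0 \<le> a - 1" "\<bar>a - 1 - a\<bar> \<le> 1" using a by auto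
    define s1 where "s1 = upd (upd s ''o'' 0 ?o) ''j'' 0 (a - 1)"
    have s1: "s1 ''v'' = s ''v''" "sound s1" by (auto simp: s1_def I)
    define s2 where "s2 = upd s1 ''v'' (adr (1 + int k) (a - 1)) (min (tab k s1 (a - 1)) ?o)"
    have S: "sound s2" "\<bar>?o\<bar> \<le> M" using sound_lower_step[OF s1(2) qq] unfolding s2_def s1(1) by auto
    have aM: "\<bar>a - 1\<bar> \<le> M" using a LL_Suc_le UU U100 by linarith
    have p: "pairs s2 m" unfolding s2_def using I qq by (intro pairs_lower) (auto simp: s1_def)
    have t2: "tab k s2 j = (if j = a - 1 then min (tab k s (a - 1)) ?o else tab k s j)" if "0 \<le> j" for j
      using that qq by (simp add: s2_def s1_def adr_inj)
    have up: "tab k s (j + 1) \<le> tab k s j + P" if "0 \<le> j" "j < ?n" for j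
      using I that by (auto simp: up_ok_def)
    have u: "up_ok s2 ?n"
      unfolding up_ok_def
    proof (intro allI impI)
      fix j
      assume j: "0 \<le> j \<and> j < ?n"
      have "tab k s2 i \<le> tab k s i" if "0 \<le> i" for i using t2[OF that] by (cases "i = a - 1") simp_all
      then have A: "tab k s2 (j + 1) \<le> tab k s (j + 1)" using j by simp
      show "tab k s2 (j + 1) \<le> tab k s2 j + P"
      proof (cases "j = a - 1")
        case True
        then have "tab k s2 (j + 1) = tab k s a" "j + 1 = a" using t2[of "j + 1"] j by simp_all
        then show ?thesis using t2[of j] j up[of j] True Ppos by (simp add: min_def)
      next
        case False
        then show ?thesis using t2[of j] j up[of j] A by simp
      qed
    qed
    have d: "down_ok s2 (a - 1)"
      unfolding down_ok_def
    proof (intro allI impI)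
      fix j
      assume j: "a - 1 \<le> j \<and> j < ?n"
      have "tab k s j \<le> tab k s (j + 1) + P" if "a \<le> j" using I j that by (auto simp: down_ok_def a_def)
      moreover have "a \<le> j \<or> j = a - 1" using j by linarith
      ultimately show "tab k s2 j \<le> tab k s2 (j + 1) + P"
        using j qq by (auto simp: t2)
    qed
    have vals: "s2 ''j'' 0 = a - 1" "ready k s0 s2" "s1 ''i'' 0 = 1 + int k" "s1 ''j'' 0 = a - 1" "s1 ''o'' 0 = ?o"
      using I r qq by (auto simp: s2_def s1_def)
    define Z where "Z = ?I (Suc q)"
    have fin: "Z t'' s2" if "t'' \<le> t' + 200" for t''
      using S p u d I that vals by (auto simp: Z_def a_def algebra_simps)
    have low: "wp M (lower (adrE (V ''i'') (V ''j''))) Z t'' s1" if "t'' \<le> t' + 100" for t''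
    proof (rule wp_lower)
      fix t3
      assume "t3 \<le> t'' + (9 + 2 * cost_exp (adrE (V ''i'') (V ''j'')))"
      then have "t3 \<le> t' + 200" using that by simp
      from fin[OF this] show "Z t3
          (upd s1 ''v'' (eval_exp (adrE (V ''i'') (V ''j'')) s1)
            (min (s1 ''v'' (eval_exp (adrE (V ''i'') (V ''j'')) s1)) (s1 ''o'' 0)))"
        by (simp only: vals s2_def[symmetric] eval_exp.simps adrE_simps)
    qed (use S vals in simp)
    have ja: "s ''j'' 0 = a" using I by (simp add: a_def)
    show "eval_bexp ?b s \<and> wp M
      (''o'' ::= Cell ''v'' (adrE (V ''i'') (V ''j'')) \<oplus> Lit P ;;
      ''j'' ::= V ''j'' \<ominus> Lit 1 ;;
      lower (adrE (V ''i'') (V ''j''))) (?I (Suc q)) (t' + cost_bexp ?b) s"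
      unfolding Z_def[symmetric]
      using low S aM a by (simp add: r ja s1_def[symmetric])
  next
    fix t' s
    assume I: "?I (nat ?n) t' s"
    then show "\<not> eval_bexp ?b s \<and> G (t' + cost_bexp ?b) s"
      using LL_Suc_le by (auto intro!: assms(6))
  qed
qed

lemma ready_built:
  assumes "ready k s0 s" "sound s" "pairs s (LL k div 2 + 2)" "up_ok s (LL (Suc k))" "down_ok s 0"
  shows "built (Suc k) s"
proof -
  have "tab k s j = F (Suc k) (cc (Suc k) + j)" if "0 \<le> j" "j \<le> LL (Suc k)" for j
  proof (rule table_exact[OF h _ _ _ that])
    show "F (Suc k) (cc (Suc k) + j) \<le> tab k s j" if "0 \<le> j" "j \<le> LL (Suc k)" for j
      using assms(2) that by (simp add: sound_def)
    show "tab k s (j + 1) \<le> tab k s j + P \<and> tab k s j \<le> tab k s (j + 1) + P" if "0 \<le> j" "j < LL (Suc k)" for j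
      using assms(4,5) that by (simp add: up_ok_def down_ok_def)
    show "tab k s (j + m) \<le> F (pr k) (cc (pr k) + j) + (P - e (Suc k) mod P) + F k (R * (cc k div R + m)) \<and>
      tab k s (j + m + 1) \<le> F (pr k) (cc (pr k) + j) + e (Suc k) mod P + F k (R * (cc k div R + m))"
      if "0 \<le> m" "m \<le> LL k div 2 + 1" "0 \<le> j" "j \<le> LL (pr k)" for m j
      using assms(3) that by (simp add: pairs_def lowered_def C1_def C2_def)
  qed
  then have "node s (Suc k)" using assms(1) by (simp add: node_def ready_def)
  then show ?thesis using assms(1) unfolding built_def ready_def by (metis le_SucE)
qed

lemma wp_tstep:
  assumes "built k s" "s ''i'' 0 = int (Suc k)" "s ''e'' (int (Suc k)) = e (Suc k)"
    "\<And>t' s'. int t' \<le> int t + 2000 * work (Suc k) \<Longrightarrow> agree TS s s' \<Longrightarrow> built (Suc k) s' \<Longrightarrow> G t' s'"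
  shows "wp M tstep G t s"
proof -
  let ?x = "LL (pr k)" and ?y = "LL k"
  have xy: "0 \<le> ?x" "0 \<le> ?y" using LL_nonneg by auto
  \<comment> \<open>Both factors of the product are at least 3, so the product also pays for the
    passes that are linear in the new window, whose length is about the sum of the factors.\<close>
  have time: "300 + 100 * (LL (Suc k) + 2) + 10 + (?y div 2 + 3) * (400 * (?x + 3)) + 10
     + 200 * (LL (Suc k) + 1) + 200 * (LL (Suc k) + 1) \<le> 2000 * work (Suc k)"
  proof -
    define Z W :: int where "Z = (?y div 2 + 3) * (400 * (?x + 3))" and "W = (?y + 3) * (?x + 3)"
    have "Z \<le> (?y + 3) * (400 * (?x + 3))"
      unfolding Z_def using xy by (intro mult_right_mono) auto
    then have "Z \<le> 400 * W" by (simp add: W_def algebra_simps)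
    moreover have "3 * (LL (Suc k) + 2) \<le> 2 * W" and "9 \<le> W"
    proof -
      have x: "3 * (?x + 3) \<le> W" unfolding W_def using xy by (intro mult_right_mono) auto
      have y: "(?y + 3) * 3 \<le> W" unfolding W_def using xy by (intro mult_left_mono) auto
      have l: "LL (Suc k) + 2 \<le> (?x + 3) + (?y + 3)" unfolding LL_h using xy by linarith
      have "9 \<le> 3 * (?x + 3)" using xy(1) by simp
      also note x
      finally show "9 \<le> W" .
      show "3 * (LL (Suc k) + 2) \<le> 2 * W" using x y l by simp
    qed
    moreover have "work (Suc k) = W" using h by (simp add: work_def W_def)
    ultimately have "300 + 100 * (LL (Suc k) + 2) + 10 + Z + 10 + 200 * (LL (Suc k) + 1) + 200 * (LL (Suc k) + 1)
        \<le> 2000 * work (Suc k)" by simp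
    then show ?thesis unfolding Z_def .
  qed
  show ?thesis
    unfolding tstep_def
  proof (simp only: wp_Seq_fun, rule wp_t_setup[OF assms(1-3)])
    fix t1 s1
    assume 1: "t1 \<le> t + 300" "ready k s s1" "s1 ''s'' 0 = base" "s1 ''j'' 0 = 0"
    show "wp M t_init (wp M (''m'' ::= Lit 0) (wp M t_pairs (wp M (''j'' ::= Lit 0) (wp M t_up (wp M t_down G))))) t1 s1"
    proof (rule wp_t_init[OF 1(2-4)])
      fix t2 s2
      assume 2: "int t2 \<le> int t1 + 100 * (LL (Suc k) + 2)" "ready k s s2" "sound s2"
      have "wp M t_pairs (wp M (''j'' ::= Lit 0) (wp M t_up (wp M t_down G))) (t2 + 3) (upd s2 ''m'' 0 0)"
      proof (rule wp_t_pairs[of s])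
        fix t3 s3
        assume 3: "int t3 \<le> int (t2 + 3) + (LL k div 2 + 3) * (400 * (LL (pr k) + 3))" "ready k s s3" "sound s3"
          "pairs s3 (LL k div 2 + 2)"
        have "wp M t_up (wp M t_down G) (t3 + 3) (upd s3 ''j'' 0 0)"
        proof (rule wp_t_up[of s _ "LL k div 2 + 2"])
          fix t4 s4
          assume 4: "int t4 \<le> int (t3 + 3) + 200 * (LL (Suc k) + 1)" "ready k s s4" "sound s4"
            "pairs s4 (LL k div 2 + 2)" "up_ok s4 (LL (Suc k))" "s4 ''j'' 0 = LL (Suc k)"
          show "wp M t_down G t4 s4"
          proof (rule wp_t_down[OF 4(2,6,3,4,5)])
            fix t5 s5
            assume 5: "int t5 \<le> int t4 + 200 * (LL (Suc k) + 1)" "ready k s s5" "sound s5"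
              "pairs s5 (LL k div 2 + 2)" "up_ok s5 (LL (Suc k))" "down_ok s5 0"
            show "G t5 s5"
            proof (rule assms(4))
              show "int t5 \<le> int t + 2000 * work (Suc k)"
                using 1(1) 2(1) 3(1) 4(1) 5(1) time by linarith
              show "agree TS s s5" using 5(2) by (simp add: ready_def)
              show "built (Suc k) s5" using ready_built 5 by blast
            qed
          qed
        qed (use 3 in auto)
        then show "wp M (''j'' ::= Lit 0) (wp M t_up (wp M t_down G)) t3 s3"
          using UU U100 by (simp add: numeral_3_eq_3)
      qed (use 2 in auto)
      then show "wp M (''m'' ::= Lit 0) (wp M t_pairs (wp M (''j'' ::= Lit 0) (wp M t_up (wp M t_down G)))) t2 s2"
        using UU U100 by (simp add: numeral_3_eq_3)
    qed
  qed
qed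

end

end

section \<open>Backtracking\<close>

context tree
begin

text \<open>The intervals between \<open>pr j\<close> and \<open>j\<close> form a laminar family, as
  brackets do. In the backward pass this protects demand cells from being overwritten.\<close>

lemma pr_nested: "i \<le> j \<Longrightarrow> pr j < i \<Longrightarrow> pr j \<le> pr i"
proof (induction j rule: less_induct)
  case (less j)
  show ?case
  proof (cases "i = j")
    case False
    then obtain k where k: "j = Suc k" "i \<le> k" using less.prems by (cases j) auto
    then have H: "H j" using less.prems by (auto split: if_splits)
    then have p: "pr j = pr (pr k)" using k by simp
    show ?thesis
    proof (cases "pr k < i")
      case True
      then have "pr k \<le> pr i" using less.IH[of k] k by simp
      then show ?thesis using p pr_le[of "pr k"] by simp
    next
      case F: False
      then show ?thesis using less.IH[of "pr k"] p less.prems k pr_le[of k] by simp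
    qed
  qed simp
qed

end

context prog
begin

section \<open>Recovering an optimal distribution from the root downwards\<close>

text \<open>No choices were recorded while the tables were built. An optimal pair is found again by
  trying every m of the range with both values for the own exponent, which is linear in the window
  of the middle child because the demand is already fixed.\<close>

definition b_search :: com where
  "b_search = While (V ''m'' \<prec> V ''w'' \<oplus> Lit 1)
     (EV (V ''i'' \<ominus> Lit 1) (Lit R \<otimes> (V ''a'' \<oplus> V ''m'')) ;;
      ''t'' ::= V ''y'' ;;
      EV (V ''x'') (V ''Z'' \<ominus> V ''a'' \<ominus> V ''m'' \<oplus> V ''b'' \<oplus> Lit 1) ;;
      ''o'' ::= V ''t'' \<oplus> V ''y'' \<oplus> (Lit P \<ominus> V ''f'') ;;
      Cond (V ''s'' \<prec> V ''o'') Skip (''q'' ::= V ''a'' \<oplus> V ''m'' ;; ''r'' ::= Lit 0 \<ominus> V ''b'' \<ominus> Lit 1) ;;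
      EV (V ''x'') (V ''Z'' \<ominus> V ''a'' \<ominus> V ''m'' \<oplus> V ''b'') ;;
      ''o'' ::= V ''t'' \<oplus> V ''y'' \<oplus> V ''f'' ;;
      Cond (V ''s'' \<prec> V ''o'') Skip (''q'' ::= V ''a'' \<oplus> V ''m'' ;; ''r'' ::= Lit 0 \<ominus> V ''b'') ;;
      ''m'' ::= V ''m'' \<oplus> Lit 1)"

definition b_setup :: com where
  "b_setup =
     (''x'' ::= Cell ''u'' (V ''i'' \<ominus> Lit 1) ;;
      ''b'' ::= Cell ''e'' (V ''i'') \<oslash> Lit P ;;
      ''f'' ::= Cell ''e'' (V ''i'') \<odot> Lit P ;;
      ''a'' ::= Cell ''c'' (V ''i'' \<ominus> Lit 1) \<oslash> Lit R ;;
      ''w'' ::= Cell ''l'' (V ''i'' \<ominus> Lit 1) \<oslash> Lit 2 \<oplus> Lit 1 ;;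
      ''Z'' ::= Cell ''d'' (V ''i'') ;;
      ''m'' ::= Lit 0 ;;
      EV (V ''i'') (V ''Z'') ;;
      ''s'' ::= V ''y'')"

text \<open>Without a left child the own exponent keeps the units meant for node 0, which by the
  triangle inequality is no dearer. At a padding position with a left child the own exponent is set
  to 0 and the left child takes its share: no letters can be placed there, since the virtual
  \<open>t\<close> up to the root do not occur in the word.\<close>

definition b_assign :: com where
  "b_assign =
     (''o'' ::= V ''Z'' \<ominus> V ''q'' ;;
      Store ''d'' (V ''i'' \<ominus> Lit 1) (Lit R \<otimes> V ''q'') ;;
      Cond (V ''x'' \<prec> Lit 1)
        (Store ''g'' (V ''i'') (Cell ''e'' (V ''i'') \<oplus> Lit P \<otimes> V ''o''))
        (Cond (V ''n'' \<prec> V ''i'')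
          (Store ''d'' (V ''x'') (V ''o'') ;;
           Store ''g'' (V ''i'') (Lit 0))
          (Store ''d'' (V ''x'') (V ''o'' \<ominus> V ''r'') ;;
           Store ''g'' (V ''i'') (Cell ''e'' (V ''i'') \<oplus> Lit P \<otimes> V ''r''))))"

definition bstep :: com where
  "bstep = Cond (Cell ''h'' (V ''i'') \<prec> Lit 0)
     (Store ''g'' (V ''i'') (Cell ''e'' (V ''i'') \<oplus> Lit P \<otimes> Cell ''d'' (V ''i'')))
     (b_setup ;; b_search ;; b_assign)"

definition backtrack :: com where
  "backtrack = (''i'' ::= V ''J'' ;; While (Lit 0 \<prec> V ''i'') (bstep ;; ''i'' ::= V ''i'' \<ominus> Lit 1))"

definition BS :: "string set" where
  "BS = {''x'', ''b'', ''f'', ''a'', ''w'', ''y'', ''z'', ''o'', ''m'', ''s'', ''q'', ''r'', ''t'', ''Z'', ''d'', ''g''}"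

context
  fixes k :: nat
  assumes h: "H (Suc k)" and kN: "Suc k \<le> N"
begin

definition cand :: "int \<Rightarrow> int \<Rightarrow> int \<Rightarrow> int" where
  "cand z m x = F k (R * m) + F (pr k) (z - m - x) + \<bar>e (Suc k) + P * x\<bar>"

definition good :: "int \<Rightarrow> int \<Rightarrow> int \<Rightarrow> bool" where
  "good z m x \<longleftrightarrow> cc k div R \<le> m \<and> m \<le> cc k div R + (LL k div 2 + 1) \<and> cand z m x \<le> F (Suc k) z
     \<and> (x = - (e (Suc k) div P) - 1 \<or> x = - (e (Suc k) div P))"

lemma good_exists: "\<exists>m x. good z m x"
proof -
  obtain m where m: "cc k div R \<le> m" "m \<le> cc k div R + LL k div 2 + 1"
      "F (Suc k) z = F k (R * m) + lconv (F (pr k)) (e (Suc k)) (z - m)"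
    using conv_attained[OF LL_nonneg, of "cc k" k "lconv (F (pr k)) (e (Suc k))" "F k" z] h
    by (auto simp: F.simps)
  obtain x where "lconv (F (pr k)) (e (Suc k)) (z - m) = F (pr k) (z - m - x) + \<bar>e (Suc k) + P * x\<bar>"
      "x = - (e (Suc k) div P) - 1 \<or> x = - (e (Suc k) div P)"
    by (rule lconv_cases)
  then show ?thesis using m by (intro exI[of _ m] exI[of _ x]) (auto simp: good_def cand_def)
qed

lemma good_le:
  assumes "good z m x"
  shows "\<bar>m\<bar> \<le> 3 * U" "\<bar>x\<bar> \<le> U + 1" "\<bar>R * m\<bar> \<le> 3 * (U * U)"
proof -
  have "\<bar>cc k div R\<bar> \<le> U" using abs_div_le[of "cc k" R] cU[of k] kN by linarith
  moreover have "LL k div 2 + 1 \<le> U + 1" using lU[of k] kN LL_nonneg[of k] by linarith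
  ultimately show "\<bar>m\<bar> \<le> 3 * U" using assms U100 unfolding good_def by linarith
  show "\<bar>R * m\<bar> \<le> 3 * (U * U)"
    using mulU[OF _ RU \<open>\<bar>m\<bar> \<le> 3 * U\<close>] by simp
  have "\<bar>e (Suc k) div P\<bar> \<le> U" using abs_div_le[of "e (Suc k)" P] eU[OF kN] by linarith
  then show "\<bar>x\<bar> \<le> U + 1" using assms unfolding good_def by linarith
qed

lemma wp_b_search:
  fixes z :: int
  assumes s0: "s0 ''i'' 0 = 1 + int k" "s0 ''x'' 0 = int (pr k)" "s0 ''b'' 0 = e (Suc k) div P"
      "s0 ''f'' 0 = e (Suc k) mod P" "s0 ''a'' 0 = cc k div R" "s0 ''w'' 0 = LL k div 2 + 1" "s0 ''Z'' 0 = z"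
      "s0 ''s'' 0 = F (Suc k) z" "s0 ''m'' 0 = 0" "node s0 k" "node s0 (pr k)"
    and z: "\<bar>z\<bar> \<le> 9 * (U * U)"
    and post: "\<And>t' s'. int t' \<le> int t + 1000 * (LL k + 3) \<Longrightarrow> agree {''q'', ''r'', ''m'', ''o'', ''t'', ''z'', ''y''} s0 s'
      \<Longrightarrow> good z (s' ''q'' 0) (s' ''r'' 0) \<Longrightarrow> G t' s'"
  shows "wp M b_search G t s0"
proof -
  let ?b = "V ''m'' \<prec> V ''w'' \<oplus> Lit 1"
  let ?a = "cc k div R" and ?l = "LL k div 2 + 1" and ?e = "e (Suc k) div P"
  define A where "A = {''q'', ''r'', ''m'', ''o'', ''t'', ''z'', ''y'' :: string}"
  \<comment> \<open>If one of the m tried so far admits an optimum, the stored pair is optimal. The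
    conditional form holds trivially at the start and becomes unconditional after the whole range by
    \<open>good_exists\<close>.\<close>
  define found where "found = (\<lambda>q (s :: state). (\<exists>m x. good z m x \<and> m < ?a + int q) \<longrightarrow> good z (s ''q'' 0) (s ''r'' 0))"
  let ?I = "\<lambda>q t' s. agree A s0 s \<and> s ''m'' 0 = int q \<and> found q s \<and> t' \<le> t + 1000 * q"
  have l0: "0 \<le> ?l" "?l \<le> U + 1" using LL_nonneg[of k] lU[of k] kN by linarith+
  have f: "0 \<le> e (Suc k) mod P" "e (Suc k) mod P < P" using Ppos by auto
  have eb: "\<bar>?e\<bar> \<le> U" using abs_div_le[of "e (Suc k)" P] eU[OF kN] by linarith
  have ab: "\<bar>?a\<bar> \<le> U" using abs_div_le[of "cc k" R] cU[of k] kN by linarith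
  have pk: "pr k \<le> N" using pr_le[of k] kN by simp
  show ?thesis
    unfolding b_search_def
  proof (rule wp_for[where I = ?I and N = "nat (?l + 1)"])
    show "?I 0 t s0" using assms by (auto simp: found_def good_def)
  next
    fix q t' s
    assume q: "q < nat (?l + 1)" and I: "?I q t' s"
    have ag: "agree A s0 s" using I by simp
    have v: "s ''i'' 0 = 1 + int k" "s ''x'' 0 = int (pr k)" "s ''b'' 0 = ?e"
      "s ''f'' 0 = e (Suc k) mod P" "s ''a'' 0 = ?a" "s ''w'' 0 = ?l" "s ''Z'' 0 = z"
      "s ''s'' 0 = F (Suc k) z" "s ''m'' 0 = int q"
      using agreeD[OF ag] s0 I by (simp_all add: A_def)
    have nodes: "node s k" "node s (pr k)" using node_agree[OF ag] s0 by (simp_all add: A_def)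
    define m where "m = ?a + int q"
    have qq: "0 \<le> int q" "int q \<le> ?l" using q by auto
    have mb: "\<bar>m\<bar> \<le> 3 * U" using ab l0 qq U100 unfolding m_def by linarith
    have Rm: "\<bar>R * m\<bar> \<le> 3 * (U * U)" using mulU[OF _ RU mb] by simp
    define z1 z2 where "z1 = z - ?a - int q + ?e + 1" and "z2 = z - ?a - int q + ?e"
    have zb: "\<bar>z1\<bar> \<le> 10 * (U * U)" "\<bar>z2\<bar> \<le> 10 * (U * U)"
      using z ab eb qq l0 UU U100 unfolding z1_def z2_def by linarith+
    have FM: "\<bar>R * m\<bar> \<le> M" "\<bar>F k (R * m)\<bar> \<le> U + 3 * (U * U * U)" "\<bar>z1\<bar> \<le> M" "\<bar>F (pr k) z1\<bar> \<le> U + 10 * (U * U * U)"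
        "\<bar>z2\<bar> \<le> M" "\<bar>F (pr k) z2\<bar> \<le> U + 10 * (U * U * U)"
    proof -
      show "\<bar>R * m\<bar> \<le> M" "\<bar>z1\<bar> \<le> M" "\<bar>z2\<bar> \<le> M" using Rm zb UU UM U100 by linarith+
    qed (use F_abs[OF _ Rm] F_abs[OF pk zb(1)] F_abs[OF pk zb(2)] kN in auto)
    then have FM': "\<bar>F k (R * m)\<bar> \<le> M" "\<bar>F (pr k) z1\<bar> \<le> M" "\<bar>F (pr k) z2\<bar> \<le> M"
      using UU UM U100 by linarith+
    define o1 o2 where "o1 = F k (R * m) + F (pr k) z1 + (P - e (Suc k) mod P)"
      and "o2 = F k (R * m) + F (pr k) z2 + e (Suc k) mod P"
    have o: "\<bar>o1\<bar> \<le> M" "\<bar>o2\<bar> \<le> M" using FM f PU UU UM U100 unfolding o1_def o2_def by linarith+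
    have oc: "o1 = cand z m (- ?e - 1)" "o2 = cand z m (- ?e)"
    proof -
      have "z - m - (- ?e - 1) = z1" "z - m - (- ?e) = z2" by (simp_all add: z1_def z2_def m_def)
      then show "o1 = cand z m (- ?e - 1)" "o2 = cand z m (- ?e)"
        unfolding cand_def abs_leaf by (simp_all only: o1_def o2_def)
    qed
    have g1: "good z m (- ?e - 1) \<longleftrightarrow> o1 \<le> F (Suc k) z" and g2: "good z m (- ?e) \<longleftrightarrow> o2 \<le> F (Suc k) z"
      using qq oc by (auto simp: good_def m_def)
    have st: "\<bar>m\<bar> \<le> M" "\<bar>- ?e - 1\<bar> \<le> M" "\<bar>?e\<bar> \<le> M" "\<bar>int q + 1\<bar> \<le> M"
      using mb eb qq l0 UU U100 by linarith+
    define Z where "Z = ?I (Suc q)"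
    define c3 c2 c1 where "c3 = (''m'' ::= V ''m'' \<oplus> Lit 1)"
      and "c2 = Cond (V ''s'' \<prec> V ''o'') Skip (''q'' ::= V ''a'' \<oplus> V ''m'' ;; ''r'' ::= Lit 0 \<ominus> V ''b'')"
      and "c1 = Cond (V ''s'' \<prec> V ''o'') Skip (''q'' ::= V ''a'' \<oplus> V ''m'' ;; ''r'' ::= Lit 0 \<ominus> V ''b'' \<ominus> Lit 1)"
    define keep where "keep = (\<lambda>s' :: state. agree A s0 s' \<and> s' ''m'' 0 = int q)"
    have kv: "s' ''i'' 0 = 1 + int k" "s' ''x'' 0 = int (pr k)" "s' ''b'' 0 = ?e"
      "s' ''f'' 0 = e (Suc k) mod P" "s' ''a'' 0 = ?a" "s' ''w'' 0 = ?l" "s' ''Z'' 0 = z"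
      "s' ''s'' 0 = F (Suc k) z" "s' ''m'' 0 = int q" "node s' k" "node s' (pr k)" if "keep s'" for s'
      using agreeD[of A s0 s'] node_agree[of A s0 s'] s0 that by (simp_all add: A_def keep_def)
    have ku: "keep (upd s' x i val)" if "keep s'" "x \<in> A" "x \<noteq> ''m''" for s' x i val
      using that by (auto simp: keep_def)
    have inA: "''y'' \<in> A" "''z'' \<in> A" "''o'' \<in> A" "''t'' \<in> A" "''q'' \<in> A" "''r'' \<in> A" "''m'' \<in> A" by (auto simp: A_def)
    have w5: "wp M c3 Z t'' s'" if "keep s'" "t'' \<le> t' + 900"
        "(good z m (- ?e - 1) \<or> good z m (- ?e) \<or> found q s') \<and> (good z m (- ?e - 1) \<or> good z m (- ?e) \<longrightarrow> good z (s' ''q'' 0) (s' ''r'' 0))" for t'' s'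
    proof -
      have "found (Suc q) (upd s' ''m'' 0 (int q + 1))"
        unfolding found_def
      proof (intro impI)
        assume "\<exists>m' x. good z m' x \<and> m' < ?a + int (Suc q)"
        then obtain m' x where m': "good z m' x" "m' < ?a + int (Suc q)" by blast
        show "good z (upd s' ''m'' 0 (int q + 1) ''q'' 0) (upd s' ''m'' 0 (int q + 1) ''r'' 0)"
        proof (cases "m' = m")
          case True
          then have "good z m (- ?e - 1) \<or> good z m (- ?e)" using m'(1) by (auto simp: good_def)
          then show ?thesis using that(3) by simp
        next
          case False
          then have "m' < ?a + int q" using m'(2) by (simp add: m_def)
          then show ?thesis using that(3) m'(1) by (auto simp: found_def)
        qed
      qed
      then show ?thesis
        using that(1,2) kv(9)[OF that(1)] st I inA by (simp add: c3_def Z_def keep_def add.commute)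
    qed
    have fu: "found q (upd s' x i v) = found q s'" if "x \<noteq> ''q''" "x \<noteq> ''r''" for s' x i v
      using that by (simp add: found_def)
    define pA where "pA = (''o'' ::= V ''t'' \<oplus> V ''y'' \<oplus> V ''f'' ;; c2 ;; c3)"
    define pB where "pB = (EV (V ''x'') (V ''Z'' \<ominus> V ''a'' \<ominus> V ''m'' \<oplus> V ''b'') ;; pA)"
    define pC where "pC = (''o'' ::= V ''t'' \<oplus> V ''y'' \<oplus> (Lit P \<ominus> V ''f'') ;; c1 ;; pB)"
    define pD where "pD = (EV (V ''x'') (V ''Z'' \<ominus> V ''a'' \<ominus> V ''m'' \<oplus> V ''b'' \<oplus> Lit 1) ;; pC)"
    define ok where "ok = (\<lambda>s' :: state. if good z m (- ?e - 1) then good z (s' ''q'' 0) (s' ''r'' 0) else found q s')"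
    have oku: "ok (upd s' x i v) = ok s'" if "x \<noteq> ''q''" "x \<noteq> ''r''" for s' x i v
      using that fu[OF that] by (simp add: ok_def)
    have w4: "wp M pA Z t'' s'"
      if "keep s'" "t'' \<le> t' + 800" "s' ''t'' 0 = F k (R * m)" "s' ''y'' 0 = F (pr k) z2" "ok s'" for t'' s'
    proof (cases "F (Suc k) z < o2")
      note T3 = that
      case True
      have W: "wp M c3 Z t3 (upd s' ''o'' 0 o2)" if "t3 \<le> t'' + 60" for t3
        using that T3 inA True g2 by (intro w5 ku) (auto simp: ok_def fu split: if_splits)
      show ?thesis
        using True
        by (simp add: kv[OF that(1)] that(3,4) o W pA_def c2_def o2_def[symmetric])
    next
      note T3 = that
      case False
      have W: "wp M c3 Z t3 (upd (upd (upd s' ''o'' 0 o2) ''q'' 0 m) ''r'' 0 (- ?e))" if "t3 \<le> t'' + 60" for t3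
        using that T3 inA ku False g2 by (intro w5) auto
      show ?thesis
        using False
        by (simp add: kv[OF that(1)] that(3,4) o st W pA_def c2_def o2_def[symmetric] m_def[symmetric])
    qed
    have w3: "wp M pB Z t'' s'" if "keep s'" "t'' \<le> t' + 600" "s' ''t'' 0 = F k (R * m)" "ok s'" for t'' s'
      unfolding pB_def
    proof (simp only: wp_Seq, rule wp_EV[OF kv(11)[OF that(1)], where z = z2])
      fix t3
      assume "t3 \<le> t'' + (60 + 20 * cost_exp (V ''x'') + cost_exp (V ''Z'' \<ominus> V ''a'' \<ominus> V ''m'' \<oplus> V ''b''))"
      then show "wp M pA Z t3 (upd (upd s' ''z'' 0 z2) ''y'' 0 (F (pr k) z2))"
        using that by (intro w4 ku inA) (auto simp: oku)
    qed (use FM(5) FM'(3) in \<open>simp_all add: kv[OF that(1)] z2_def\<close>)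
    have w2: "wp M pC Z t'' s'"
      if "keep s'" "t'' \<le> t' + 500" "s' ''t'' 0 = F k (R * m)" "s' ''y'' 0 = F (pr k) z1" "found q s'" for t'' s'
    proof (cases "F (Suc k) z < o1")
      note T3 = that
      case True
      have W: "wp M pB Z t3 (upd s' ''o'' 0 o1)" if "t3 \<le> t'' + 60" for t3
        using that T3 inA True g1 fu[of "''o''" s'] by (intro w3 ku) (auto simp: ok_def)
      show ?thesis
        using True
        by (simp add: kv[OF that(1)] that(3,4) o W pC_def c1_def o1_def[symmetric])
    next
      note T3 = that
      case False
      have W: "wp M pB Z t3 (upd (upd (upd s' ''o'' 0 o1) ''q'' 0 m) ''r'' 0 (- ?e - 1))" if "t3 \<le> t'' + 60" for t3
        using that T3 inA False g1 by (intro w3 ku) (auto simp: ok_def)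
      show ?thesis
        using False
        by (simp add: kv[OF that(1)] that(3,4) o st W pC_def c1_def o1_def[symmetric] m_def[symmetric])
    qed
    have w1: "wp M pD Z t'' s'"
      if "keep s'" "t'' \<le> t' + 300" "s' ''t'' 0 = F k (R * m)" "found q s'" for t'' s'
      unfolding pD_def
    proof (simp only: wp_Seq, rule wp_EV[OF kv(11)[OF that(1)], where z = z1])
      fix t3
      assume "t3 \<le> t'' + (60 + 20 * cost_exp (V ''x'') + cost_exp (V ''Z'' \<ominus> V ''a'' \<ominus> V ''m'' \<oplus> V ''b'' \<oplus> Lit 1))"
      then show "wp M pC Z t3 (upd (upd s' ''z'' 0 z1) ''y'' 0 (F (pr k) z1))"
        using that by (intro w2 ku inA) (auto simp: fu)
    qed (use FM(3) FM'(2) in \<open>simp_all add: kv[OF that(1)] z1_def\<close>)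
    have w0: "wp M (EV (V ''i'' \<ominus> Lit 1) (Lit R \<otimes> (V ''a'' \<oplus> V ''m'')) ;; ''t'' ::= V ''y'' ;; pD) Z (t' + cost_bexp ?b) s"
    proof (simp only: wp_Seq, rule wp_EV[OF nodes(1), where z = "R * m"])
      fix t3
      assume t3: "t3 \<le> t' + cost_bexp ?b + (60 + 20 * cost_exp (V ''i'' \<ominus> Lit 1) + cost_exp (Lit R \<otimes> (V ''a'' \<oplus> V ''m'')))"
      have k0: "keep s" using I by (simp add: keep_def)
      have W: "wp M pD Z t4 (upd (upd (upd s ''z'' 0 (R * m)) ''y'' 0 (F k (R * m))) ''t'' 0 (F k (R * m)))"
        if "t4 \<le> t3 + 60" for t4
        using that t3 k0 I by (intro w1 ku inA) (auto simp: fu)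
      show "wp M (''t'' ::= V ''y'' ;; pD) Z t3 (upd (upd s ''z'' 0 (R * m)) ''y'' 0 (F k (R * m)))"
        by (simp add: FM' W)
    qed (use FM(1) FM'(1) in \<open>simp_all add: v m_def\<close>)
    show "eval_bexp ?b s \<and> wp M
      (EV (V ''i'' \<ominus> Lit 1) (Lit R \<otimes> (V ''a'' \<oplus> V ''m'')) ;;
      ''t'' ::= V ''y'' ;;
      EV (V ''x'') (V ''Z'' \<ominus> V ''a'' \<ominus> V ''m'' \<oplus> V ''b'' \<oplus> Lit 1) ;;
      ''o'' ::= V ''t'' \<oplus> V ''y'' \<oplus> (Lit P \<ominus> V ''f'') ;;
      Cond (V ''s'' \<prec> V ''o'') Skip (''q'' ::= V ''a'' \<oplus> V ''m'' ;; ''r'' ::= Lit 0 \<ominus> V ''b'' \<ominus> Lit 1) ;;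
      EV (V ''x'') (V ''Z'' \<ominus> V ''a'' \<ominus> V ''m'' \<oplus> V ''b'') ;;
      ''o'' ::= V ''t'' \<oplus> V ''y'' \<oplus> V ''f'' ;;
      Cond (V ''s'' \<prec> V ''o'') Skip (''q'' ::= V ''a'' \<oplus> V ''m'' ;; ''r'' ::= Lit 0 \<ominus> V ''b'') ;;
      ''m'' ::= V ''m'' \<oplus> Lit 1) (?I (Suc q)) (t' + cost_bexp ?b) s"
    proof (rule conjI)
      show "eval_bexp ?b s" using v qq by simp
    qed (rule w0[unfolded pD_def pC_def pB_def pA_def c1_def c2_def c3_def Z_def])
  next
    fix t' s
    assume I: "?I (nat (?l + 1)) t' s"
    then have v: "s ''w'' 0 = ?l" using agreeD[of A s0 s] s0 by (simp add: A_def)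
    obtain m x where g: "good z m x" using good_exists by blast
    then have "m \<le> ?a + ?l" by (simp only: good_def)
    then have "m < ?a + int (nat (?l + 1))" using l0 by simp
    moreover have "found (nat (?l + 1)) s" using I by simp
    ultimately have "good z (s ''q'' 0) (s ''r'' 0)" using g unfolding found_def by blast
    moreover have "int (t' + cost_bexp ?b) \<le> int t + 1000 * (LL k + 3)"
    proof -
      have "?l + 2 \<le> LL k + 3" using LL_nonneg[of k] by linarith
      moreover have "int t' \<le> int (t + 1000 * nat (?l + 1))" using I by (simp only: of_nat_le_iff)
      ultimately show ?thesis using l0 by simp
    qed
    ultimately show "\<not> eval_bexp ?b s \<and> G (t' + cost_bexp ?b) s"
      using I v l0 unfolding A_def by (intro conjI post) auto
  qed
qed

end

end

context prog
begin

context
  fixes k :: nat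
  assumes h: "H (Suc k)" and kN: "Suc k \<le> N"
begin

definition step_opt :: "state \<Rightarrow> bool" where
  "step_opt s \<longleftrightarrow> (\<exists>m y. s ''d'' (int k) = R * m \<and> s ''g'' (1 + int k) = e (Suc k) + P * y
     \<and> s ''d'' (1 + int k) = m + s ''d'' (int (pr k)) + y
     \<and> F k (s ''d'' (int k)) + F (pr k) (s ''d'' (int (pr k))) + \<bar>s ''g'' (1 + int k)\<bar> \<le> F (Suc k) (s ''d'' (1 + int k)))"

text \<open>Demands grow additively on the way down. The middle child receives \<open>R * m\<close>
  with m in a bounded range, and the left child receives the own demand changed by
  \<open>m + x\<close> at most, which is below \<open>5 * U\<close>. Starting from
  \<open>3 * (U * U)\<close>, the at most \<open>U\<close> steps stay within
  \<open>8 * (U * U)\<close>.\<close>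

lemma wp_b_pop:
  assumes built: "\<forall>j \<le> Suc k. node s j" "s ''u'' (int k) = int (pr k)"
    and s: "s ''i'' 0 = 1 + int k" "s ''e'' (1 + int k) = e (Suc k)" "s ''n'' 0 = int n" "s ''d'' 0 = 0"
    and pad: "n < Suc k \<Longrightarrow> e (Suc k) = 0"
    and D: "\<And>j. \<bar>s ''d'' (int j)\<bar> \<le> D" "3 * (U * U) \<le> D" "D \<le> 8 * (U * U)"
    and post: "\<And>t' s'. int t' \<le> int t + 1500 * (LL k + 3) \<Longrightarrow> agree BS s s' \<Longrightarrow> step_opt s'
      \<Longrightarrow> (n \<le> k \<Longrightarrow> pr k \<noteq> 0 \<Longrightarrow> s' ''g'' (1 + int k) = 0)
      \<Longrightarrow> (\<And>j. j \<noteq> k \<Longrightarrow> j \<noteq> pr k \<or> pr k = 0 \<Longrightarrow> s' ''d'' (int j) = s ''d'' (int j))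
      \<Longrightarrow> (\<And>j. j \<noteq> Suc k \<Longrightarrow> s' ''g'' (int j) = s ''g'' (int j))
      \<Longrightarrow> (\<And>j. \<bar>s' ''d'' (int j)\<bar> \<le> D + 5 * U) \<Longrightarrow> G t' s'"
  shows "wp M (b_setup ;; b_search ;; b_assign) G t s"
proof -
  define z where "z = s ''d'' (1 + int k)"
  have z: "\<bar>z\<bar> \<le> D" using D(1)[of "Suc k"] by (simp add: z_def)
  have z8: "\<bar>z\<bar> \<le> 8 * (U * U)" using z D by linarith
  have k0: "0 < k" using h H1 by (cases k) auto
  have n: "node s k" "node s (Suc k)" "node s (pr k)" using built pr_le[of k] by auto
  have ck: "s ''c'' (int k) = cc k" "s ''l'' (int k) = LL k" using n by (auto simp: node_def)
  have zM: "\<bar>z\<bar> \<le> M" using z8 UU UM U100 by linarith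
  have eM: "\<bar>e (Suc k) mod P\<bar> \<le> M"
    using pos_mod_bound[of P "e (Suc k)"] pos_mod_sign[of P "e (Suc k)"] Ppos PU UU by linarith
  have lM: "LL k div 2 + 1 \<le> M" using lU[of k] kN LL_nonneg[of k] UU U100 by linarith
  have e1: "\<bar>e (Suc k) div P\<bar> \<le> M" "\<bar>cc k div R\<bar> \<le> M" "\<bar>LL k div 2 + 1\<bar> \<le> M" "\<bar>int (pr k)\<bar> \<le> M"
      "\<bar>e (Suc k) mod P\<bar> \<le> M" "\<bar>z\<bar> \<le> M" "\<bar>F (Suc k) z\<bar> \<le> M" "\<bar>e (Suc k)\<bar> \<le> U" "\<bar>cc k\<bar> \<le> U"
    using eU[OF kN] abs_div_le[of "e (Suc k)" P] abs_div_le[of "cc k" R] cU[of k] lU[of k] LL_nonneg[of k]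
      UU UM U100 zM eM lM F_abs[OF kN z8] NU kN pr_le[of k]
    by auto
  have x0: "int (pr k) \<le> M" "0 \<le> M" using e1(4) by simp_all
  define s1 where "s1 = upd (upd (upd (upd (upd (upd (upd s ''x'' 0 (int (pr k))) ''b'' 0 (e (Suc k) div P))
    ''f'' 0 (e (Suc k) mod P)) ''a'' 0 (cc k div R)) ''w'' 0 (LL k div 2 + 1)) ''Z'' 0 z) ''m'' 0 0"
  define s2 where "s2 = upd (upd (upd s1 ''z'' 0 z) ''y'' 0 (F (Suc k) z)) ''s'' 0 (F (Suc k) z)"
  have ag2: "agree BS s s2" by (simp add: s2_def s1_def BS_def)
  have v2: "s2 ''i'' 0 = 1 + int k" "s2 ''x'' 0 = int (pr k)" "s2 ''b'' 0 = e (Suc k) div P"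
      "s2 ''f'' 0 = e (Suc k) mod P" "s2 ''a'' 0 = cc k div R" "s2 ''w'' 0 = LL k div 2 + 1" "s2 ''Z'' 0 = z"
      "s2 ''s'' 0 = F (Suc k) z" "s2 ''m'' 0 = 0" "node s2 k" "node s2 (pr k)"
      "s2 ''d'' = s ''d''" "s2 ''g'' = s ''g''" "s2 ''e'' = s ''e''" "s2 ''n'' = s ''n''"
    using s n by (simp_all add: s2_def s1_def)
  have assign: "wp M b_assign G t' s3" if t': "int t' \<le> int t + 300 + 1000 * (LL k + 3)"
    and ag3: "agree {''q'', ''r'', ''m'', ''o'', ''t'', ''z'', ''y''} s2 s3"
    and g: "good k z (s3 ''q'' 0) (s3 ''r'' 0)" for t' s3
  proof -
    define m x where "m = s3 ''q'' 0" and "x = s3 ''r'' 0"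
    have v3: "s3 ''i'' 0 = 1 + int k" "s3 ''x'' 0 = int (pr k)" "s3 ''Z'' 0 = z" "s3 ''d'' = s ''d''" "s3 ''g'' = s ''g''"
        "s3 ''e'' = s ''e''" "s3 ''n'' = s ''n''"
      using agreeD[OF ag3] v2 by simp_all
    have g: "good k z m x" using g by (simp add: m_def x_def)
    note gl = good_le[OF h kN g]
    have ag: "agree BS s s3" by (rule agree_trans[OF ag2 ag3]) (auto simp: BS_def)
    have le: "F k (R * m) + F (pr k) (z - m - x) + \<bar>e (Suc k) + P * x\<bar> \<le> F (Suc k) z"
      using g by (simp add: good_def[OF h kN] cand_def[OF h kN])
    have zm: "\<bar>z - m\<bar> \<le> D + 5 * U" "\<bar>z - m - x\<bar> \<le> D + 5 * U" "\<bar>z - m\<bar> \<le> 9 * (U * U)" "\<bar>x\<bar> \<le> 9 * (U * U)"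
    proof -
      show "\<bar>z - m\<bar> \<le> D + 5 * U" using z gl(1) U100 by linarith
      show "\<bar>z - m - x\<bar> \<le> D + 5 * U" using z gl(1,2) U100 by linarith
      show "\<bar>z - m\<bar> \<le> 9 * (U * U)" using z8 gl(1) UU(1) U100 by linarith
      show "\<bar>x\<bar> \<le> 9 * (U * U)" using gl(2) UU(1) U100 by linarith
    qed
    have Py: "\<bar>P * (z - m)\<bar> \<le> 9 * (U * U * U)" "\<bar>P * x\<bar> \<le> 9 * (U * U * U)"
      using mulU[OF _ PU zm(3)] mulU[OF _ PU zm(4)] by (simp_all add: mult.assoc)
    have b: "\<bar>z - m\<bar> \<le> M" "\<bar>R * m\<bar> \<le> M" "\<bar>e (Suc k) + P * (z - m)\<bar> \<le> M" "\<bar>z - m - x\<bar> \<le> M" "\<bar>e (Suc k) + P * x\<bar> \<le> M" "0 \<le> M"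
    proof -
      show "0 \<le> M" using UU(3,4) by linarith
      show "\<bar>z - m\<bar> \<le> M" using zm(3) UU(1,2) UM U100 by linarith
      show "\<bar>R * m\<bar> \<le> M" using gl(3) UU(1,2) UM U100 by linarith
      show "\<bar>e (Suc k) + P * (z - m)\<bar> \<le> M" using Py(1) e1(8) UU(1,2) UM U100 by linarith
      show "\<bar>z - m - x\<bar> \<le> M" using zm(2) D(3) UU(1,2) UM U100 by linarith
      show "\<bar>e (Suc k) + P * x\<bar> \<le> M" using Py(2) e1(8) UU(1,2) UM U100 by linarith
    qed
    have dk: "int k \<noteq> 1 + int k" "int (pr k) \<noteq> 1 + int k" "int k \<noteq> 0" using pr_le[of k] k0 by auto
    \<comment> \<open>One statement serves the three branches of \<open>b_assign\<close>.
      \<open>X\<close> is the demand cell written last: that of the left child, or, if there is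
      none, the cell of \<open>k\<close> written again with the same value
      \<open>R * m\<close>.\<close>
    have fin: "G t'' s'" if t'': "t'' \<le> t' + 100"
      and s': "s' = upd (upd (upd (upd s3 ''o'' 0 (z - m)) ''d'' (int k) (R * m)) ''d'' X w) ''g'' (1 + int k) (e (Suc k) + P * y)"
      and Xw: "X = int (pr k) \<and> 0 < pr k \<or> pr k = 0 \<and> X = int k \<and> w = R * m"
      and sum: "z = m + (if pr k = 0 then 0 else w) + y" and wD: "\<bar>w\<bar> \<le> D + 5 * U"
      and cost: "F k (R * m) + F (pr k) (if pr k = 0 then 0 else w) + \<bar>e (Suc k) + P * y\<bar> \<le> F (Suc k) z"
      and y0: "n \<le> k \<Longrightarrow> pr k \<noteq> 0 \<Longrightarrow> y = 0"
      for t'' s' X w y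
    proof (rule post)
      have pk: "pr k < k" using pr_less[OF k0] .
      have dk': "s' ''d'' (int k) = R * m" using Xw pk by (auto simp: s')
      have dp: "s' ''d'' (int (pr k)) = (if pr k = 0 then 0 else w)"
        using Xw pk k0 s(4) by (auto simp: s' v3)
      have ds: "s' ''d'' (1 + int k) = z" using Xw pk by (auto simp: s' v3 z_def)
      show "step_opt s'"
        unfolding step_opt_def dk' dp ds using sum cost by (intro exI[of _ m] exI[of _ y]) (simp add: s')
      show "s' ''g'' (1 + int k) = 0" if "n \<le> k" "pr k \<noteq> 0" using y0[OF that] pad that by (simp add: s')
      show "agree BS s s'" using ag by (simp add: s' BS_def)
      show "int t'' \<le> int t + 1500 * (LL k + 3)" using t' t'' LL_nonneg[of k] by simp
      show "s' ''d'' (int j) = s ''d'' (int j)" if "j \<noteq> k" "j \<noteq> pr k \<or> pr k = 0" for j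
        using that Xw by (auto simp: s' v3)
      show "s' ''g'' (int j) = s ''g'' (int j)" if "j \<noteq> Suc k" for j
        using that by (auto simp: s' v3)
      have "\<bar>R * m\<bar> \<le> D + 5 * U" using gl(3) D(2) UU(4) by linarith
      then show "\<bar>s' ''d'' (int j)\<bar> \<le> D + 5 * U" for j
        using wD D(1)[of j] UU(4) by (auto simp: s' v3)
    qed
    show ?thesis
    proof (cases "pr k = 0")
      case True
      have "F (pr k) (z - m - x) = P * \<bar>z - m - x\<bar>" using True by simp
      moreover have "\<bar>e (Suc k) + P * (z - m)\<bar> \<le> P * \<bar>z - m - x\<bar> + \<bar>e (Suc k) + P * x\<bar>"
      proof -
        have "e (Suc k) + P * (z - m) = P * (z - m - x) + (e (Suc k) + P * x)" by (simp add: algebra_simps)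
        then have "\<bar>e (Suc k) + P * (z - m)\<bar> \<le> \<bar>P * (z - m - x)\<bar> + \<bar>e (Suc k) + P * x\<bar>"
          using abs_triangle_ineq by presburger
        then show ?thesis by (simp add: abs_mult)
      qed
      ultimately have cost: "F k (R * m) + F (pr k) (if pr k = 0 then 0 else R * m) + \<bar>e (Suc k) + P * (z - m)\<bar> \<le> F (Suc k) z"
        using le True by simp
      have "\<bar>R * m\<bar> \<le> D + 5 * U" using gl(3) D(2) UU(4) by linarith
      then have F: "G t'' (upd (upd (upd s3 ''o'' 0 (z - m)) ''d'' (int k) (R * m)) ''g'' (1 + int k) (e (Suc k) + P * (z - m)))"
        if "t'' \<le> t' + 100" for t''
      proof -
        have eq: "upd (upd s3 ''o'' 0 (z - m)) ''d'' (int k) (R * m) = upd (upd (upd s3 ''o'' 0 (z - m)) ''d'' (int k) (R * m)) ''d'' (int k) (R * m)"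
          by (simp add: upd_def)
        show ?thesis
          by (subst eq, rule fin[OF that HOL.refl]) (use True cost \<open>\<bar>R * m\<bar> \<le> D + 5 * U\<close> in auto)
      qed
      show ?thesis
        unfolding b_assign_def using True
        by (simp add: b dk v3 s F m_def[symmetric] x_def[symmetric])
    next
      case X: False
      then have X0: "0 < pr k" by simp
      show ?thesis
      proof (cases "n < Suc k")
        case True
        have e0: "e (Suc k) = 0" using pad True by simp
        have "F (pr k) (z - m) \<le> F (pr k) (z - m - x) + P * \<bar>x\<bar>"
          using F_le_shift[of "pr k" "z - m" "z - m - x"] by simp
        moreover have "\<bar>e (Suc k) + P * x\<bar> = P * \<bar>x\<bar>" by (simp add: e0 abs_mult)
        ultimately have "F k (R * m) + F (pr k) (z - m) \<le> F (Suc k) z" using le by simp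
        then have F: "G t'' (upd (upd (upd (upd s3 ''o'' 0 (z - m)) ''d'' (int k) (R * m)) ''d'' (int (pr k)) (z - m)) ''g'' (1 + int k) (e (Suc k) + P * 0))"
          if "t'' \<le> t' + 100" for t''
          using that zm X X0 by (intro fin[OF that HOL.refl]) (auto simp: e0)
        show ?thesis
          unfolding b_assign_def using X True
          by (simp add: b dk v3 s F[unfolded e0 mult_zero_right add_0] m_def[symmetric] x_def[symmetric] e0)
      next
        case False
        have F: "G t'' (upd (upd (upd (upd s3 ''o'' 0 (z - m)) ''d'' (int k) (R * m)) ''d'' (int (pr k)) (z - m - x)) ''g'' (1 + int k) (e (Suc k) + P * x))"
          if "t'' \<le> t' + 100" for t''
          using that zm X X0 le False by (intro fin[OF that HOL.refl]) auto
        show ?thesis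
          unfolding b_assign_def using X False
          by (simp add: b dk v3 s F m_def[symmetric] x_def[symmetric])
      qed
    qed
  qed
  have search: "wp M b_search (wp M b_assign G) t' s2" if "t' \<le> t + 300" for t'
    by (rule wp_b_search[OF h kN v2(1-11)]) (use z8 that in \<open>auto intro!: assign UU\<close>)
  have ns1: "node s1 (Suc k)" using n by (simp add: s1_def)
  have ev: "wp M (EV (V ''i'') (V ''Z'')) (wp M (''s'' ::= V ''y'') (wp M b_search (wp M b_assign G))) t' s1" if "t' \<le> t + 100" for t'
  proof (rule wp_EV[OF ns1, where z = z])
    fix t3
    assume "t3 \<le> t' + (60 + 20 * cost_exp (V ''i'') + cost_exp (V ''Z''))"
    then have W: "wp M b_search (wp M b_assign G) t4 s2" if "t4 \<le> t3 + 4" for t4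
      using that \<open>t' \<le> t + 100\<close> by (intro search) simp
    show "wp M (''s'' ::= V ''y'') (wp M b_search (wp M b_assign G)) t3 (upd (upd s1 ''z'' 0 z) ''y'' 0 (F (Suc k) z))"
      using e1(7) by (simp add: s2_def[symmetric] W)
  qed (use s e1(6,7) in \<open>simp_all add: s1_def\<close>)
  have "wp M b_setup (wp M b_search (wp M b_assign G)) t s"
    unfolding b_setup_def wp_Seq_fun
    by (simp add: e1(1-7) x0 built(2) s ck ev z_def[symmetric] s1_def[symmetric])
  then show ?thesis by (simp only: wp_Seq_fun)
qed

end

definition data :: "nat \<Rightarrow> state \<Rightarrow> bool" where
  "data i s \<longleftrightarrow> (\<forall>j. 1 \<le> j \<and> j \<le> i \<longrightarrow> s ''e'' (int j) = e j \<and> s ''h'' (int j) = (if H j then 1 else - 1))"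

text \<open>For \<open>k = 0\<close> these are the virtual positions after \<open>n\<close> up to
  the root, where a bracket is still open; positions beyond the root belong to the spur and may hold
  letters.\<close>

definition zeros :: "nat \<Rightarrow> nat \<Rightarrow> nat \<Rightarrow> state \<Rightarrow> bool" where
  "zeros n J k s \<longleftrightarrow> (\<forall>j. k \<le> j \<and> j < J \<and> n \<le> j \<and> pr j \<noteq> 0 \<longrightarrow> s ''g'' (1 + int j) = 0)"

lemma wp_bstep:
  assumes k: "Suc k \<le> J" "J \<le> N" and built: "built J s" and data: "data J s"
    and s: "s ''i'' 0 = 1 + int k" "s ''n'' 0 = int n" "s ''d'' 0 = 0" "s ''d'' (int J) = 0"
    and pad: "\<And>i. n < i \<Longrightarrow> H i \<and> e i = 0"
    and opt: "optimal (Suc k) (\<lambda>j. s ''d'' (int j)) (\<lambda>j. s ''g'' (int j)) J" and zs: "zeros n J (Suc k) s"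
    and D: "\<And>j. \<bar>s ''d'' (int j)\<bar> \<le> D" "3 * (U * U) \<le> D" "D \<le> 8 * (U * U)"
    and L: "LL k \<le> Lm" "0 \<le> Lm"
    and post: "\<And>t' s'. int t' \<le> int t + 1600 * (Lm + 3) \<Longrightarrow> agree BS s s'
      \<Longrightarrow> optimal k (\<lambda>j. s' ''d'' (int j)) (\<lambda>j. s' ''g'' (int j)) J \<Longrightarrow> zeros n J k s' \<Longrightarrow> s' ''d'' (int J) = 0
      \<Longrightarrow> s' ''d'' 0 = 0 \<Longrightarrow> (\<And>j. \<bar>s' ''d'' (int j)\<bar> \<le> D + 5 * U) \<Longrightarrow> G t' s'"
  shows "wp M bstep G t s"
proof -
  have kN: "Suc k \<le> N" using k by simp
  have pe: "\<And>i. n < i \<Longrightarrow> e i = 0" using pad by simp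
  have e: "s ''e'' (1 + int k) = e (Suc k)" "s ''h'' (1 + int k) = (if H (Suc k) then 1 else - 1)"
    using data k by (auto simp: data_def dest: spec[of _ "Suc k"])
  show ?thesis
  proof (cases "H (Suc k)")
    case False
    have zU: "\<bar>s ''d'' (1 + int k)\<bar> \<le> 8 * (U * U)" using D(1)[of "Suc k"] D(3) by simp
    have "\<bar>P * s ''d'' (1 + int k)\<bar> \<le> U * (8 * (U * U))" by (rule mulU[OF _ PU zU]) simp
    then have "\<bar>e (Suc k) + P * s ''d'' (1 + int k)\<bar> \<le> M" using eU[OF kN] UU UM U100 by linarith
    moreover have "G t' (upd s ''g'' (1 + int k) (e (Suc k) + P * s ''d'' (1 + int k)))" if "t' \<le> t + 100" for t'
    proof (rule post)
      show "int t' \<le> int t + 1600 * (Lm + 3)" using that L by simp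
      show "agree BS s (upd s ''g'' (1 + int k) (e (Suc k) + P * s ''d'' (1 + int k)))" by (simp add: BS_def)
      show "optimal k (\<lambda>j. upd s ''g'' (1 + int k) (e (Suc k) + P * s ''d'' (1 + int k)) ''d'' (int j))
         (\<lambda>j. upd s ''g'' (1 + int k) (e (Suc k) + P * s ''d'' (1 + int k)) ''g'' (int j)) J"
        unfolding optimal_def
      proof (intro conjI allI impI)
        fix j
        assume j: "k \<le> j \<and> j < J"
        show "if H (Suc j)
          then \<exists>m y. upd s ''g'' (1 + int k) (e (Suc k) + P * s ''d'' (1 + int k)) ''d'' (int j) = R * m \<and>
               upd s ''g'' (1 + int k) (e (Suc k) + P * s ''d'' (1 + int k)) ''g'' (int (Suc j)) = e (Suc j) + P * y \<and>
               upd s ''g'' (1 + int k) (e (Suc k) + P * s ''d'' (1 + int k)) ''d'' (int (Suc j)) =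
                 m + upd s ''g'' (1 + int k) (e (Suc k) + P * s ''d'' (1 + int k)) ''d'' (int (pr j)) + y \<and>
               F j (upd s ''g'' (1 + int k) (e (Suc k) + P * s ''d'' (1 + int k)) ''d'' (int j)) +
               F (pr j) (upd s ''g'' (1 + int k) (e (Suc k) + P * s ''d'' (1 + int k)) ''d'' (int (pr j))) +
               \<bar>upd s ''g'' (1 + int k) (e (Suc k) + P * s ''d'' (1 + int k)) ''g'' (int (Suc j))\<bar>
               \<le> F (Suc j) (upd s ''g'' (1 + int k) (e (Suc k) + P * s ''d'' (1 + int k)) ''d'' (int (Suc j)))
          else upd s ''g'' (1 + int k) (e (Suc k) + P * s ''d'' (1 + int k)) ''g'' (int (Suc j)) =
               e (Suc j) + P * upd s ''g'' (1 + int k) (e (Suc k) + P * s ''d'' (1 + int k)) ''d'' (int (Suc j))"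
        proof (cases "j = k")
          case True
          then show ?thesis using False by simp
        next
          case jk: False
          then show ?thesis using opt[unfolded optimal_def, THEN conjunct2, rule_format, of j] j
            by (cases "H (Suc j)") simp_all
        qed
      qed (use s in simp)
      show "zeros n J k (upd s ''g'' (1 + int k) (e (Suc k) + P * s ''d'' (1 + int k)))"
        unfolding zeros_def
      proof (intro allI impI)
        fix j
        assume j: "k \<le> j \<and> j < J \<and> n \<le> j \<and> pr j \<noteq> 0"
        then have "j \<noteq> k" using False pad[of "Suc k"] by auto
        then show "upd s ''g'' (1 + int k) (e (Suc k) + P * s ''d'' (1 + int k)) ''g'' (1 + int j) = 0"
          using zs j by (simp add: zeros_def)
      qed
      have U0: "0 \<le> U" by (rule UU(4))
      show "\<bar>upd s ''g'' (1 + int k) (e (Suc k) + P * s ''d'' (1 + int k)) ''d'' (int j)\<bar> \<le> D + 5 * U" for j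
        using D(1)[of j] U0 by simp
    qed (use s in simp_all)
    ultimately show ?thesis using e s False by (simp add: bstep_def)
  next
    case h: True
    have nodes: "\<forall>j \<le> Suc k. node s j" "s ''u'' (int k) = int (pr k)"
      using built k by (auto simp: built_def)
    have pop: "wp M (b_setup ;; b_search ;; b_assign) G t' s" if t': "t' \<le> t + 100" for t'
    proof (rule wp_b_pop[OF h kN nodes s(1) e(1) s(2,3) pe D])
      fix t'' s'
      assume 1: "int t'' \<le> int t' + 1500 * (LL k + 3)" "agree BS s s'" "step_opt k s'"
        and g0: "n \<le> k \<Longrightarrow> pr k \<noteq> 0 \<Longrightarrow> s' ''g'' (1 + int k) = 0"
        and d: "\<And>j. j \<noteq> k \<Longrightarrow> j \<noteq> pr k \<or> pr k = 0 \<Longrightarrow> s' ''d'' (int j) = s ''d'' (int j)"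
        and g: "\<And>j. j \<noteq> Suc k \<Longrightarrow> s' ''g'' (int j) = s ''g'' (int j)"
        and D': "\<And>j. \<bar>s' ''d'' (int j)\<bar> \<le> D + 5 * U"
      have k0: "0 < k" using h H1 by (cases k) auto
      show "G t'' s'"
      proof (rule post)
        show "int t'' \<le> int t + 1600 * (Lm + 3)" using 1(1) t' L by simp
        show d0: "s' ''d'' 0 = 0" using d[of 0] k0 s(3) by (cases "pr k = 0") auto
        show "s' ''d'' (int J) = 0" using d[of J] k pr_le[of k] s(4) by auto
        show "zeros n J k s'"
          unfolding zeros_def
        proof (intro allI impI)
          fix j
          assume j: "k \<le> j \<and> j < J \<and> n \<le> j \<and> pr j \<noteq> 0"
          show "s' ''g'' (1 + int j) = 0"
          proof (cases "j = k")
            case True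
            then show ?thesis using g0 j by simp
          next
            case False
            then show ?thesis using g[of "Suc j"] zs j by (simp add: zeros_def)
          qed
        qed
        show "optimal k (\<lambda>j. s' ''d'' (int j)) (\<lambda>j. s' ''g'' (int j)) J"
          unfolding optimal_def
        proof (intro conjI allI impI)
          show "s' ''d'' (int 0) = 0" using d0 by simp
          fix j
          assume j: "k \<le> j \<and> j < J"
          show "if H (Suc j) then \<exists>m y. s' ''d'' (int j) = R * m \<and> s' ''g'' (int (Suc j)) = e (Suc j) + P * y
              \<and> s' ''d'' (int (Suc j)) = m + s' ''d'' (int (pr j)) + y
              \<and> F j (s' ''d'' (int j)) + F (pr j) (s' ''d'' (int (pr j))) + \<bar>s' ''g'' (int (Suc j))\<bar> \<le> F (Suc j) (s' ''d'' (int (Suc j)))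
            else s' ''g'' (int (Suc j)) = e (Suc j) + P * s' ''d'' (int (Suc j))"
          proof (cases "j = k")
            case True
            then show ?thesis using h 1(3) by (simp add: step_opt_def[OF h kN])
          next
            case False
            then have jk: "Suc k \<le> j" using j by simp
            have pk: "pr k < k" using pr_less[OF k0] .
            \<comment> \<open>The node \<open>k\<close> is about to write the demands of
              \<open>k\<close> and \<open>pr k\<close>. Nested brackets imply that no later position
              has one of these as its left child, so the conditions established for later positions
              survive.\<close>
            have "pr j \<noteq> k \<and> (pr j \<noteq> pr k \<or> pr k = 0)"
            proof (cases "pr j < Suc k")
              case True
              then have le: "pr j \<le> pr (pr k)" using pr_nested[OF jk True] h by simp
              show ?thesis
              proof (cases "pr k = 0")
                case True
                then show ?thesis using le pk by simp
              next
                case F: False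
                then have "pr (pr k) < pr k" using pr_less[of "pr k"] by simp
                then show ?thesis using le pk by simp
              qed
            next
              case F: False
              then show ?thesis using pk by simp
            qed
            then have "s' ''d'' (int (pr j)) = s ''d'' (int (pr j))" by (intro d) auto
            moreover have "s' ''d'' (int j) = s ''d'' (int j)" using jk pk by (intro d) auto
            moreover have "s' ''d'' (int (Suc j)) = s ''d'' (int (Suc j))" using jk pk by (intro d) auto
            moreover have "s' ''g'' (int (Suc j)) = s ''g'' (int (Suc j))" using jk by (intro g) auto
            ultimately show ?thesis using opt[unfolded optimal_def, THEN conjunct2, rule_format, of j] j jk
              by (cases "H (Suc j)") simp_all
          qed
        qed
      qed (use 1 D' in auto)
    qed
    then show ?thesis using e s h unfolding bstep_def by (simp del: wp_Seq)
  qed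
qed

lemma wp_backtrack:
  assumes k: "J \<le> N" and built: "built J s" and data: "data J s"
    and s: "s ''J'' 0 = int J" "s ''n'' 0 = int n" "\<And>j. s ''d'' (int j) = 0"
    and pad: "\<And>i. n < i \<Longrightarrow> H i \<and> e i = 0" and L: "\<And>i. i \<le> N \<Longrightarrow> LL i \<le> Lm" "0 \<le> Lm"
    and post: "\<And>t' s'. int t' \<le> int t + int (J + 1) * (1700 * (Lm + 3)) \<Longrightarrow> agree (insert ''i'' BS) s s'
      \<Longrightarrow> optimal 0 (\<lambda>j. s' ''d'' (int j)) (\<lambda>j. s' ''g'' (int j)) J \<Longrightarrow> zeros n J 0 s' \<Longrightarrow> s' ''d'' (int J) = 0 \<Longrightarrow> G t' s'"
  shows "wp M backtrack G t s"
proof -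
  let ?b = "Lit 0 \<prec> V ''i''"
  let ?I = "\<lambda>q t' s'. agree (insert ''i'' BS) s s' \<and> s' ''i'' 0 = int (J - q)
    \<and> optimal (J - q) (\<lambda>j. s' ''d'' (int j)) (\<lambda>j. s' ''g'' (int j)) J \<and> zeros n J (J - q) s' \<and> s' ''d'' (int J) = 0 \<and> s' ''d'' 0 = 0
    \<and> (\<forall>j. \<bar>s' ''d'' (int j)\<bar> \<le> 3 * (U * U) + 5 * U * int q)
    \<and> int t' \<le> int t + 5 + int q * (1700 * (Lm + 3))"
  have JU: "int J \<le> U" using NU k by simp
  have "wp M (While ?b (bstep ;; ''i'' ::= V ''i'' \<ominus> Lit 1)) G (Suc (Suc (Suc (Suc t)))) (upd s ''i'' 0 (int J))"
  proof (rule wp_for[where I = ?I and N = J])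
    show "?I 0 (Suc (Suc (Suc (Suc t)))) (upd s ''i'' 0 (int J))"
      using s UU by (auto simp: optimal_def zeros_def s(3)[of 0, simplified])
  next
    fix q t' s'
    assume q: "q < J" and I: "?I q t' s'"
    define k where "k = J - Suc q"
    have kq: "J - q = Suc k" using q by (simp add: k_def)
    have ag: "agree (insert ''i'' BS) s s'" using I by simp
    have built': "built J s'"
      using built node_agree[OF ag] agreeD[OF ag, of "''u''"] by (simp add: built_def BS_def)
    have data': "data J s'"
      using data agreeD[OF ag, of "''e''"] agreeD[OF ag, of "''h''"] by (simp add: data_def BS_def)
    have s': "s' ''i'' 0 = 1 + int k" "s' ''n'' 0 = int n" "s' ''d'' 0 = 0" "s' ''d'' (int J) = 0"
      using I kq s agreeD[OF ag, of "''n''"] by (simp_all add: BS_def)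
    have "5 * U * int q \<le> 5 * U * U" using q JU UU(4) by (intro mult_left_mono) auto
    then have D: "3 * (U * U) + 5 * U * int q \<le> 8 * (U * U)" "3 * (U * U) \<le> 3 * (U * U) + 5 * U * int q"
      using UU(4) by auto
    have kM: "\<bar>int k\<bar> \<le> M" using q JU UU by (simp add: k_def)
    define Z where "Z = ?I (Suc q)"
    have "wp M bstep (wp M (''i'' ::= V ''i'' \<ominus> Lit 1) Z) (t' + cost_bexp ?b) s'"
    proof (rule wp_bstep[OF _ k built' data' s' pad _ _ _ D(2,1) L(1) L(2)])
      show "Suc k \<le> J" "k \<le> N" using q k by (auto simp: k_def)
      show "optimal (Suc k) (\<lambda>j. s' ''d'' (int j)) (\<lambda>j. s' ''g'' (int j)) J" "zeros n J (Suc k) s'" using I kq by simp_all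
      show "\<bar>s' ''d'' (int j)\<bar> \<le> 3 * (U * U) + 5 * U * int q" for j using I by simp
      fix t3 s3
      assume 3: "int t3 \<le> int (t' + cost_bexp ?b) + 1600 * (Lm + 3)" "agree BS s' s3"
        "optimal k (\<lambda>j. s3 ''d'' (int j)) (\<lambda>j. s3 ''g'' (int j)) J" "zeros n J k s3" "s3 ''d'' (int J) = 0" "s3 ''d'' 0 = 0"
        "\<And>j. \<bar>s3 ''d'' (int j)\<bar> \<le> 3 * (U * U) + 5 * U * int q + 5 * U"
      have "agree (insert ''i'' BS) s s3" by (rule agree_trans[OF ag 3(2)]) auto
      moreover have "s3 ''i'' 0 = 1 + int k" using agreeD[OF 3(2), of "''i''"] s' by (simp add: BS_def)
      ultimately show "wp M (''i'' ::= V ''i'' \<ominus> Lit 1) Z t3 s3"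
        using 3 kM I L(2) by (simp add: Z_def k_def[symmetric] zeros_def[of n J k "upd s3 ''i'' 0 (int k)"] zeros_def[of n J k s3] algebra_simps)
    qed
    then show "eval_bexp ?b s' \<and> wp M (bstep ;; ''i'' ::= V ''i'' \<ominus> Lit 1) (?I (Suc q)) (t' + cost_bexp ?b) s'"
      using s' unfolding Z_def wp_Seq by simp
  next
    fix t' s'
    assume I: "?I J t' s'"
    then have "G (t' + cost_bexp ?b) s'"
      using L(2) by (intro post) (auto simp: algebra_simps)
    then show "\<not> eval_bexp ?b s' \<and> G (t' + cost_bexp ?b) s'" using I by simp
  qed
  then show ?thesis
    using s JU UU by (simp add: backtrack_def)
qed

end

section \<open>The sweep over all nodes\<close>

context prog
begin

definition loopA :: com where
  "loopA = While (V ''i'' \<prec> V ''n'')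
     (''i'' ::= V ''i'' \<oplus> Lit 1 ;;
      Cond (Cell ''h'' (V ''i'') \<prec> Lit 0) leafstep
        (tstep ;; Cond (Cell ''u'' (V ''i'' \<ominus> Lit 1) \<prec> Lit 1) (''P'' ::= V ''i'') Skip))"

definition pad_step :: com where
  "pad_step = (''i'' ::= V ''i'' \<oplus> Lit 1 ;; Store ''h'' (V ''i'') (Lit 1) ;; Store ''e'' (V ''i'') (Lit 0) ;; tstep)"

definition loopB :: com where
  "loopB = While (Lit 0 \<prec> Cell ''u'' (V ''i'')) pad_step"

text \<open>A spur of j levels costs at least the 2j letters \<open>t\<close> and \<open>T\<close>.
  The search can stop as soon as twice the number of levels tried reaches the best value
  found.\<close>

definition loopC :: com where
  "loopC = While ((V ''i'' \<ominus> V ''N'') \<oplus> (V ''i'' \<ominus> V ''N'') \<prec> V ''B'')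
     (pad_step ;; EV (V ''i'') (Lit 0) ;;
      ''o'' ::= V ''y'' \<oplus> ((V ''i'' \<ominus> V ''N'') \<oplus> (V ''i'' \<ominus> V ''N'')) ;;
      Cond (V ''o'' \<prec> V ''B'') (''B'' ::= V ''o'' ;; ''J'' ::= V ''i'') Skip)"

definition forward :: com where
  "forward = (''i'' ::= Lit 1 ;; ''P'' ::= Lit 1 ;; leafstep ;; loopA ;; loopB ;;
     ''N'' ::= V ''i'' ;; ''J'' ::= V ''i'' ;; EV (V ''i'') (Lit 0) ;; ''B'' ::= V ''y'' ;; loopC)"

definition FS :: "string set" where
  "FS = TS \<union> {''i'', ''h'', ''e'', ''P'', ''N'', ''J'', ''B''}"

text \<open>The position behind the last \<open>t\<close> that no earlier \<open>T\<close> matches,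
  or position 1. It lies on the highest level of the expression, and the spur will be inserted
  there.\<close>

definition top :: "nat \<Rightarrow> int \<Rightarrow> bool" where
  "top i x \<longleftrightarrow> (\<exists>m. x = int m \<and> 1 \<le> m \<and> m \<le> i \<and> pr m = 0 \<and> (\<forall>j. m \<le> j \<and> j < i \<and> H (Suc j) \<longrightarrow> pr j \<noteq> 0))"

context
  fixes n :: nat
  assumes n1: "1 \<le> n" and pad: "\<And>i. n < i \<Longrightarrow> H i \<and> e i = 0"
begin

definition fwd :: "nat \<Rightarrow> state \<Rightarrow> state \<Rightarrow> bool" where
  "fwd i s0 s \<longleftrightarrow> agree FS s0 s \<and> built i s \<and> data (max i n) s \<and> s ''i'' 0 = int i \<and> s ''n'' 0 = int n"

definition cost :: "nat \<Rightarrow> int" where "cost i = (\<Sum>j=1..i. 2000 * work j + 500)"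

lemma cost_Suc: "cost (Suc i) = cost i + (2000 * work (Suc i) + 500)"
  by (simp add: cost_def)

lemma built_upd: "x \<notin> {''c'', ''l'', ''v'', ''u''} \<Longrightarrow> built i (upd s x k v) = built i s"
  by (auto simp: built_def)

lemma data_upd: "x \<notin> {''e'', ''h''} \<Longrightarrow> data i (upd s x k v) = data i s"
  by (auto simp: data_def)

lemma inFS: "''i'' \<in> FS" "''h'' \<in> FS" "''e'' \<in> FS" "''P'' \<in> FS" "''N'' \<in> FS" "''J'' \<in> FS" "''B'' \<in> FS"
    "''z'' \<in> FS" "''y'' \<in> FS" "''o'' \<in> FS" "''n'' \<notin> FS" "''u'' \<in> FS"
  by (auto simp: FS_def TS_def)

lemma notTS: "''i'' \<notin> TS" "''h'' \<notin> TS" "''e'' \<notin> TS" "''P'' \<notin> TS" "''N'' \<notin> TS" "''J'' \<notin> TS" "''B'' \<notin> TS" "''n'' \<notin> TS"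
  by (auto simp: TS_def)

lemma fwd_TS:
  assumes "agree FS s0 s" "data (max i n) s" "s ''i'' 0 = int i" "s ''n'' 0 = int n" "agree TS s s'" "built i s'"
  shows "fwd i s0 s'"
proof -
  have "agree FS s0 s'" by (rule agree_trans[OF assms(1,5)]) (auto simp: FS_def)
  then show ?thesis
    using assms agreeD[OF assms(5)] by (simp add: fwd_def data_def notTS)
qed

lemma iM: "i \<le> N \<Longrightarrow> \<bar>int i\<bar> \<le> M"
  using NU UU by simp

lemma wp_loopA:
  assumes f: "fwd 1 s0 s" and top: "top 1 (s ''P'' 0)" and nN: "n \<le> N"
    and post: "\<And>t' s'. int t' \<le> int t + cost n + 10 \<Longrightarrow> fwd n s0 s' \<Longrightarrow> top n (s' ''P'' 0) \<Longrightarrow> G t' s'"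
  shows "wp M loopA G t s"
proof -
  let ?b = "V ''i'' \<prec> V ''n''"
  let ?I = "\<lambda>q t' s. fwd (Suc q) s0 s \<and> top (Suc q) (s ''P'' 0) \<and> int t' \<le> int t + cost (Suc q)"
  show ?thesis
    unfolding loopA_def
  proof (rule wp_for[where I = ?I and N = "n - 1"])
    have "0 \<le> cost (Suc 0)" using work_nonneg[of 1] by (simp add: cost_def)
    then show "?I 0 t s" using f top by simp
  next
    fix q t' s
    assume q: "q < n - 1" and I: "?I q t' s"
    let ?k = "Suc q"
    define Z where "Z = ?I (Suc q)"
    define s1 where "s1 = upd s ''i'' 0 (int (Suc ?k))"
    have F: "agree FS s0 s" "built ?k s" "data n s" "s ''i'' 0 = int ?k" "s ''n'' 0 = int n"
    proof -
      have "max ?k n = n" using q by simp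
      then show "agree FS s0 s" "built ?k s" "data n s" "s ''i'' 0 = int ?k" "s ''n'' 0 = int n"
        using I by (simp_all add: fwd_def)
    qed
    have kN: "Suc ?k \<le> N" "Suc ?k \<le> n" using q nN by auto
    have s1: "agree FS s0 s1" "built ?k s1" "data (max (Suc ?k) n) s1" "s1 ''i'' 0 = int (Suc ?k)" "s1 ''n'' 0 = int n"
        "s1 ''P'' = s ''P''"
      using F kN by (simp_all add: s1_def inFS built_upd data_upd max_def)
    have eh: "s1 ''e'' (int (Suc ?k)) = e (Suc ?k)" "s1 ''h'' (int (Suc ?k)) = (if H (Suc ?k) then 1 else - 1)"
      using s1(3) kN by (auto simp: data_def simp del: of_nat_Suc)
    have leaf: "wp M leafstep Z t3 s1" if "\<not> H (Suc ?k)" "t3 \<le> t' + 50" for t3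
    proof (rule wp_leafstep[OF s1(2) that(1) kN(1) s1(4) eh(1)])
      fix t4 s4
      assume 4: "t4 \<le> t3 + 100" "agree TS s1 s4" "built (Suc ?k) s4"
      have "fwd (Suc ?k) s0 s4" using fwd_TS[OF s1(1,3,4,5) 4(2,3)] .
      moreover have "s4 ''P'' = s ''P''" using agreeD[OF 4(2), of "''P''"] s1(6) by (simp add: notTS)
      moreover have "top (Suc ?k) (s ''P'' 0)"
        using I that(1) unfolding top_def by (metis le_Suc_eq less_Suc_eq)
      moreover have "int t4 \<le> int t + cost (Suc ?k)"
        using that(2) 4(1) I work_nonneg[of "Suc ?k"] by (simp add: cost_Suc[of ?k])
      ultimately show "Z t4 s4" by (simp add: Z_def)
    qed
    have pop: "wp M tstep (wp M (Cond (Cell ''u'' (V ''i'' \<ominus> Lit 1) \<prec> Lit 1) (''P'' ::= V ''i'') Skip) Z) t3 s1"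
      if h: "H (Suc ?k)" and t3: "t3 \<le> t' + 50" for t3
    proof (rule wp_tstep[OF h kN(1) s1(2,4) eh(1)])
      fix t4 s4
      assume 4: "int t4 \<le> int t3 + 2000 * work (Suc ?k)" "agree TS s1 s4" "built (Suc ?k) s4"
      have f4: "fwd (Suc ?k) s0 s4" using fwd_TS[OF s1(1,3,4,5) 4(2,3)] .
      have P4: "s4 ''P'' = s ''P''" using agreeD[OF 4(2), of "''P''"] s1(6) by (simp add: notTS)
      have u4: "s4 ''u'' (int ?k) = int (pr ?k)" "s4 ''i'' 0 = int (Suc ?k)" using 4(3)[unfolded built_def, rule_format, of ?k] f4 by (auto simp: fwd_def)
      have t4: "int t5 \<le> int t + cost (Suc ?k)" if "t5 \<le> t4 + 50" for t5
        using that t3 4(1) I by (simp add: cost_Suc[of ?k])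
      show "wp M (Cond (Cell ''u'' (V ''i'' \<ominus> Lit 1) \<prec> Lit 1) (''P'' ::= V ''i'') Skip) Z t4 s4"
      proof (cases "pr ?k = 0")
        case True
        have "top (Suc ?k) (int (Suc ?k))" using True h unfolding top_def by (intro exI[of _ "Suc ?k"]) simp
        then have Z: "Z t5 (upd s4 ''P'' 0 (int (Suc ?k)))" if "t5 \<le> t4 + 50" for t5
          using t4[OF that] f4 by (simp add: Z_def fwd_def inFS built_upd data_upd)
        show ?thesis using Z iM[OF kN(1)] u4 True by simp
      next
        case False
        then have "top (Suc ?k) (s ''P'' 0)"
          using I unfolding top_def by (metis le_Suc_eq less_Suc_eq)
        then have Z: "Z t5 s4" if "t5 \<le> t4 + 50" for t5
          using t4[OF that] f4 P4 by (simp add: Z_def)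
        show ?thesis using Z u4 False by simp
      qed
    qed
    have W: "wp M (''i'' ::= V ''i'' \<oplus> Lit 1 ;; Cond (Cell ''h'' (V ''i'') \<prec> Lit 0) leafstep
        (tstep ;; Cond (Cell ''u'' (V ''i'' \<ominus> Lit 1) \<prec> Lit 1) (''P'' ::= V ''i'') Skip)) Z (t' + cost_bexp ?b) s"
    proof -
      have k1: "int ?k + 1 = int (Suc ?k)" by simp
      show ?thesis
        using iM[OF kN(1)] leaf pop
        by (cases "H (Suc ?k)") (simp_all add: F k1 eh(2) s1_def[symmetric] s1(4) del: of_nat_Suc)
    qed
    have b: "eval_bexp ?b s" using F kN by simp
    show "eval_bexp ?b s \<and> wp M (''i'' ::= V ''i'' \<oplus> Lit 1 ;; Cond (Cell ''h'' (V ''i'') \<prec> Lit 0) leafstep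
        (tstep ;; Cond (Cell ''u'' (V ''i'' \<ominus> Lit 1) \<prec> Lit 1) (''P'' ::= V ''i'') Skip)) (?I (Suc q)) (t' + cost_bexp ?b) s"
      by (rule conjI[OF b W[unfolded Z_def]])
  next
    fix t' s
    assume I: "?I (n - 1) t' s"
    then have "fwd n s0 s" "top n (s ''P'' 0)" "int t' \<le> int t + cost n" using n1 by auto
    then show "\<not> eval_bexp ?b s \<and> G (t' + cost_bexp ?b) s" by (auto simp: fwd_def intro!: post)
  qed
qed

lemma wp_pad_step:
  assumes f: "fwd k s0 s" and k: "n \<le> k" "Suc k \<le> N"
    and post: "\<And>t' s'. int t' \<le> int t + 2000 * work (Suc k) + 100 \<Longrightarrow> fwd (Suc k) s0 s' \<Longrightarrow> agree (TS \<union> {''i'', ''h'', ''e''}) s s' \<Longrightarrow> G t' s'"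
  shows "wp M pad_step G t s"
proof -
  have F: "agree FS s0 s" "built k s" "data k s" "s ''i'' 0 = int k" "s ''n'' 0 = int n"
    using f k by (auto simp: fwd_def max_def split: if_splits)
  have h: "H (Suc k)" "e (Suc k) = 0" using pad[of "Suc k"] k by auto
  define s1 where "s1 = upd (upd (upd s ''i'' 0 (int (Suc k))) ''h'' (int (Suc k)) 1) ''e'' (int (Suc k)) 0"
  have s1: "agree FS s0 s1" "built k s1" "s1 ''i'' 0 = int (Suc k)" "s1 ''n'' 0 = int n"
    using F by (simp_all add: s1_def inFS built_upd)
  have d1: "data (max (Suc k) n) s1"
  proof -
    have "s1 ''e'' (int j) = e j \<and> s1 ''h'' (int j) = (if H j then 1 else - 1)" if "1 \<le> j" "j \<le> Suc k" for j
    proof (cases "j = Suc k")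
      case True
      then show ?thesis using h by (simp add: s1_def)
    next
      case False
      then show ?thesis using F(3) that by (simp add: s1_def data_def del: of_nat_Suc)
    qed
    then show ?thesis using k by (simp add: data_def max_def)
  qed
  have e1: "s1 ''e'' (int (Suc k)) = e (Suc k)" by (simp add: s1_def h)
  have t: "wp M tstep G t3 s1" if "t3 \<le> t + 100" for t3
  proof (rule wp_tstep[OF h(1) k(2) s1(2,3) e1])
    fix t4 s4
    assume 4: "int t4 \<le> int t3 + 2000 * work (Suc k)" "agree TS s1 s4" "built (Suc k) s4"
    show "G t4 s4"
    proof (rule post)
      show "int t4 \<le> int t + 2000 * work (Suc k) + 100" using 4(1) that by simp
      show "fwd (Suc k) s0 s4" by (rule fwd_TS[OF s1(1) d1 s1(3,4) 4(2,3)])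
      have "agree {''i'', ''h'', ''e''} s s1" by (simp add: s1_def)
      then show "agree (TS \<union> {''i'', ''h'', ''e''}) s s4" by (rule agree_trans[OF _ 4(2)]) auto
    qed
  qed
  have k1: "int k + 1 = int (Suc k)" by simp
  then show ?thesis
    using iM[OF k(2)] t by (simp add: pad_step_def F k1 s1_def[symmetric] del: of_nat_Suc)
qed

section \<open>Padding up to a root and choosing the spur\<close>

text \<open>The stack has at most \<open>n\<close> entries at position \<open>n\<close>, and every
  padding letter \<open>t\<close> removes one as long as more than one is left.\<close>

lemma root_exists: "\<exists>m \<ge> n. m \<le> 2 * n \<and> pr m = 0 \<and> (\<forall>j. n \<le> j \<and> j < m \<longrightarrow> pr j \<noteq> 0)"
proof -
  let ?g = "\<lambda>i::nat. if i = 0 then 0 else 1 :: int"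
  have up: "ch ?g i \<le> int i" for i
    using ch_le_sum[of ?g i "\<lambda>_. 1"] by simp
  have *: "ch ?g (n + m) = ch ?g n - int m" if "\<forall>j. n \<le> j \<and> j < n + m \<longrightarrow> pr j \<noteq> 0" for m
    using that
  proof (induction m)
    case (Suc m)
    have "pr (n + m) \<noteq> 0" using Suc.prems by simp
    then show ?case
      using Suc ch_pop[of ?g "n + m"] pad[of "Suc (n + m)"] n1 by simp
  qed simp
  have ex: "\<exists>m \<le> n. pr (n + m) = 0"
  proof (rule ccontr)
    assume "\<not> ?thesis"
    then have nz: "\<forall>j. n \<le> j \<and> j < n + n \<longrightarrow> pr j \<noteq> 0" by (metis le_add_diff_inverse less_diff_conv2 less_imp_le)
    have "ch ?g (n + n) \<ge> ?g (n + n)" by (rule ch_ge_head) auto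
    then show False using *[OF nz] up[of n] n1 by simp
  qed
  define m where "m = (LEAST m. pr (n + m) = 0)"
  obtain m' where m': "m' \<le> n" "pr (n + m') = 0" using ex by blast
  have 1: "pr (n + m) = 0" unfolding m_def by (rule LeastI[where P = "\<lambda>m. pr (n + m) = 0", OF m'(2)])
  have 2: "m \<le> n"
    unfolding m_def by (rule order_trans[OF Least_le[where P = "\<lambda>m. pr (n + m) = 0", OF m'(2)] m'(1)])
  have 3: "pr j \<noteq> 0" if "n \<le> j" "j < n + m" for j
  proof -
    have "j - n < m" using that by simp
    then have "pr (n + (j - n)) \<noteq> 0" unfolding m_def by (rule not_less_Least)
    then show ?thesis using that(1) by simp
  qed
  show ?thesis
  proof (intro exI[of _ "n + m"] conjI allI impI)
    show "n \<le> n + m" by simp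
    show "n + m \<le> 2 * n" using 2 by simp
    show "pr (n + m) = 0" by (rule 1)
    show "pr j \<noteq> 0" if "n \<le> j \<and> j < n + m" for j using 3 that by blast
  qed
qed

definition root :: nat where
  "root = (SOME m. n \<le> m \<and> m \<le> 2 * n \<and> pr m = 0 \<and> (\<forall>j. n \<le> j \<and> j < m \<longrightarrow> pr j \<noteq> 0))"

lemma root: "n \<le> root" "root \<le> 2 * n" "pr root = 0" "\<And>j. n \<le> j \<Longrightarrow> j < root \<Longrightarrow> pr j \<noteq> 0"
proof -
  have "n \<le> root \<and> root \<le> 2 * n \<and> pr root = 0 \<and> (\<forall>j. n \<le> j \<and> j < root \<longrightarrow> pr j \<noteq> 0)"
    unfolding root_def by (rule someI_ex) (use root_exists in blast)
  then show "n \<le> root" "root \<le> 2 * n" "pr root = 0" "\<And>j. n \<le> j \<Longrightarrow> j < root \<Longrightarrow> pr j \<noteq> 0" by blast+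
qed

lemma wp_loopB:
  assumes f: "fwd n s0 s" and rN: "root \<le> N"
    and post: "\<And>t' s'. int t' \<le> int t + (cost root - cost n) + 10 \<Longrightarrow> fwd root s0 s' \<Longrightarrow> s' ''P'' = s ''P'' \<Longrightarrow> G t' s'"
  shows "wp M loopB G t s"
proof -
  let ?b = "Lit 0 \<prec> Cell ''u'' (V ''i'')"
  let ?I = "\<lambda>q t' s'. fwd (n + q) s0 s' \<and> s' ''P'' = s ''P'' \<and> int t' \<le> int t + (cost (n + q) - cost n)"
  show ?thesis
    unfolding loopB_def
  proof (rule wp_for[where I = ?I and N = "root - n"])
    show "?I 0 t s" using f by simp
  next
    fix q t' s'
    assume q: "q < root - n" and I: "?I q t' s'"
    define Z where "Z = ?I (Suc q)"
    have "pr (n + q) \<noteq> 0" using q by (intro root(4)) auto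
    moreover have "s' ''u'' (int (n + q)) = int (pr (n + q))" "s' ''i'' 0 = int (n + q)"
      using I by (auto simp: fwd_def built_def simp del: of_nat_add)
    ultimately have b: "eval_bexp ?b s'" by simp
    have "wp M pad_step Z (t' + cost_bexp ?b) s'"
    proof (rule wp_pad_step)
      show "fwd (n + q) s0 s'" "n \<le> n + q" "Suc (n + q) \<le> N" using I q rN by auto
      fix t3 s3
      assume 3: "int t3 \<le> int (t' + cost_bexp ?b) + 2000 * work (Suc (n + q)) + 100" "fwd (Suc (n + q)) s0 s3"
        "agree (TS \<union> {''i'', ''h'', ''e''}) s' s3"
      have "s3 ''P'' = s' ''P''" using agreeD[OF 3(3), of "''P''"] by (simp add: notTS)
      then show "Z t3 s3" using 3 I cost_Suc[of "n + q"] by (simp add: Z_def)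
    qed
    then show "eval_bexp ?b s' \<and> wp M pad_step (?I (Suc q)) (t' + cost_bexp ?b) s'"
      using b unfolding Z_def by blast
  next
    fix t' s'
    assume I: "?I (root - n) t' s'"
    then have r: "fwd root s0 s'" "s' ''P'' = s ''P''" "int t' \<le> int t + (cost root - cost n)" using root(1) by auto
    then have "s' ''u'' (int root) = 0" "s' ''i'' 0 = int root"
      using root(3) by (auto simp: fwd_def built_def)
    then show "\<not> eval_bexp ?b s' \<and> G (t' + cost_bexp ?b) s'" using r by (auto intro!: post)
  qed
qed

text \<open>Length of the best word whose spur has \<open>j\<close> levels, not counting the
  \<open>n - 1\<close> letters of the reduced expression.\<close>

definition val :: "nat \<Rightarrow> int" where "val j = F (root + j) 0 + 2 * int j"

lemma val_ge: "2 * int j \<le> val j"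
  using F_nonneg[of "root + j" 0] by (simp add: val_def)

lemma cost_mono: "i \<le> j \<Longrightarrow> cost i \<le> cost j"
  by (rule lift_Suc_mono_le[of cost]) (use work_nonneg in \<open>auto simp: cost_Suc add_nonneg_nonneg\<close>)

lemma wp_loopC:
  assumes f: "fwd root s0 s" and s: "s ''N'' 0 = int root" "s ''J'' 0 = int root" "s ''B'' 0 = val 0"
    and gN: "root + g + 1 \<le> N" and g: "\<exists>j. val j \<le> int g"
    and post: "\<And>t' s' j i. int t' \<le> int t + (cost (root + g + 1) - cost root) + 20 + 200 * int (g + 1) \<Longrightarrow> fwd i s0 s' \<Longrightarrow> s' ''P'' = s ''P'' \<Longrightarrow>
       s' ''N'' 0 = int root \<Longrightarrow> s' ''J'' 0 = int (root + j) \<Longrightarrow> root + j \<le> i \<Longrightarrow> i \<le> N \<Longrightarrow> (\<And>j'. val j \<le> val j') \<Longrightarrow> G t' s'"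
  shows "wp M loopC G t s"
proof -
  let ?b = "(V ''i'' \<ominus> V ''N'') \<oplus> (V ''i'' \<ominus> V ''N'') \<prec> V ''B''"
  let ?body = "pad_step ;; EV (V ''i'') (Lit 0) ;;
      ''o'' ::= V ''y'' \<oplus> ((V ''i'' \<ominus> V ''N'') \<oplus> (V ''i'' \<ominus> V ''N'')) ;;
      Cond (V ''o'' \<prec> V ''B'') (''B'' ::= V ''o'' ;; ''J'' ::= V ''i'') Skip"
  define Iq where "Iq = (\<lambda>q t' s'. fwd (root + q) s0 s' \<and> s' ''P'' = s ''P'' \<and> s' ''N'' 0 = int root \<and> q \<le> g + 1
    \<and> (\<exists>j \<le> q. s' ''J'' 0 = int (root + j) \<and> s' ''B'' 0 = val j \<and> (\<forall>j' \<le> q. val j \<le> val j'))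
    \<and> int t' \<le> int t + (cost (root + q) - cost root) + 200 * int q)"
  let ?I = "\<lambda>t' s'. \<exists>q. Iq q t' s'"
  show ?thesis
    unfolding loopC_def
  proof (rule wp_While[where I = ?I and \<mu> = "\<lambda>s. nat (int root + int g + 2 - s ''i'' 0)"])
    show "?I t s" using f s by (intro exI[of _ 0]) (auto simp: Iq_def)
  next
    fix t' s'
    assume "?I t' s'" and b: "eval_bexp ?b s'"
    then obtain q j where q: "Iq q t' s'" and j: "j \<le> q" "s' ''J'' 0 = int (root + j)" "s' ''B'' 0 = val j" "\<forall>j' \<le> q. val j \<le> val j'"
      by (auto simp: Iq_def)
    have si: "s' ''i'' 0 = int (root + q)" using q by (auto simp: Iq_def fwd_def)
    have lt: "2 * int q < val j" using b q j si by (simp add: Iq_def)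
    \<comment> \<open>The best value found never exceeds \<open>g\<close> once an index with value
      at most \<open>g\<close> has been tried, and an index not yet tried with such a value is
      itself at most \<open>g\<close>. Either way the loop stops after at most \<open>g + 1\<close>
      rounds.\<close>
    have qg: "q \<le> g"
    proof -
      obtain jj where jj: "val jj \<le> int g" using g by auto
      show ?thesis
      proof (cases "jj \<le> q")
        case True
        then show ?thesis using j(4) jj lt by force
      next
        case False
        then show ?thesis using jj val_ge[of jj] by simp
      qed
    qed
    define Z where "Z = (\<lambda>t'' s''. ?I t'' s'' \<and> nat (int root + int g + 2 - s'' ''i'' 0) < nat (int root + int g + 2 - s' ''i'' 0))"
    have kN: "Suc (root + q) \<le> N" using gN qg by simp
    have "wp M ?body Z (t' + cost_bexp ?b) s'"
    proof (simp only: wp_Seq, rule wp_pad_step[OF _ _ kN])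
      show "fwd (root + q) s0 s'" "n \<le> root + q" using q root(1) by (auto simp: Iq_def)
      fix t3 s3
      assume 3: "int t3 \<le> int (t' + cost_bexp ?b) + 2000 * work (Suc (root + q)) + 100" "fwd (Suc (root + q)) s0 s3"
        "agree (TS \<union> {''i'', ''h'', ''e''}) s' s3"
      have v3: "s3 ''P'' = s ''P''" "s3 ''N'' 0 = int root" "s3 ''J'' 0 = int (root + j)" "s3 ''B'' 0 = val j"
        using agreeD[OF 3(3)] q j by (auto simp: notTS Iq_def)
      have i3: "s3 ''i'' 0 = int (Suc (root + q))" "node s3 (Suc (root + q))" using 3(2) by (auto simp: fwd_def built_def)
      let ?i = "Suc (root + q)"
      have FM: "\<bar>F ?i 0\<bar> \<le> U" using FU[OF kN] F_nonneg[of ?i 0] by simp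
      define w where "w = F ?i 0 + 2 * int (Suc q)"
      have w: "w = val (Suc q)" by (simp add: w_def val_def)
      have wM: "\<bar>w\<bar> \<le> M" using FM kN NU UU unfolding w_def by simp
      define s4 where "s4 = upd (upd (upd s3 ''z'' 0 0) ''y'' 0 (F ?i 0)) ''o'' 0 w"
      have fw: "fwd ?i s0 (upd s'' x c v)" if "fwd ?i s0 s''" "x \<in> {''z'', ''y'', ''o'', ''B'', ''J''}" for s'' x c v
        using that by (auto simp: fwd_def built_upd data_upd inFS)
      have f4: "fwd ?i s0 s4" unfolding s4_def using 3(2) by (intro fw) auto
      have tm: "int t5 \<le> int t + (cost (root + Suc q) - cost root) + 200 * int (Suc q)" if "t5 \<le> t3 + 150" for t5
        using that 3(1) q cost_Suc[of "root + q"] by (simp add: Iq_def)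
      have fin: "wp M (Cond (V ''o'' \<prec> V ''B'') (''B'' ::= V ''o'' ;; ''J'' ::= V ''i'') Skip) Z t4 s4"
        if t4: "t4 \<le> t3 + 120" for t4
      proof (cases "w < val j")
        case True
        have "\<forall>j' \<le> Suc q. val (Suc q) \<le> val j'" using True w j(4) by (auto simp: le_Suc_eq)
        then have "Iq (Suc q) t5 (upd (upd s4 ''B'' 0 w) ''J'' 0 (int ?i))" if "t5 \<le> t4 + 30" for t5
          using fw[OF fw[OF f4]] v3 w tm[of t5] that t4 qg unfolding Iq_def
          by (auto simp: s4_def intro!: exI[of _ "Suc q"])
        then have Z: "Z t5 (upd (upd s4 ''B'' 0 w) ''J'' 0 (int ?i))" if "t5 \<le> t4 + 30" for t5
          using that si qg i3 unfolding Z_def by (auto simp: s4_def)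
        have s4v: "s4 ''o'' 0 = w" "s4 ''B'' 0 = val j" "s4 ''i'' 0 = int ?i" using v3 i3 by (auto simp: s4_def)
        show ?thesis using True Z iM[OF kN] wM by (simp add: s4v del: of_nat_Suc)
      next
        case False
        have "\<forall>j' \<le> Suc q. val j \<le> val j'" using False w j(4) by (auto simp: le_Suc_eq)
        then have "Iq (Suc q) t5 s4" if "t5 \<le> t4 + 30" for t5
          using f4 v3 j(1) tm[of t5] that t4 qg unfolding Iq_def
          by (auto simp: s4_def intro!: exI[of _ j])
        then have Z: "Z t5 s4" if "t5 \<le> t4 + 30" for t5
          using that si qg i3 unfolding Z_def by (auto simp: s4_def)
        have s4v: "s4 ''o'' 0 = w" "s4 ''B'' 0 = val j" using v3 by (auto simp: s4_def)
        show ?thesis using False Z by (simp add: s4v)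
      qed
      show "wp M (EV (V ''i'') (Lit 0) ;; ''o'' ::= V ''y'' \<oplus> ((V ''i'' \<ominus> V ''N'') \<oplus> (V ''i'' \<ominus> V ''N'')) ;;
         Cond (V ''o'' \<prec> V ''B'') (''B'' ::= V ''o'' ;; ''J'' ::= V ''i'') Skip) Z t3 s3"
      proof (simp only: wp_Seq, rule wp_EV[OF i3(2), where z = 0])
        fix t4
        assume t4: "t4 \<le> t3 + (60 + 20 * cost_exp (V ''i'') + cost_exp (Lit 0))"
        have "F ?i 0 + (int ?i - int root + (int ?i - int root)) = w" by (simp add: w_def)
        then show "wp M (''o'' ::= V ''y'' \<oplus> ((V ''i'' \<ominus> V ''N'') \<oplus> (V ''i'' \<ominus> V ''N'')) ;;
           Cond (V ''o'' \<prec> V ''B'') (''B'' ::= V ''o'' ;; ''J'' ::= V ''i'') Skip) Z t4 (upd (upd s3 ''z'' 0 0) ''y'' 0 (F ?i 0))"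
          using wM t4 i3(1) v3(2) by (simp add: s4_def[symmetric] fin del: of_nat_Suc wp_Cond wp_simps add: wp_Seq wp_Store)
      qed (use i3 FM UU in auto)
    qed
    then show "wp M ?body (\<lambda>t'' s''. ?I t'' s'' \<and> nat (int root + int g + 2 - s'' ''i'' 0) < nat (int root + int g + 2 - s' ''i'' 0)) (t' + cost_bexp ?b) s'"
      unfolding Z_def .
  next
    fix t' s'
    assume "?I t' s'" and b: "\<not> eval_bexp ?b s'"
    then obtain q j where q: "Iq q t' s'" and j: "j \<le> q" "s' ''J'' 0 = int (root + j)" "s' ''B'' 0 = val j" "\<forall>j' \<le> q. val j \<le> val j'"
      by (auto simp: Iq_def)
    have si: "s' ''i'' 0 = int (root + q)" using q by (auto simp: Iq_def fwd_def)
    have le: "val j \<le> 2 * int q" using b q j si by (simp add: Iq_def)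
    show "G (t' + cost_bexp ?b) s'"
    proof (rule post[of _ "root + q" _ j])
      \<comment> \<open>Every untried index j' exceeds q, so its value is at least 2j' and thus
        above 2q, where the loop was left.\<close>
      show "val j \<le> val j'" for j'
      proof (cases "j' \<le> q")
        case False
        then show ?thesis using le val_ge[of j'] by simp
      qed (use j in auto)
      have "cost (root + q) \<le> cost (root + g + 1)" using q by (intro cost_mono) (auto simp: Iq_def)
      moreover have "q \<le> g + 1" "int t' \<le> int t + (cost (root + q) - cost root) + 200 * int q"
        using q by (simp_all add: Iq_def)
      ultimately show "int (t' + cost_bexp ?b) \<le> int t + (cost (root + g + 1) - cost root) + 20 + 200 * int (g + 1)"
        by simp
    qed (use q j gN in \<open>auto simp: Iq_def\<close>)
  qed
qed

lemma wp_forward: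
  assumes s: "built 0 s" "data n s" "s ''n'' 0 = int n"
    and gN: "root + g + 1 \<le> N" and g: "\<exists>j. val j \<le> int g"
    and post: "\<And>t' s' j i. int t' \<le> int t + cost (root + g + 1) + 500 + 200 * int (g + 1) \<Longrightarrow> fwd i s s' \<Longrightarrow> top n (s' ''P'' 0) \<Longrightarrow>
       s' ''N'' 0 = int root \<Longrightarrow> s' ''J'' 0 = int (root + j) \<Longrightarrow> root + j \<le> i \<Longrightarrow> i \<le> N \<Longrightarrow> (\<And>j'. val j \<le> val j') \<Longrightarrow> G t' s'"
  shows "wp M forward G t s"
proof -
  define s1 where "s1 = upd (upd s ''i'' 0 1) ''P'' 0 1"
  have N1: "Suc 0 \<le> N" "n \<le> N" "root \<le> N" using gN root(1) n1 by auto
  have s1: "agree FS s s1" "built 0 s1" "data (max (Suc 0) n) s1" "s1 ''i'' 0 = int (Suc 0)" "s1 ''n'' 0 = int n" "s1 ''P'' 0 = 1"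
    using s n1 by (simp_all add: s1_def inFS built_upd data_upd max_def)
  have e1: "s1 ''e'' (int (Suc 0)) = e (Suc 0)" using s1(3) n1 by (auto simp: data_def)
  have M1: "1 \<le> M" using UU U100 by linarith
  define tl where "tl = (''N'' ::= V ''i'' ;; ''J'' ::= V ''i'' ;; EV (V ''i'') (Lit 0) ;; ''B'' ::= V ''y'' ;; loopC)"
  have rest: "wp M tl G t3 s3"
    if t3: "int t3 \<le> int t + cost root + 200" and f3: "fwd root s s3" and P3: "top n (s3 ''P'' 0)" for t3 s3
  proof -
    have i3: "s3 ''i'' 0 = int root" "node s3 root" using f3 by (auto simp: fwd_def built_def)
    define s4 where "s4 = upd (upd s3 ''N'' 0 (int root)) ''J'' 0 (int root)"
    define s5 where "s5 = upd (upd (upd s4 ''z'' 0 0) ''y'' 0 (F root 0)) ''B'' 0 (F root 0)"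
    have FM: "\<bar>F root 0\<bar> \<le> M" using FU[OF N1(3)] F_nonneg[of root 0] UU by simp
    have f5: "fwd root s s5" using f3 by (simp add: s5_def s4_def fwd_def built_upd data_upd inFS)
    have C: "wp M loopC G t5 s5" if "t5 \<le> t3 + 200" for t5
    proof (rule wp_loopC[OF f5 _ _ _ gN g])
      show "s5 ''N'' 0 = int root" "s5 ''J'' 0 = int root" "s5 ''B'' 0 = val 0"
        by (auto simp: s5_def s4_def val_def)
      fix t6 s6 j i
      assume 6: "int t6 \<le> int t5 + (cost (root + g + 1) - cost root) + 20 + 200 * int (g + 1)" "fwd i s s6" "s6 ''P'' = s5 ''P''"
       "s6 ''N'' 0 = int root" "s6 ''J'' 0 = int (root + j)" "root + j \<le> i" "i \<le> N" "\<And>j'. val j \<le> val j'"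
      show "G t6 s6"
      proof (rule post[OF _ 6(2) _ 6(4-8)])
        show "top n (s6 ''P'' 0)" using P3 6(3) by (simp add: s5_def s4_def)
        show "int t6 \<le> int t + cost (root + g + 1) + 500 + 200 * int (g + 1)" using 6(1) that t3 by linarith
      qed
    qed
    have n4: "node s4 root" using i3 by (simp add: s4_def)
    have E: "wp M (EV (V ''i'') (Lit 0)) (wp M (''B'' ::= V ''y'' ;; loopC) G) t4 s4" if t4: "t4 \<le> t3 + 20" for t4
    proof (rule wp_EV[OF n4, where z = 0])
      fix t5
      assume "t5 \<le> t4 + (60 + 20 * cost_exp (V ''i'') + cost_exp (Lit 0))"
      then show "wp M (''B'' ::= V ''y'' ;; loopC) G t5 (upd (upd s4 ''z'' 0 0) ''y'' 0 (F root 0))"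
        using FM t4 C by (simp add: s5_def[symmetric])
    qed (use i3 FM M1 in \<open>auto simp: s4_def\<close>)
    show ?thesis
      unfolding tl_def using E iM[OF N1(3)] by (simp add: i3 s4_def[symmetric])
  qed
  have body: "wp M leafstep (wp M (loopA ;; loopB ;; tl) G) t3 s1" if t3: "t3 \<le> t + 20" for t3
  proof (rule wp_leafstep[OF s1(2) H1 N1(1) s1(4) e1])
    fix t4 s4
    assume 4: "t4 \<le> t3 + 100" "agree TS s1 s4" "built (Suc 0) s4"
    have f4: "fwd 1 s s4" using fwd_TS[OF s1(1,3,4,5) 4(2,3)] by simp
    have "s4 ''P'' 0 = 1" using agreeD[OF 4(2), of "''P''"] s1(6) by (simp add: notTS)
    then have P4: "top 1 (s4 ''P'' 0)" unfolding top_def using H1 by (intro exI[of _ 1]) simp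
    show "wp M (loopA ;; loopB ;; tl) G t4 s4"
    proof (simp only: wp_Seq, rule wp_loopA[OF f4 P4 N1(2)])
      fix t5 s5
      assume 5: "int t5 \<le> int t4 + cost n + 10" "fwd n s s5" "top n (s5 ''P'' 0)"
      show "wp M (loopB ;; tl) G t5 s5"
      proof (simp only: wp_Seq, rule wp_loopB[OF 5(2) N1(3)])
        fix t6 s6
        assume 6: "int t6 \<le> int t5 + (cost root - cost n) + 10" "fwd root s s6" "s6 ''P'' = s5 ''P''"
        show "wp M tl G t6 s6"
        proof (rule rest)
          show "int t6 \<le> int t + cost root + 200" using 6(1) 5(1) 4(1) t3 by linarith
        qed (use 5 6 in auto)
      qed
    qed
  qed
  define c where "c = (leafstep ;; loopA ;; loopB ;; tl)"
  have "wp M c G t3 s1" if "t3 \<le> t + 20" for t3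
    using body[OF that] by (simp only: c_def wp_Seq)
  then show ?thesis
    unfolding forward_def tl_def[symmetric] c_def[symmetric] using M1 by (simp add: s1_def[symmetric])
qed

end

end

section \<open>Britton reduction\<close>

text \<open>These are the inner sinks: positions entered by \<open>T\<close> and left by
  \<open>t\<close>. A final position entered by \<open>T\<close> is a sink as well and is added
  separately where needed.\<close>

primrec valleys :: "(nat \<Rightarrow> bool) \<Rightarrow> nat \<Rightarrow> nat" where
  "valleys H 0 = 0"
| "valleys H (Suc j) = valleys H j + (if 0 < j \<and> \<not> H j \<and> H (Suc j) then 1 else 0)"

lemma valleys_cong: "(\<And>j. 1 \<le> j \<Longrightarrow> j \<le> n \<Longrightarrow> H j = H' j) \<Longrightarrow> valleys H n = valleys H' n"
  by (induction n) auto

lemma valleys_mono: "m \<le> n \<Longrightarrow> valleys H m \<le> valleys H n"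
  by (rule lift_Suc_mono_le[of "valleys H"]) auto

context bs
begin

text \<open>The factor \<open>(P + Q) - m\<close> exchanges \<open>P\<close> and \<open>Q\<close>,
  so one formula treats both kinds of pinch.\<close>

lemma wd_pinch:
  assumes n: "1 < n" and m: "m = (if H n then P else Q)" and d: "m dvd E n"
  shows "wd H E n @ [tl_of (\<not> H n)] @ a_pow x
    \<approx> wd H (E(n - 1 := E (n - 1) + (E n div m) * ((P + Q) - m) + x)) (n - 1)"
proof -
  obtain k where k: "n = Suc (Suc k)" using n by (metis less_iff_Suc_add add_Suc_right One_nat_def plus_1_eq_Suc add_Suc)
  let ?y = "(E n div m) * ((P + Q) - m)"
  have En: "E n = m * (E n div m)" using d by simp
  have "[tl_of (H n)] @ a_pow (E n) @ [tl_of (\<not> H n)] \<approx> a_pow ?y"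
    using t_pinch[of "E n div m"] T_pinch[of "E n div m"] En by (cases "H n") (simp_all add: m mult.commute)
  then have "wd H E n @ [tl_of (\<not> H n)] @ a_pow x \<approx> wd H E (Suc k) @ a_pow ?y @ a_pow x"
    by (rule eqv_context[where a = "wd H E (Suc k)" and b = "a_pow x"]) (simp_all add: k)
  also have "\<dots> \<approx> wd H E (Suc k) @ a_pow (?y + x)"
    by (rule eqv_right[OF a_pow_add])
  also have "\<dots> \<approx> (wd H E k @ (if k = 0 then [] else [tl_of (H (Suc k))])) @ a_pow (E (Suc k) + (?y + x))"
    using eqv_right[OF a_pow_add[of "E (Suc k)" "?y + x"], of "wd H E k @ (if k = 0 then [] else [tl_of (H (Suc k))])"]
    by simp
  also have "(wd H E k @ (if k = 0 then [] else [tl_of (H (Suc k))])) @ a_pow (E (Suc k) + (?y + x))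
     = wd H (E(n - 1 := E (n - 1) + ?y + x)) (n - 1)"
    using wd_cong[of k H H "E(Suc k := E (Suc k) + ?y + x)" E] by (simp add: k add.assoc)
  finally show ?thesis .
qed

text \<open>\<open>m\<close> is the divisor required by a pinch that the new letter would close.
  Directions are stored as 1 and -1, so opposite letters are those whose codes add up to 0.\<close>

definition britton_step :: com where
  "britton_step =
    (Cond (Cell ''theta'' (V ''i'') \<prec> Lit 0) (''m'' ::= Lit P) (''m'' ::= Lit Q) ;;
     Cond (Conj (Lit 1 \<prec> V ''n'')
        (Conj (Neg (Cell ''h'' (V ''n'') \<oplus> Cell ''theta'' (V ''i'') \<prec> Lit 0))
        (Conj (Neg (Lit 0 \<prec> Cell ''h'' (V ''n'') \<oplus> Cell ''theta'' (V ''i'')))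
          (Cell ''e'' (V ''n'') \<odot> V ''m'' \<prec> Lit 1))))
       (Store ''e'' (V ''n'' \<ominus> Lit 1) (Cell ''e'' (V ''n'' \<ominus> Lit 1)
          \<oplus> (Cell ''e'' (V ''n'') \<oslash> V ''m'') \<otimes> (Lit (P + Q) \<ominus> V ''m'') \<oplus> Cell ''alpha'' (V ''i'')) ;;
        ''n'' ::= V ''n'' \<ominus> Lit 1)
       (''n'' ::= V ''n'' \<oplus> Lit 1 ;; Store ''h'' (V ''n'') (Cell ''theta'' (V ''i'')) ;;
        Store ''e'' (V ''n'') (Cell ''alpha'' (V ''i''))) ;;
     ''i'' ::= V ''i'' \<oplus> Lit 1)"

definition britton :: com where
  "britton = (''n'' ::= Lit 1 ;; Store ''h'' (Lit 1) (Lit (- 1)) ;; Store ''e'' (Lit 1) (Cell ''alpha'' (Lit 0)) ;;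
     ''i'' ::= Lit 1 ;; While (V ''i'' \<prec> V ''k'' \<oplus> Lit 1) britton_step)"

context
  fixes H0 :: "nat \<Rightarrow> bool" and g0 :: "nat \<Rightarrow> int" and k :: nat and M :: int
  assumes H01: "\<not> H0 1" and Mk: "int k + 10 \<le> M" and MQ: "Q \<le> M"
    and Mg: "R ^ k * (\<Sum>j=1..Suc k. \<bar>g0 j\<bar>) \<le> M"
begin

definition input :: "state \<Rightarrow> bool" where
  "input s \<longleftrightarrow> s ''k'' 0 = int k \<and> (\<forall>j \<le> k. s ''alpha'' (int j) = g0 (Suc j))
    \<and> (\<forall>j. 1 \<le> j \<and> j \<le> k \<longrightarrow> s ''theta'' (int j) = (if H0 (Suc j) then 1 else - 1))"

definition hs :: "state \<Rightarrow> nat \<Rightarrow> bool" where "hs s j \<longleftrightarrow> s ''h'' (int j) = 1"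
definition es :: "state \<Rightarrow> nat \<Rightarrow> int" where "es s j = s ''e'' (int j)"

text \<open>The second inequality counts the last position as a sink when it is entered by
  \<open>T\<close>; pushing a \<open>t\<close> creates precisely this valley, so both counts are
  carried along. The bound on the exponents reflects that one step multiplies an exponent by at most
  \<open>R\<close>; after k steps this adds a number of bits linear in k.\<close>

definition stack :: "nat \<Rightarrow> nat \<Rightarrow> (nat \<Rightarrow> bool) \<Rightarrow> (nat \<Rightarrow> int) \<Rightarrow> bool" where
  "stack i n H E \<longleftrightarrow> 1 \<le> n \<and> n \<le> i \<and> \<not> H 1 \<and> reduced H E n \<and> wd H E n \<approx> wd H0 g0 i
     \<and> valleys H n \<le> valleys H0 i
     \<and> valleys H n + (if H n then 0 else 1) \<le> valleys H0 i + (if H0 i then 0 else 1)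
     \<and> (\<Sum>j=1..n. \<bar>E j\<bar>) \<le> R ^ (i - 1) * (\<Sum>j=1..i. \<bar>g0 j\<bar>)"

lemma growth:
  assumes "A \<le> R ^ (i - 1) * (\<Sum>j=1..i. \<bar>g0 j\<bar>)" "1 \<le> i" "B \<le> R * A + \<bar>g0 (Suc i)\<bar>"
  shows "B \<le> R ^ (Suc i - 1) * (\<Sum>j=1..Suc i. \<bar>g0 j\<bar>)"
proof -
  have "R * A \<le> R * (R ^ (i - 1) * (\<Sum>j=1..i. \<bar>g0 j\<bar>))" using assms(1) by (intro mult_left_mono) auto
  also have "\<dots> = R ^ i * (\<Sum>j=1..i. \<bar>g0 j\<bar>)" using assms(2) by (cases i) (simp_all add: mult.assoc)
  finally have "R * A \<le> R ^ i * (\<Sum>j=1..i. \<bar>g0 j\<bar>)" .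
  moreover have "1 * \<bar>g0 (Suc i)\<bar> \<le> R ^ i * \<bar>g0 (Suc i)\<bar>" using R2 by (intro mult_right_mono one_le_power) auto
  ultimately show ?thesis using assms(3) by (simp add: distrib_left)
qed

lemma stack_le_M:
  assumes "stack i n H E" "i \<le> Suc k" "1 \<le> j" "j \<le> n"
  shows "\<bar>E j\<bar> \<le> M"
proof -
  have "\<bar>E j\<bar> \<le> (\<Sum>j=1..n. \<bar>E j\<bar>)" using assms(3,4) by (intro member_le_sum) auto
  also have "\<dots> \<le> R ^ (i - 1) * (\<Sum>j=1..i. \<bar>g0 j\<bar>)" using assms(1) by (simp add: stack_def)
  also have "\<dots> \<le> R ^ k * (\<Sum>j=1..Suc k. \<bar>g0 j\<bar>)"
    using assms(2) R2 by (intro mult_mono power_increasing sum_mono2 sum_nonneg) auto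
  finally show ?thesis using Mg by linarith
qed

lemma stack_pinch:
  assumes st: "stack i n H E" and n: "1 < n" and h: "H n \<noteq> H0 (Suc i)"
    and m: "m = (if H n then P else Q)" and d: "m dvd E n"
  shows "stack (Suc i) (n - 1) H (E(n - 1 := E (n - 1) + (E n div m) * ((P + Q) - m) + g0 (Suc i)))"
proof -
  obtain n' where n': "n = Suc n'" "1 \<le> n'" using n by (cases n) auto
  let ?x = "E (n - 1) + (E n div m) * ((P + Q) - m) + g0 (Suc i)"
  have h': "H0 (Suc i) = (\<not> H n)" using h by blast
  have i1: "1 \<le> i" using st by (simp add: stack_def)
  have "reduced H (E(n' := ?x)) n'"
    using st by (intro reduced_upd_last) (auto simp: stack_def reduced_def n')
  moreover have "wd H (E(n' := ?x)) n' \<approx> wd H0 g0 (Suc i)"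
  proof -
    have "wd H (E(n' := ?x)) n' \<approx> wd H E n @ [tl_of (\<not> H n)] @ a_pow (g0 (Suc i))"
      using bs_eq.sym[OF wd_pinch[where n = n and m = m and H = H and E = E and x = "g0 (Suc i)", OF n m d]] by (simp add: n')
    also have "\<dots> \<approx> wd H0 g0 i @ [tl_of (\<not> H n)] @ a_pow (g0 (Suc i))"
      using st by (intro eqv_left) (simp add: stack_def)
    finally show ?thesis using i1 h' by simp
  qed
  moreover have "(\<Sum>j=1..n'. \<bar>(E(n' := ?x)) j\<bar>) \<le> R ^ (Suc i - 1) * (\<Sum>j=1..Suc i. \<bar>g0 j\<bar>)"
  proof (rule growth[OF _ i1])
    show "(\<Sum>j=1..n. \<bar>E j\<bar>) \<le> R ^ (i - 1) * (\<Sum>j=1..i. \<bar>g0 j\<bar>)" using st by (simp add: stack_def)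
    have m0: "0 < m" using m Ppos Qpos by simp
    \<comment> \<open>Removing t a^(pm) T multiplies the exponent by r, and removing T a^(qm) t
      divides it by r.\<close>
    have "\<bar>(E n div m) * ((P + Q) - m)\<bar> \<le> R * \<bar>E n\<bar>"
    proof -
      have "(P + Q) - m \<le> R * m"
      proof (cases "H n")
        case True
        then show ?thesis using m by (simp add: mult.commute)
      next
        case False
        have "P * 1 \<le> P * (R * R)" using P1 R2 mult_mono[of 1 R 1 R] by (intro mult_left_mono) auto
        then show ?thesis using m False by (simp add: mult_ac)
      qed
      moreover have "0 \<le> (P + Q) - m" using m by simp
      ultimately have "\<bar>E n div m\<bar> * \<bar>(P + Q) - m\<bar> \<le> \<bar>E n div m\<bar> * (R * m)"
        by (intro mult_left_mono) auto
      also have "\<dots> = R * \<bar>m * (E n div m)\<bar>" using m0 by (simp add: abs_mult mult_ac)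
      also have "m * (E n div m) = E n" using d by simp
      finally show ?thesis by (simp add: abs_mult)
    qed
    then have x: "\<bar>?x\<bar> \<le> \<bar>E n'\<bar> + R * \<bar>E n\<bar> + \<bar>g0 (Suc i)\<bar>" using n' by simp
    have S: "(\<Sum>j=1..n'. \<bar>(E(n' := ?x)) j\<bar>) = (\<Sum>j=1..n'-1. \<bar>E j\<bar>) + \<bar>?x\<bar>"
    proof -
      obtain n'' where "n' = Suc n''" using n'(2) by (cases n') auto
      then show ?thesis by simp
    qed
    have S': "(\<Sum>j=1..n. \<bar>E j\<bar>) = (\<Sum>j=1..n'-1. \<bar>E j\<bar>) + \<bar>E n'\<bar> + \<bar>E n\<bar>"
    proof -
      obtain n'' where "n' = Suc n''" using n'(2) by (cases n') auto
      then show ?thesis by (simp add: n')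
    qed
    have "1 * ((\<Sum>j=1..n'-1. \<bar>E j\<bar>) + \<bar>E n'\<bar>) \<le> R * ((\<Sum>j=1..n'-1. \<bar>E j\<bar>) + \<bar>E n'\<bar>)"
      using R2 by (intro mult_right_mono add_nonneg_nonneg sum_nonneg) auto
    then show "(\<Sum>j=1..n'. \<bar>(E(n' := ?x)) j\<bar>) \<le> R * (\<Sum>j=1..n. \<bar>E j\<bar>) + \<bar>g0 (Suc i)\<bar>"
      unfolding S S' using x by (simp add: distrib_left)
  qed
  moreover have "valleys H n' \<le> valleys H0 (Suc i)"
    "valleys H n' + (if H n' then 0 else 1) \<le> valleys H0 (Suc i) + (if H0 (Suc i) then 0 else 1)"
    using st n' h' i1 by (auto simp: stack_def split: if_splits)
  ultimately show ?thesis using st n' by (simp add: stack_def)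
qed

lemma stack_push:
  assumes st: "stack i n H E" and H': "\<And>j. 1 \<le> j \<Longrightarrow> j \<le> n \<Longrightarrow> H' j = H j" "H' (Suc n) = H0 (Suc i)"
    and E': "\<And>j. 1 \<le> j \<Longrightarrow> j \<le> n \<Longrightarrow> E' j = E j" "E' (Suc n) = g0 (Suc i)"
    and np: "1 < n \<Longrightarrow> H n \<noteq> H0 (Suc i) \<Longrightarrow> \<not> (if H n then P else Q) dvd E n"
  shows "stack (Suc i) (Suc n) H' E'"
proof -
  have n1: "1 \<le> n" "1 \<le> i" using st by (auto simp: stack_def)
  have wdn: "wd H' E' n = wd H E n" using H' E' by (intro wd_cong) auto
  have vn: "valleys H' n = valleys H n" using H' by (intro valleys_cong) auto
  have sn: "(\<Sum>j=1..n. \<bar>E' j\<bar>) = (\<Sum>j=1..n. \<bar>E j\<bar>)" using E' by (intro sum.cong) auto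
  have "reduced H' E' (Suc n)"
    unfolding reduced_def
  proof (intro allI impI)
    fix j
    assume j: "1 < j \<and> j < Suc n"
    show "(H' j \<and> \<not> H' (Suc j) \<longrightarrow> \<not> P dvd E' j) \<and> (\<not> H' j \<and> H' (Suc j) \<longrightarrow> \<not> Q dvd E' j)"
    proof (cases "j = n")
      case True
      then show ?thesis using np j H'(1)[of n] H'(2) E'(1)[of n] by (auto split: if_splits)
    next
      case False
      then show ?thesis
        using st j H'(1)[of j] H'(1)[of "Suc j"] E'(1)[of j] by (auto simp: stack_def reduced_def)
    qed
  qed
  moreover have "wd H' E' (Suc n) \<approx> wd H0 g0 (Suc i)"
  proof -
    have "wd H E n \<approx> wd H0 g0 i" using st by (simp add: stack_def)
    then have "wd H E n @ [tl_of (H0 (Suc i))] @ a_pow (g0 (Suc i)) \<approx> wd H0 g0 i @ [tl_of (H0 (Suc i))] @ a_pow (g0 (Suc i))"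
      by (rule eqv_left)
    then show ?thesis using n1 by (simp add: wdn H' E')
  qed
  moreover have "(\<Sum>j=1..Suc n. \<bar>E' j\<bar>) \<le> R ^ (Suc i - 1) * (\<Sum>j=1..Suc i. \<bar>g0 j\<bar>)"
  proof (rule growth[OF _ n1(2)])
    show "(\<Sum>j=1..n. \<bar>E j\<bar>) \<le> R ^ (i - 1) * (\<Sum>j=1..i. \<bar>g0 j\<bar>)" using st by (simp add: stack_def)
    have "1 * (\<Sum>j=1..n. \<bar>E j\<bar>) \<le> R * (\<Sum>j=1..n. \<bar>E j\<bar>)" using R2 by (intro mult_right_mono sum_nonneg) auto
    then show "(\<Sum>j=1..Suc n. \<bar>E' j\<bar>) \<le> R * (\<Sum>j=1..n. \<bar>E j\<bar>) + \<bar>g0 (Suc i)\<bar>" using sn E'(2) by simp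
  qed
  moreover have "valleys H' (Suc n) \<le> valleys H0 (Suc i)"
    "valleys H' (Suc n) + (if H' (Suc n) then 0 else 1) \<le> valleys H0 (Suc i) + (if H0 (Suc i) then 0 else 1)"
    using st n1 vn H'(1)[of n] H'(2) by (auto simp: stack_def split: if_splits)
  ultimately show ?thesis using st n1 H'(1)[of 1] by (simp add: stack_def)
qed

definition binv :: "nat \<Rightarrow> state \<Rightarrow> state \<Rightarrow> bool" where
  "binv i s0 s \<longleftrightarrow> agree {''n'', ''h'', ''e'', ''i'', ''m''} s0 s \<and> s ''i'' 0 = int i
     \<and> (\<exists>n. s ''n'' 0 = int n \<and> stack i n (hs s) (es s) \<and> (\<forall>j. 1 \<le> j \<and> j \<le> n \<longrightarrow> s ''h'' (int j) \<in> {1, - 1}))"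

lemma wp_britton_step:
  assumes inp: "input s0" and inv: "binv i s0 s" and i: "1 \<le> i" "i \<le> k"
    and post: "\<And>t' s'. t' \<le> t + 100 \<Longrightarrow> binv (Suc i) s0 s' \<Longrightarrow> G t' s'"
  shows "wp M britton_step G t s"
proof -
  obtain n where n: "s ''n'' 0 = int n" "stack i n (hs s) (es s)" "\<forall>j. 1 \<le> j \<and> j \<le> n \<longrightarrow> s ''h'' (int j) \<in> {1, - 1}"
    using inv by (auto simp: binv_def)
  have ag: "agree {''n'', ''h'', ''e'', ''i'', ''m''} s0 s" and si: "s ''i'' 0 = int i" using inv by (auto simp: binv_def)
  have th: "s ''theta'' (int i) = (if H0 (Suc i) then 1 else - 1)" and al: "s ''alpha'' (int i) = g0 (Suc i)"
    using inp agreeD[OF ag] i by (auto simp: input_def)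
  have n1: "1 \<le> n" "n \<le> i" using n(2) by (auto simp: stack_def)
  have hn: "s ''h'' (int n) = (if hs s n then 1 else - 1)" using n(3) n1 by (auto simp: hs_def)
  have M0: "0 \<le> M" "1 \<le> M" "\<bar>P\<bar> \<le> M" "\<bar>Q\<bar> \<le> M"
  proof -
    have "P * 1 \<le> Q" using P1 R2 by (intro mult_left_mono) auto
    then show "0 \<le> M" "1 \<le> M" "\<bar>P\<bar> \<le> M" "\<bar>Q\<bar> \<le> M" using Mk MQ Ppos by linarith+
  qed
  define m where "m = (if H0 (Suc i) then Q else P)"
  define s1 where "s1 = upd s ''m'' 0 m"
  have m0: "0 < m" using Ppos Qpos by (simp add: m_def)
  have hes: "hs s1 = hs s" "es s1 = es s" by (auto simp: s1_def hs_def es_def fun_eq_iff)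
  have iM: "\<bar>int i + 1\<bar> \<le> M" "\<bar>int n - 1\<bar> \<le> M" "int i + 1 \<le> M" "int n + 1 \<le> M" using i n1 Mk by auto
  let ?c = "Conj (Lit 1 \<prec> V ''n'')
        (Conj (Neg (Cell ''h'' (V ''n'') \<oplus> Cell ''theta'' (V ''i'') \<prec> Lit 0))
        (Conj (Neg (Lit 0 \<prec> Cell ''h'' (V ''n'') \<oplus> Cell ''theta'' (V ''i'')))
          (Cell ''e'' (V ''n'') \<odot> V ''m'' \<prec> Lit 1)))"
  let ?A = "Store ''e'' (V ''n'' \<ominus> Lit 1) (Cell ''e'' (V ''n'' \<ominus> Lit 1)
          \<oplus> (Cell ''e'' (V ''n'') \<oslash> V ''m'') \<otimes> (Lit (P + Q) \<ominus> V ''m'') \<oplus> Cell ''alpha'' (V ''i'')) ;;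
        ''n'' ::= V ''n'' \<ominus> Lit 1"
  let ?B = "''n'' ::= V ''n'' \<oplus> Lit 1 ;; Store ''h'' (V ''n'') (Cell ''theta'' (V ''i'')) ;;
        Store ''e'' (V ''n'') (Cell ''alpha'' (V ''i''))"
  let ?C = "''i'' ::= V ''i'' \<oplus> Lit 1"
  have v1: "s1 ''n'' 0 = int n" "s1 ''i'' 0 = int i" "s1 ''m'' 0 = m" "s1 ''e'' = s ''e''" "s1 ''h'' = s ''h''"
      "s1 ''theta'' = s ''theta''" "s1 ''alpha'' = s ''alpha''"
    using n si by (simp_all add: s1_def)
  have ag1: "agree {''n'', ''h'', ''e'', ''i'', ''m''} s0 s1" using ag by (simp add: s1_def)
  have modz: "es s n mod m < 1 \<longleftrightarrow> m dvd es s n"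
    using pos_mod_sign[OF m0, of "es s n"] by (auto simp: dvd_eq_mod_eq_0)
  have c: "eval_bexp ?c s1 \<longleftrightarrow> 1 < n \<and> hs s n \<noteq> H0 (Suc i) \<and> m dvd es s n"
    using modz by (auto simp: v1 hn th es_def)
  have step: "wp M (Cond ?c ?A ?B) (wp M ?C G) t1 s1" if t1: "t1 \<le> t + 20" for t1
  proof (cases "eval_bexp ?c s1")
    case True
    then have p: "1 < n" "hs s n \<noteq> H0 (Suc i)" "m dvd es s n" using c by auto
    have mh: "m = (if hs s n then P else Q)" using p(2) by (simp add: m_def)
    define n' where "n' = n - 1"
    define x where "x = es s n' + (es s n div m) * ((P + Q) - m) + g0 (Suc i)"
    have st: "stack (Suc i) n' (hs s) ((es s)(n' := x))"
      unfolding x_def n'_def by (rule stack_pinch[OF n(2) p(1,2) mh p(3)])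
    have xM: "\<bar>x\<bar> \<le> M" using stack_le_M[OF st, of n'] i p(1) by (simp add: n'_def)
    have iM': "int i + 1 \<le> M" "int n' \<le> M" using iM n1 by (auto simp: n'_def)
    have nn: "int n - 1 = int n'" using p(1) by (simp add: n'_def)
    define s2 where "s2 = upd (upd (upd s1 ''e'' (int n') x) ''n'' 0 (int n')) ''i'' 0 (int i + 1)"
    have "hs s2 = hs s" "es s2 = (es s)(n' := x)"
      by (auto simp: s2_def s1_def hs_def es_def fun_eq_iff)
    moreover have "agree {''n'', ''h'', ''e'', ''i'', ''m''} s0 s2" using ag1 by (simp add: s2_def)
    moreover have "s2 ''h'' = s ''h''" "s2 ''i'' 0 = int (Suc i)" "s2 ''n'' 0 = int n'" by (simp_all add: s2_def s1_def)
    ultimately have "binv (Suc i) s0 s2" unfolding binv_def using st n(3) by (intro conjI exI[of _ n']) (auto simp: n'_def)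
    then have Z: "G t' s2" if "t' \<le> t + 100" for t' using that by (rule post[rotated])
    have xe: "s ''e'' (int n') + (s ''e'' (int n) div m) * ((P + Q) - m) + g0 (Suc i) = x"
      by (simp add: x_def es_def)
    show ?thesis
      unfolding wp_Cond using True t1
      by (simp add: v1 nn al xe xM iM' s2_def[symmetric] Z del: eval_bexp.simps)
  next
    case False
    define s2 where "s2 = upd (upd (upd (upd s1 ''n'' 0 (int n + 1)) ''h'' (int n + 1) (if H0 (Suc i) then 1 else - 1))
       ''e'' (int n + 1) (g0 (Suc i))) ''i'' 0 (int i + 1)"
    have st: "stack (Suc i) (Suc n) (hs s2) (es s2)"
    proof (rule stack_push[OF n(2)])
      show "\<not> (if hs s n then P else Q) dvd es s n" if "1 < n" "hs s n \<noteq> H0 (Suc i)"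
        using False that c by (auto simp: m_def split: if_splits)
    qed (auto simp: s2_def s1_def hs_def es_def)
    have gM: "\<bar>g0 (Suc i)\<bar> \<le> M"
      using stack_le_M[OF st, of "Suc n"] i by (simp add: s2_def es_def)
    have "agree {''n'', ''h'', ''e'', ''i'', ''m''} s0 s2" using ag1 by (simp add: s2_def)
    moreover have "s2 ''h'' (int j) \<in> {1, - 1}" if "1 \<le> j" "j \<le> Suc n" for j
    proof (cases "j = Suc n")
      case False
      then show ?thesis using that n(3) by (simp add: s2_def s1_def)
    qed (simp add: s2_def)
    moreover have "s2 ''i'' 0 = int (Suc i)" "s2 ''n'' 0 = int (Suc n)" by (simp_all add: s2_def)
    ultimately have "binv (Suc i) s0 s2" unfolding binv_def using st by (intro conjI exI[of _ "Suc n"]) auto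
    then have Z: "G t' s2" if "t' \<le> t + 100" for t' using that by (rule post[rotated])
    show ?thesis
      unfolding wp_Cond using False t1 M0
      by (simp add: v1 al th gM iM s2_def[symmetric] Z del: eval_bexp.simps)
  qed
  have "wp M (Cond (Cell ''theta'' (V ''i'') \<prec> Lit 0) (''m'' ::= Lit P) (''m'' ::= Lit Q)) (wp M (Cond ?c ?A ?B) (wp M ?C G)) t s"
    using step M0 by (cases "H0 (Suc i)") (simp_all add: si th s1_def m_def del: wp_Cond[of _ ?c] wp_simps add: wp_Cond[of _ "Cell ''theta'' (V ''i'') \<prec> Lit 0"] wp_Store)
  then show ?thesis by (simp only: britton_step_def wp_Seq_fun)
qed

lemma wp_britton:
  assumes inp: "input s"
    and post: "\<And>t' s'. t' \<le> t + 120 * (k + 1) \<Longrightarrow> binv (Suc k) s s' \<Longrightarrow> G t' s'"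
  shows "wp M britton G t s"
proof -
  define s1 where "s1 = upd (upd (upd (upd s ''n'' 0 1) ''h'' 1 (- 1)) ''e'' 1 (g0 (Suc 0))) ''i'' 0 1"
  have al: "s ''alpha'' 0 = g0 (Suc 0)" using inp by (auto simp: input_def dest: spec[of _ 0])
  have st: "stack 1 1 (hs s1) (es s1)"
    using H01 by (simp add: stack_def hs_def es_def s1_def reduced_def)
  have gM: "\<bar>g0 (Suc 0)\<bar> \<le> M" using stack_le_M[OF st, of 1] by (simp add: es_def s1_def)
  have inv: "binv 1 s s1"
    unfolding binv_def using st by (intro conjI exI[of _ 1]) (auto simp: s1_def)
  let ?b = "V ''i'' \<prec> V ''k'' \<oplus> Lit 1"
  let ?I = "\<lambda>q t' s'. binv (Suc q) s s' \<and> t' \<le> t + 30 + 120 * q"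
  have loop: "wp M (While ?b britton_step) G t1 s1" if t1: "t1 \<le> t + 30" for t1
  proof (rule wp_for[where I = ?I and N = k])
    show "?I 0 t1 s1" using inv t1 by simp
  next
    fix q t' s'
    assume q: "q < k" and I: "?I q t' s'"
    have sk: "s' ''k'' 0 = int k" "s' ''i'' 0 = int (Suc q)"
      using I inp by (auto simp: binv_def input_def agree_def)
    have "wp M britton_step (?I (Suc q)) (t' + cost_bexp ?b) s'"
    proof (rule wp_britton_step[OF inp])
      show "binv (Suc q) s s'" "1 \<le> Suc q" "Suc q \<le> k" using I q by auto
      fix t2 s2
      assume "t2 \<le> t' + cost_bexp ?b + 100" "binv (Suc (Suc q)) s s2"
      then show "?I (Suc q) t2 s2" using I by simp
    qed
    then show "eval_bexp ?b s' \<and> wp M britton_step (?I (Suc q)) (t' + cost_bexp ?b) s'" using sk q by simp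
  next
    fix t' s'
    assume I: "?I k t' s'"
    have sk: "s' ''k'' 0 = int k" "s' ''i'' 0 = int (Suc k)"
      using I inp by (auto simp: binv_def input_def agree_def)
    show "\<not> eval_bexp ?b s' \<and> G (t' + cost_bexp ?b) s'" using sk I by (auto intro!: post)
  qed
  have "1 \<le> M" using Mk by simp
  then show ?thesis
    unfolding britton_def using gM by (simp add: al s1_def[symmetric] loop)
qed

end

end

section \<open>Writing the word\<close>

lemma length_a_pow: "int (length (a_pow x)) = \<bar>x\<bar>"
  by (simp add: a_pow_def)

definition emit :: "exp \<Rightarrow> com" where
  "emit c = (Store ''word'' (V ''length'') c ;; ''length'' ::= V ''length'' \<oplus> Lit 1)"

definition emit_pow :: "exp \<Rightarrow> com" where
  "emit_pow E = (''x'' ::= E ;;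
     While (Lit 0 \<prec> V ''x'') (emit (Lit 2) ;; ''x'' ::= V ''x'' \<ominus> Lit 1) ;;
     While (V ''x'' \<prec> Lit 0) (emit (Lit (- 2)) ;; ''x'' ::= V ''x'' \<oplus> Lit 1))"

text \<open>The spur is written directly after the exponent of position \<open>P\<close>: the levels
  from \<open>N\<close> to \<open>J\<close> upwards, each a \<open>t\<close> with its exponent, then
  the same number of letters \<open>T\<close>.\<close>

definition write_word :: com where
  "write_word = (''length'' ::= Lit 0 ;; ''i'' ::= Lit 0 ;;
     While (V ''i'' \<prec> V ''n'')
       (''i'' ::= V ''i'' \<oplus> Lit 1 ;; Cond (Lit 1 \<prec> V ''i'') (emit (Cell ''h'' (V ''i''))) Skip ;;
        emit_pow (Cell ''g'' (V ''i'')) ;;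
        Cond (Conj (Neg (V ''i'' \<prec> V ''P'')) (Neg (V ''P'' \<prec> V ''i'')))
          (''j'' ::= V ''N'' ;;
           While (V ''j'' \<prec> V ''J'') (''j'' ::= V ''j'' \<oplus> Lit 1 ;; emit (Lit 1) ;; emit_pow (Cell ''g'' (V ''j''))) ;;
           While (V ''N'' \<prec> V ''j'') (emit (Lit (- 1)) ;; ''j'' ::= V ''j'' \<ominus> Lit 1))
          Skip))"

lemma output_word_snoc:
  assumes "output_word s u" "c = code l" "x = int (length u)" "y = x + 1"
  shows "output_word (upd (upd s ''word'' x c) ''length'' 0 y) (u @ [l])"
  using assms by (auto simp: output_word_def nth_append less_Suc_eq)

lemma output_word_upd: "x \<notin> {''word'', ''length''} \<Longrightarrow> output_word (upd s x i v) u = output_word s u"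
  by (auto simp: output_word_def)

lemma wp_emit:
  assumes o: "output_word s u" and c: "eval_exp c s = code l" and M: "int (length u) + 1 \<le> M" "2 \<le> M"
    and post: "\<And>t' s'. t' \<le> t + 10 + cost_exp c \<Longrightarrow> output_word s' (u @ [l]) \<Longrightarrow> agree {''word'', ''length''} s s' \<Longrightarrow> G t' s'"
  shows "wp M (emit c) G t s"
proof -
  have l: "s ''length'' 0 = int (length u)" using o by (simp add: output_word_def)
  have cM: "\<bar>code l\<bar> \<le> M" using M by (cases l) auto
  have "G t' (upd (upd s ''word'' (int (length u)) (code l)) ''length'' 0 (int (length u) + 1))" if "t' \<le> t + 10 + cost_exp c" for t'
    by (rule post[OF that]) (use output_word_snoc[OF o HOL.refl HOL.refl HOL.refl] in simp_all)
  then show ?thesis using M cM by (simp add: emit_def l c)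
qed

lemma a_pow_snoc_eq: "0 \<le> x \<Longrightarrow> a_pow (x + 1) = a_pow x @ [La]" "x \<le> 0 \<Longrightarrow> a_pow (x - 1) = a_pow x @ [LA]"
proof -
  assume "0 \<le> x"
  then show "a_pow (x + 1) = a_pow x @ [La]"
    by (simp add: a_pow_def nat_add_distrib replicate_append_same[symmetric])
next
  assume "x \<le> 0"
  then have "nat (- (x - 1)) = Suc (nat (- x))" by simp
  then show "a_pow (x - 1) = a_pow x @ [LA]"
    using \<open>x \<le> 0\<close> by (cases "x = 0") (simp_all add: a_pow_def replicate_append_same[symmetric] del: minus_diff_eq)
qed

lemma wp_emit_pow:
  assumes o: "output_word s u" and E: "eval_exp E s = x" and M: "int (length u) + \<bar>x\<bar> \<le> M" "2 \<le> M"
    and post: "\<And>t' s'. int t' \<le> int t + 20 + int (cost_exp E) + 30 * \<bar>x\<bar> \<Longrightarrow> output_word s' (u @ a_pow x) \<Longrightarrow>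
      agree {''word'', ''length'', ''x''} s s' \<Longrightarrow> G t' s'"
  shows "wp M (emit_pow E) G t s"
proof -
  let ?S = "{''word'', ''length'', ''x''}"
  let ?b1 = "Lit 0 \<prec> V ''x''" and ?b2 = "V ''x'' \<prec> Lit 0"
  let ?c1 = "emit (Lit 2) ;; ''x'' ::= V ''x'' \<ominus> Lit 1" and ?c2 = "emit (Lit (- 2)) ;; ''x'' ::= V ''x'' \<oplus> Lit 1"
  define N1 N2 where "N1 = nat x" and "N2 = nat (- x)"
  have N: "int N1 = max x 0" "int N2 = max (- x) 0" by (auto simp: N1_def N2_def)
  define I1 where "I1 q t' s' \<longleftrightarrow> int t' \<le> int t + 5 + int (cost_exp E) + 30 * int q \<and> output_word s' (u @ a_pow (int q))
     \<and> agree ?S s s' \<and> s' ''x'' 0 = x - int q" for q t' s'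
  define I2 where "I2 q t' s' \<longleftrightarrow> int t' \<le> int t + 10 + int (cost_exp E) + 30 * int N1 + 30 * int q
     \<and> output_word s' (u @ a_pow (int N1) @ a_pow (- int q)) \<and> agree ?S s s' \<and> s' ''x'' 0 = x - int N1 + int q" for q t' s'
  have w2: "wp M (While ?b2 ?c2) G t1 s1" if st: "I2 0 t1 s1" for t1 s1
  proof (rule wp_for[where I = I2 and N = N2, OF st])
    fix q t' s'
    assume q: "q < N2" and I: "I2 q t' s'"
    have N10: "N1 = 0" using q by (auto simp: N1_def N2_def)
    have len: "int (length (u @ a_pow (int N1) @ a_pow (- int q))) + 1 \<le> M"
      using M(1) q N N10 by (simp add: length_a_pow)
    have "wp M ?c2 (I2 (Suc q)) (t' + cost_bexp ?b2) s'"
      unfolding wp_Seq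
    proof (rule wp_emit[OF _ _ len M(2), where l = LA])
      show "output_word s' (u @ a_pow (int N1) @ a_pow (- int q))" using I by (simp add: I2_def)
      fix t2 s2
      assume 2: "t2 \<le> t' + cost_bexp ?b2 + 10 + cost_exp (Lit (- 2))"
        "output_word s2 ((u @ a_pow (int N1) @ a_pow (- int q)) @ [LA])" "agree {''word'', ''length''} s' s2"
      have e: "- int (Suc q) = - int q - 1" by simp
      have "a_pow (- int (Suc q)) = a_pow (- int q) @ [LA]" unfolding e by (rule a_pow_snoc_eq(2)) simp
      then have o2: "output_word s2 (u @ a_pow (int N1) @ a_pow (- int (Suc q)))" using 2(2) by (simp del: of_nat_Suc)
      have x2: "s2 ''x'' 0 = x + int q" using I agreeD[OF 2(3), of "''x''"] by (simp add: I2_def N10)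
      have ag: "agree ?S s s2"
        using I by (intro agree_trans[OF _ 2(3)]) (auto simp: I2_def)
      have qM: "\<bar>x + int q + 1\<bar> \<le> M" using q N M by auto
      have "I2 (Suc q) t3 (upd s2 ''x'' 0 (x + int q + 1))" if "t3 \<le> t2 + 6" for t3
        using that 2(1) I o2 ag unfolding I2_def by (simp add: output_word_upd N10 del: of_nat_Suc) simp
      then show "wp M (''x'' ::= V ''x'' \<oplus> Lit 1) (I2 (Suc q)) t2 s2" using qM by (simp add: x2)
    qed simp
    then show "eval_bexp ?b2 s' \<and> wp M ?c2 (I2 (Suc q)) (t' + cost_bexp ?b2) s'" using I q N N10 by (simp add: I2_def)
  next
    fix t' s'
    assume I: "I2 N2 t' s'"
    have x: "a_pow (int N1) @ a_pow (- int N2) = a_pow x" "int N1 + int N2 = \<bar>x\<bar>"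
      by (auto simp: N1_def N2_def)
    have "G (t' + cost_bexp ?b2) s'"
    proof (rule post)
      show "output_word s' (u @ a_pow x)" "agree ?S s s'" using I x(1) by (auto simp: I2_def)
      show "int (t' + cost_bexp ?b2) \<le> int t + 20 + int (cost_exp E) + 30 * \<bar>x\<bar>"
        using I by (simp add: I2_def x(2)[symmetric])
    qed
    then show "\<not> eval_bexp ?b2 s' \<and> G (t' + cost_bexp ?b2) s'" using I N by (simp add: I2_def)
  qed
  have w1: "wp M (While ?b1 ?c1) (wp M (While ?b2 ?c2) G) t1 s1" if st: "I1 0 t1 s1" for t1 s1
  proof (rule wp_for[where I = I1 and N = N1, OF st])
    fix q t' s'
    assume q: "q < N1" and I: "I1 q t' s'"
    have len: "int (length (u @ a_pow (int q))) + 1 \<le> M"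
      using M(1) q N by (simp add: length_a_pow)
    have "wp M ?c1 (I1 (Suc q)) (t' + cost_bexp ?b1) s'"
      unfolding wp_Seq
    proof (rule wp_emit[OF _ _ len M(2), where l = La])
      show "output_word s' (u @ a_pow (int q))" using I by (simp add: I1_def)
      fix t2 s2
      assume 2: "t2 \<le> t' + cost_bexp ?b1 + 10 + cost_exp (Lit 2)"
        "output_word s2 ((u @ a_pow (int q)) @ [La])" "agree {''word'', ''length''} s' s2"
      have e: "int (Suc q) = int q + 1" by simp
      have "a_pow (int (Suc q)) = a_pow (int q) @ [La]" unfolding e by (rule a_pow_snoc_eq(1)) simp
      then have o2: "output_word s2 (u @ a_pow (int (Suc q)))" using 2(2) by (simp del: of_nat_Suc)
      have x2: "s2 ''x'' 0 = x - int q" using I agreeD[OF 2(3), of "''x''"] by (simp add: I1_def)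
      have ag: "agree ?S s s2"
        using I by (intro agree_trans[OF _ 2(3)]) (auto simp: I1_def)
      have qM: "\<bar>x - int q - 1\<bar> \<le> M" using q N M by auto
      have "I1 (Suc q) t3 (upd s2 ''x'' 0 (x - int q - 1))" if "t3 \<le> t2 + 6" for t3
        using that 2(1) I o2 ag unfolding I1_def by (simp add: output_word_upd del: of_nat_Suc) simp
      then show "wp M (''x'' ::= V ''x'' \<ominus> Lit 1) (I1 (Suc q)) t2 s2" using qM by (simp add: x2)
    qed simp
    then show "eval_bexp ?b1 s' \<and> wp M ?c1 (I1 (Suc q)) (t' + cost_bexp ?b1) s'" using I q N by (simp add: I1_def)
  next
    fix t' s'
    assume I: "I1 N1 t' s'"
    have "wp M (While ?b2 ?c2) G (t' + cost_bexp ?b1) s'"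
      by (rule w2) (use I in \<open>simp add: I1_def I2_def\<close>)
    then show "\<not> eval_bexp ?b1 s' \<and> wp M (While ?b2 ?c2) G (t' + cost_bexp ?b1) s'" using I N by (simp add: I1_def)
  qed
  define s1 where "s1 = upd s ''x'' 0 x"
  have I0: "I1 0 t1 s1" if "t1 \<le> t + cost_exp E + 5" for t1
    using that o by (simp add: I1_def s1_def output_word_upd)
  have w: "wp M (While ?b1 ?c1) (wp M (While ?b2 ?c2) G) t1 s1" if "t1 \<le> t + cost_exp E + 5" for t1
    by (rule w1[OF I0[OF that]])
  have "\<bar>x\<bar> \<le> M" using M by simp
  then show ?thesis
    unfolding emit_pow_def wp_Seq_fun using w by (simp add: wp_Store E s1_def[symmetric] del: wp_Seq wp_Cond wp_Skip)
qed

context tree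
begin

section \<open>The output word represents the input\<close>

primrec spur_up :: "nat \<Rightarrow> (nat \<Rightarrow> int) \<Rightarrow> nat \<Rightarrow> letter list" where
  "spur_up N g 0 = []"
| "spur_up N g (Suc q) = spur_up N g q @ [Lt] @ a_pow (g (N + Suc q))"

primrec out_word :: "nat \<Rightarrow> letter list \<Rightarrow> (nat \<Rightarrow> int) \<Rightarrow> nat \<Rightarrow> letter list" where
  "out_word m S g 0 = []"
| "out_word m S g (Suc i) = out_word m S g i @ (if i = 0 then [] else [tl_of (H (Suc i))]) @ a_pow (g (Suc i))
     @ (if Suc i = m then S else [])"

text \<open>Number of letters \<open>T\<close> still unmatched at the position, read off as the
  height of the stack minus 1.\<close>

definition depth :: "nat \<Rightarrow> int" where "depth i = ch (\<lambda>i. if i = 0 then 0 else 1) i - 1"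

lemma depth_0: "1 \<le> i \<Longrightarrow> pr i = 0 \<Longrightarrow> depth i = 0"
  using ch_root[of "\<lambda>i. if i = 0 then 0 else 1" i] by (simp add: depth_def)

lemma depth_nonneg: "1 \<le> i \<Longrightarrow> 0 \<le> depth i"
proof -
  assume "1 \<le> i"
  moreover have "(\<lambda>i. if i = 0 then 0 else 1 :: int) i \<le> ch (\<lambda>i. if i = 0 then 0 else 1) i"
    by (rule ch_ge_head) auto
  ultimately show ?thesis by (simp add: depth_def)
qed

lemma depth_push: "\<not> H (Suc i) \<Longrightarrow> depth (Suc i) = depth i + 1"
  using ch_push[of i "\<lambda>i. if i = 0 then 0 else 1"] by (simp add: depth_def)

lemma depth_pop: "H (Suc i) \<Longrightarrow> pr i \<noteq> 0 \<Longrightarrow> depth (Suc i) = depth i - 1"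
proof -
  assume "H (Suc i)" "pr i \<noteq> 0"
  moreover from this have "i \<noteq> 0" by (cases i) auto
  ultimately show ?thesis using ch_pop[of "\<lambda>i. if i = 0 then 0 else 1" i] by (simp add: depth_def)
qed

context
  fixes n root J m :: nat and g f :: "nat \<Rightarrow> int"
  assumes fl: "flow H e g f J" and fJ: "f J = 0" and n1: "1 \<le> n" and nr: "n \<le> root" and rJ: "root \<le> J"
    and pad: "\<And>i. n < i \<Longrightarrow> H i \<and> e i = 0" and pr_root: "pr root = 0" "\<And>i. n \<le> i \<Longrightarrow> i < root \<Longrightarrow> pr i \<noteq> 0"
    and g0: "\<And>i. n < i \<Longrightarrow> i \<le> root \<Longrightarrow> g i = 0"
    and m: "1 \<le> m" "m \<le> n" "pr m = 0" "\<And>j. m \<le> j \<Longrightarrow> j < n \<Longrightarrow> H (Suc j) \<Longrightarrow> pr j \<noteq> 0"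
begin

lemma flow_t:
  assumes "H (Suc i)" "Suc i \<le> J"
  shows "g (Suc i) = e (Suc i) + P * (f i div R) - P * f (Suc i)" "R dvd f i"
  using fl assms by (auto simp: flow_def inflow_def)

text \<open>The levels collapse from the inside. Virtual positions have exponent 0 in
  \<open>e\<close>, so each level together with the flow above it is a pinch t a^(pm) T with m the
  flow below divided by r.\<close>

lemma spur_up_word: "q \<le> J - root \<Longrightarrow> spur_up root g q @ a_pow (P * f (root + q)) @ replicate q LT \<approx> a_pow (P * f root)"
proof (induction q)
  case (Suc q)
  have i: "Suc (root + q) \<le> J" "n < Suc (root + q)" using Suc.prems nr by auto
  have "H (Suc (root + q))" "e (Suc (root + q)) = 0" using pad[OF i(2)] by auto
  then have fq: "g (Suc (root + q)) = P * (f (root + q) div R) - P * f (Suc (root + q))" "R dvd f (root + q)"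
    using flow_t[of "root + q"] i by auto
  let ?b = "LT # replicate q LT" and ?a = "spur_up root g q @ [Lt]"
  have "spur_up root g (Suc q) @ a_pow (P * f (root + Suc q)) @ replicate (Suc q) LT
      \<approx> ?a @ a_pow (P * (f (root + q) div R)) @ ?b"
    by (rule eqv_context[OF a_pow_add[of "g (Suc (root + q))" "P * f (Suc (root + q))"], where a = ?a and b = ?b])
      (simp_all add: fq)
  also have "\<dots> \<approx> spur_up root g q @ a_pow (Q * (f (root + q) div R)) @ replicate q LT"
    by (rule eqv_context[OF t_pinch[of "f (root + q) div R"], where a = "spur_up root g q" and b = "replicate q LT"]) simp_all
  also have "Q * (f (root + q) div R) = P * f (root + q)" using fq(2) by (auto simp: mult_ac)
  also have "spur_up root g q @ a_pow (P * f (root + q)) @ replicate q LT \<approx> a_pow (P * f root)"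
    using Suc by simp
  finally show ?case .
qed simp

definition Sp :: "letter list" where "Sp = spur_up root g (J - root) @ replicate (J - root) LT"

lemma Sp_word: "Sp \<approx> a_pow (P * f root)"
  using spur_up_word[of "J - root"] rJ by (simp add: Sp_def fJ)

text \<open>Between \<open>n\<close> and the root the exponents stay 0 on both sides, so the flow is
  only divided by r at each virtual \<open>t\<close>, and there are as many of these as brackets
  open at \<open>n\<close>.\<close>

lemma flow_depth: "n \<le> i \<Longrightarrow> i \<le> root \<Longrightarrow> f i = R ^ nat (depth i) * f root"
proof (induction "root - i" arbitrary: i)
  case 0
  then show ?case using depth_0[of root] n1 pr_root(1) by simp
next
  case (Suc d)
  then have i: "i < root" by simp
  have h: "H (Suc i)" "e (Suc i) = 0" "g (Suc i) = 0" using pad[of "Suc i"] g0[of "Suc i"] Suc i by auto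
  have IH: "f (Suc i) = R ^ nat (depth (Suc i)) * f root" using Suc i by (intro Suc.hyps) auto
  have fi: "P * (f i div R) = P * f (Suc i)" "R dvd f i" using flow_t[of i] h i rJ by auto
  have "f i div R = f (Suc i)" using fi(1) Ppos by simp
  then have "f i = R * f (Suc i)" using dvd_mult_div_cancel[OF fi(2)] by simp
  moreover have "depth (Suc i) = depth i - 1" using depth_pop h pr_root(2) Suc i by simp
  moreover have "0 \<le> depth (Suc i)" by (rule depth_nonneg) simp
  ultimately have "nat (depth i) = Suc (nat (depth (Suc i)))" by simp
  then show ?case using \<open>f i = R * f (Suc i)\<close> IH by simp
qed

lemma out_word_before: "i < m \<Longrightarrow> out_word m S g i = wd H g i"
  by (induction i) auto

text \<open>The spur is worth \<open>P * f root\<close> at position \<open>m\<close>, where the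
  depth is 0. Carried to the right, this power is multiplied by r at every \<open>T\<close> and
  divided by r at every \<open>t\<close>, hence scaled by r to the depth. At \<open>n\<close> the
  result is exactly what the flow lets out of the last real position.\<close>

lemma out_word_eqv: "m \<le> i \<Longrightarrow> i \<le> n \<Longrightarrow> out_word m Sp g i \<approx> wd H g i @ a_pow (P * (R ^ nat (depth i) * f root))"
proof (induction i)
  case (Suc i)
  show ?case
  proof (cases "Suc i = m")
    case True
    then have "out_word m Sp g (Suc i) = wd H g (Suc i) @ Sp" using out_word_before[of i Sp] True[symmetric] by simp
    also have "\<dots> \<approx> wd H g (Suc i) @ a_pow (P * f root)" by (rule eqv_right[OF Sp_word])
    finally show ?thesis using depth_0[OF m(1,3)] True by simp
  next
    case False
    then have mi: "m \<le> i" "i < n" "i \<noteq> 0" using Suc.prems m(1) by auto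
    let ?z = "R ^ nat (depth i) * f root" and ?z' = "R ^ nat (depth (Suc i)) * f root"
    let ?l = "tl_of (H (Suc i))"
    have d0: "0 \<le> depth i" "0 \<le> depth (Suc i)" using mi by (auto intro: depth_nonneg)
    have move: "a_pow (P * ?z) @ [?l] \<approx> [?l] @ a_pow (P * ?z')"
    proof (cases "H (Suc i)")
      case True
      have "nat (depth i) = Suc (nat (depth (Suc i)))"
        using depth_pop[OF True m(4)[OF mi(1,2) True]] d0 by simp
      then have e: "P * ?z = Q * ?z'" by simp
      show ?thesis unfolding e using bs_eq.sym[OF t_push[of ?z']] True by simp
    next
      case F: False
      have "nat (depth (Suc i)) = Suc (nat (depth i))" using depth_push[OF F] d0 by (simp add: nat_add_distrib)
      then have e: "P * ?z' = Q * ?z" by simp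
      show ?thesis unfolding e using bs_eq.sym[OF T_push[of ?z]] F by simp
    qed
    have ne: "out_word m Sp g (Suc i) = out_word m Sp g i @ [?l] @ a_pow (g (Suc i))" using False mi by simp
    have "out_word m Sp g i @ [?l] @ a_pow (g (Suc i)) \<approx> (wd H g i @ a_pow (P * ?z)) @ [?l] @ a_pow (g (Suc i))"
      by (rule eqv_left[OF Suc.IH]) (use mi in auto)
    also have "\<dots> \<approx> wd H g i @ ([?l] @ a_pow (P * ?z')) @ a_pow (g (Suc i))"
      by (rule eqv_context[OF move, where a = "wd H g i" and b = "a_pow (g (Suc i))"]) simp_all
    also have "\<dots> \<approx> (wd H g i @ [?l]) @ a_pow (P * ?z' + g (Suc i))"
      using eqv_right[OF a_pow_add[of "P * ?z'" "g (Suc i)"], of "wd H g i @ [?l]"] by simp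
    also have "P * ?z' + g (Suc i) = g (Suc i) + P * ?z'" by simp
    also have "(wd H g i @ [?l]) @ a_pow (g (Suc i) + P * ?z') \<approx> (wd H g i @ [?l]) @ a_pow (g (Suc i)) @ a_pow (P * ?z')"
      by (rule eqv_right[OF bs_eq.sym[OF a_pow_add]])
    finally show ?thesis using ne mi by simp
  qed
qed (use m in simp)

theorem out_word_correct: "out_word m Sp g n \<approx> wd H e n"
proof -
  have "out_word m Sp g n \<approx> wd H g n @ a_pow (P * f n)"
    using out_word_eqv[of n] m flow_depth[of n] nr by simp
  also have "\<dots> \<approx> wd H e n" using flow_word[OF fl, of n] nr rJ by simp
  finally show ?thesis .
qed

lemma length_spur_up: "int (length (spur_up root g q)) = int q + (\<Sum>i=root+1..root+q. \<bar>g i\<bar>)"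
  by (induction q) (simp_all add: length_a_pow)

lemma length_out_word: "int (length (out_word m S g i)) = int (i - 1) + (\<Sum>j=1..i. \<bar>g j\<bar>) + (if 1 \<le> m \<and> m \<le> i then int (length S) else 0)"
  by (induction i) (auto simp: length_a_pow)

theorem length_out: "int (length (out_word m Sp g n)) = int (n - 1) + (\<Sum>j=1..J. \<bar>g j\<bar>) + 2 * int (J - root)"
proof -
  have "(\<Sum>j=1..J. \<bar>g j\<bar>) = (\<Sum>j=1..n. \<bar>g j\<bar>) + (\<Sum>j=n+1..root. \<bar>g j\<bar>) + (\<Sum>j=root+1..J. \<bar>g j\<bar>)"
    using nr rJ sum.ub_add_nat[of 1 root "\<lambda>j. \<bar>g j\<bar>" "J - root"] sum.ub_add_nat[of 1 n "\<lambda>j. \<bar>g j\<bar>" "root - n"] by simp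
  moreover have "(\<Sum>j=n+1..root. \<bar>g j\<bar>) = 0" using g0 by (intro sum.neutral) auto
  ultimately show ?thesis
    using length_out_word[of Sp n] m length_spur_up[of "J - root"] rJ by (simp add: Sp_def)
qed

lemma wp_write_spur:
  fixes M :: int
  assumes s: "s ''N'' 0 = int root" "s ''J'' 0 = int J" "\<And>i. s ''g'' (int i) = g i"
    and o: "output_word s u" and M: "int (length (u @ Sp)) \<le> M" "int J + 2 \<le> M" "0 \<le> M"
    and post: "\<And>t' s'. int t' \<le> int t + 50 + 100 * int (length Sp) \<Longrightarrow> output_word s' (u @ Sp) \<Longrightarrow>
       agree {''word'', ''length'', ''x'', ''j''} s s' \<Longrightarrow> G t' s'"
  shows "wp M (''j'' ::= V ''N'' ;;
           While (V ''j'' \<prec> V ''J'') (''j'' ::= V ''j'' \<oplus> Lit 1 ;; emit (Lit 1) ;; emit_pow (Cell ''g'' (V ''j''))) ;;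
           While (V ''N'' \<prec> V ''j'') (emit (Lit (- 1)) ;; ''j'' ::= V ''j'' \<ominus> Lit 1)) G t s"
proof -
  let ?S = "{''word'', ''length'', ''x'', ''j''}"
  let ?b1 = "V ''j'' \<prec> V ''J''" and ?b2 = "V ''N'' \<prec> V ''j''"
  let ?c1 = "''j'' ::= V ''j'' \<oplus> Lit 1 ;; emit (Lit 1) ;; emit_pow (Cell ''g'' (V ''j''))"
    and ?c2 = "emit (Lit (- 1)) ;; ''j'' ::= V ''j'' \<ominus> Lit 1"
  define D where "D = J - root"
  have J: "int J = int root + int D" using rJ by (simp add: D_def)
  have M2: "2 \<le> M" using M by simp
  define I1 where "I1 q t' s' \<longleftrightarrow> int t' \<le> int t + 10 + 70 * int (length (spur_up root g q)) \<and> output_word s' (u @ spur_up root g q)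
     \<and> agree ?S s s' \<and> s' ''j'' 0 = int root + int q" for q t' s'
  define I2 where "I2 q t' s' \<longleftrightarrow> int t' \<le> int t + 20 + 70 * int (length (spur_up root g D)) + 70 * int q
     \<and> output_word s' (u @ spur_up root g D @ replicate q LT) \<and> agree ?S s s' \<and> s' ''j'' 0 = int root + int (D - q)" for q t' s'
  have ags: "s' ''N'' 0 = int root" "s' ''J'' 0 = int root + int D" "\<And>i. s' ''g'' (int i) = g i" if "agree ?S s s'" for s'
    using agreeD[OF that] s J by auto
  have lenS: "int (length Sp) = int (length (spur_up root g D)) + int D" by (simp add: Sp_def D_def)
  have w2: "wp M (While ?b2 ?c2) G t1 s1" if st: "I2 0 t1 s1" for t1 s1
  proof (rule wp_for[where I = I2 and N = D, OF st])
    fix q t' s'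
    assume q: "q < D" and I: "I2 q t' s'"
    have len: "int (length (u @ spur_up root g D @ replicate q LT)) + 1 \<le> M" using M(1) q lenS by simp
    have ag: "agree ?S s s'" using I by (simp add: I2_def)
    have "wp M ?c2 (I2 (Suc q)) (t' + cost_bexp ?b2) s'"
      unfolding wp_Seq
    proof (rule wp_emit[OF _ _ len M2, where l = LT])
      show "output_word s' (u @ spur_up root g D @ replicate q LT)" using I by (simp add: I2_def)
      fix t2 s2
      assume 2: "t2 \<le> t' + cost_bexp ?b2 + 10 + cost_exp (Lit (- 1))"
        "output_word s2 ((u @ spur_up root g D @ replicate q LT) @ [LT])" "agree {''word'', ''length''} s' s2"
      have o2: "output_word s2 (u @ spur_up root g D @ replicate (Suc q) LT)"
        using 2(2) by (simp add: replicate_append_same[symmetric] del: replicate.simps(2)) (simp add: replicate_append_same)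
      have j2: "s2 ''j'' 0 = int root + int (D - q)" using I agreeD[OF 2(3), of "''j''"] by (simp add: I2_def)
      have ag2: "agree ?S s s2" by (rule agree_trans[OF ag 2(3)]) auto
      have e: "int root + int (D - q) - 1 = int root + int (D - Suc q)" using q by simp
      have jM: "\<bar>int root + int (D - Suc q)\<bar> \<le> M" using M(2) J by simp
      have "I2 (Suc q) t3 (upd s2 ''j'' 0 (int root + int (D - Suc q)))" if "t3 \<le> t2 + 6" for t3
        using that 2(1) I o2 ag2 unfolding I2_def by (simp add: output_word_upd)
      then show "wp M (''j'' ::= V ''j'' \<ominus> Lit 1) (I2 (Suc q)) t2 s2" using jM by (simp add: j2 e)
    qed simp
    then show "eval_bexp ?b2 s' \<and> wp M ?c2 (I2 (Suc q)) (t' + cost_bexp ?b2) s'"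
      using I q ags[OF ag] by (simp add: I2_def)
  next
    fix t' s'
    assume I: "I2 D t' s'"
    have ag: "agree ?S s s'" using I by (simp add: I2_def)
    have "G (t' + cost_bexp ?b2) s'"
      by (rule post[OF _ _ ag]) (use I lenS in \<open>simp_all add: I2_def Sp_def D_def\<close>)
    then show "\<not> eval_bexp ?b2 s' \<and> G (t' + cost_bexp ?b2) s'" using I ags[OF ag] by (simp add: I2_def)
  qed
  have pref: "int (length (spur_up root g (Suc q))) + int (length u) \<le> M" if "q < D" for q
  proof -
    have "int (length (spur_up root g (Suc q))) \<le> int (length (spur_up root g D))"
      unfolding length_spur_up using that by (intro add_mono sum_mono2) auto
    then show ?thesis using M(1) lenS by simp
  qed
  have w1: "wp M (While ?b1 ?c1) (wp M (While ?b2 ?c2) G) t1 s1" if st: "I1 0 t1 s1" for t1 s1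
  proof (rule wp_for[where I = I1 and N = D, OF st])
    fix q t' s'
    assume q: "q < D" and I: "I1 q t' s'"
    have ag: "agree ?S s s'" and j: "s' ''j'' 0 = int root + int q" and o1: "output_word s' (u @ spur_up root g q)"
      and t1: "int t' \<le> int t + 10 + 70 * int (length (spur_up root g q))"
      using I by (auto simp: I1_def)
    define i where "i = root + Suc q"
    have ji: "int root + int q + 1 = int i" by (simp add: i_def)
    have iM: "\<bar>int i\<bar> \<le> M" using M(2) J q by (simp add: i_def)
    have len: "int (length (spur_up root g (Suc q))) = int (length (spur_up root g q)) + 1 + \<bar>g i\<bar>"
      by (simp add: length_a_pow i_def)
    define s2 where "s2 = upd s' ''j'' 0 (int i)"
    have w: "wp M (emit (Lit 1)) (wp M (emit_pow (Cell ''g'' (V ''j''))) (I1 (Suc q))) t2 s2" if t2: "t2 \<le> t' + 12" for t2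
    proof (rule wp_emit[OF _ _ _ M2, where l = Lt and u = "u @ spur_up root g q"])
      show "output_word s2 (u @ spur_up root g q)" using o1 by (simp add: s2_def output_word_upd)
      show "int (length (u @ spur_up root g q)) + 1 \<le> M" using pref[OF q] len by simp
      fix t3 s3
      assume 3: "t3 \<le> t2 + 10 + cost_exp (Lit 1)" "output_word s3 ((u @ spur_up root g q) @ [Lt])" "agree {''word'', ''length''} s2 s3"
      have ag2: "agree ?S s s2" using ag by (simp add: s2_def)
      have ag3: "agree ?S s s3" by (rule agree_trans[OF ag2 3(3)]) auto
      have j3: "s3 ''j'' 0 = int i" using agreeD[OF 3(3), of "''j''"] by (simp add: s2_def)
      show "wp M (emit_pow (Cell ''g'' (V ''j''))) (I1 (Suc q)) t3 s3"
      proof (rule wp_emit_pow[OF 3(2) _ _ M2, where x = "g i"])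
        show "eval_exp (Cell ''g'' (V ''j'')) s3 = g i" using ags(3)[OF ag3, of i] j3 by simp
        show "int (length ((u @ spur_up root g q) @ [Lt])) + \<bar>g i\<bar> \<le> M" using pref[OF q] len by simp
        fix t4 s4
        assume 4: "int t4 \<le> int t3 + 20 + int (cost_exp (Cell ''g'' (V ''j''))) + 30 * \<bar>g i\<bar>"
          "output_word s4 (((u @ spur_up root g q) @ [Lt]) @ a_pow (g i))" "agree {''word'', ''length'', ''x''} s3 s4"
        have ag4: "agree ?S s s4" by (rule agree_trans[OF ag3 4(3)]) auto
        have j4: "s4 ''j'' 0 = int i" using agreeD[OF 4(3), of "''j''"] j3 by simp
        have "int t4 \<le> int t + 10 + 70 * int (length (spur_up root g (Suc q)))"
          unfolding len using 4(1) 3(1) t2 t1 by simp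
        then show "I1 (Suc q) t4 s4"
          unfolding I1_def using 4(2) ag4 j4 by (simp add: i_def)
      qed
    qed simp
    have "wp M ?c1 (I1 (Suc q)) (t' + cost_bexp ?b1) s'"
      unfolding wp_Seq_fun using iM w by (simp add: wp_Store j ji s2_def[symmetric] del: wp_Seq wp_Cond wp_Skip)
    then show "eval_bexp ?b1 s' \<and> wp M ?c1 (I1 (Suc q)) (t' + cost_bexp ?b1) s'"
      using j q ags[OF ag] by simp
  next
    fix t' s'
    assume I: "I1 D t' s'"
    have ag: "agree ?S s s'" using I by (simp add: I1_def)
    have "wp M (While ?b2 ?c2) G (t' + cost_bexp ?b1) s'"
      by (rule w2) (use I in \<open>simp add: I1_def I2_def\<close>)
    then show "\<not> eval_bexp ?b1 s' \<and> wp M (While ?b2 ?c2) G (t' + cost_bexp ?b1) s'"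
      using I ags[OF ag] by (simp add: I1_def)
  qed
  define s1 where "s1 = upd s ''j'' 0 (int root)"
  have w: "wp M (While ?b1 ?c1) (wp M (While ?b2 ?c2) G) t1 s1" if "t1 \<le> t + 10" for t1
    by (rule w1) (use that o in \<open>simp add: I1_def s1_def output_word_upd\<close>)
  have "\<bar>int root\<bar> \<le> M" using M(2) J by simp
  then show ?thesis
    unfolding wp_Seq_fun using w by (simp add: wp_Store s(1) s1_def[symmetric] del: wp_Seq wp_Cond wp_Skip)
qed

lemma wp_write_word:
  fixes M :: int
  assumes s: "s ''N'' 0 = int root" "s ''J'' 0 = int J" "s ''P'' 0 = int m" "s ''n'' 0 = int n"
      "\<And>i. s ''g'' (int i) = g i" "\<And>i. 1 \<le> i \<Longrightarrow> i \<le> n \<Longrightarrow> s ''h'' (int i) = (if H i then 1 else - 1)"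
    and M: "int (length (out_word m Sp g n)) \<le> M" "int J + 2 \<le> M" "0 \<le> M"
    and post: "\<And>t' s'. int t' \<le> int t + 20 + 200 * int n + 200 * int (length (out_word m Sp g n))
       \<Longrightarrow> output_word s' (out_word m Sp g n) \<Longrightarrow> G t' s'"
  shows "wp M write_word G t s"
proof -
  let ?S = "{''word'', ''length'', ''x'', ''j'', ''i''}"
  let ?b = "V ''i'' \<prec> V ''n''"
  let ?c3 = "''j'' ::= V ''N'' ;;
           While (V ''j'' \<prec> V ''J'') (''j'' ::= V ''j'' \<oplus> Lit 1 ;; emit (Lit 1) ;; emit_pow (Cell ''g'' (V ''j''))) ;;
           While (V ''N'' \<prec> V ''j'') (emit (Lit (- 1)) ;; ''j'' ::= V ''j'' \<ominus> Lit 1)"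
  let ?b3 = "Conj (Neg (V ''i'' \<prec> V ''P'')) (Neg (V ''P'' \<prec> V ''i''))"
  let ?c1 = "Cond (Lit 1 \<prec> V ''i'') (emit (Cell ''h'' (V ''i''))) Skip"
  let ?c = "''i'' ::= V ''i'' \<oplus> Lit 1 ;; ?c1 ;; emit_pow (Cell ''g'' (V ''i'')) ;; Cond ?b3 ?c3 Skip"
  define ow where "ow = out_word m Sp g"
  have M2: "2 \<le> M" using M by simp
  define I where "I q t' s' \<longleftrightarrow> int t' \<le> int t + 10 + 200 * int q + 200 * int (length (ow q)) \<and> output_word s' (ow q)
     \<and> agree ?S s s' \<and> s' ''i'' 0 = int q" for q t' s'
  have pref: "int (length (ow i)) \<le> M" if "i \<le> n" for i
  proof -
    have "int (length (ow i)) \<le> int (length (ow n))"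
      unfolding ow_def length_out_word using that by (intro add_mono sum_mono2) auto
    then show ?thesis using M(1) by (simp add: ow_def)
  qed
  have w: "wp M (While ?b ?c) G t1 s1" if st: "I 0 t1 s1" for t1 s1
  proof (rule wp_for[where I = I and N = n, OF st])
    fix q t' s'
    assume q: "q < n" and Iq: "I q t' s'"
    have ag: "agree ?S s s'" and i: "s' ''i'' 0 = int q" and o1: "output_word s' (ow q)"
      and t1: "int t' \<le> int t + 10 + 200 * int q + 200 * int (length (ow q))"
      using Iq by (auto simp: I_def)
    define k where "k = Suc q"
    have ik: "int q + 1 = int k" by (simp add: k_def)
    have kM: "\<bar>int k\<bar> \<le> M" using M(2) q nr rJ by (simp add: k_def)
    let ?l = "if q = 0 then [] else [tl_of (H k)]"
    let ?S3 = "if k = m then Sp else []"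
    have owk: "ow k = ow q @ ?l @ a_pow (g k) @ ?S3" by (simp add: ow_def k_def)
    have lenk: "int (length (ow k)) = int (length (ow q)) + int (length ?l) + \<bar>g k\<bar> + int (length ?S3)"
      unfolding owk by (simp add: length_a_pow)
    have kM': "int (length (ow k)) \<le> M" using pref[of k] q by (simp add: k_def)
    have hk: "s ''h'' (int k) = (if H k then 1 else - 1)" using s(6)[of k] q by (simp add: k_def)
    define s2 where "s2 = upd s' ''i'' 0 (int k)"
    have ag2: "agree ?S s s2" using ag by (simp add: s2_def)
    have o2: "output_word s2 (ow q)" using o1 by (simp add: s2_def output_word_upd)
    have pow: "wp M (emit_pow (Cell ''g'' (V ''i''))) (wp M (Cond ?b3 ?c3 Skip) (I k)) t3 s3"
      if t3: "t3 \<le> t' + 40" and o3: "output_word s3 (ow q @ ?l)" and ag3: "agree ?S s s3" and i3: "s3 ''i'' 0 = int k" for t3 s3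
    proof (rule wp_emit_pow[OF o3 _ _ M2, where x = "g k"])
      show "eval_exp (Cell ''g'' (V ''i'')) s3 = g k" using agreeD[OF ag3, of "''g''"] s(5)[of k] i3 by simp
      show "int (length (ow q @ ?l)) + \<bar>g k\<bar> \<le> M" using kM' lenk by simp
      fix t4 s4
      assume 4: "int t4 \<le> int t3 + 20 + int (cost_exp (Cell ''g'' (V ''i''))) + 30 * \<bar>g k\<bar>"
        "output_word s4 ((ow q @ ?l) @ a_pow (g k))" "agree {''word'', ''length'', ''x''} s3 s4"
      have ag4: "agree ?S s s4" by (rule agree_trans[OF ag3 4(3)]) auto
      have i4: "s4 ''i'' 0 = int k" "s4 ''P'' 0 = int m" "s4 ''N'' 0 = int root" "s4 ''J'' 0 = int J" "\<And>i. s4 ''g'' (int i) = g i"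
        using agreeD[OF 4(3), of "''i''"] i3 agreeD[OF ag4] s by simp_all
      have t4: "int t4 \<le> int t + 10 + 200 * int q + 200 * int (length (ow q)) + 70 + 30 * \<bar>g k\<bar>" using 4(1) t3 t1 by simp
      show "wp M (Cond ?b3 ?c3 Skip) (I k) t4 s4"
      proof (cases "k = m")
        case True
        have b: "eval_bexp ?b3 s4" using True i4 by simp
        have "wp M ?c3 (I k) (t4 + cost_bexp ?b3) s4"
        proof (rule wp_write_spur[OF i4(3,4,5) 4(2) _ M(2,3)])
          show "int (length (((ow q @ ?l) @ a_pow (g k)) @ Sp)) \<le> M" using kM' owk True by simp
          fix t5 s5
          assume 5: "int t5 \<le> int (t4 + cost_bexp ?b3) + 50 + 100 * int (length Sp)"
            "output_word s5 (((ow q @ ?l) @ a_pow (g k)) @ Sp)" "agree {''word'', ''length'', ''x'', ''j''} s4 s5"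
          have ag5: "agree ?S s s5" by (rule agree_trans[OF ag4 5(3)]) auto
          have "s5 ''i'' 0 = int k" using agreeD[OF 5(3), of "''i''"] i4 by simp
          moreover have "int t5 \<le> int t + 10 + 200 * int k + 200 * int (length (ow k))"
            unfolding lenk using 5(1) t4 True by (simp add: k_def)
          moreover have "output_word s5 (ow k)" unfolding owk using 5(2) True by simp
          ultimately show "I k t5 s5" using ag5 by (simp add: I_def)
        qed
        then show ?thesis unfolding wp_Cond using b by (simp del: wp_simps)
      next
        case False
        have "output_word s4 (ow k)" using 4(2) False by (simp add: owk)
        moreover have "int (t4 + 30) \<le> int t + 10 + 200 * int k + 200 * int (length (ow k))"
          unfolding lenk using t4 by (simp add: k_def)
        ultimately have "I k t5 s4" if "t5 \<le> t4 + 30" for t5 using ag4 i4 that by (simp add: I_def)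
        then show ?thesis using False i4 by auto
      qed
    qed
    have c1: "wp M ?c1 (wp M (emit_pow (Cell ''g'' (V ''i''))) (wp M (Cond ?b3 ?c3 Skip) (I k))) t2 s2" if t2: "t2 \<le> t' + 15" for t2
    proof (cases "q = 0")
      case True
      have i2: "s2 ''i'' 0 = 1" using True by (simp add: s2_def k_def)
      have "wp M (emit_pow (Cell ''g'' (V ''i''))) (wp M (Cond ?b3 ?c3 Skip) (I k)) t3 s2" if "t3 \<le> t' + 40" for t3
        by (rule pow[OF that]) (use o2 True ag2 in \<open>simp_all add: s2_def\<close>)
      then show ?thesis using t2 by (simp add: wp_Cond i2 del: wp_Seq wp_Store)
    next
      case False
      have len: "int (length (ow q)) + 1 \<le> M" using kM' lenk False by simp
      have i2: "s2 ''i'' 0 = int k" by (simp add: s2_def)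
      have "wp M (emit (Cell ''h'' (V ''i''))) (wp M (emit_pow (Cell ''g'' (V ''i''))) (wp M (Cond ?b3 ?c3 Skip) (I k))) t3 s2"
        if t3: "t3 \<le> t2 + 4" for t3
      proof (rule wp_emit[OF o2 _ len M2, where l = "tl_of (H k)"])
        show "eval_exp (Cell ''h'' (V ''i'')) s2 = code (tl_of (H k))" using agreeD[OF ag2, of "''h''"] hk i2 by (simp add: tl_of_def)
        fix t4 s4
        assume 4: "t4 \<le> t3 + 10 + cost_exp (Cell ''h'' (V ''i''))" "output_word s4 (ow q @ [tl_of (H k)])" "agree {''word'', ''length''} s2 s4"
        show "wp M (emit_pow (Cell ''g'' (V ''i''))) (wp M (Cond ?b3 ?c3 Skip) (I k)) t4 s4"
        proof (rule pow)
          show "t4 \<le> t' + 40" using 4(1) t3 t2 by simp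
          show "output_word s4 (ow q @ ?l)" using 4(2) False by simp
          show "agree ?S s s4" by (rule agree_trans[OF ag2 4(3)]) auto
          show "s4 ''i'' 0 = int k" using agreeD[OF 4(3), of "''i''"] i2 by simp
        qed
      qed
      moreover have "1 < int k" using False by (simp add: k_def)
      ultimately show ?thesis by (simp add: wp_Cond i2 del: wp_Seq wp_Store wp_Skip)
    qed
    have "wp M ?c (I k) (t' + cost_bexp ?b) s'"
      unfolding wp_Seq_fun using kM c1 by (simp add: wp_Store i ik s2_def[symmetric] del: wp_Seq wp_Cond wp_Skip)
    then show "eval_bexp ?b s' \<and> wp M ?c (I (Suc q)) (t' + cost_bexp ?b) s'"
      using i q agreeD[OF ag, of "''n''"] s(4) by (simp add: k_def del: wp_simps)
  next
    fix t' s'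
    assume Iq: "I n t' s'"
    then have "G (t' + cost_bexp ?b) s'" by (intro post) (simp_all add: I_def ow_def)
    moreover have "s' ''n'' 0 = int n" using Iq s(4) by (simp add: I_def agree_def)
    ultimately show "\<not> eval_bexp ?b s' \<and> G (t' + cost_bexp ?b) s'" using Iq by (simp add: I_def)
  qed
  define s1 where "s1 = upd (upd s ''length'' 0 0) ''i'' 0 0"
  have "wp M (While ?b ?c) G t1 s1" if "t1 \<le> t + 10" for t1
    by (rule w) (use that in \<open>simp add: I_def s1_def ow_def output_word_def\<close>)
  then show ?thesis
    unfolding write_word_def wp_Seq_fun using M(3) by (simp add: wp_Store s1_def[symmetric] del: wp_Seq wp_Cond wp_Skip)
qed

end

end

section \<open>The whole program\<close>

lemma valleys_card: "valleys H n = card {i. 0 < i \<and> i < n \<and> \<not> H i \<and> H (Suc i)}"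
proof (induction n)
  case (Suc n)
  let ?S = "\<lambda>n. {i. 0 < i \<and> i < n \<and> \<not> H i \<and> H (Suc i)}"
  have "?S (Suc n) = (if 0 < n \<and> \<not> H n \<and> H (Suc n) then insert n (?S n) else ?S n)"
    by (auto simp: less_Suc_eq)
  moreover have "finite (?S n)" by simp
  ultimately show ?case using Suc by auto
qed simp

text \<open>Only the first padding letter \<open>t\<close> can create a valley, namely when it
  follows a \<open>T\<close>.\<close>

lemma valleys_pad:
  assumes "1 \<le> n" "\<And>i. n < i \<Longrightarrow> H i"
  shows "valleys H i \<le> valleys H n + (if H n then 0 else 1)"
proof -
  have "valleys H (Suc (n + j)) = valleys H n + (if H n then 0 else 1)" for j
    using assms by (induction j) auto
  moreover have "i \<le> Suc (n + i)" by simp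
  ultimately show ?thesis using valleys_mono[of i "Suc (n + i)" H] by simp
qed

lemma length_alphas: "length (alphas w) = Suc (length (thetas w))"
  by (induction w rule: alphas.induct) (auto simp: thetas_def)

lemma alphas_Cons: "alphas w = hd (alphas w) # tl (alphas w)"
  using length_alphas[of w] by (cases "alphas w") auto

lemma abs_lt_bits: "\<bar>x\<bar> < 2 ^ bits x"
proof (cases "x = 0")
  case False
  then have "nat \<bar>x\<bar> < 2 ^ floorlog 2 (nat \<bar>x\<bar>)" using floorlog_bounds[of "nat \<bar>x\<bar>" 2] by simp
  then have "int (nat \<bar>x\<bar>) < int (2 ^ floorlog 2 (nat \<bar>x\<bar>))" by (simp only: of_nat_less_iff)
  then show ?thesis by (simp add: bits_def)
qed (simp add: bits_def)

lemma sum_list_abs_le: "(\<Sum>\<alpha>\<leftarrow>xs. \<bar>\<alpha>\<bar>) \<le> (2::int) ^ (\<Sum>\<alpha>\<leftarrow>xs. bits \<alpha> + 1)"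
proof (induction xs)
  case (Cons x xs)
  have 1: "1 \<le> (2::int) ^ (\<Sum>\<alpha>\<leftarrow>xs. bits \<alpha> + 1)" "(1::int) \<le> 2 ^ bits x" by simp_all
  have "\<bar>x\<bar> + (\<Sum>\<alpha>\<leftarrow>xs. \<bar>\<alpha>\<bar>) \<le> 2 ^ bits x * 1 + 1 * 2 ^ (\<Sum>\<alpha>\<leftarrow>xs. bits \<alpha> + 1)"
    using abs_lt_bits[of x] Cons by simp
  also have "\<dots> \<le> 2 ^ bits x * 2 ^ (\<Sum>\<alpha>\<leftarrow>xs. bits \<alpha> + 1) + 2 ^ bits x * 2 ^ (\<Sum>\<alpha>\<leftarrow>xs. bits \<alpha> + 1)"
    using 1 by (intro add_mono mult_mono) auto
  also have "\<dots> = 2 ^ (\<Sum>\<alpha>\<leftarrow>x # xs. bits \<alpha> + 1)" by (simp add: power_add)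
  finally show ?case by simp
qed simp

definition path :: "(letter \<times> int) list \<Rightarrow> letter list" where
  "path zs = concat (map (\<lambda>(\<theta>, x). \<theta> # a_pow x) zs)"

text \<open>The letter in front of the 1-based position \<open>j\<close> has index
  \<open>j - 2\<close> in the list. The condition \<open>2 <= j\<close> makes position 1 count as
  entered by \<open>T\<close>, matching the convention for sinks at the left end.\<close>

definition dir :: "letter list \<Rightarrow> nat \<Rightarrow> bool" where
  "dir w j \<longleftrightarrow> 2 \<le> j \<and> thetas w ! (j - 2) = Lt"

definition val_at :: "letter list \<Rightarrow> nat \<Rightarrow> int" where
  "val_at w j = alphas w ! (j - 1)"

lemma sum_val_at: "(\<Sum>j=1..Suc (length (thetas w)). \<bar>val_at w j\<bar>) = (\<Sum>\<alpha>\<leftarrow>alphas w. \<bar>\<alpha>\<bar>)"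
proof -
  have "(\<Sum>\<alpha>\<leftarrow>alphas w. \<bar>\<alpha>\<bar>) = (\<Sum>j<Suc (length (thetas w)). \<bar>alphas w ! j\<bar>)"
    by (simp add: sum_list_sum_nth length_alphas atLeast0LessThan del: sum.lessThan_Suc)
  also have "\<dots> = (\<Sum>j=1..Suc (length (thetas w)). \<bar>val_at w j\<bar>)"
    by (rule sum.reindex_bij_witness[of _ "\<lambda>j. j - 1" Suc]) (auto simp: val_at_def)
  finally show ?thesis by simp
qed

text \<open>A valley at the 1-based position \<open>i\<close> is the sink with index
  \<open>i - 1\<close>. Entering position 1 by a fictitious \<open>T\<close> agrees with the vacuous
  condition on the left, and the extra summand stands for the last position, where the condition on
  the right is vacuous.\<close>

lemma valleys_dir:
  "valleys (dir w) (Suc (length (thetas w))) + (if dir w (Suc (length (thetas w))) then 0 else 1) \<le> num_sinks w"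
proof -
  let ?k = "length (thetas w)"
  let ?S = "{i. 0 < i \<and> i < Suc ?k \<and> \<not> dir w i \<and> dir w (Suc i)}"
  let ?T = "?S \<union> (if dir w (Suc ?k) then {} else {Suc ?k})"
  have fin: "finite ?S" by simp
  have "valleys (dir w) (Suc ?k) + (if dir w (Suc ?k) then 0 else 1) = card ?T"
    unfolding valleys_card using fin by auto
  also have "\<dots> \<le> card (sinks w)"
  proof (rule card_inj_on_le[of "\<lambda>i. i - 1"])
    show "inj_on (\<lambda>i. i - 1) ?T" by (auto simp: inj_on_def split: if_splits)
    have up: "thetas w ! (i - 1) \<noteq> Lt \<or> i = 0" if "\<not> dir w (Suc i)" for i
      using that by (cases i) (auto simp: dir_def)
    have dn: "thetas w ! i \<noteq> LT" if "dir w (Suc (Suc i))" for i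
      using that by (auto simp: dir_def)
    have "i - 1 \<in> sinks w" if iT: "i \<in> ?T" for i
    proof -
      have "i \<noteq> 0" using iT by (auto split: if_splits)
      then obtain i' where i': "i = Suc i'" by (cases i) auto
      show ?thesis
        using iT up[of i'] dn[of i'] unfolding i' sinks_def by (auto split: if_splits)
    qed
    then show "(\<lambda>i. i - 1) ` ?T \<subseteq> sinks w" by blast
    show "finite (sinks w)" by (rule finite_subset[of _ "{..?k}"]) (auto simp: sinks_def)
  qed
  finally show ?thesis by (simp add: num_sinks_def)
qed

lemma num_sinks_bounds: "1 \<le> num_sinks w" "num_sinks w \<le> Suc (length (thetas w))"
proof -
  let ?k = "length (thetas w)"
  have "card (sinks w) \<le> card {..?k}" by (intro card_mono) (auto simp: sinks_def)
  then show "num_sinks w \<le> Suc ?k" by (simp add: num_sinks_def)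
  show "1 \<le> num_sinks w"
  proof (cases "dir w (Suc ?k)")
    case True
    then have "0 < valleys (dir w) (Suc ?k)"
    proof -
      have "0 < valleys (dir w) j" if "dir w j" for j
        using that
      proof (induction j)
        case (Suc j)
        then show ?case by (cases "dir w j") (auto simp: dir_def)
      qed (simp add: dir_def)
      then show ?thesis using True by blast
    qed
    then show ?thesis using valleys_dir[of w] by linarith
  next
    case False
    then show ?thesis using valleys_dir[of w] by simp
  qed
qed

context bs
begin

section \<open>Words, geodesic length and norm\<close>

lemma word_path: "w \<approx> a_pow (hd (alphas w)) @ path (zip (thetas w) (tl (alphas w)))"
proof (induction w)
  case (Cons l w)
  let ?X = "path (zip (thetas w) (tl (alphas w)))" and ?h = "hd (alphas w)"
  have a1: "a_pow 1 = [La]" "a_pow (- 1) = [LA]" by (simp_all add: a_pow_def)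
  have IH: "[l] @ w \<approx> [l] @ a_pow ?h @ ?X" by (rule eqv_right[OF Cons.IH])
  show ?case
  proof (cases l)
    case La
    have "[La] @ a_pow ?h @ ?X \<approx> a_pow (1 + ?h) @ ?X"
      using eqv_left[OF a_pow_add[of 1 ?h], of ?X] by (simp add: a1)
    then show ?thesis using bs_eq.trans[OF IH] La by (simp add: thetas_def add.commute)
  next
    case LA
    have "[LA] @ a_pow ?h @ ?X \<approx> a_pow (- 1 + ?h) @ ?X"
      using eqv_left[OF a_pow_add[of "- 1" ?h], of ?X] by (simp add: a1)
    then show ?thesis using bs_eq.trans[OF IH] LA by (simp add: thetas_def)
  next
    case Lt
    show ?thesis using IH alphas_Cons[of w] Lt
      by (cases "alphas w") (simp_all add: thetas_def path_def)
  next
    case LT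
    show ?thesis using IH alphas_Cons[of w] LT
      by (cases "alphas w") (simp_all add: thetas_def path_def)
  qed
qed (simp add: thetas_def path_def)

lemma wd_path:
  assumes "i \<le> length (thetas w)"
  shows "wd (dir w) (val_at w) (Suc i) = a_pow (hd (alphas w)) @ path (take i (zip (thetas w) (tl (alphas w))))"
  using assms
proof (induction i)
  case 0
  show ?case using alphas_Cons[of w] by (cases "alphas w") (simp_all add: val_at_def path_def)
next
  case (Suc i)
  then have i: "i < length (thetas w)" by simp
  have len: "length (zip (thetas w) (tl (alphas w))) = length (thetas w)" by (simp add: length_alphas)
  have "thetas w ! i \<in> set (thetas w)" using i by (rule nth_mem)
  then have th: "thetas w ! i = Lt \<or> thetas w ! i = LT" by (auto simp: thetas_def)
  have "tl_of (dir w (Suc (Suc i))) = thetas w ! i" using th by (auto simp: dir_def tl_of_def)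
  moreover have "val_at w (Suc (Suc i)) = tl (alphas w) ! i"
    using i length_alphas[of w] by (simp add: val_at_def nth_tl)
  moreover have "take (Suc i) (zip (thetas w) (tl (alphas w)))
     = take i (zip (thetas w) (tl (alphas w))) @ [(thetas w ! i, tl (alphas w) ! i)]"
    using i len by (simp add: take_Suc_conv_app_nth length_alphas)
  ultimately show ?case using Suc.IH i by (simp add: path_def)
qed

lemma word_wd: "w \<approx> wd (dir w) (val_at w) (Suc (length (thetas w)))"
  unfolding wd_path[OF order_refl] using word_path[of w] by (simp add: length_alphas)

lemma geo_len_ex: "\<exists>v. v \<approx> w \<and> length v = geo_len p (p * r) w"
  unfolding geo_len_def by (rule LeastI[of "\<lambda>n. \<exists>v. v \<approx> w \<and> length v = n" "length w"]) (intro exI[of _ w] conjI bs_eq.refl HOL.refl)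

lemma geo_len_le: "v \<approx> w \<Longrightarrow> geo_len p (p * r) w \<le> length v"
  unfolding geo_len_def by (intro Least_le exI[of _ v] conjI HOL.refl)

lemma short_path:
  "\<exists>v. v \<approx> path (zip \<theta>s xs) \<and> length v \<le> length \<theta>s + (\<Sum>x\<leftarrow>xs. geo_len p (p * r) (a_pow x))"
proof (induction \<theta>s arbitrary: xs)
  case (Cons \<theta> \<theta>s)
  show ?case
  proof (cases xs)
    case Nil
    show ?thesis by (intro exI[of _ "[]"]) (simp add: Nil path_def)
  next
    case (Cons x ys)
    obtain v where v: "v \<approx> path (zip \<theta>s ys)" "length v \<le> length \<theta>s + (\<Sum>x\<leftarrow>ys. geo_len p (p * r) (a_pow x))"
      using Cons.IH[of ys] by blast
    obtain u where u: "u \<approx> a_pow x" "length u = geo_len p (p * r) (a_pow x)" using geo_len_ex by blast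
    have "[\<theta>] @ u @ v \<approx> [\<theta>] @ a_pow x @ path (zip \<theta>s ys)"
      by (intro bs_eq.cong bs_eq.refl u v)
    then have "\<theta> # u @ v \<approx> path (zip (\<theta> # \<theta>s) xs)" by (simp add: path_def Cons)
    then show ?thesis using u v by (intro exI[of _ "\<theta> # u @ v"]) (simp add: Cons)
  qed
qed (intro exI[of _ "[]"], simp add: path_def)

text \<open>Replacing every power of \<open>a\<close> by a geodesic word for it gives a word whose
  length is the norm. The bound limits the padding rounds and the time needed to write the
  result.\<close>

lemma geo_len_le_norm: "geo_len p (p * r) w \<le> norm_w p (p * r) w"
proof -
  obtain v where v: "v \<approx> path (zip (thetas w) (tl (alphas w)))"
    "length v \<le> length (thetas w) + (\<Sum>x\<leftarrow>tl (alphas w). geo_len p (p * r) (a_pow x))"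
    using short_path by blast
  obtain u where u: "u \<approx> a_pow (hd (alphas w))" "length u = geo_len p (p * r) (a_pow (hd (alphas w)))"
    using geo_len_ex by blast
  have "u @ v \<approx> w" by (rule bs_eq.trans[OF bs_eq.cong[OF u(1) v(1)] bs_eq.sym[OF word_path]])
  then have "geo_len p (p * r) w \<le> length (u @ v)" by (rule geo_len_le)
  also have "(\<Sum>\<alpha>\<leftarrow>alphas w. geo_len p (p * r) (a_pow \<alpha>))
     = geo_len p (p * r) (a_pow (hd (alphas w))) + (\<Sum>\<alpha>\<leftarrow>tl (alphas w). geo_len p (p * r) (a_pow \<alpha>))"
    using alphas_Cons[of w] by (cases "alphas w") simp_all
  then have "length (u @ v) \<le> norm_w p (p * r) w"
    unfolding norm_w_def using u v by simp
  finally show ?thesis .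
qed

lemma norm_le: "int (norm_w p (p * r) w) \<le> int (length (thetas w)) + (\<Sum>\<alpha>\<leftarrow>alphas w. \<bar>\<alpha>\<bar>)"
proof -
  have "int (\<Sum>x\<leftarrow>xs. geo_len p (p * r) (a_pow x)) \<le> (\<Sum>\<alpha>\<leftarrow>xs. \<bar>\<alpha>\<bar>)" for xs
  proof (induction xs)
    case (Cons x xs)
    have "int (geo_len p (p * r) (a_pow x)) \<le> \<bar>x\<bar>"
      using geo_len_le[OF bs_eq.refl, of "a_pow x"] by (simp add: length_a_pow[symmetric])
    then show ?case using Cons by simp
  qed simp
  then show ?thesis by (simp add: norm_w_def)
qed

end

lemma (in tree) ch_sg_valleys: "ch sg n = int (valleys H n)"
  by (induction n) (auto simp: ch_sg_Suc)

section \<open>Assembly: optimality, running time and word size\<close>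

definition (in bs) program :: com where
  "program = (britton ;; prog.forward p r ;; prog.backtrack p r ;; write_word)"

context bs
begin

context
  fixes w :: "letter list" and U M :: int and k g :: nat
  assumes k: "k = length (thetas w)" and g: "g = norm_w p (p * r) w" and M: "M = 100 * (U * U * U)"
    and U100: "100 \<le> U" and QU: "Q \<le> U" and NU: "2 * int (k + 1) + int g + 1 \<le> U"
    and AU: "R ^ k * (\<Sum>j=1..Suc k. \<bar>val_at w j\<bar>) + 2 * int (k + 1) + int g + 1 \<le> U"
    and kU: "10 * int (k + 1) \<le> U"
begin

lemma UM: "10 * U \<le> M" "U \<le> M"
proof -
  have "100 * 100 \<le> U * U" using U100 by (intro mult_mono) auto
  then have "1 * U \<le> (U * U) * U" using U100 by (intro mult_right_mono) auto
  then show "10 * U \<le> M" "U \<le> M" using M U100 by linarith+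
qed

lemma wp_program:
  "wp M program (\<lambda>t s'. \<exists>u. int t \<le> 1000000 * (int (num_sinks w) * (int (num_sinks w) + int g))
     \<and> output_word s' u \<and> u \<approx> w \<and> (\<forall>v. v \<approx> w \<longrightarrow> length u \<le> length v)) 0 (input_state w)"
  (is "wp M program ?Z 0 ?s")
proof -
  define Z where "Z = ?Z"
  \<comment> \<open>The root is at most \<open>2 * n\<close> with \<open>n <= k + 1\<close>, and the
    search for the spur pads at most \<open>g + 1\<close> further positions.\<close>
  define N where "N = 2 * (k + 1) + g + 1"
  let ?A = "R ^ k * (\<Sum>j=1..Suc k. \<bar>val_at w j\<bar>)"
  have H01: "\<not> dir w 1" by (simp add: dir_def)
  have A0: "0 \<le> ?A" by (intro mult_nonneg_nonneg sum_nonneg) auto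
  have "10 * int k + 10 \<le> U" using kU by simp
  then have Mk: "int k + 10 \<le> M" using UM U100 by linarith
  have MQ: "Q \<le> M" using QU UM by linarith
  have Mg: "?A \<le> M" using AU UM A0 by linarith
  have inp: "input (dir w) (val_at w) k ?s"
    unfolding input_def[where ?H0.0 = "dir w" and ?g0.0 = "val_at w" and k = k and M = M, OF H01 Mk MQ Mg]
  proof (intro conjI allI impI)
    show "?s ''k'' 0 = int k" by (simp add: input_state_def k)
    show "?s ''alpha'' (int j) = val_at w (Suc j)" if "j \<le> k" for j using that by (simp add: input_state_def val_at_def k)
    show "?s ''theta'' (int j) = (if dir w (Suc j) then 1 else - 1)" if j: "1 \<le> j \<and> j \<le> k" for j
    proof -
      have "thetas w ! (j - 1) \<in> set (thetas w)" using j k by (intro nth_mem) auto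
      then have "thetas w ! (j - 1) = Lt \<or> thetas w ! (j - 1) = LT" by (auto simp: thetas_def)
      moreover have "nat (int j - 1) = j - 1" by simp
      moreover have "Suc j - 2 = j - 1" by simp
      ultimately show ?thesis using j k by (auto simp: input_state_def dir_def)
    qed
  qed
  have "wp M britton (wp M (prog.forward p r) (wp M (prog.backtrack p r) (wp M write_word Z))) 0 ?s"
  proof (rule wp_britton[where ?H0.0 = "dir w" and ?g0.0 = "val_at w" and k = k and M = M, OF H01 Mk MQ Mg inp])
    fix t1 s1
    assume t1: "t1 \<le> 0 + 120 * (k + 1)" and "binv (dir w) (val_at w) (Suc k) ?s s1"
    then obtain n where ag1: "agree {''n'', ''h'', ''e'', ''i'', ''m''} ?s s1" and n: "s1 ''n'' 0 = int n"
      "stack (dir w) (val_at w) (Suc k) n (hs s1) (es s1)" "\<forall>j. 1 \<le> j \<and> j \<le> n \<longrightarrow> s1 ''h'' (int j) \<in> {1, - 1}"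
      by (auto simp: binv_def[where ?H0.0 = "dir w" and ?g0.0 = "val_at w" and k = k and M = M, OF H01 Mk MQ Mg])
    note st = n(2)[unfolded stack_def[where ?H0.0 = "dir w" and ?g0.0 = "val_at w" and k = k and M = M, OF H01 Mk MQ Mg]]
    \<comment> \<open>Beyond \<open>n\<close> the reduced expression is prolonged virtually by
      letters \<open>t\<close> with exponent 0.\<close>
    define H where "H j \<longleftrightarrow> (if j \<le> n then hs s1 j else True)" for j
    define e where "e j = (if 1 \<le> j \<and> j \<le> n then es s1 j else 0)" for j
    have n1: "1 \<le> n" "n \<le> Suc k" using st by auto
    have pad: "\<And>i. n < i \<Longrightarrow> H i \<and> e i = 0" by (simp add: H_def e_def)
    have Hn: "\<not> H 1" using st n1 by (simp add: H_def)
    have red: "reduced H e n" using st by (auto simp: reduced_def H_def e_def)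
    have wdn: "wd H e n \<approx> w"
    proof -
      have "wd H e n = wd (hs s1) (es s1) n" by (rule wd_cong) (auto simp: H_def e_def)
      also have "\<dots> \<approx> wd (dir w) (val_at w) (Suc k)" using st by blast
      also have "\<dots> \<approx> w" unfolding k by (rule bs_eq.sym[OF word_wd])
      finally show ?thesis .
    qed
    have sum_e: "(\<Sum>j=1..i. \<bar>e j\<bar>) \<le> ?A" for i
    proof -
      have "(\<Sum>j=1..i. \<bar>e j\<bar>) = (\<Sum>j\<in>{1..i} \<inter> {1..n}. \<bar>e j\<bar>)"
        by (rule sum.mono_neutral_right) (auto simp: e_def)
      also have "\<dots> \<le> (\<Sum>j=1..n. \<bar>e j\<bar>)" by (intro sum_mono2) auto
      also have "\<dots> = (\<Sum>j=1..n. \<bar>es s1 j\<bar>)" by (intro sum.cong) (auto simp: e_def)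
      also have "\<dots> \<le> ?A" using st by simp
      finally show ?thesis .
    qed
    define S where "S = int (num_sinks w)"
    have S: "1 \<le> S" "S \<le> int (k + 1)" using num_sinks_bounds[of w] k by (auto simp: S_def)
    have vS: "int (valleys H i) \<le> S" for i
    proof -
      have "valleys H i \<le> valleys H n + (if H n then 0 else 1)" using valleys_pad[of n H i] n1 pad by blast
      also have "valleys H n = valleys (hs s1) n" by (rule valleys_cong) (simp add: H_def)
      also have "valleys (hs s1) n + (if H n then 0 else 1) \<le> num_sinks w"
        using st valleys_dir[of w] k by (simp add: H_def)
      finally show ?thesis by (simp add: S_def)
    qed
    interpret tr: tree p r H e by unfold_locales (use Hn in simp)
    have sgS: "tr.ch tr.sg i \<le> S" for i using vS[of i] by (simp add: tr.ch_sg_valleys)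
    have LS: "tr.LL i \<le> 6 * S + 1" for i
      using tr.LL_le[of i] tr.sg_le_ch[of i i] sgS[of i] by simp
    interpret pg: prog p r H e N U M
    proof unfold_locales
      fix i
      assume i: "i \<le> N"
      have NA: "?A + int N \<le> U" using AU by (simp add: N_def)
      show "\<bar>e i\<bar> \<le> U"
      proof (cases "i = 0")
        case False
        then have "\<bar>e i\<bar> \<le> (\<Sum>j=1..i. \<bar>e j\<bar>)" by (intro member_le_sum) auto
        then show ?thesis using sum_e[of i] NA by linarith
      qed (use U100 in \<open>simp add: e_def\<close>)
      have "(\<Sum>j=1..i. \<bar>e j\<bar> + 1) = (\<Sum>j=1..i. \<bar>e j\<bar>) + int i" by (simp add: sum.distrib)
      then show "\<bar>tr.cc i\<bar> \<le> U" using tr.cc_le_sum[of i] sum_e[of i] NA i by linarith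
      have "6 * S + 1 \<le> 10 * int (k + 1)" using S by simp
      also have "\<dots> \<le> U" by (rule kU)
      finally show "tr.LL i \<le> U" by (rule order_trans[OF LS[of i]])
      show "tr.F i 0 \<le> U" using tr.F0_le_sum[of i] sum_e[of i] NA by linarith
    next
      show "int N \<le> U" using NU by (simp add: N_def)
      show "100 * (U * U * U) \<le> M" by (simp add: M)
    qed (rule U100 QU)+
    have root: "n \<le> pg.root n" "pg.root n \<le> 2 * n" "tr.pr (pg.root n) = 0"
      "\<And>j. n \<le> j \<Longrightarrow> j < pg.root n \<Longrightarrow> tr.pr j \<noteq> 0"
      using pg.root[OF n1(1) pad] by blast+
    let ?root = "pg.root n"
    \<comment> \<open>Any word \<open>v\<close> for the same element has a reduced expression with
      spurs no longer than \<open>v\<close>. By uniqueness it has the same \<open>n - 1\<close>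
      letters and differs from the reduced input by a flow that vanishes at \<open>n\<close>, so the
      optimum bounds the rest of its length.\<close>
    have low: "\<exists>j. tr.F (?root + j) 0 + 2 * int j \<le> int (length v) - int (n - 1)" if v: "v \<approx> w" for v
    proof -
      obtain n' H' g' c where r: "1 \<le> n'" "\<not> H' 1" "reduced H' g' n'" "wd H' g' n' \<approx> v"
         "\<forall>i. 1 \<le> i \<and> i \<le> n' \<longrightarrow> spur (g' i) (c i)" "n' - 1 + (\<Sum>i=1..n'. c i) \<le> length v"
        using reduced_expression[of v] by blast
      have "wd H e n \<approx> wd H' g' n'"
        by (rule bs_eq.trans[OF wdn bs_eq.sym[OF bs_eq.trans[OF r(4) v]]])
      then obtain f where f: "n' = n" "flow H e g' f n" "f n = 0"
        using reduced_unique[OF red Hn n1(1) r(3,2,1)] by blast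
      have sp: "\<forall>i. 1 \<le> i \<and> i \<le> n \<longrightarrow> spur (g' i) (c i)" using r(5) f(1) by simp
      obtain j where "tr.F (?root + j) 0 + 2 * int j \<le> (\<Sum>i=1..n. int (c i))"
        using tr.optimum_le[OF f(2) sp f(3) root(3,1) pad] by blast
      moreover have "int (n - 1) + (\<Sum>i=1..n. int (c i)) \<le> int (length v)"
        using r(6) f(1) by (simp flip: of_nat_sum of_nat_add)
      ultimately show ?thesis by (intro exI[of _ j]) linarith
    qed
    have val: "pg.val n j = tr.F (?root + j) 0 + 2 * int j" for j
      by (rule pg.val_def[OF n1(1)]) (use pad in auto)
    have ex: "\<exists>j. pg.val n j \<le> int g"
    proof -
      obtain v where v: "v \<approx> w" "length v = geo_len p (p * r) w" using geo_len_ex by blast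
      then have "int (length v) \<le> int g" using geo_len_le_norm[of w] g by simp
      moreover obtain j where "tr.F (?root + j) 0 + 2 * int j \<le> int (length v) - int (n - 1)" using low[OF v(1)] by blast
      ultimately show ?thesis unfolding val by (intro exI[of _ j]) linarith
    qed
    have zero: "?s x i = 0" if "x \<notin> {''k'', ''alpha'', ''theta''}" for x i
      using that by (simp add: input_state_def)
    have z1: "s1 x i = 0" if "x \<notin> {''k'', ''alpha'', ''theta'', ''n'', ''h'', ''e'', ''i'', ''m''}" for x i
      using agreeD[OF ag1, of x] zero[of x i] that by simp
    have b0: "pg.built 0 s1" by (simp add: pg.built_def pg.node_def z1 adr_def)
    have d0: "pg.data n s1"
      unfolding pg.data_def
    proof (intro allI impI)
      fix j
      assume j: "1 \<le> j \<and> j \<le> n"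
      then have "s1 ''h'' (int j) \<in> {1, - 1}" using n(3) by blast
      then show "s1 ''e'' (int j) = e j \<and> s1 ''h'' (int j) = (if H j then 1 else - 1)"
        using j by (auto simp: e_def H_def es_def[where ?H0.0 = "dir w" and ?g0.0 = "val_at w" and k = k and M = M, OF H01 Mk MQ Mg]
            hs_def[where ?H0.0 = "dir w" and ?g0.0 = "val_at w" and k = k and M = M, OF H01 Mk MQ Mg])
    qed
    have gN: "?root + g + 1 \<le> N" using root(2) n1 by (simp add: N_def)
    show "wp M pg.forward (wp M pg.backtrack (wp M write_word Z)) t1 s1"
    proof (rule pg.wp_forward[OF n1(1) pad b0 d0 n(1) gN ex])
      fix t2 s2 j i
      assume t2: "int t2 \<le> int t1 + pg.cost (?root + g + 1) + 500 + 200 * int (g + 1)"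
        and fw: "pg.fwd n i s1 s2" and top: "pg.top n (s2 ''P'' 0)" and s2: "s2 ''N'' 0 = int ?root" "s2 ''J'' 0 = int (?root + j)"
        and ji: "?root + j \<le> i" "i \<le> N" and min: "\<And>j'. pg.val n j \<le> pg.val n j'"
      let ?J = "?root + j"
      have ag2: "agree pg.FS s1 s2" and bi: "pg.built i s2" and da: "pg.data (max i n) s2" and n2: "s2 ''n'' 0 = int n"
        using fw by (auto simp: pg.fwd_def[OF n1(1) pad])
      have bJ: "pg.built ?J s2" using bi ji by (auto simp: pg.built_def)
      have dJ: "pg.data ?J s2" using da ji by (auto simp: pg.data_def)
      have dd: "s2 ''d'' (int l) = 0" for l
        using agreeD[OF ag2, of "''d''"] z1[of "''d''" "int l"] by (simp add: pg.FS_def pg.TS_def)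
      have JN: "?J \<le> N" using ji by simp
      show "wp M pg.backtrack (wp M write_word Z) t2 s2"
      proof (rule pg.wp_backtrack[OF JN bJ dJ s2(2) n2 dd pad LS])
        show "0 \<le> 6 * S + 1" using S by simp
        fix t3 s3
        assume t3: "int t3 \<le> int t2 + int (?J + 1) * (1700 * (6 * S + 1 + 3))"
          and ag3: "agree (insert ''i'' pg.BS) s2 s3"
          and opt: "tr.optimal 0 (\<lambda>j. s3 ''d'' (int j)) (\<lambda>j. s3 ''g'' (int j)) ?J"
          and zs: "pg.zeros n ?J 0 s3" and dJ0: "s3 ''d'' (int ?J) = 0"
        define G where "G = (\<lambda>j. s3 ''g'' (int j))"
        define f where "f = tr.out (\<lambda>j. s3 ''d'' (int j))"
        have prJ: "tr.pr (?root + l) = 0" for l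
        proof (induction l)
          case (Suc l)
          have "H (Suc (?root + l))" using pad[of "Suc (?root + l)"] root(1) by simp
          then show ?case using Suc by simp
        qed (use root(3) in simp)
        have fl: "flow H e G f ?J" "f ?J = 0"
          using tr.optimal_flow[OF opt prJ dJ0] by (simp_all add: G_def f_def)
        have sumG: "(\<Sum>l=1..?J. \<bar>G l\<bar>) \<le> tr.F ?J 0"
          using tr.optimal_sum[OF opt prJ] dJ0 by (simp add: G_def)
        have G0: "G l = 0" if "n < l" "l \<le> ?root" for l
        proof -
          have "tr.pr (l - 1) \<noteq> 0" using that by (intro root(4)) auto
          moreover have "l - 1 < ?J" "n \<le> l - 1" using that by auto
          ultimately show ?thesis
            using zs[unfolded pg.zeros_def, rule_format, of "l - 1"] that by (simp add: G_def)
        qed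
        obtain m where m: "s2 ''P'' 0 = int m" "1 \<le> m" "m \<le> n" "tr.pr m = 0"
          "\<And>j. m \<le> j \<Longrightarrow> j < n \<Longrightarrow> H (Suc j) \<Longrightarrow> tr.pr j \<noteq> 0"
          using top unfolding pg.top_def by blast
        have rJ: "?root \<le> ?J" by simp
        note ctx = fl n1(1) root(1) rJ pad root(3,4) G0 m(2-5)
        define u where "u = tr.out_word m (tr.Sp ?root ?J G) G n"
        have uw: "u \<approx> w"
          unfolding u_def by (rule bs_eq.trans[OF tr.out_word_correct[where n = n and root = ?root and J = ?J and m = m and g = G and f = f, OF ctx] wdn])
        have lu: "int (length u) = int (n - 1) + (\<Sum>l=1..?J. \<bar>G l\<bar>) + 2 * int (?J - ?root)"
          unfolding u_def by (rule tr.length_out[where n = n and root = ?root and J = ?J and m = m and g = G and f = f, OF ctx])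
        have lenu: "int (length u) \<le> int (n - 1) + pg.val n j"
          unfolding lu val using sumG by simp
        have opt_u: "length u \<le> length v" if vw: "v \<approx> w" for v
        proof -
          obtain j' where "tr.F (?root + j') 0 + 2 * int j' \<le> int (length v) - int (n - 1)" using low[OF vw] by blast
          then have "int (length u) \<le> int (length v)"
            using lenu min[of j'] unfolding val by linarith
          then show ?thesis by simp
        qed
        have ug: "length u \<le> g"
        proof -
          obtain v where v: "v \<approx> w" "length v = geo_len p (p * r) w" using geo_len_ex by blast
          then show ?thesis using opt_u[OF v(1)] geo_len_le_norm[of w] g by simp
        qed
        have nm: "x \<notin> insert ''i'' pg.BS" if "x \<in> {''N'', ''J'', ''P'', ''n'', ''h''}" for x
          using that by (auto simp: pg.BS_def)
        have s3: "s3 ''N'' 0 = int ?root" "s3 ''J'' 0 = int ?J" "s3 ''P'' 0 = int m" "s3 ''n'' 0 = int n"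
          using agreeD[OF ag3 nm] s2 m(1) n2 by simp_all
        have h3: "s3 ''h'' (int l) = (if H l then 1 else - 1)" if "1 \<le> l" "l \<le> n" for l
          using agreeD[OF ag3 nm, of "''h''"] da that by (simp add: pg.data_def)
        have N10: "int N \<le> U" "2 \<le> U" using NU U100 by (simp_all add: N_def)
        show "wp M write_word Z t3 s3"
        proof (rule tr.wp_write_word[where n = n and root = ?root and J = ?J and m = m and g = G and f = f and s = s3, OF ctx s3])
          show "s3 ''g'' (int l) = G l" for l by (simp add: G_def)
          show "s3 ''h'' (int l) = (if H l then 1 else - 1)" if "1 \<le> l" "l \<le> n" for l using h3 that .
          have "int g \<le> int N" by (simp add: N_def)
          then show "int (length (tr.out_word m (tr.Sp ?root ?J G) G n)) \<le> M"
            using ug N10 UM unfolding u_def by linarith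
          show "int ?J + 2 \<le> M" using JN N10 UM by linarith
          show "0 \<le> M" using N10 UM by linarith
          fix t4 s4
          assume t4: "int t4 \<le> int t3 + 20 + 200 * int n + 200 * int (length (tr.out_word m (tr.Sp ?root ?J G) G n))"
            and o: "output_word s4 (tr.out_word m (tr.Sp ?root ?J G) G n)"
          define X where "X = S + int g"
          \<comment> \<open>The norm counts every letter \<open>t\<close> and \<open>T\<close>, so
            the number of positions, and with it \<open>N\<close>, is linear in \<open>X\<close>,
            the sum of sinks and norm.\<close>
          have kg: "int k \<le> int g" using g k by (simp add: norm_w_def)
          have X: "int k + 1 \<le> X" "S \<le> X" "int g \<le> X" "1 \<le> X" using kg S by (simp_all add: X_def)
          have NX: "int N + 1 \<le> 5 * X" using X by (simp add: N_def)
          have SX: "X \<le> S * X" using mult_right_mono[of 1 S X] S X by simp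
          have SS: "S * S \<le> S * X" using mult_left_mono[of S X S] S X by simp
          \<comment> \<open>With \<open>l <= 5 * X\<close> and \<open>S <= X\<close> the bound of
            \<open>work_sum\<close> is at most \<open>240 * (S * X)\<close>; then 482500 is 2000
            times 240 plus 500 times 5.\<close>
          have cst: "pg.cost (?root + g + 1) \<le> 482500 * (S * X)"
          proof -
            define l where "l = ?root + g + 1"
            have i: "int l \<le> 5 * X" using gN NX by (simp add: l_def)
            have "S * int l \<le> S * (5 * X)" using i S by (intro mult_left_mono) auto
            moreover have "(\<Sum>x=1..l. tr.work x) \<le> 40 * S * (S + int l)"
              by (rule tr.work_sum[OF S(1) sgS])
            moreover have "pg.cost l = 2000 * (\<Sum>x=1..l. tr.work x) + 500 * int l"
            proof -
              have "pg.cost l = (\<Sum>x=1..l. 2000 * tr.work x + 500)"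
                by (rule pg.cost_def[OF n1(1)]) (use pad in auto)
              also have "\<dots> = 2000 * (\<Sum>x=1..l. tr.work x) + 500 * int l"
                unfolding sum.distrib sum_distrib_left[symmetric] by simp
              finally show ?thesis .
            qed
            moreover have "40 * S * (S + int l) = 40 * (S * S) + 40 * (S * int l)" by (simp add: algebra_simps)
            ultimately show ?thesis unfolding l_def[symmetric] using SS SX i by linarith
          qed
          have bt: "int (?J + 1) * (1700 * (6 * S + 1 + 3)) \<le> 85000 * (S * X)"
          proof -
            have "int (?J + 1) * (1700 * (6 * S + 1 + 3)) \<le> (5 * X) * (17000 * S)"
            proof (rule mult_mono)
              have "int (?J + 1) \<le> int N + 1" using JN by simp
              then show "int (?J + 1) \<le> 5 * X" using NX by (rule order_trans)
              show "1700 * (6 * S + 1 + 3) \<le> 17000 * S" using S(1) by simp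
              show "0 \<le> 5 * X" using X(4) by linarith
              show "0 \<le> 1700 * (6 * S + 1 + 3)" using S(1) by simp
            qed
            then show ?thesis by (simp add: mult_ac)
          qed
          have total: "x4 \<le> 1000000 * (S * X)"
            if "x4 \<le> x3 + 20 + 200 * nn + 200 * len" "x3 \<le> x2 + b" "x2 \<le> x1 + c + 500 + 200 * gg" "x1 \<le> 120 * X"
              "nn \<le> X" "len \<le> X" "gg \<le> 2 * X" "c \<le> 482500 * (S * X)" "b \<le> 85000 * (S * X)"
            for x1 x2 x3 x4 nn len gg b c :: int
            using that SX X(4) by linarith
          have "int (length (tr.out_word m (tr.Sp ?root ?J G) G n)) \<le> int g" using ug unfolding u_def by simp
          then have lX: "int (length (tr.out_word m (tr.Sp ?root ?J G) G n)) \<le> X" using X(3) by (rule order_trans)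
          have t1X: "int t1 \<le> 120 * X" and nX: "int n \<le> X" and gX: "int (g + 1) \<le> 2 * X" using t1 X n1 by simp_all
          have "int t4 \<le> 1000000 * (S * X)"
            by (rule total[OF t4 t3 t2 t1X nX lX gX cst bt])
          then show "Z t4 s4"
            unfolding Z_def using o uw opt_u by (intro exI[of _ u]) (simp add: u_def S_def X_def)
        qed
      qed
    qed
  qed
  then show ?thesis unfolding Z_def program_def wp_Seq_fun .
qed

end

lemma okc_program:
  assumes "2 * Q \<le> M" "2 \<le> M"
  shows "okc M 20 program"
proof -
  \<comment> \<open>The program text depends on \<open>p\<close> and \<open>r\<close> only, so a
    trivial instance suffices to unfold its definitions.\<close>
  interpret tr: tree p r "\<lambda>_. False" "\<lambda>_. 0" by unfold_locales simp
  interpret pg: prog p r "\<lambda>_. False" "\<lambda>_. 0" 0 "Q + 100" "100 * ((Q + 100) * (Q + 100) * (Q + 100))"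
    by unfold_locales (use Qpos in auto)
  have "P * 1 \<le> Q" "1 * R \<le> Q" using P1 R2 by (intro mult_mono; simp)+
  then have M: "P + Q \<le> M" "P \<le> M" "Q \<le> M" "R \<le> M" "1 \<le> M" "0 \<le> M" using assms Qpos by linarith+
  show ?thesis
    unfolding program_def britton_def britton_step_def pg.forward_def pg.loopA_def pg.loopB_def pg.loopC_def pg.pad_step_def
      pg.leafstep_def pg.tstep_def pg.t_setup_def pg.t_init_def pg.t_inner_def pg.t_pairs_def pg.t_up_def pg.t_down_def
      pg.EV_def lower_def adrE_def
      pg.backtrack_def pg.bstep_def pg.b_setup_def pg.b_search_def pg.b_assign_def
      write_word_def emit_pow_def emit_def
    using M assms Ppos Rpos Qpos by (simp add: M assms)
qed

end

theorem theorem7p1: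
  fixes p q :: nat
  assumes "1 \<le> p" and "p < q" and "p dvd q"
  shows "\<exists>(prog :: com) (C :: nat) (K :: nat). \<forall>w :: letter list. \<exists>(n :: nat) (s' :: state) (g :: letter list).
           run (K * input_length w) prog (input_state w) n s'
         \<and> n \<le> C * (num_sinks w * (num_sinks w + norm_w p q w))
         \<and> output_word s' g
         \<and> geodesic p q w g
         \<and> s' ''length'' 0 = int (geo_len p q w)"
proof -
  obtain r where q: "q = p * r" using assms(3) by (auto simp: dvd_def)
  have "2 \<le> r"
  proof (rule ccontr)
    assume "\<not> 2 \<le> r"
    then have "r = 0 \<or> r = 1" by auto
    then show False using q assms(2) by auto
  qed
  then interpret bs p r by unfold_locales (use assms(1) in auto)
  \<comment> \<open>\<open>U\<close> will be 2 to the power \<open>c * L\<close>. The part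
    \<open>r + 1\<close> covers the growth of exponents during reduction, since
    \<open>r < 2 ^ r\<close>; the part \<open>p * r + 19\<close> covers \<open>Q\<close> and
    numerical factors.\<close>
  define c where "c = (r + 1) + (p * r + 19)"
  \<comment> \<open>\<open>M\<close> is 100 times the cube of \<open>U\<close>, and 100 is below
    2^7. The factor 20 is the degree allowed by \<open>okc_program\<close>, and the final 1 makes
    the comparison strict.\<close>
  define K where "K = (7 + 3 * c) * 20 + 1"
  have "\<exists>n s' g. run (K * input_length w) program (input_state w) n s'
         \<and> n \<le> 1000000 * (num_sinks w * (num_sinks w + norm_w p q w))
         \<and> output_word s' g \<and> geodesic p q w g \<and> s' ''length'' 0 = int (geo_len p q w)" for w
  proof -
    define L where "L = input_length w"
    define k where "k = length (thetas w)"
    define g where "g = norm_w p (p * r) w"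
    define B where "B = (\<Sum>\<alpha>\<leftarrow>alphas w. \<bar>\<alpha>\<bar>)"
    \<comment> \<open>\<open>E\<close> dominates the number of letters and the sum of the input
      exponents, \<open>Y\<close> that sum multiplied by \<open>R ^ k\<close>, and \<open>W\<close>
      the constants 100 and \<open>Q\<close>.\<close>
    define E Y W :: int where "E = 2 ^ L" and "Y = 2 ^ ((r + 1) * L)" and "W = 2 ^ ((p * r + 19) * L)"
    define U where "U = Y * W"
    define M where "M = 100 * (U * U * U)"
    have "length xs \<le> (\<Sum>\<alpha>\<leftarrow>xs. bits \<alpha> + 1)" for xs by (induction xs) auto
    from this[of "alphas w"] have Lk: "k + 1 \<le> L" "1 \<le> L"
      by (simp_all add: L_def input_length_def k_def length_alphas)
    have "L < 2 ^ L" by (rule less_exp)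
    then have "int L < int (2 ^ L)" by (simp only: of_nat_less_iff)
    then have LE: "int L \<le> E" by (simp add: E_def)
    have kE: "int k + 1 \<le> E" "2 \<le> E"
    proof -
      show "int k + 1 \<le> E" using LE Lk by linarith
      show "2 \<le> E" using Lk power_increasing[of 1 L "2::int"] by (simp add: E_def)
    qed
    have BE: "B \<le> E"
    proof -
      have "B \<le> 2 ^ (\<Sum>\<alpha>\<leftarrow>alphas w. bits \<alpha> + 1)" unfolding B_def by (rule sum_list_abs_le)
      also have "\<dots> \<le> E" unfolding E_def by (rule power_increasing) (simp_all add: L_def input_length_def)
      finally show ?thesis .
    qed
    have B0: "0 \<le> B" unfolding B_def by (rule sum_list_nonneg) auto
    have RY: "R ^ k * B \<le> Y"
    proof -
      have "r < 2 ^ r" by (rule less_exp)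
      then have "int r < int (2 ^ r)" by (simp only: of_nat_less_iff)
      then have "R ^ k \<le> (2 ^ r) ^ k" by (intro power_mono) auto
      also have "\<dots> \<le> 2 ^ (r * L)" unfolding power_mult[symmetric] using Lk by (intro power_increasing mult_left_mono) auto
      finally have "R ^ k * B \<le> 2 ^ (r * L) * E" using BE B0 by (intro mult_mono) auto
      also have "\<dots> = Y" by (simp add: E_def Y_def power_add[symmetric] add_mult_distrib add.commute)
      finally show ?thesis .
    qed
    have EY: "E \<le> Y" unfolding E_def Y_def by (rule power_increasing) auto
    have W: "100 \<le> W" "Q \<le> W"
    proof -
      have "(2::int) ^ 19 \<le> W" unfolding W_def using Lk by (intro power_increasing) (auto simp: algebra_simps intro: trans_le_add2)
      then show "100 \<le> W" by simp
      have "p * r < 2 ^ (p * r)" by (rule less_exp)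
      then have "int (p * r) < int (2 ^ (p * r))" by (simp only: of_nat_less_iff)
      then have "Q \<le> 2 ^ (p * r)" by simp
      also have "\<dots> \<le> W" unfolding W_def
      proof (rule power_increasing)
        have "(p * r + 19) * 1 \<le> (p * r + 19) * L" using Lk by (intro mult_left_mono) auto
        then show "p * r \<le> (p * r + 19) * L" by (rule order_trans[rotated]) simp
      qed simp
      finally show "Q \<le> W" .
    qed
    have U: "100 * Y \<le> U" "W \<le> U"
    proof -
      have "Y * 100 \<le> Y * W" using W EY kE by (intro mult_left_mono) auto
      then show "100 * Y \<le> U" by (simp add: U_def mult.commute)
      have "1 * W \<le> Y * W" using W EY kE by (intro mult_right_mono) auto
      then show "W \<le> U" by (simp add: U_def)
    qed
    have gE: "int g \<le> 2 * E" using norm_le[of w] BE kE by (simp add: g_def B_def k_def)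
    have U100: "100 \<le> U" and QU: "Q \<le> U" using U W by linarith+
    have AU: "R ^ k * (\<Sum>j=1..Suc k. \<bar>val_at w j\<bar>) + 2 * int (k + 1) + int g + 1 \<le> U"
    proof -
      have "(\<Sum>j=1..Suc k. \<bar>val_at w j\<bar>) = B" using sum_val_at[of w] by (simp add: B_def k_def)
      then have "R ^ k * (\<Sum>j=1..Suc k. \<bar>val_at w j\<bar>) \<le> Y" using RY by simp
      moreover have "2 * int (k + 1) + int g + 1 \<le> 99 * Y" using gE EY kE by simp
      ultimately show ?thesis using U by linarith
    qed
    have NU: "2 * int (k + 1) + int g + 1 \<le> U"
    proof -
      have "2 * int (k + 1) + int g + 1 \<le> 99 * Y" using gE EY kE by simp
      then show ?thesis using U EY kE by linarith
    qed
    have kU: "10 * int (k + 1) \<le> U" using kE EY U by simp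
    have UM: "10 * U \<le> M" by (rule UM[OF k_def g_def M_def U100 QU NU AU kU])
    obtain n s' u where ex: "exec M program (input_state w) n s'"
      and u: "int n \<le> 1000000 * (int (num_sinks w) * (int (num_sinks w) + int g))" "output_word s' u" "bs_eq p (p * r) u w"
        "\<forall>v. bs_eq p (p * r) v w \<longrightarrow> length u \<le> length v"
      using wp_program[OF k_def g_def M_def U100 QU NU AU kU] unfolding wp_def by auto
    have bnd: "bounded M (input_state w)"
    proof -
      have EM: "E \<le> M" "2 \<le> M" using UM U EY U100 kE by linarith+
      have "\<bar>alphas w ! j\<bar> \<le> M" if "j \<le> k" for j
      proof -
        have "\<bar>val_at w (Suc j)\<bar> \<le> (\<Sum>j=1..Suc k. \<bar>val_at w j\<bar>)" using that by (intro member_le_sum) auto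
        also have "\<dots> = B" using sum_val_at[of w] by (simp add: B_def k_def)
        finally show ?thesis using BE EM by (simp add: val_at_def)
      qed
      moreover have "\<bar>code l\<bar> \<le> M" for l using EM by (cases l) auto
      moreover have "int k \<le> M" using kE EM by simp
      ultimately show ?thesis using EM unfolding bounded_def input_state_def k_def[symmetric] by auto
    qed
    have MK: "M ^ 20 < 2 ^ (K * L)"
    proof -
      have UP: "U = 2 ^ (c * L)" unfolding U_def Y_def W_def c_def power_add[symmetric] by (simp add: add_mult_distrib)
      have e: "3 * c * L = c * L + c * L + c * L" by simp
      have "M \<le> 2 ^ 7 * 2 ^ (3 * c * L)"
        unfolding M_def UP e power_add by simp
      also have "\<dots> \<le> 2 ^ (7 * L) * 2 ^ (3 * c * L)"
        using Lk by (intro mult_right_mono power_increasing) auto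
      also have "\<dots> = 2 ^ ((7 + 3 * c) * L)" by (simp add: power_add[symmetric] algebra_simps)
      finally have "M ^ 20 \<le> (2 ^ ((7 + 3 * c) * L)) ^ 20" using UM U100 by (intro power_mono) auto
      also have "\<dots> = 2 ^ ((7 + 3 * c) * L * 20)" by (simp add: power_mult)
      also have "\<dots> < 2 ^ (K * L)"
        using Lk by (intro power_strict_increasing) (auto simp: K_def algebra_simps)
      finally show ?thesis .
    qed
    have "okc M 20 program" using UM U100 QU by (intro okc_program) linarith+
    then have "run (K * L) program (input_state w) n s'"
      using exec_run[OF ex bnd _ _ _ MK] UM U100 by simp
    moreover have "n \<le> 1000000 * (num_sinks w * (num_sinks w + norm_w p q w))"
    proof -
      have "int n \<le> int (1000000 * (num_sinks w * (num_sinks w + norm_w p q w)))" using u(1) by (simp add: g_def q)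
      then show ?thesis by (simp only: of_nat_le_iff)
    qed
    moreover have "geodesic p q w u" using u(3,4) by (simp add: geodesic_def q)
    moreover have "geo_len p q w = length u"
      unfolding geo_len_def q by (rule Least_equality) (use u(3,4) in auto)
    then have "s' ''length'' 0 = int (geo_len p q w)" using u(2) by (simp add: output_word_def)
    ultimately show ?thesis using u(2) unfolding L_def by blast
  qed
  then show ?thesis by blast
qed

end
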